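(* Let $n\ge1$ and let $\lambda,\mu$ be two partitions of $n$. Let $rT_\mu$ be the row canonical standard Young tableau of shape $\mu$, i.e. the tableau of shape $\mu$ filled increasingly with $1,\dots,n$ from left to right and bottom to top (row by row, starting with the longest row), and let $\hat 0$ be the minimal tableau in the poset of standard Young tableaux of size $n$. Then the Kostka number $K_{\lambda,\mu}$ is the number of standard Young tableaux of shape $\lambda$ in the interval $[\hat 0,rT_\mu]$, for any one of the four partial orders (weak, Kazhdan-Lusztig, geometric, chain) on the set $\mathbb{YT}_n$ of standard Young tableaux of size $n$.
   Context: $K_{\lambda,\mu}$ is the number of semi-standard Young tableaux of shape $\lambda$ with exactly $\mu_i$ entries equal to $i$ for each $i$. Young tableaux are drawn in French notation (longest row at the bottom, rows increasing from left to right, columns increasing upwards). $P(\sigma)$ denotes the Schensted (row) insertion tableau of a permutation $\sigma\in\mathfrak S_n$. The minimal tableau $\hat0$ (for each of the orders) is the one-row tableau. $[s,s']$ denotes $\{t:s\le t\le s'\}$ for the order considered. The four partial orders on $\mathbb{YT}_n$ (those studied by Taskin, "Properties of four partial orders on standard Young tableaux") are: (a) *Weak order*: the transitive closure of the relation "$S\le T$ if there are $\sigma,\tau\in\mathfrak S_n$ with $P(\sigma)=S$, $P(\tau)=T$ and $\sigma\le_p\tau$", where $\le_p$ is the weak order on $\mathfrak S_n$ generated by exchanging two adjacent letters $\sigma(i)<\sigma(i+1)$ of the word $\sigma$ (equivalently $\sigma\le_p\tau$ iff each pair $i<j$ with $j$ to the left of $i$ in the word $\sigma$ also has $j$ to the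 left of $i$ in $\tau$). (b) *Kazhdan-Lusztig order*: $S\le T$ if $\tau\le_R\sigma$ for $\sigma,\tau$ with $P(\sigma)=S$, $P(\tau)=T$, where $\le_R$ is the Kazhdan-Lusztig right preorder on $\mathfrak S_n$ (with the convention that $\tau\le_R\sigma$ is generated by: $C_\tau$ appears with nonzero coefficient in $C_\sigma C_s$ for some simple reflection $s$, where $(C_w)$ is the Kazhdan-Lusztig basis of the Hecke algebra; thus the identity is maximal). The right cells are the classes $\{\sigma:P(\sigma)=T\}$, so this does not depend on the choice of $\sigma,\tau$. (c) *Geometric order*: $S\le T$ if $\overline{V_T}\subseteq\overline{V_S}$, where, for a standard Young tableau $T$ of size $n$, $V_T$ is the set of strictly upper triangular complex $n\times n$ matrices $N$ such that for each $1\le i\le n$ the restriction of $N$ to the span of the first $i$ basis vectors has Jordan type (partition of block sizes) equal to the shape of the restriction of $T$ to the entries $1,\dots,i$; closures are Zariski closures. (d) *Chain order*: $S\le T$ if for all $1\le i\le j\le n$, $\lambda(S_{/i,j})\ge_{dom}\lambda(T_{/i,j})$, where $\lambda(T_{/i,j})$ is the shape of the tableau obtained from $T$ by restricting to the entries in $[i,j]$, lowering all entries by $i-1$, and sliding the resulting skew tableau into normal shape by jeu-de-taquin, and $\ge_{dom}$ is the dominance order on partitions: $\alpha\ge_{dom}\beta$ iff $\alpha_1+\cdots+\alpha_r\ge\beta_1+\cdots+\beta_r$ for all $1\le r\le\min(\ell(\alpha),\ell(\beta))$. *)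

theory Defs
  imports
    Complex_Main
    "HOL-Library.Poly_Mapping"
    "HOL-Combinatorics.Permutations"
    "HOL-Algebra.Ring"
    "Jordan_Normal_Form.Jordan_Normal_Form"
begin

section \<open>Partitions and tableaux\<close>

definition is_partition :: "nat \<Rightarrow> nat list \<Rightarrow> bool" where
  "is_partition n p \<longleftrightarrow> sorted_wrt (\<ge>) p \<and> 0 \<notin> set p \<and> sum_list p = n"

definition dom_ge :: "nat list \<Rightarrow> nat list \<Rightarrow> bool" where
  "dom_ge a b \<longleftrightarrow>
     (\<forall>r. 1 \<le> r \<and> r \<le> min (length a) (length b) \<longrightarrow> sum_list (take r a) \<ge> sum_list (take r b))"

text \<open>A tableau (French notation) is the list of its rows, from the bottom row upwards.\<close>

type_synonym tableau = "nat list list"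

definition shape :: "tableau \<Rightarrow> nat list" where
  "shape T = map length T"

definition columns_increasing :: "tableau \<Rightarrow> bool" where
  "columns_increasing T \<longleftrightarrow>
     (\<forall>r c. Suc r < length T \<and> c < length (T ! Suc r) \<longrightarrow> T ! r ! c < T ! Suc r ! c)"

definition semistandard :: "tableau \<Rightarrow> bool" where
  "semistandard T \<longleftrightarrow>
     is_partition (length (concat T)) (shape T) \<and>
     (\<forall>r \<in> set T. sorted_wrt (\<le>) r) \<and> columns_increasing T"

definition YT :: "nat \<Rightarrow> tableau set" where
  "YT n = {T. is_partition n (shape T) \<and>
     (\<forall>r \<in> set T. sorted_wrt (<) r) \<and> columns_increasing T \<and>
     distinct (concat T) \<and> set (concat T) = {1..n}}"

definition kostka :: "nat list \<Rightarrow> nat list \<Rightarrow> nat" where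
  "kostka lam mu = card {T. semistandard T \<and> shape T = lam \<and>
     set (concat T) \<subseteq> {1..length mu} \<and>
     (\<forall>i < length mu. count_list (concat T) (Suc i) = mu ! i)}"

definition row_canonical :: "nat list \<Rightarrow> tableau" where
  "row_canonical mu =
     map (\<lambda>r. [Suc (sum_list (take r mu)) ..< Suc (sum_list (take (Suc r) mu))]) [0..<length mu]"

definition one_row :: "nat \<Rightarrow> tableau" where
  "one_row n = [[1..<Suc n]]"

definition interval :: "nat \<Rightarrow> (tableau \<Rightarrow> tableau \<Rightarrow> bool) \<Rightarrow> tableau \<Rightarrow> tableau \<Rightarrow> tableau set" where
  "interval n R S S' = {T \<in> YT n. R S T \<and> R T S'}"


section \<open>Schensted insertion\<close>

text \<open>\<open>row_bump x r\<close> returns the new row together with the entry that was bumped out, if any;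
  the bumped entry is the leftmost one larger than \<open>x\<close>.\<close>

fun row_bump :: "nat \<Rightarrow> nat list \<Rightarrow> nat list \<times> nat option" where
  "row_bump x [] = ([x], None)"
| "row_bump x (y # ys) =
     (if x < y then (x # ys, Some y)
      else (case row_bump x ys of (zs, b) \<Rightarrow> (y # zs, b)))"

fun row_insert :: "nat \<Rightarrow> tableau \<Rightarrow> tableau" where
  "row_insert x [] = [[x]]"
| "row_insert x (r # rs) =
     (case row_bump x r of
        (r', None) \<Rightarrow> r' # rs
      | (r', Some y) \<Rightarrow> r' # row_insert y rs)"

text \<open>Permutations of \<open>{1..n}\<close> are functions; the word of \<open>\<sigma>\<close> is \<open>\<sigma>(1) \<dots> \<sigma>(n)\<close>.\<close>

definition insertion_tableau :: "nat \<Rightarrow> (nat \<Rightarrow> nat) \<Rightarrow> tableau" where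
  "insertion_tableau n \<sigma> = fold row_insert (map \<sigma> [1..<Suc n]) []"

text \<open>Since \<open>(\<sigma> \<circ> simple_refl i)\<close> is \<open>\<sigma>\<close> with the letters in positions \<open>i\<close> and \<open>i + 1\<close>
  exchanged, multiplication by simple reflections on the right acts on positions.\<close>

definition simple_refl :: "nat \<Rightarrow> nat \<Rightarrow> nat" where
  "simple_refl i = Transposition.transpose i (Suc i)"


section \<open>Weak order\<close>

definition perm_weak_step :: "nat \<Rightarrow> (nat \<Rightarrow> nat) \<Rightarrow> (nat \<Rightarrow> nat) \<Rightarrow> bool" where
  "perm_weak_step n \<sigma> \<tau> \<longleftrightarrow>
     (\<exists>i \<in> {1..<n}. \<sigma> i < \<sigma> (Suc i) \<and> \<tau> = \<sigma> \<circ> simple_refl i)"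

definition perm_weak_le :: "nat \<Rightarrow> (nat \<Rightarrow> nat) \<Rightarrow> (nat \<Rightarrow> nat) \<Rightarrow> bool" where
  "perm_weak_le n = (perm_weak_step n)\<^sup>*\<^sup>*"

definition weak_le :: "nat \<Rightarrow> tableau \<Rightarrow> tableau \<Rightarrow> bool" where
  "weak_le n = (\<lambda>S T. \<exists>\<sigma> \<tau>. \<sigma> permutes {1..n} \<and> \<tau> permutes {1..n} \<and>
     insertion_tableau n \<sigma> = S \<and> insertion_tableau n \<tau> = T \<and> perm_weak_le n \<sigma> \<tau>)\<^sup>+\<^sup>+"


section \<open>Hecke algebra and Kazhdan-Lusztig order\<close>

text \<open>The ground ring \<open>\<int>[v, 1/v]\<close>, with \<open>v = q\<^sup>1\<^sup>/\<^sup>2\<close>.\<close>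

type_synonym laurent = "int \<Rightarrow>\<^sub>0 int"

definition v_pow :: "int \<Rightarrow> laurent" where
  "v_pow k = Poly_Mapping.single k 1"

definition laurent_bar :: "laurent \<Rightarrow> laurent" where
  "laurent_bar = Poly_Mapping.map_key uminus"

definition perm_length :: "nat \<Rightarrow> (nat \<Rightarrow> nat) \<Rightarrow> nat" where
  "perm_length n w = card {(i, j). 1 \<le> i \<and> i < j \<and> j \<le> n \<and> w j < w i}"

definition reduced_word :: "nat \<Rightarrow> (nat \<Rightarrow> nat) \<Rightarrow> nat list" where
  "reduced_word n w = (SOME is. set is \<subseteq> {1..<n} \<and>
     foldr (\<lambda>i u. simple_refl i \<circ> u) is id = w \<and> length is = perm_length n w)"

text \<open>An element of the Hecke algebra is the family of its coefficients in the normalised standard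
  basis \<open>H\<^sub>w = v\<^sup>-\<^sup>l\<^sup>(\<^sup>w\<^sup>) T\<^sub>w\<close>, where \<open>T\<^sub>s\<^sup>2 = (q - 1) T\<^sub>s + q\<close>. Then
  \<open>H\<^sub>y H\<^sub>s = H\<^sub>y\<^sub>s\<close> if \<open>l(ys) > l(y)\<close>, and \<open>H\<^sub>y H\<^sub>s = H\<^sub>y\<^sub>s + (v - 1/v) H\<^sub>y\<close> otherwise.\<close>

type_synonym hecke = "(nat \<Rightarrow> nat) \<Rightarrow> laurent"

definition hecke_std :: "(nat \<Rightarrow> nat) \<Rightarrow> hecke" where
  "hecke_std w = (\<lambda>x. if x = w then 1 else 0)"

definition hecke_std_times_gen :: "nat \<Rightarrow> (nat \<Rightarrow> nat) \<Rightarrow> nat \<Rightarrow> hecke" where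
  "hecke_std_times_gen n y i = (\<lambda>x. hecke_std (y \<circ> simple_refl i) x +
     (if perm_length n (y \<circ> simple_refl i) > perm_length n y then 0
      else (v_pow 1 - v_pow (-1)) * hecke_std y x))"

definition hecke_times_gen :: "nat \<Rightarrow> nat \<Rightarrow> hecke \<Rightarrow> hecke" where
  "hecke_times_gen n i h =
     (\<lambda>x. \<Sum>y | y permutes {1..n}. h y * hecke_std_times_gen n y i x)"

text \<open>\<open>h \<cdot> H\<^sub>w\<close> is obtained by multiplying successively by the generators along a reduced word of
  \<open>w\<close>; the result does not depend on that word.\<close>

definition hecke_times_std :: "nat \<Rightarrow> hecke \<Rightarrow> (nat \<Rightarrow> nat) \<Rightarrow> hecke" where
  "hecke_times_std n h w = fold (hecke_times_gen n) (reduced_word n w) h"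

definition hecke_algebra :: "nat \<Rightarrow> hecke ring" where
  "hecke_algebra n =
    \<lparr>carrier = {h. \<forall>w. h w \<noteq> 0 \<longrightarrow> w permutes {1..n}},
     mult = (\<lambda>h k x. \<Sum>w | w permutes {1..n}. k w * hecke_times_std n h w x),
     one = hecke_std id,
     zero = (\<lambda>_. 0),
     add = (\<lambda>h k x. h x + k x)\<rparr>"

text \<open>The bar involution: \<open>v \<mapsto> 1/v\<close> and \<open>H\<^sub>w \<mapsto> (H of the inverse of w) inverted\<close>.\<close>

definition hecke_bar :: "nat \<Rightarrow> hecke \<Rightarrow> hecke" where
  "hecke_bar n h = (\<lambda>x. \<Sum>w | w permutes {1..n}.
     laurent_bar (h w) * m_inv (hecke_algebra n) (hecke_std (inv_into UNIV w)) x)"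

text \<open>The Kazhdan-Lusztig basis element \<open>C\<^sub>w\<close> is the unique bar-invariant element of
  \<open>H\<^sub>w + \<Sum>\<^sub>y\<^sub>\<noteq>\<^sub>w v\<int>[v] H\<^sub>y\<close>. This is the original (signed) normalisation, in which
  \<open>C\<^sub>s = H\<^sub>s - v = q\<^sup>-\<^sup>1\<^sup>/\<^sup>2 T\<^sub>s - q\<^sup>1\<^sup>/\<^sup>2\<close>; the coefficient of \<open>H\<^sub>y\<close> is the Kazhdan-Lusztig polynomial
  \<open>P\<^sub>y\<^sub>,\<^sub>w\<close> evaluated at \<open>1/q\<close>, times \<open>(-v)\<^sup>l\<^sup>(\<^sup>w\<^sup>)\<^sup>-\<^sup>l\<^sup>(\<^sup>y\<^sup>)\<close>.\<close>

definition kl_basis :: "nat \<Rightarrow> (nat \<Rightarrow> nat) \<Rightarrow> hecke" where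
  "kl_basis n w = (THE C. C \<in> carrier (hecke_algebra n) \<and> hecke_bar n C = C \<and> C w = 1 \<and>
     (\<forall>y. y \<noteq> w \<longrightarrow> (\<forall>k \<in> Poly_Mapping.keys (C y). k > 0)))"

definition kl_right_step :: "nat \<Rightarrow> (nat \<Rightarrow> nat) \<Rightarrow> (nat \<Rightarrow> nat) \<Rightarrow> bool" where
  "kl_right_step n \<tau> \<sigma> \<longleftrightarrow> \<sigma> permutes {1..n} \<and> \<tau> permutes {1..n} \<and>
     (\<exists>i \<in> {1..<n}. \<exists>a :: hecke.
        kl_basis n \<sigma> \<otimes>\<^bsub>hecke_algebra n\<^esub> kl_basis n (simple_refl i) =
          (\<lambda>x. \<Sum>z | z permutes {1..n}. a z * kl_basis n z x) \<and> a \<tau> \<noteq> 0)"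

definition kl_right_le :: "nat \<Rightarrow> (nat \<Rightarrow> nat) \<Rightarrow> (nat \<Rightarrow> nat) \<Rightarrow> bool" where
  "kl_right_le n = (kl_right_step n)\<^sup>*\<^sup>*"

definition kl_le :: "nat \<Rightarrow> tableau \<Rightarrow> tableau \<Rightarrow> bool" where
  "kl_le n S T \<longleftrightarrow> (\<exists>\<sigma> \<tau>. \<sigma> permutes {1..n} \<and> \<tau> permutes {1..n} \<and>
     insertion_tableau n \<sigma> = S \<and> insertion_tableau n \<tau> = T \<and> kl_right_le n \<tau> \<sigma>)"


section \<open>Geometric order\<close>

inductive_set mat_poly_fun :: "nat \<Rightarrow> (complex mat \<Rightarrow> complex) set" for n :: nat where
  const: "(\<lambda>_. a) \<in> mat_poly_fun n"
| entry: "r < n \<Longrightarrow> c < n \<Longrightarrow> (\<lambda>N. N $$ (r, c)) \<in> mat_poly_fun n"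
| add: "f \<in> mat_poly_fun n \<Longrightarrow> g \<in> mat_poly_fun n \<Longrightarrow> (\<lambda>N. f N + g N) \<in> mat_poly_fun n"
| mult: "f \<in> mat_poly_fun n \<Longrightarrow> g \<in> mat_poly_fun n \<Longrightarrow> (\<lambda>N. f N * g N) \<in> mat_poly_fun n"

definition zariski_closed :: "nat \<Rightarrow> complex mat set \<Rightarrow> bool" where
  "zariski_closed n Z \<longleftrightarrow>
     (\<exists>F \<subseteq> mat_poly_fun n. Z = {N \<in> carrier_mat n n. \<forall>f \<in> F. f N = 0})"

definition zariski_closure :: "nat \<Rightarrow> complex mat set \<Rightarrow> complex mat set" where
  "zariski_closure n V = \<Inter> {Z. zariski_closed n Z \<and> V \<subseteq> Z}"

definition has_jordan_type :: "complex mat \<Rightarrow> nat list \<Rightarrow> bool" where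
  "has_jordan_type A p \<longleftrightarrow> (\<exists>n_as. jordan_nf A n_as \<and> mset (map fst n_as) = mset p)"

definition tableau_upto :: "nat \<Rightarrow> tableau \<Rightarrow> tableau" where
  "tableau_upto i T = filter (\<lambda>r. r \<noteq> []) (map (filter (\<lambda>x. x \<le> i)) T)"

text \<open>For a strictly upper triangular \<open>N\<close>, the span of the first \<open>i\<close> basis vectors is stable, and
  the restriction of \<open>N\<close> to it is given by the top left \<open>i \<times> i\<close> block.\<close>

definition geom_cell :: "nat \<Rightarrow> tableau \<Rightarrow> complex mat set" where
  "geom_cell n T = {N \<in> carrier_mat n n.
     (\<forall>r < n. \<forall>c < n. c \<le> r \<longrightarrow> N $$ (r, c) = 0) \<and>
     (\<forall>i \<in> {1..n}. has_jordan_type (mat i i (\<lambda>(r, c). N $$ (r, c))) (shape (tableau_upto i T)))}"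

definition geom_le :: "nat \<Rightarrow> tableau \<Rightarrow> tableau \<Rightarrow> bool" where
  "geom_le n S T \<longleftrightarrow>
     S \<in> YT n \<and> T \<in> YT n \<and>
     zariski_closure n (geom_cell n T) \<subseteq> zariski_closure n (geom_cell n S)"


section \<open>Jeu de taquin and chain order\<close>

text \<open>A filling assigns entries to cells \<open>(row, column)\<close>, both counted from \<open>0\<close>, rows from the
  bottom. A skew tableau is given by the set of cells of its inner shape and a filling.\<close>

type_synonym filling = "nat \<times> nat \<Rightarrow> nat option"

definition filling_of :: "tableau \<Rightarrow> filling" where
  "filling_of T = (\<lambda>(r, c). if r < length T \<and> c < length (T ! r) then Some (T ! r ! c) else None)"

text \<open>\<open>jdt_slide h F F'\<close>: sliding into the empty cell \<open>h\<close> of \<open>F\<close>, until the hole has no occupied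
  neighbour to its right or above it, produces \<open>F'\<close>.\<close>

inductive jdt_slide :: "nat \<times> nat \<Rightarrow> filling \<Rightarrow> filling \<Rightarrow> bool" where
  stop: "F (r, Suc c) = None \<Longrightarrow> F (Suc r, c) = None \<Longrightarrow> jdt_slide (r, c) F F"
| from_right: "F (r, Suc c) = Some x \<Longrightarrow> (\<And>y. F (Suc r, c) = Some y \<Longrightarrow> x < y) \<Longrightarrow>
    jdt_slide (r, Suc c) (F((r, c) := Some x, (r, Suc c) := None)) F' \<Longrightarrow> jdt_slide (r, c) F F'"
| from_above: "F (Suc r, c) = Some y \<Longrightarrow> (\<And>x. F (r, Suc c) = Some x \<Longrightarrow> y < x) \<Longrightarrow>
    jdt_slide (Suc r, c) (F((r, c) := Some y, (Suc r, c) := None)) F' \<Longrightarrow> jdt_slide (r, c) F F'"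

inductive rectifies :: "(nat \<times> nat) set \<Rightarrow> filling \<Rightarrow> filling \<Rightarrow> bool" where
  normal: "rectifies {} F F"
| slide: "(r, c) \<in> I \<Longrightarrow> (r, Suc c) \<notin> I \<Longrightarrow> (Suc r, c) \<notin> I \<Longrightarrow>
    jdt_slide (r, c) F F' \<Longrightarrow> rectifies (I - {(r, c)}) F' F'' \<Longrightarrow> rectifies I F F''"

definition normal_shape :: "filling \<Rightarrow> nat list" where
  "normal_shape F = map (\<lambda>r. card {c. (r, c) \<in> dom F}) [0..<card {r. (r, 0) \<in> dom F}]"

definition inner_cells :: "tableau \<Rightarrow> nat \<Rightarrow> (nat \<times> nat) set" where
  "inner_cells T i = {h. \<exists>x. filling_of T h = Some x \<and> x < i}"

definition skew_part :: "tableau \<Rightarrow> nat \<Rightarrow> nat \<Rightarrow> filling" where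
  "skew_part T i j = (\<lambda>h. case filling_of T h of
     None \<Rightarrow> None
   | Some x \<Rightarrow> if i \<le> x \<and> x \<le> j then Some (x - (i - 1)) else None)"

text \<open>The rectification does not depend on the order of the slides, so that any choice gives the
  same shape.\<close>

definition chain_shape :: "tableau \<Rightarrow> nat \<Rightarrow> nat \<Rightarrow> nat list" where
  "chain_shape T i j = normal_shape (SOME F. rectifies (inner_cells T i) (skew_part T i j) F)"

definition chain_le :: "nat \<Rightarrow> tableau \<Rightarrow> tableau \<Rightarrow> bool" where
  "chain_le n S T \<longleftrightarrow>
     S \<in> YT n \<and> T \<in> YT n \<and>
     (\<forall>i j. 1 \<le> i \<and> i \<le> j \<and> j \<le> n \<longrightarrow> dom_ge (chain_shape S i j) (chain_shape T i j))"

end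

theory Submission
  imports
    Defs
    "Jordan_Normal_Form.Jordan_Normal_Form_Existence"
    "Jordan_Normal_Form.Jordan_Normal_Form_Uniqueness"
begin

text \<open>All four intervals are one and the same set of tableaux, and this set is in bijection
  with the semistandard tableaux of content \<open>mu\<close>. Call \<open>i\<close> an ascent of a
  standard tableau if \<open>Suc i\<close> lies in a column strictly to the right of
  \<open>i\<close>, equivalently in a row not above it. The ascents of the row canonical tableau are
  the \<open>i\<close> that share their row with \<open>Suc i\<close>. A tableau \<open>T\<close>
  turns out to lie in the interval exactly if all of these are ascents of \<open>T\<close> as well
  (\<open>compat_tableaux\<close>), which means that every row of \<open>row_canonical mu\<close>
  occupies a horizontal strip of \<open>T\<close>, filled from left to right. Replacing the entries
  of each such row by the number of that row gives a semistandard tableau of the same shape and of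
  content \<open>mu\<close>; standardization is the inverse (\<open>kostka_eq_card_compat\<close>).

  The condition is necessary because ascents can only get lost on the way up. In the weak order,
  insertion keeps the relative order of consecutive values (\<open>row_insert_pair_filter\<close>),
  and a weak step only creates inversions. In the Kazhdan-Lusztig order, multiplying
  \<open>C_\<sigma>\<close> from the right stays inside the eigenspaces of the left multiplications
  that record the left descents of \<sigma> (\<open>kl_right_step_descent\<close>). In the geometric
  order, a non-ascent makes a superdiagonal entry vanish on the whole cell, which is a closed
  condition (\<open>geom_cell_superdiagonal\<close>). In the chain order, the windows
  \<open>[i, i+1]\<close> already see the ascents (\<open>chain_le_ascent\<close>).

  The condition is sufficient for the following reasons. In the weak order, the row reading words of
  \<open>T\<close> and of \<open>row_canonical mu\<close> are themselves comparable
  (\<open>row_perm_weak_le\<close>). The Kazhdan-Lusztig order contains the weak order, since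
  \<open>C_\<sigma> C_s\<close> has leading term \<open>C_{\<sigma>s}\<close> when \<sigma> ascends
  at \<open>s\<close> (\<open>kl_right_step_ascent\<close>). In the geometric order, every matrix in
  the cell of \<open>row_canonical mu\<close> has a Jordan basis adapted to the standard flag, and
  in that basis a line of matrices joins it to the cell of \<open>T\<close>
  (\<open>row_canonical_superdiagonal\<close>, \<open>closure_criterion\<close>). In the chain
  order, a count in the spirit of Greene's theorem applies: the rows of
  \<open>row_canonical mu\<close>, cut down to a window, are strips in both rectifications, and the
  total size of the \<open>k\<close> largest bounds the first \<open>k\<close> rows from above for
  \<open>row_canonical mu\<close> and from below for \<open>T\<close>
  (\<open>chain_shape_compat_dominates\<close>).\<close>

abbreviation pinv :: "(nat \<Rightarrow> nat) \<Rightarrow> nat \<Rightarrow> nat" where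
  "pinv \<equiv> inv_into UNIV"

section \<open>Permutations: inversions, length and the weak order\<close>

lemma simple_refl_apply [simp]:
  "simple_refl i i = Suc i" "simple_refl i (Suc i) = i"
  by (simp_all add: simple_refl_def)

lemma simple_refl_other: "a \<noteq> i \<Longrightarrow> a \<noteq> Suc i \<Longrightarrow> simple_refl i a = a"
  by (simp add: simple_refl_def transpose_def)

lemma simple_refl_simple_refl [simp]: "simple_refl i (simple_refl i a) = a"
  by (simp add: simple_refl_def)

lemma simple_refl_comp_self [simp]: "simple_refl i \<circ> simple_refl i = id"
  by (simp add: fun_eq_iff)

lemma comp_simple_refl_twice [simp]: "w \<circ> simple_refl i \<circ> simple_refl i = w"
  by (simp add: fun_eq_iff)

lemma simple_refl_comp_twice [simp]: "simple_refl i \<circ> (simple_refl i \<circ> w) = w"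
  by (simp add: fun_eq_iff)

lemma inv_simple_refl [simp]: "pinv (simple_refl i) = simple_refl i"
  by (rule inv_unique_comp) simp_all

lemma simple_refl_permutes: "i \<in> {1..<n} \<Longrightarrow> simple_refl i permutes {1..n}"
  unfolding simple_refl_def by (rule permutes_swap_id) auto

lemma comp_simple_refl_permutes:
  "w permutes {1..n} \<Longrightarrow> i \<in> {1..<n} \<Longrightarrow> w \<circ> simple_refl i permutes {1..n}"
  by (rule permutes_compose[OF simple_refl_permutes])

lemma simple_refl_comp_permutes:
  "w permutes {1..n} \<Longrightarrow> i \<in> {1..<n} \<Longrightarrow> simple_refl i \<circ> w permutes {1..n}"
  by (rule permutes_compose[OF _ simple_refl_permutes])

text \<open>The pair \<open>(i, Suc i)\<close> is the only one whose order an adjacent transposition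
  reverses; this is why lengths change by exactly one.\<close>

lemma simple_refl_less:
  assumes "a < b" "(a, b) \<noteq> (i, Suc i)"
  shows "simple_refl i a < simple_refl i b"
  using assms by (auto simp: simple_refl_def transpose_def)

lemma insert_eqI: "x \<in> A \<Longrightarrow> B \<subseteq> A - {x} \<Longrightarrow> A - {x} \<subseteq> B \<Longrightarrow> A = insert x B"
  by blast

text \<open>Applying the transposition to both positions carries the inversions of \<open>w\<close>
  bijectively onto those of \<open>w \<circ> simple_refl i\<close>, except for the new inversion
  \<open>(i, Suc i)\<close>.\<close>

lemma perm_length_ascent:
  assumes w: "w permutes {1..n}" and i: "i \<in> {1..<n}" and asc: "w i < w (Suc i)"
  shows "perm_length n (w \<circ> simple_refl i) = Suc (perm_length n w)"
proof -
  let ?I = "\<lambda>w. {(a, b). 1 \<le> a \<and> a < b \<and> b \<le> n \<and> w b < (w a :: nat)}"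
  let ?f = "map_prod (simple_refl i) (simple_refl i)"
  have fin: "finite (?I w)"
    by (rule finite_subset[of _ "{1..n} \<times> {1..n}"]) auto
  have rng: "simple_refl i a \<in> {1..n} \<longleftrightarrow> a \<in> {1..n}" for a
    using permutes_in_image[OF simple_refl_permutes[OF i]] .
  have sub: "?f ` ?I w \<subseteq> ?I (w \<circ> simple_refl i) - {(i, Suc i)}"
  proof
    fix p assume "p \<in> ?f ` ?I w"
    then obtain a b where p: "p = ?f (a, b)" and h: "1 \<le> a" "a < b" "b \<le> n" "w b < w a"
      by auto
    then have ne: "(a, b) \<noteq> (i, Suc i)" using asc by auto
    have "simple_refl i a < simple_refl i b" by (rule simple_refl_less) (use h ne in auto)
    moreover have "simple_refl i a \<in> {1..n}" "simple_refl i b \<in> {1..n}" using h rng by auto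
    moreover have "(simple_refl i a, simple_refl i b) \<noteq> (i, Suc i)"
    proof
      assume "(simple_refl i a, simple_refl i b) = (i, Suc i)"
      then have "a = Suc i" "b = i"
        using simple_refl_simple_refl[of i a] simple_refl_simple_refl[of i b] by auto
      then show False using h by simp
    qed
    ultimately show "p \<in> ?I (w \<circ> simple_refl i) - {(i, Suc i)}"
      using h by (simp add: p)
  qed
  have sup: "?I (w \<circ> simple_refl i) - {(i, Suc i)} \<subseteq> ?f ` ?I w"
  proof
    fix p assume "p \<in> ?I (w \<circ> simple_refl i) - {(i, Suc i)}"
    then obtain a b where p: "p = (a, b)" and h: "1 \<le> a" "a < b" "b \<le> n"
      "(w \<circ> simple_refl i) b < (w \<circ> simple_refl i) a" "(a, b) \<noteq> (i, Suc i)"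
      by blast
    have "simple_refl i a < simple_refl i b" by (rule simple_refl_less) (use h in auto)
    moreover have "simple_refl i a \<in> {1..n}" "simple_refl i b \<in> {1..n}" using h rng by auto
    ultimately have "(simple_refl i a, simple_refl i b) \<in> ?I w" using h by auto
    moreover have "p = ?f (simple_refl i a, simple_refl i b)" by (simp add: p)
    ultimately show "p \<in> ?f ` ?I w" by blast
  qed
  have "(i, Suc i) \<in> ?I (w \<circ> simple_refl i)" using asc i by simp
  then have "?I (w \<circ> simple_refl i) = insert (i, Suc i) (?f ` ?I w)"
    using sub sup insert_eqI[of "(i, Suc i)" "?I (w \<circ> simple_refl i)" "?f ` ?I w"] by simp
  moreover have "(i, Suc i) \<notin> ?f ` ?I w"
  proof
    assume "(i, Suc i) \<in> ?f ` ?I w"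
    with sub have "(i, Suc i) \<in> ?I (w \<circ> simple_refl i) - {(i, Suc i)}" by (rule subsetD)
    then show False by simp
  qed
  moreover have "inj ?f"
    by (intro prod.inj_map inj_on_inverseI[of _ "simple_refl i"]) simp_all
  then have "card (?f ` ?I w) = card (?I w)" by (rule card_image[OF inj_on_subset]) simp
  moreover have "finite (?f ` ?I w)" using fin by (rule finite_imageI)
  ultimately have "card (?I (w \<circ> simple_refl i)) = Suc (card (?I w))"
    by (metis (no_types, lifting) card_insert_disjoint)
  then show ?thesis unfolding perm_length_def .
qed

lemma perm_length_descent:
  assumes w: "w permutes {1..n}" and i: "i \<in> {1..<n}" and desc: "w (Suc i) < w i"
  shows "perm_length n w = Suc (perm_length n (w \<circ> simple_refl i))"
  using perm_length_ascent[OF comp_simple_refl_permutes[OF w i] i] desc by simp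

lemma perm_ascent_or_descent:
  assumes "w permutes S" shows "w i < w (Suc i) \<or> w (Suc i) < (w i :: nat)"
  using injD[OF permutes_inj[OF assms], of i "Suc i"] by (cases "w i = w (Suc i)") auto

text \<open>An inversion at positions \<open>(a, b)\<close> of \<open>w\<close> gives one at
  positions \<open>(w b, w a)\<close> of the inverse. This map is injective, and it is available in
  both directions.\<close>

lemma perm_length_inv:
  assumes w: "w permutes {1..n}"
  shows "perm_length n (pinv w) = perm_length n w"
proof -
  let ?I = "\<lambda>w. {(a, b). 1 \<le> a \<and> a < b \<and> b \<le> n \<and> w b < (w a :: nat)}"
  have sub: "(\<lambda>(a, b). (w b, w a)) ` ?I w \<subseteq> ?I (pinv w)" if w: "w permutes {1..n}" for w
  proof
    fix p assume "p \<in> (\<lambda>(a, b). (w b, w a)) ` ?I w"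
    then obtain a b where p: "p = (w b, w a)" and ab: "1 \<le> a" "a < b" "b \<le> n" "w b < w a" by auto
    have "w a \<in> {1..n}" "w b \<in> {1..n}" using ab permutes_in_image[OF w, of a] permutes_in_image[OF w, of b] by simp_all
    then show "p \<in> ?I (pinv w)" using ab by (simp add: p permutes_inverses(2)[OF w])
  qed
  have le: "card (?I w) \<le> card (?I (pinv w))" if w: "w permutes {1..n}" for w
  proof (rule card_inj_on_le[OF _ sub[OF w]])
    show "inj_on (\<lambda>(a, b). (w b, w a)) (?I w)"
      by (auto simp: inj_on_def permutes_inj[OF w, THEN inj_eq])
    show "finite (?I (pinv w))"
      by (rule finite_subset[of _ "{1..n} \<times> {1..n}"]) auto
  qed
  from le[OF w] le[OF permutes_inv[OF w]] show ?thesis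
    unfolding perm_length_def permutes_inv_inv[OF w] by (rule antisym[rotated])
qed

lemma inv_simple_refl_comp:
  assumes "w permutes S" shows "pinv (simple_refl i \<circ> w) = pinv w \<circ> simple_refl i"
proof -
  have "bij (simple_refl i)" by (rule o_bij[of "simple_refl i"]) simp_all
  then show ?thesis using o_inv_distrib[of "simple_refl i" w] permutes_bij[OF assms] by simp
qed

lemma inv_comp_simple_refl:
  assumes "w permutes S" shows "pinv (w \<circ> simple_refl i) = simple_refl i \<circ> pinv w"
proof -
  have "bij (simple_refl i)" by (rule o_bij[of "simple_refl i"]) simp_all
  then show ?thesis using o_inv_distrib[of w "simple_refl i"] permutes_bij[OF assms] by simp
qed

lemma perm_length_left_ascent:
  assumes w: "w permutes {1..n}" and i: "i \<in> {1..<n}" and asc: "pinv w i < pinv w (Suc i)"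
  shows "perm_length n (simple_refl i \<circ> w) = Suc (perm_length n w)"
  using perm_length_ascent[OF permutes_inv[OF w] i asc]
    perm_length_inv[OF simple_refl_comp_permutes[OF w i]] perm_length_inv[OF w]
  by (simp add: inv_simple_refl_comp[OF w])

lemma perm_length_left_descent:
  assumes w: "w permutes {1..n}" and i: "i \<in> {1..<n}" and desc: "pinv w (Suc i) < pinv w i"
  shows "perm_length n w = Suc (perm_length n (simple_refl i \<circ> w))"
  using perm_length_descent[OF permutes_inv[OF w] i desc]
    perm_length_inv[OF simple_refl_comp_permutes[OF w i]] perm_length_inv[OF w]
  by (simp add: inv_simple_refl_comp[OF w])

text \<open>An increasing permutation satisfies \<open>a \<le> w a\<close> everywhere; one strict
  inequality would make the sum of the values exceed the sum of the positions.\<close>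

lemma perm_no_descent_id:
  assumes w: "w permutes {1..n}" and asc: "\<And>i. i \<in> {1..<n} \<Longrightarrow> w i < w (Suc i)"
  shows "w = id"
proof -
  have ge: "a \<le> w a" if "a \<le> n" for a
    using that
  proof (induction a)
    case (Suc a)
    show ?case
    proof (cases "a = 0")
      case True
      then show ?thesis using permutes_in_image[OF w, of 1] Suc.prems by auto
    next
      case False
      then have "w a < w (Suc a)" using asc Suc.prems by simp
      then show ?thesis using Suc by simp
    qed
  qed simp
  have "w a = a" if a: "a \<in> {1..n}" for a
  proof (rule ccontr)
    assume ne: "w a \<noteq> a"
    have "(\<Sum>a\<in>{1..n}. a) < (\<Sum>a\<in>{1..n}. w a)"
      using a ne ge by (intro sum_strict_mono_ex1) (auto intro!: bexI[of _ a] simp: le_neq_implies_less)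
    then show False using sum.permute[OF w, of id] by simp
  qed
  then show ?thesis using permutes_not_in[OF w] by (auto simp: fun_eq_iff)
qed

lemma perm_length_id [simp]: "perm_length n id = 0"
proof -
  have "{(i, j). 1 \<le> i \<and> i < j \<and> j \<le> n \<and> id j < (id i :: nat)} = {}" by auto
  then show ?thesis unfolding perm_length_def by (simp only: card.empty)
qed

text \<open>The inversion-set description of the weak order, by induction on the length of
  \<open>pinv \<tau> \<circ> \<sigma>\<close>. A descent of this permutation at \<open>i\<close>
  means that \<tau> has the letters \<open>\<sigma> i\<close> and \<open>\<sigma> (Suc i)\<close> in
  the opposite order; by hypothesis they cannot already form an inversion of \<sigma>, so exchanging
  them is a weak step towards \<tau>.\<close>

lemma perm_weak_le_inversions:
  assumes \<sigma>: "\<sigma> permutes {1..n}" and \<tau>: "\<tau> permutes {1..n}"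
    and "\<And>a b. 1 \<le> a \<Longrightarrow> a < b \<Longrightarrow> b \<le> n \<Longrightarrow> \<sigma> b < \<sigma> a \<Longrightarrow> pinv \<tau> (\<sigma> a) < pinv \<tau> (\<sigma> b)"
  shows "perm_weak_le n \<sigma> \<tau>"
  using \<sigma> assms(3)
proof (induction "perm_length n (pinv \<tau> \<circ> \<sigma>)" arbitrary: \<sigma>)
  case 0
  have p: "pinv \<tau> \<circ> \<sigma> permutes {1..n}"
    using 0 permutes_compose permutes_inv[OF \<tau>] by blast
  have "(pinv \<tau> \<circ> \<sigma>) i < (pinv \<tau> \<circ> \<sigma>) (Suc i)" if "i \<in> {1..<n}" for i
    using perm_length_descent[OF p that] perm_ascent_or_descent[OF p, of i] "0.hyps" by linarith
  then have "pinv \<tau> \<circ> \<sigma> = id" by (rule perm_no_descent_id[OF p])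
  then have "\<sigma> = \<tau>"
    using permutes_inverses(1)[OF \<tau>] by (auto simp: fun_eq_iff) metis
  then show ?case by (simp add: perm_weak_le_def)
next
  case (Suc l)
  have p: "pinv \<tau> \<circ> \<sigma> permutes {1..n}"
    using Suc permutes_compose permutes_inv[OF \<tau>] by blast
  obtain i where i: "i \<in> {1..<n}" and desc: "(pinv \<tau> \<circ> \<sigma>) (Suc i) < (pinv \<tau> \<circ> \<sigma>) i"
  proof (rule ccontr)
    assume "\<not> thesis"
    then have "pinv \<tau> \<circ> \<sigma> = id"
      using perm_no_descent_id[OF p] perm_ascent_or_descent[OF p] that by blast
    then show False using Suc.hyps(2) by simp
  qed
  let ?\<sigma>' = "\<sigma> \<circ> simple_refl i"
  have asc: "\<sigma> i < \<sigma> (Suc i)"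
    using Suc.prems(2)[of i "Suc i"] desc i perm_ascent_or_descent[OF Suc.prems(1), of i] by auto
  have "perm_weak_le n ?\<sigma>' \<tau>"
  proof (rule Suc.hyps(1))
    show "l = perm_length n (pinv \<tau> \<circ> ?\<sigma>')"
      using perm_length_descent[OF p i desc] Suc.hyps(2) unfolding o_assoc by linarith
    show "?\<sigma>' permutes {1..n}" by (rule comp_simple_refl_permutes[OF Suc.prems(1) i])
    fix a b assume ab: "1 \<le> a" "a < b" "b \<le> n" "?\<sigma>' b < ?\<sigma>' a"
    show "pinv \<tau> (?\<sigma>' a) < pinv \<tau> (?\<sigma>' b)"
    proof (cases "(a, b) = (i, Suc i)")
      case True
      then show ?thesis using desc by simp
    next
      case False
      have "simple_refl i a < simple_refl i b" by (rule simple_refl_less) (use ab False in auto)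
      moreover have "simple_refl i a \<in> {1..n}" "simple_refl i b \<in> {1..n}"
        using ab permutes_in_image[OF simple_refl_permutes[OF i]] by auto
      ultimately show ?thesis using Suc.prems(2) ab(4) by simp
    qed
  qed
  moreover have "perm_weak_step n \<sigma> ?\<sigma>'" using i asc by (auto simp: perm_weak_step_def)
  ultimately show ?case
    unfolding perm_weak_le_def by (meson converse_rtranclp_into_rtranclp)
qed

lemma id_perm_weak_le:
  assumes "\<tau> permutes {1..n}" shows "perm_weak_le n id \<tau>"
  by (rule perm_weak_le_inversions[OF permutes_id assms]) simp

section \<open>Cells, entries and ascents of standard tableaux\<close>

definition cells :: "tableau \<Rightarrow> (nat \<times> nat) set" where
  "cells T = {(r, c). r < length T \<and> c < length (T ! r)}"

definition entry_pos :: "tableau \<Rightarrow> nat \<Rightarrow> nat \<times> nat" where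
  "entry_pos T x = (THE p. p \<in> cells T \<and> T ! fst p ! snd p = x)"

abbreviation "entry_row T x \<equiv> fst (entry_pos T x)"
abbreviation "entry_col T x \<equiv> snd (entry_pos T x)"

text \<open>The complement of the usual descent set of a tableau. The column form is chosen because
  ascents at consecutive \<open>i\<close> can be chained into a strict inequality of
  columns.\<close>

definition ascent :: "tableau \<Rightarrow> nat \<Rightarrow> bool" where
  "ascent T i \<longleftrightarrow> entry_col T i < entry_col T (Suc i)"

lemma cells_iff [simp]: "(r, c) \<in> cells T \<longleftrightarrow> r < length T \<and> c < length (T ! r)"
  by (simp add: cells_def)

lemma YT_row_nonempty: "T \<in> YT n \<Longrightarrow> r < length T \<Longrightarrow> T ! r \<noteq> []"
  by (auto simp: YT_def is_partition_def shape_def dest: nth_mem)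

lemma YT_row_length: "T \<in> YT n \<Longrightarrow> r \<le> r' \<Longrightarrow> r' < length T \<Longrightarrow> length (T ! r') \<le> length (T ! r)"
  by (cases "r = r'") (auto simp: YT_def is_partition_def shape_def sorted_wrt_iff_nth_less)

lemma YT_row_less:
  assumes "T \<in> YT n" "r < length T" "c < c'" "c' < length (T ! r)" shows "T ! r ! c < T ! r ! c'"
  using assms by (auto simp: YT_def sorted_wrt_iff_nth_less)

lemma YT_row_mono:
  assumes "T \<in> YT n" "r < length T" "c \<le> c'" "c' < length (T ! r)" shows "T ! r ! c \<le> T ! r ! c'"
  using YT_row_less[OF assms(1,2) _ assms(4)] assms(3) by (cases "c = c'") (auto simp: less_imp_le)

lemma YT_col_less:
  assumes T: "T \<in> YT n" and "r < r'" "r' < length T" "c < length (T ! r')"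
  shows "T ! r ! c < T ! r' ! c"
  using assms(2-)
proof (induction r')
  case (Suc r')
  have step: "T ! r' ! c < T ! Suc r' ! c"
    using T Suc.prems by (auto simp: YT_def columns_increasing_def)
  show ?case
  proof (cases "r = r'")
    case False
    have "c < length (T ! r')" using YT_row_length[OF T, of r' "Suc r'"] Suc.prems by simp
    then show ?thesis using Suc False step by simp
  qed (use step in simp)
qed simp

lemma YT_entry_less:
  assumes T: "T \<in> YT n" and "(r', c') \<in> cells T" "r \<le> r'" "c \<le> c'" "(r, c) \<noteq> (r', c')"
  shows "T ! r ! c < T ! r' ! c'"
proof (cases "r = r'")
  case True
  then show ?thesis using YT_row_less[OF T, of r' c c'] assms by auto
next
  case False
  then have "T ! r ! c < T ! r' ! c" using YT_col_less[OF T, of r r' c] assms by auto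
  also have "\<dots> \<le> T ! r' ! c'" using YT_row_mono[OF T, of r' c c'] assms by auto
  finally show ?thesis .
qed

lemma YT_entry_range:
  assumes T: "T \<in> YT n" and "(r, c) \<in> cells T" shows "T ! r ! c \<in> {1..n}"
proof -
  have "T ! r \<in> set T" "T ! r ! c \<in> set (T ! r)" using assms by auto
  then have "T ! r ! c \<in> set (concat T)" by auto
  moreover have "set (concat T) = {1..n}" using T by (simp add: YT_def)
  ultimately show ?thesis by (simp only:)
qed

lemma YT_entry_exists:
  assumes T: "T \<in> YT n" and x: "x \<in> {1..n}"
  obtains r c where "(r, c) \<in> cells T" "T ! r ! c = x"
proof -
  have "x \<in> set (concat T)" using assms by (simp add: YT_def)
  then obtain row where "row \<in> set T" "x \<in> set row" by auto
  then show ?thesis using that by (auto simp: in_set_conv_nth)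
qed

lemma YT_entry_inj:
  assumes T: "T \<in> YT n" and p: "(r, c) \<in> cells T" "(r', c') \<in> cells T" and eq: "T ! r ! c = T ! r' ! c'"
  shows "(r, c) = (r', c')"
proof -
  have dis: "distinct (concat T)" using T by (simp add: YT_def)
  have "[] \<notin> set T" using YT_row_nonempty[OF T] by (metis in_set_conv_nth)
  then have "distinct T" using dis by (simp add: distinct_concat_iff removeAll_id)
  have "T ! r = T ! r'"
  proof (rule ccontr)
    assume "T ! r \<noteq> T ! r'"
    then have "set (T ! r) \<inter> set (T ! r') = {}" using dis p by (auto simp: distinct_concat_iff)
    then show False using p eq by (auto dest: nth_mem)
  qed
  then have r: "r = r'" using \<open>distinct T\<close> p by (simp add: nth_eq_iff_index_eq)
  have "distinct (T ! r)" using dis p by (auto simp: distinct_concat_iff)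
  then show ?thesis using r p eq by (simp add: nth_eq_iff_index_eq)
qed

lemma entry_pos_eq:
  assumes T: "T \<in> YT n" and p: "(r, c) \<in> cells T" and "T ! r ! c = x"
  shows "entry_pos T x = (r, c)"
  unfolding entry_pos_def
proof (rule the_equality)
  show "(r, c) \<in> cells T \<and> T ! fst (r, c) ! snd (r, c) = x" using assms by simp
next
  fix q assume "q \<in> cells T \<and> T ! fst q ! snd q = x"
  then show "q = (r, c)" using YT_entry_inj[OF T, of "fst q" "snd q" r c] assms by simp
qed

lemma entry_pos_cell:
  assumes T: "T \<in> YT n" and x: "x \<in> {1..n}"
  shows "entry_row T x < length T" "entry_col T x < length (T ! entry_row T x)"
    "T ! entry_row T x ! entry_col T x = x"
proof -
  obtain r c where "(r, c) \<in> cells T" "T ! r ! c = x" using YT_entry_exists[OF T x] .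
  then show "entry_row T x < length T" "entry_col T x < length (T ! entry_row T x)"
    "T ! entry_row T x ! entry_col T x = x"
    using entry_pos_eq[OF T] by auto
qed

lemma entry_less_cases:
  assumes T: "T \<in> YT n" and x: "x \<in> {1..n}" and y: "y \<in> {1..n}" and "x < y"
  shows "entry_row T x < entry_row T y \<or> entry_col T x < entry_col T y"
proof (rule ccontr)
  assume "\<not> ?thesis"
  moreover have "entry_pos T x \<noteq> entry_pos T y"
    using entry_pos_cell(3)[OF T x] entry_pos_cell(3)[OF T y] assms(4) by auto
  ultimately have "T ! entry_row T y ! entry_col T y < T ! entry_row T x ! entry_col T x"
    by (intro YT_entry_less[OF T]) (use entry_pos_cell[OF T x] in \<open>auto simp: prod_eq_iff cells_def split_beta\<close>)
  then show False using entry_pos_cell(3)[OF T x] entry_pos_cell(3)[OF T y] assms(4) by simp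
qed

text \<open>If \<open>Suc i\<close> were both strictly above and strictly to the right of
  \<open>i\<close>, the cell in the row of \<open>Suc i\<close> and the column of \<open>i\<close>
  would hold an integer strictly between \<open>i\<close> and \<open>Suc i\<close>.\<close>

lemma ascent_iff_row:
  assumes T: "T \<in> YT n" and i: "i \<in> {1..<n}"
  shows "ascent T i \<longleftrightarrow> entry_row T (Suc i) \<le> entry_row T i"
proof
  assume "entry_row T (Suc i) \<le> entry_row T i"
  then show "ascent T i" using entry_less_cases[OF T, of i "Suc i"] i by (auto simp: ascent_def)
next
  assume asc: "ascent T i"
  show "entry_row T (Suc i) \<le> entry_row T i"
  proof (rule ccontr)
    let ?r = "entry_row T i" and ?c = "entry_col T i"
    let ?r' = "entry_row T (Suc i)" and ?c' = "entry_col T (Suc i)"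
    assume "\<not> ?r' \<le> ?r"
    then have lt: "?r < ?r'" by simp
    note p = entry_pos_cell[OF T, of i] and p' = entry_pos_cell[OF T, of "Suc i"]
    have cell: "(?r', ?c) \<in> cells T" using p' asc i by (auto simp: ascent_def)
    have "i < T ! ?r' ! ?c" using YT_entry_less[OF T cell, of ?r ?c] lt p i by (auto simp: prod_eq_iff)
    moreover have "T ! ?r' ! ?c < Suc i"
      using YT_entry_less[OF T, of ?r' ?c' ?r' ?c] p' asc i by (auto simp: ascent_def prod_eq_iff cells_def split_beta)
    ultimately show False by simp
  qed
qed

lemma less_chain:
  fixes f :: "nat \<Rightarrow> 'a :: order"
  assumes "\<And>i. x \<le> i \<Longrightarrow> i < y \<Longrightarrow> f i < f (Suc i)" and "x < y"
  shows "f x < f y"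
  using assms
proof (induction y)
  case (Suc y)
  have "f y < f (Suc y)" using Suc.prems by simp
  moreover have "f x < f y" if "x \<noteq> y" using Suc that by simp
  ultimately show ?case by (cases "x = y") auto
qed simp

section \<open>Reading words and insertion\<close>

abbreviation reading_word :: "tableau \<Rightarrow> nat list" where
  "reading_word T \<equiv> concat (rev T)"

text \<open>Restricting a word to two consecutive values records which of them comes first.
  Insertion preserves this information, and for the reading word of a standard tableau it tells
  whether \<open>i\<close> is an ascent.\<close>

abbreviation pair_filter :: "nat \<Rightarrow> nat list \<Rightarrow> nat list" where
  "pair_filter i \<equiv> filter (\<lambda>z. z = i \<or> z = Suc i)"

lemma reading_word_YT:
  assumes "T \<in> YT n" shows "distinct (reading_word T)" "set (reading_word T) = {1..n}"
proof -
  have "mset (reading_word T) = mset (concat T)" by (induction T) auto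
  then show "distinct (reading_word T)" "set (reading_word T) = {1..n}"
    using assms mset_eq_imp_distinct_iff[of "reading_word T" "concat T"] by (auto simp: YT_def)
qed

lemma filter_pair_sorted_wrt:
  assumes "distinct w" "sorted_wrt R w" "a \<in> set w" "b \<in> set w" "a \<noteq> b" "\<not> R b a"
  shows "filter (\<lambda>z. z = a \<or> z = b) w = [a, b]"
proof -
  let ?l = "filter (\<lambda>z. z = a \<or> z = b) w"
  have d: "distinct ?l" and s: "set ?l = {a, b}" using assms by auto
  have "length ?l = 2" using distinct_card[OF d] s assms(5) by simp
  then obtain u v where l: "?l = [u, v]" by (auto simp: numeral_2_eq_2 length_Suc_conv)
  moreover have "sorted_wrt R ?l" using assms(2) by (rule sorted_wrt_filter)
  ultimately have "R u v" by simp
  then show ?thesis using l s assms(5,6) by (auto simp: doubleton_eq_iff)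
qed

lemma sorted_wrt_concat:
  assumes "\<And>xs. xs \<in> set xss \<Longrightarrow> sorted_wrt R xs"
    and "sorted_wrt (\<lambda>xs ys. \<forall>x\<in>set xs. \<forall>y\<in>set ys. R x y) xss"
  shows "sorted_wrt R (concat xss)"
  using assms by (induction xss) (auto simp: sorted_wrt_append)

lemma sorted_wrt_reading_word:
  assumes T: "T \<in> YT n"
  shows "sorted_wrt (\<lambda>x y. entry_row T y < entry_row T x \<or> entry_row T y = entry_row T x \<and> x < y)
    (reading_word T)"
proof (rule sorted_wrt_concat)
  fix xs assume "xs \<in> set (rev T)"
  then obtain r where r: "r < length T" "xs = T ! r" by (auto simp: in_set_conv_nth)
  show "sorted_wrt (\<lambda>x y. entry_row T y < entry_row T x \<or> entry_row T y = entry_row T x \<and> x < y) xs"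
    unfolding sorted_wrt_iff_nth_less
  proof (intro allI impI disjI2)
    fix i j assume "i < j" "j < length xs"
    then show "entry_row T (xs ! j) = entry_row T (xs ! i) \<and> xs ! i < xs ! j"
      using r YT_row_less[OF T, of r i j] entry_pos_eq[OF T, of r i] entry_pos_eq[OF T, of r j] by simp
  qed
next
  show "sorted_wrt (\<lambda>xs ys. \<forall>x\<in>set xs. \<forall>y\<in>set ys.
      entry_row T y < entry_row T x \<or> entry_row T y = entry_row T x \<and> x < y) (rev T)"
    unfolding sorted_wrt_rev unfolding sorted_wrt_iff_nth_less
  proof (intro allI impI ballI disjI1)
    fix i j x y assume h: "i < j" "j < length T" "x \<in> set (T ! j)" "y \<in> set (T ! i)"
    then obtain c d where "c < length (T ! j)" "T ! j ! c = x" "d < length (T ! i)" "T ! i ! d = y"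
      by (auto simp: in_set_conv_nth)
    then show "entry_row T y < entry_row T x"
      using h entry_pos_eq[OF T, of j c x] entry_pos_eq[OF T, of i d y] by simp
  qed
qed

lemma pair_filter_reading_word:
  assumes T: "T \<in> YT n" and i: "i \<in> {1..<n}"
  shows "pair_filter i (reading_word T) = (if ascent T i then [i, Suc i] else [Suc i, i])"
proof -
  have d: "distinct (reading_word T)" "set (reading_word T) = {1..n}"
    by (fact reading_word_YT[OF T])+
  have eq: "filter (\<lambda>z. z = Suc i \<or> z = i) (reading_word T) = pair_filter i (reading_word T)"
    by (rule filter_cong) auto
  have mem: "i \<in> set (reading_word T)" "Suc i \<in> set (reading_word T)" using d(2) i by simp_all
  show ?thesis
  proof (cases "ascent T i")
    case True
    then show ?thesis
      using filter_pair_sorted_wrt[OF d(1) sorted_wrt_reading_word[OF T] mem] ascent_iff_row[OF T i]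
      by simp
  next
    case False
    then show ?thesis
      using filter_pair_sorted_wrt[OF d(1) sorted_wrt_reading_word[OF T] mem(2,1)] ascent_iff_row[OF T i]
      unfolding eq by simp
  qed
qed

lemma pair_filter_perm_word:
  assumes \<sigma>: "\<sigma> permutes {1..n}" and i: "i \<in> {1..<n}"
  shows "pair_filter i (map \<sigma> [1..<Suc n]) =
    (if pinv \<sigma> i < pinv \<sigma> (Suc i) then [i, Suc i] else [Suc i, i])"
proof -
  let ?w = "map \<sigma> [1..<Suc n]"
  have d: "distinct ?w" using permutes_inj[OF \<sigma>] by (simp add: distinct_map inj_on_subset)
  have st: "set ?w = {1..n}" using permutes_image[OF \<sigma>] by (simp add: atLeastLessThanSuc_atLeastAtMost del: upt_Suc)
  have s: "sorted_wrt (\<lambda>x y. pinv \<sigma> x < pinv \<sigma> y) ?w"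
    by (simp add: sorted_wrt_map permutes_inverses(2)[OF \<sigma>] del: upt_Suc)
  have eq: "filter (\<lambda>z. z = Suc i \<or> z = i) ?w = pair_filter i ?w"
    by (rule filter_cong) auto
  have mem: "i \<in> set ?w" "Suc i \<in> set ?w" unfolding st using i by simp_all
  have "pinv \<sigma> i \<noteq> pinv \<sigma> (Suc i)"
    using permutes_inj[OF permutes_inv[OF \<sigma>]] by (simp add: inj_eq)
  then show ?thesis
    using filter_pair_sorted_wrt[OF d s mem] filter_pair_sorted_wrt[OF d s mem(2,1)] unfolding eq
    by (cases "pinv \<sigma> i < pinv \<sigma> (Suc i)") (simp_all del: upt_Suc)
qed

lemma row_bump_cases:
  assumes "sorted_wrt (<) r" "x \<notin> set r"
  shows "(row_bump x r = (r @ [x], None) \<and> (\<forall>z\<in>set r. z < x)) \<or>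
    (\<exists>p y q. r = p @ y # q \<and> row_bump x r = (p @ x # q, Some y) \<and> x < y \<and> (\<forall>z\<in>set p. z < x))"
  using assms
proof (induction r)
  case (Cons a r)
  show ?case
  proof (cases "x < a")
    case True
    then show ?thesis by (intro disjI2 exI[of _ "[]"]) auto
  next
    case False
    then have "a < x" using Cons.prems by auto
    from Cons have "(row_bump x r = (r @ [x], None) \<and> (\<forall>z\<in>set r. z < x)) \<or>
      (\<exists>p y q. r = p @ y # q \<and> row_bump x r = (p @ x # q, Some y) \<and> x < y \<and> (\<forall>z\<in>set p. z < x))" by simp
    then show ?thesis
    proof
      assume "\<exists>p y q. r = p @ y # q \<and> row_bump x r = (p @ x # q, Some y) \<and> x < y \<and> (\<forall>z\<in>set p. z < x)"
      then obtain p y q where "r = p @ y # q" "row_bump x r = (p @ x # q, Some y)" "x < y" "\<forall>z\<in>set p. z < x"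
        by blast
      then show ?thesis using \<open>a < x\<close> by (intro disjI2 exI[of _ "a # p"] exI[of _ y] exI[of _ q]) auto
    qed (use \<open>a < x\<close> in auto)
  qed
qed simp

text \<open>Bumping moves \<open>x\<close> and \<open>y\<close> past letters whose values do not neighbour them, so letters with
  consecutive values never change their relative order.\<close>

lemma row_insert_pair_filter:
  assumes "\<forall>r\<in>set T. sorted_wrt (<) r" "distinct (concat T)" "x \<notin> set (concat T)"
  shows "pair_filter i (reading_word (row_insert x T)) = pair_filter i (reading_word T @ [x])
    \<and> (\<forall>r\<in>set (row_insert x T). sorted_wrt (<) r)
    \<and> mset (concat (row_insert x T)) = add_mset x (mset (concat T))"
  using assms
proof (induction T arbitrary: x)
  case (Cons r rs)
  have sr: "sorted_wrt (<) r" and xr: "x \<notin> set r" using Cons.prems by auto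
  from row_bump_cases[OF sr xr] show ?case
  proof
    assume "row_bump x r = (r @ [x], None) \<and> (\<forall>z\<in>set r. z < x)"
    then show ?thesis using Cons.prems by (auto simp: sorted_wrt_append)
  next
    assume "\<exists>p y q. r = p @ y # q \<and> row_bump x r = (p @ x # q, Some y) \<and> x < y \<and> (\<forall>z\<in>set p. z < x)"
    then obtain p y q where b: "r = p @ y # q" "row_bump x r = (p @ x # q, Some y)" "x < y" "\<forall>z\<in>set p. z < x"
      by blast
    have qy: "\<forall>z\<in>set q. y < z" and pq: "sorted_wrt (<) (p @ x # q)"
      using sr b by (auto simp: sorted_wrt_append)
    have "y \<notin> set (concat rs)" using Cons.prems b by auto
    moreover have "\<forall>r\<in>set rs. sorted_wrt (<) r" "distinct (concat rs)" using Cons.prems by auto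
    ultimately have IH: "pair_filter i (reading_word (row_insert y rs)) = pair_filter i (reading_word rs @ [y])"
      "\<forall>r\<in>set (row_insert y rs). sorted_wrt (<) r"
      "mset (concat (row_insert y rs)) = add_mset y (mset (concat rs))"
      using Cons.IH[of y] by blast+
    have "pair_filter i (y # p @ x # q) = pair_filter i (p @ y # q @ [x])"
    proof -
      have "pair_filter i (y # p) = pair_filter i (p @ [y])"
      proof (cases "y = i \<or> y = Suc i")
        case True
        have "z \<noteq> i \<and> z \<noteq> Suc i" if "z \<in> set p" for z
          using True bspec[OF b(4) that] b(3) by linarith
        then have "pair_filter i p = []" by (simp add: filter_empty_conv)
        then show ?thesis by simp
      qed simp
      moreover have "pair_filter i (x # q) = pair_filter i (q @ [x])"
      proof (cases "x = i \<or> x = Suc i")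
        case True
        have "z \<noteq> i \<and> z \<noteq> Suc i" if "z \<in> set q" for z
          using True bspec[OF qy that] b(3) by linarith
        then have "pair_filter i q = []" by (simp add: filter_empty_conv)
        then show ?thesis by simp
      qed simp
      ultimately have "pair_filter i ((y # p) @ (x # q)) = pair_filter i ((p @ [y]) @ (q @ [x]))"
        unfolding filter_append by (simp only:)
      then show ?thesis by simp
    qed
    then have "pair_filter i ((reading_word rs @ [y]) @ p @ x # q) = pair_filter i (reading_word (r # rs) @ [x])"
      using b(1) by (simp only: filter_append append_assoc append.simps rev.simps concat_append concat.simps)
    moreover have "pair_filter i ((reading_word rs @ [y]) @ p @ x # q) =
        pair_filter i (reading_word (row_insert x (r # rs)))"
      unfolding filter_append[of _ "reading_word rs @ [y]"] IH(1)[symmetric] using b(2) by simp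
    ultimately have "pair_filter i (reading_word (row_insert x (r # rs))) =
        pair_filter i (reading_word (r # rs) @ [x])"
      by (simp only:)
    moreover have "\<forall>r\<in>set (row_insert x (r # rs)). sorted_wrt (<) r" using IH(2) b pq by simp
    moreover have "mset (concat (row_insert x (r # rs))) = add_mset x (mset (concat (r # rs)))"
      using IH(3) b by simp
    ultimately show ?thesis by blast
  qed
qed simp

lemma fold_row_insert_pair_filter:
  assumes "\<forall>r\<in>set T. sorted_wrt (<) r" "distinct (concat T @ w)"
  shows "pair_filter i (reading_word (fold row_insert w T)) = pair_filter i (reading_word T @ w)"
  using assms
proof (induction w arbitrary: T)
  case (Cons x w)
  note ins = row_insert_pair_filter[of T x i]
  have sp: "\<forall>r\<in>set T. sorted_wrt (<) r" "distinct (concat T)" "x \<notin> set (concat T)"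
    using Cons.prems by auto
  have ms: "mset (concat (row_insert x T)) = add_mset x (mset (concat T))" using ins[OF sp] by blast
  have "distinct (concat (row_insert x T) @ w)"
  proof -
    have "mset (concat (row_insert x T) @ w) = mset (concat T @ x # w)" using ms by simp
    then show ?thesis using Cons.prems(2) mset_eq_imp_distinct_iff by blast
  qed
  then have "pair_filter i (reading_word (fold row_insert w (row_insert x T))) =
      pair_filter i (reading_word (row_insert x T) @ w)"
    using Cons.IH ins[OF sp] by blast
  then show ?case using ins[OF sp] by simp
qed simp

lemma pair_filter_insertion_tableau:
  assumes \<sigma>: "\<sigma> permutes {1..n}" and i: "i \<in> {1..<n}"
  shows "pair_filter i (reading_word (insertion_tableau n \<sigma>)) =
    (if pinv \<sigma> i < pinv \<sigma> (Suc i) then [i, Suc i] else [Suc i, i])"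
proof -
  have "distinct (map \<sigma> [1..<Suc n])"
    using permutes_inj[OF \<sigma>] by (simp add: distinct_map inj_on_subset)
  then show ?thesis
    unfolding insertion_tableau_def
    using fold_row_insert_pair_filter[of "[]" "map \<sigma> [1..<Suc n]" i] pair_filter_perm_word[OF \<sigma> i]
    by simp
qed

lemma ascent_insertion_tableau:
  assumes "\<sigma> permutes {1..n}" "i \<in> {1..<n}" "insertion_tableau n \<sigma> \<in> YT n"
  shows "ascent (insertion_tableau n \<sigma>) i \<longleftrightarrow> pinv \<sigma> i < pinv \<sigma> (Suc i)"
  using pair_filter_insertion_tableau[OF assms(1,2)] pair_filter_reading_word[OF assms(3,2)]
  by (auto split: if_splits)

lemma row_bump_all_less:
  "(\<forall>z\<in>set p. z < x) \<Longrightarrow> row_bump x p = (p @ [x], None)"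
  "(\<forall>z\<in>set p. z < x) \<Longrightarrow> x < y \<Longrightarrow> row_bump x (p @ y # q) = (p @ x # q, Some y)"
  by (induction p) (auto simp: not_less_iff_gr_or_eq)

section \<open>A tableau is recovered by inserting its reading word\<close>

lemma fold_row_insert_row:
  assumes "sorted_wrt (<) (p @ xs)" "length ys \<le> length xs" "\<And>c. c < length ys \<Longrightarrow> xs ! c < ys ! c"
  shows "fold row_insert xs ((p @ ys) # rest) = (p @ xs) # fold row_insert ys rest"
  using assms
proof (induction xs arbitrary: p ys rest)
  case (Cons x xs)
  have px: "\<forall>z\<in>set p. z < x" using Cons.prems(1) by (auto simp: sorted_wrt_append)
  have srt: "sorted_wrt (<) ((p @ [x]) @ xs)" using Cons.prems(1) by simp
  show ?case
  proof (cases ys)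
    case Nil
    then show ?thesis using Cons.IH[OF srt, of "[]" rest] row_bump_all_less(1)[OF px] by simp
  next
    case (Cons y ys')
    have "x < y" using Cons.prems(3)[of 0] Cons by simp
    moreover have "fold row_insert xs (((p @ [x]) @ ys') # row_insert y rest) =
        ((p @ [x]) @ xs) # fold row_insert ys' (row_insert y rest)"
      using Cons.IH[OF srt, of ys'] Cons.prems(2) Cons.prems(3)[of "Suc _"] Cons by auto
    ultimately show ?thesis using Cons row_bump_all_less(2)[OF px] by simp
  qed
qed simp

lemma columns_increasing_Cons: "columns_increasing (r # rs) \<Longrightarrow> columns_increasing rs"
  unfolding columns_increasing_def by (metis Suc_less_eq length_Cons nth_Cons_Suc)

text \<open>Each letter of the bottom row bumps the letter directly above it, since the letters
  inserted before are smaller. The second row is thereby inserted, in its own order, into the rows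
  above it, and the argument repeats.\<close>

lemma fold_row_insert_tableau:
  assumes "\<forall>r\<in>set T. sorted_wrt (<) r \<and> r \<noteq> []" "columns_increasing T" "sorted_wrt (\<ge>) (shape T)" "T \<noteq> []"
  shows "fold row_insert (hd T) (tl T) = T"
  using assms
proof (induction T)
  case (Cons r rs)
  show ?case
  proof (cases rs)
    case Nil
    obtain x xs where r: "r = x # xs" using Cons.prems(1) by (cases r) auto
    have "fold row_insert r [] = fold row_insert r [[]]" by (simp add: r)
    also have "\<dots> = [r]" using fold_row_insert_row[of "[]" r "[]" "[]"] Cons.prems by simp
    finally show ?thesis using Nil by simp
  next
    case (Cons ys rest)
    have col: "columns_increasing rs"
      using Cons.prems(2) by (rule columns_increasing_Cons)
    have "fold row_insert r rs = r # fold row_insert ys rest"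
      unfolding Cons
    proof (rule fold_row_insert_row[of "[]" r ys rest, simplified])
      fix c assume "c < length ys"
      then show "r ! c < ys ! c"
        using Cons.prems(2) Cons unfolding columns_increasing_def by (auto dest: spec[of _ 0])
    qed (use Cons.prems Cons in \<open>auto simp: shape_def\<close>)
    then show ?thesis using Cons.IH Cons.prems(1,3) col Cons by (auto simp: shape_def)
  qed
qed simp

lemma fold_row_insert_reading_word:
  assumes "\<forall>r\<in>set T. sorted_wrt (<) r \<and> r \<noteq> []" "columns_increasing T" "sorted_wrt (\<ge>) (shape T)"
  shows "fold row_insert (reading_word T) [] = T"
  using assms
proof (induction T)
  case (Cons r rs)
  have "columns_increasing rs"
    using Cons.prems(2) by (rule columns_increasing_Cons)
  then have "fold row_insert (reading_word rs) [] = rs"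
    using Cons by (auto simp: shape_def)
  then show ?case using fold_row_insert_tableau[OF Cons.prems] by simp
qed simp

definition word_perm :: "nat \<Rightarrow> nat list \<Rightarrow> nat \<Rightarrow> nat" where
  "word_perm n w i = (if i \<in> {1..n} then w ! (i - 1) else i)"

lemma word_perm:
  assumes "distinct w" "set w = {1..n}"
  shows "word_perm n w permutes {1..n}" "map (word_perm n w) [1..<Suc n] = w"
proof -
  have len: "length w = n" using distinct_card[OF assms(1)] assms(2) by simp
  show m: "map (word_perm n w) [1..<Suc n] = w"
    by (rule nth_equalityI) (auto simp: len word_perm_def simp del: upt_Suc)
  have "word_perm n w ` {1..n} = {1..n}"
    using arg_cong[OF m, of set] assms(2) by (simp add: atLeastLessThanSuc_atLeastAtMost del: upt_Suc)
  moreover from this have "inj_on (word_perm n w) {1..n}" by (simp add: eq_card_imp_inj_on)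
  ultimately show "word_perm n w permutes {1..n}"
    by (intro bij_imp_permutes) (auto simp: bij_betw_def word_perm_def)
qed

definition row_perm :: "nat \<Rightarrow> tableau \<Rightarrow> nat \<Rightarrow> nat" where
  "row_perm n T = word_perm n (reading_word T)"

lemma row_perm_permutes: "T \<in> YT n \<Longrightarrow> row_perm n T permutes {1..n}"
  unfolding row_perm_def by (intro word_perm reading_word_YT)

lemma insertion_tableau_row_perm:
  assumes T: "T \<in> YT n" shows "insertion_tableau n (row_perm n T) = T"
proof -
  have "\<forall>r\<in>set T. sorted_wrt (<) r \<and> r \<noteq> []"
    using T YT_row_nonempty[OF T] by (auto simp: YT_def in_set_conv_nth)
  then have "fold row_insert (reading_word T) [] = T"
    using T by (intro fold_row_insert_reading_word) (auto simp: YT_def is_partition_def)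
  then show ?thesis
    unfolding insertion_tableau_def row_perm_def using word_perm(2)[OF reading_word_YT[OF T]] by simp
qed

lemma row_perm_before:
  assumes T: "T \<in> YT n" and a: "1 \<le> a" "a < b" "b \<le> n"
  defines "x \<equiv> row_perm n T a" and "y \<equiv> row_perm n T b"
  shows "entry_row T y < entry_row T x \<or> entry_row T y = entry_row T x \<and> x < y"
proof -
  have "length (reading_word T) = n"
    using distinct_card[OF reading_word_YT(1)[OF T]] reading_word_YT(2)[OF T] by simp
  then show ?thesis
    using sorted_wrt_reading_word[OF T] a
    by (auto simp: x_def y_def row_perm_def word_perm_def sorted_wrt_iff_nth_less)
qed

section \<open>Row canonical tableaux\<close>

abbreviation offset :: "nat list \<Rightarrow> nat \<Rightarrow> nat" where
  "offset mu b \<equiv> sum_list (take b mu)"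

lemma offset_Suc: "b < length mu \<Longrightarrow> offset mu (Suc b) = offset mu b + mu ! b"
  by (simp add: take_Suc_conv_app_nth)

lemma offset_mono: "b \<le> b' \<Longrightarrow> offset mu b \<le> offset mu b'"
  by (auto simp: le_iff_add take_add)

lemma length_row_canonical [simp]: "length (row_canonical mu) = length mu"
  by (simp add: row_canonical_def)

lemma length_row_canonical_row [simp]: "b < length mu \<Longrightarrow> length (row_canonical mu ! b) = mu ! b"
  by (simp add: row_canonical_def offset_Suc del: upt_Suc)

lemma row_canonical_entry:
  "b < length mu \<Longrightarrow> c < mu ! b \<Longrightarrow> row_canonical mu ! b ! c = Suc (offset mu b + c)"
  by (simp add: row_canonical_def offset_Suc del: upt_Suc)

lemma partition_nth_pos: "is_partition n mu \<Longrightarrow> b < length mu \<Longrightarrow> 0 < mu ! b"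
  by (metis gr0I is_partition_def nth_mem)

lemma partition_nth_mono: "is_partition n mu \<Longrightarrow> b \<le> b' \<Longrightarrow> b' < length mu \<Longrightarrow> mu ! b' \<le> mu ! b"
  by (cases "b = b'") (auto simp: is_partition_def sorted_wrt_iff_nth_less)

lemma concat_row_canonical: "concat (row_canonical mu) = [1..<Suc (sum_list mu)]"
proof -
  have "concat (map (\<lambda>r. [Suc (offset mu r) ..< Suc (offset mu (Suc r))]) [0..<k]) = [1..<Suc (offset mu k)]"
    if "k \<le> length mu" for k
    using that
  proof (induction k)
    case (Suc k)
    have "[1..<Suc (offset mu k)] @ [Suc (offset mu k) ..< Suc (offset mu (Suc k))] = [1..<Suc (offset mu (Suc k))]"
      using Suc.prems upt_add_eq_append[of 1 "Suc (offset mu k)" "mu ! k"] by (simp add: offset_Suc)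
    then show ?case using Suc by (simp del: upt_Suc add: upt_Suc[of 0])
  qed simp
  from this[of "length mu"] show ?thesis by (simp add: row_canonical_def)
qed

lemma shape_row_canonical: "shape (row_canonical mu) = mu"
  by (rule nth_equalityI) (simp_all add: shape_def)

lemma row_canonical_YT:
  assumes mu: "is_partition n mu" shows "row_canonical mu \<in> YT n"
proof -
  have "sum_list mu = n" using mu by (simp add: is_partition_def)
  then have c: "concat (row_canonical mu) = [1..<Suc n]" using concat_row_canonical[of mu] by simp
  have "columns_increasing (row_canonical mu)"
    unfolding columns_increasing_def
  proof (intro allI impI, elim conjE)
    fix r c assume "Suc r < length (row_canonical mu)" "c < length (row_canonical mu ! Suc r)"
    moreover from this have "mu ! Suc r \<le> mu ! r" using partition_nth_mono[OF mu] by simp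
    ultimately show "row_canonical mu ! r ! c < row_canonical mu ! Suc r ! c"
      using partition_nth_pos[OF mu, of r] by (simp add: row_canonical_entry offset_Suc)
  qed
  moreover have "\<forall>r\<in>set (row_canonical mu). sorted_wrt (<) r"
    by (auto simp: row_canonical_def simp del: upt_Suc)
  moreover have "distinct (concat (row_canonical mu))" "set (concat (row_canonical mu)) = {1..n}"
    unfolding c by (auto simp del: upt_Suc)
  ultimately show ?thesis
    using mu unfolding YT_def by (simp only: mem_Collect_eq shape_row_canonical simp_thms)
qed

lemma row_canonical_pos:
  assumes "is_partition n mu" "b < length mu" "c < mu ! b"
  shows "entry_pos (row_canonical mu) (Suc (offset mu b + c)) = (b, c)"
  using assms by (intro entry_pos_eq[OF row_canonical_YT[OF assms(1)]]) (simp_all add: row_canonical_entry)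

lemma row_canonical_posE:
  assumes mu: "is_partition n mu" and x: "x \<in> {1..n}"
  obtains b c where "b < length mu" "c < mu ! b" "x = Suc (offset mu b + c)"
    "entry_pos (row_canonical mu) x = (b, c)"
proof -
  obtain b c where bc: "(b, c) \<in> cells (row_canonical mu)" "row_canonical mu ! b ! c = x"
    using YT_entry_exists[OF row_canonical_YT[OF mu] x] .
  then have "b < length mu" "c < mu ! b" by auto
  then show ?thesis
    using that row_canonical_entry[of b mu c] row_canonical_pos[OF mu, of b c] bc by simp
qed

lemma row_canonical_row_mono:
  assumes mu: "is_partition n mu" and x: "x \<in> {1..n}" and y: "y \<in> {1..n}" and "x \<le> y"
  shows "entry_row (row_canonical mu) x \<le> entry_row (row_canonical mu) y"
proof (rule ccontr)
  assume n: "\<not> ?thesis"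
  obtain b c where bc: "b < length mu" "c < mu ! b" "x = Suc (offset mu b + c)"
    "entry_pos (row_canonical mu) x = (b, c)" using row_canonical_posE[OF mu x] .
  obtain b' c' where bc': "b' < length mu" "c' < mu ! b'" "y = Suc (offset mu b' + c')"
    "entry_pos (row_canonical mu) y = (b', c')" using row_canonical_posE[OF mu y] .
  have "offset mu (Suc b') \<le> offset mu b" using n bc bc' by (intro offset_mono) simp
  then show False using assms(4) bc bc' by (simp add: offset_Suc)
qed

lemma row_canonical_ascent:
  assumes mu: "is_partition n mu" and x: "x \<in> {1..n}" and y: "y \<in> {1..n}"
    and eq: "entry_row (row_canonical mu) x = entry_row (row_canonical mu) y"
    and i: "x \<le> i" "i < y"
  shows "ascent (row_canonical mu) i"
proof -
  have "entry_row (row_canonical mu) (Suc i) \<le> entry_row (row_canonical mu) y"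
    by (rule row_canonical_row_mono[OF mu]) (use x y i in auto)
  also have "\<dots> = entry_row (row_canonical mu) x" using eq by simp
  also have "\<dots> \<le> entry_row (row_canonical mu) i"
    by (rule row_canonical_row_mono[OF mu]) (use x y i in auto)
  finally show ?thesis
    using ascent_iff_row[OF row_canonical_YT[OF mu], of i] x y i by auto
qed

lemma one_row_eq_row_canonical: "one_row n = row_canonical [n]"
  by (simp add: one_row_def row_canonical_def)

lemma is_partition_singleton: "n \<ge> 1 \<Longrightarrow> is_partition n [n]"
  by (simp add: is_partition_def)

text \<open>The common value of the four intervals below \<open>row_canonical mu\<close>. In terms
  of descents: those of \<open>T\<close> are among those of \<open>row_canonical mu\<close>.\<close>

definition compat_tableaux :: "nat \<Rightarrow> nat list \<Rightarrow> tableau set" where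
  "compat_tableaux n mu =
    {T \<in> YT n. \<forall>i\<in>{1..<n}. ascent (row_canonical mu) i \<longrightarrow> ascent T i}"

text \<open>A row of \<open>row_canonical mu\<close> is a run of consecutive integers whose inner
  members are ascents, so chaining the ascents of \<open>T\<close> shows that the row occupies a
  horizontal strip of \<open>T\<close>.\<close>

lemma compat_tableaux_col_less:
  assumes mu: "is_partition n mu" and T: "T \<in> compat_tableaux n mu"
    and x: "x \<in> {1..n}" and y: "y \<in> {1..n}" and "x < y"
    and eq: "entry_row (row_canonical mu) x = entry_row (row_canonical mu) y"
  shows "entry_col T x < entry_col T y"
proof (rule less_chain[OF _ \<open>x < y\<close>])
  fix i assume "x \<le> i" "i < y"
  then have "ascent T i"
    using row_canonical_ascent[OF mu x y eq] T x y by (auto simp: compat_tableaux_def)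
  then show "entry_col T i < entry_col T (Suc i)" by (simp add: ascent_def)
qed

lemma one_row_ascent:
  assumes "n \<ge> 1" "i \<in> {1..<n}" shows "ascent (one_row n) i"
proof -
  have "entry_pos (row_canonical [n]) (Suc (offset [n] 0 + c)) = (0, c)" if "c < n" for c
    using that by (intro row_canonical_pos[OF is_partition_singleton[OF assms(1)]]) auto
  from this[of "i - 1"] this[of i] assms show ?thesis
    by (auto simp: ascent_def one_row_eq_row_canonical)
qed

lemma one_row_in_compat:
  assumes "n \<ge> 1" shows "one_row n \<in> compat_tableaux n mu"
  using one_row_ascent[OF assms] row_canonical_YT[OF is_partition_singleton[OF assms]]
  by (auto simp: compat_tableaux_def one_row_eq_row_canonical)

section \<open>The weak order\<close>

text \<open>Consider an inversion in the reading word of \<open>T\<close>, a larger letter before a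
  smaller one. If \<open>row_canonical mu\<close> read the smaller one first, both would lie in one
  row of it, because its rows are read from the top and larger entries never lie lower. Then all
  values between them are ascents of \<open>T\<close>, which forces the smaller letter to come first
  in the word of \<open>T\<close> too, a contradiction.\<close>

lemma row_perm_weak_le:
  assumes mu: "is_partition n mu" and T: "T \<in> compat_tableaux n mu"
  shows "perm_weak_le n (row_perm n T) (row_perm n (row_canonical mu))"
proof -
  let ?C = "row_canonical mu"
  have TY: "T \<in> YT n" using T by (simp add: compat_tableaux_def)
  note CY = row_canonical_YT[OF mu]
  define \<sigma> where "\<sigma> = row_perm n T"
  define \<tau> where "\<tau> = row_perm n ?C"
  have \<sigma>: "\<sigma> permutes {1..n}" and \<tau>: "\<tau> permutes {1..n}"
    unfolding \<sigma>_def \<tau>_def using TY CY by (intro row_perm_permutes; simp)+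
  have "perm_weak_le n \<sigma> \<tau>"
  proof (rule perm_weak_le_inversions[OF \<sigma> \<tau>])
    fix a b assume ab: "1 \<le> a" "a < b" "b \<le> n" and lt: "\<sigma> b < \<sigma> a"
    have mem: "\<sigma> a \<in> {1..n}" "\<sigma> b \<in> {1..n}"
      using ab permutes_in_image[OF \<sigma>, of a] permutes_in_image[OF \<sigma>, of b] by simp_all
    have mem': "pinv \<tau> (\<sigma> a) \<in> {1..n}" "pinv \<tau> (\<sigma> b) \<in> {1..n}"
      using mem permutes_in_image[OF permutes_inv[OF \<tau>]] by blast+
    have ne: "pinv \<tau> (\<sigma> a) \<noteq> pinv \<tau> (\<sigma> b)"
      using lt permutes_inverses(1)[OF \<tau>] by (metis less_irrefl)
    show "pinv \<tau> (\<sigma> a) < pinv \<tau> (\<sigma> b)"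
    proof (rule ccontr)
      assume "\<not> ?thesis"
      then have "pinv \<tau> (\<sigma> b) < pinv \<tau> (\<sigma> a)" using ne by simp
      then have "entry_row ?C (\<sigma> a) < entry_row ?C (\<sigma> b) \<or> entry_row ?C (\<sigma> a) = entry_row ?C (\<sigma> b)"
        using row_perm_before[OF CY, of "pinv \<tau> (\<sigma> b)" "pinv \<tau> (\<sigma> a)"] mem'
        unfolding \<tau>_def[symmetric] permutes_inverses(1)[OF \<tau>] by auto
      moreover have "entry_row ?C (\<sigma> b) \<le> entry_row ?C (\<sigma> a)"
        using row_canonical_row_mono[OF mu mem(2,1)] lt by simp
      ultimately have eq: "entry_row ?C (\<sigma> b) = entry_row ?C (\<sigma> a)" by simp
      have "pinv \<sigma> i < pinv \<sigma> (Suc i)" if "\<sigma> b \<le> i" "i < \<sigma> a" for i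
      proof -
        have i: "i \<in> {1..<n}" using that mem by auto
        have "ascent T i"
          using row_canonical_ascent[OF mu mem(2,1) eq that] T i by (auto simp: compat_tableaux_def)
        then show ?thesis
          using ascent_insertion_tableau[OF \<sigma> i] insertion_tableau_row_perm[OF TY] TY
          by (simp add: \<sigma>_def)
      qed
      then have "pinv \<sigma> (\<sigma> b) < pinv \<sigma> (\<sigma> a)"
        using lt by (rule less_chain)
      then show False using ab permutes_inverses(2)[OF \<sigma>] by simp
    qed
  qed
  then show ?thesis by (simp add: \<sigma>_def \<tau>_def)
qed

lemma insertion_tableau_id: "n \<ge> 1 \<Longrightarrow> insertion_tableau n id = one_row n"
  unfolding insertion_tableau_def
  using fold_row_insert_reading_word[of "one_row n"]
  by (simp add: one_row_def columns_increasing_def shape_def del: upt_Suc)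

lemma one_row_below_perm:
  assumes "n \<ge> 1" "T \<in> YT n"
  shows "id permutes {1..n}" "row_perm n T permutes {1..n}" "insertion_tableau n id = one_row n"
    "insertion_tableau n (row_perm n T) = T" "perm_weak_le n id (row_perm n T)"
  using assms row_perm_permutes insertion_tableau_row_perm insertion_tableau_id id_perm_weak_le
  by (auto intro: permutes_id)

text \<open>A weak step moves a larger letter in front of a smaller one and leaves every other pair
  of letters alone, so a value that precedes its successor afterwards did so before.\<close>

lemma perm_weak_step_inv_less:
  assumes \<sigma>: "\<sigma> permutes {1..n}" and step: "perm_weak_step n \<sigma> \<tau>" and lt: "pinv \<tau> i < pinv \<tau> (Suc i)"
  shows "\<tau> permutes {1..n}" "pinv \<sigma> i < pinv \<sigma> (Suc i)"
proof -
  obtain k where k: "k \<in> {1..<n}" "\<sigma> k < \<sigma> (Suc k)" "\<tau> = \<sigma> \<circ> simple_refl k"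
    using step by (auto simp: perm_weak_step_def)
  then show "\<tau> permutes {1..n}" using comp_simple_refl_permutes[OF \<sigma>] by simp
  have inv: "pinv \<tau> = simple_refl k \<circ> pinv \<sigma>" using inv_comp_simple_refl[OF \<sigma>] k by simp
  show "pinv \<sigma> i < pinv \<sigma> (Suc i)"
  proof (rule ccontr)
    assume "\<not> ?thesis"
    moreover have "pinv \<sigma> i \<noteq> pinv \<sigma> (Suc i)" using lt inv by auto
    ultimately have gt: "pinv \<sigma> (Suc i) < pinv \<sigma> i" by simp
    have "(pinv \<sigma> (Suc i), pinv \<sigma> i) \<noteq> (k, Suc k)"
    proof
      assume "(pinv \<sigma> (Suc i), pinv \<sigma> i) = (k, Suc k)"
      then have "\<sigma> k = Suc i" "\<sigma> (Suc k) = i" using permutes_inverses(1)[OF \<sigma>] by (metis Pair_inject)+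
      then show False using k by simp
    qed
    then have "simple_refl k (pinv \<sigma> (Suc i)) < simple_refl k (pinv \<sigma> i)" by (rule simple_refl_less[OF gt])
    then show False using lt inv by simp
  qed
qed

lemma perm_weak_le_inv_less:
  assumes "perm_weak_le n \<sigma> \<tau>" "\<sigma> permutes {1..n}" "pinv \<tau> i < pinv \<tau> (Suc i)"
  shows "pinv \<sigma> i < pinv \<sigma> (Suc i)"
  using assms(1) unfolding perm_weak_le_def
  using assms(2,3)
proof (induction rule: converse_rtranclp_induct)
  case (step \<sigma> \<sigma>')
  have "\<sigma>' permutes {1..n}"
    using step.hyps(1) comp_simple_refl_permutes[OF step.prems(1)] by (auto simp: perm_weak_step_def)
  then have "pinv \<sigma>' i < pinv \<sigma>' (Suc i)" using step by simp
  then show ?case using perm_weak_step_inv_less(2)[OF step.prems(1) step.hyps(1)] by simp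
qed

text \<open>Stated for reading words instead of \<open>ascent\<close>, because the intermediate
  tableaux of the transitive closure are only given as insertion tableaux, without membership in
  \<open>YT n\<close>.\<close>

lemma weak_le_pair_filter:
  assumes "weak_le n S T" "i \<in> {1..<n}" "pair_filter i (reading_word T) = [i, Suc i]"
  shows "pair_filter i (reading_word S) = [i, Suc i]"
  using assms(1) unfolding weak_le_def
  using assms(2,3)
proof (induction rule: converse_tranclp_induct)
  case (base S)
  then obtain \<sigma> \<tau> where st: "\<sigma> permutes {1..n}" "\<tau> permutes {1..n}"
    "insertion_tableau n \<sigma> = S" "insertion_tableau n \<tau> = T" "perm_weak_le n \<sigma> \<tau>" by blast
  have "pinv \<tau> i < pinv \<tau> (Suc i)"
    using pair_filter_insertion_tableau[OF st(2) base.prems(1)] base.prems(2) st(4) by (auto split: if_splits)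
  then show ?case
    using perm_weak_le_inv_less[OF st(5,1)] pair_filter_insertion_tableau[OF st(1) base.prems(1)] st(3) by simp
next
  case (step S S')
  then obtain \<sigma> \<tau> where st: "\<sigma> permutes {1..n}" "\<tau> permutes {1..n}"
    "insertion_tableau n \<sigma> = S" "insertion_tableau n \<tau> = S'" "perm_weak_le n \<sigma> \<tau>" by blast
  have "pair_filter i (reading_word S') = [i, Suc i]" using step by blast
  then have "pinv \<tau> i < pinv \<tau> (Suc i)"
    using pair_filter_insertion_tableau[OF st(2) step.prems(1)] st(4) by (auto split: if_splits)
  then show ?case
    using perm_weak_le_inv_less[OF st(5,1)] pair_filter_insertion_tableau[OF st(1) step.prems(1)] st(3) by simp
qed

lemma interval_weak_le:
  assumes n: "n \<ge> 1" and mu: "is_partition n mu"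
  shows "interval n (weak_le n) (one_row n) (row_canonical mu) = compat_tableaux n mu"
proof (intro equalityI subsetI)
  fix T assume "T \<in> interval n (weak_le n) (one_row n) (row_canonical mu)"
  then have T: "T \<in> YT n" "weak_le n T (row_canonical mu)" by (auto simp: interval_def)
  have "ascent T i" if i: "i \<in> {1..<n}" and asc: "ascent (row_canonical mu) i" for i
    using weak_le_pair_filter[OF T(2) i] pair_filter_reading_word[OF row_canonical_YT[OF mu] i]
      pair_filter_reading_word[OF T(1) i] asc by (auto split: if_splits)
  then show "T \<in> compat_tableaux n mu" using T by (simp add: compat_tableaux_def)
next
  fix T assume T: "T \<in> compat_tableaux n mu"
  then have TY: "T \<in> YT n" by (simp add: compat_tableaux_def)
  note CY = row_canonical_YT[OF mu]
  have "weak_le n (one_row n) T"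
    unfolding weak_le_def by (rule tranclp.r_into_trancl) (use one_row_below_perm[OF n TY] in blast)
  moreover have "weak_le n T (row_canonical mu)"
    unfolding weak_le_def
    by (rule tranclp.r_into_trancl)
      (use one_row_below_perm[OF n TY] one_row_below_perm[OF n CY] row_perm_weak_le[OF mu T] in blast)
  ultimately show "T \<in> interval n (weak_le n) (one_row n) (row_canonical mu)"
    using TY by (simp add: interval_def)
qed

section \<open>Laurent polynomials\<close>

lemma map_key_uminus_lookup: "Poly_Mapping.lookup (laurent_bar p) k = Poly_Mapping.lookup p (- k)"
  unfolding laurent_bar_def by (subst map_key.rep_eq) (auto simp: inj_on_def)

lemma laurent_bar_simps [simp]:
  "laurent_bar 0 = 0" "laurent_bar (a + b) = laurent_bar a + laurent_bar b"
  "laurent_bar (a - b) = laurent_bar a - laurent_bar b" "laurent_bar (- a) = - laurent_bar a"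
  "laurent_bar (v_pow k) = v_pow (- k)" "laurent_bar 1 = 1"
  by (auto intro!: poly_mapping_eqI
      simp: map_key_uminus_lookup lookup_add lookup_minus v_pow_def lookup_single lookup_one when_def)

lemma laurent_induct [case_names zero v_pow diff]:
  fixes p :: laurent
  assumes "P 0" "\<And>k. P (v_pow k)" "\<And>a b. P a \<Longrightarrow> P b \<Longrightarrow> P (a - b)"
  shows "P p"
  by (rule frag_induction[of p UNIV]) (use assms in \<open>auto simp: v_pow_def\<close>)

lemma v_pow_mult: "v_pow k * v_pow l = v_pow (k + l)"
  by (simp add: v_pow_def mult_single)

lemma v_pow_0 [simp]: "v_pow 0 = 1"
  by (simp add: v_pow_def)

lemma v_pow_mult_v_pow [simp]: "v_pow k * (v_pow l * a) = v_pow (k + l) * a"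
  by (simp add: v_pow_mult mult.assoc[symmetric])

lemma laurent_bar_mult [simp]: "laurent_bar (a * b) = laurent_bar a * laurent_bar b"
proof (induction a rule: laurent_induct)
  case (v_pow k)
  show ?case by (induction b rule: laurent_induct) (simp_all add: v_pow_mult algebra_simps)
qed (simp_all add: algebra_simps)

lemma laurent_bar_of_int [simp]: "laurent_bar (of_int c) = of_int c"
  by (induction c rule: int_induct[of _ 0]) simp_all

lemma lookup_v_pow_mult: "Poly_Mapping.lookup (v_pow k * p) m = Poly_Mapping.lookup p (m - k)"
  by (induction p rule: laurent_induct)
    (auto simp: v_pow_mult algebra_simps lookup_minus, auto simp: v_pow_def lookup_single when_def)

lemma lookup_of_int_mult: "Poly_Mapping.lookup (of_int c * (p :: laurent)) m = c * Poly_Mapping.lookup p m"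
  by (induction c rule: int_induct[of _ 0]) (simp_all add: algebra_simps lookup_add lookup_minus)

lemma lookup_of_int: "Poly_Mapping.lookup (of_int c :: laurent) m = (if m = 0 then c else 0)"
  using lookup_of_int_mult[of c 1 m] by (simp add: lookup_one when_def)

definition positive_degrees :: "laurent \<Rightarrow> bool" where
  "positive_degrees a \<longleftrightarrow> (\<forall>k \<le> 0. Poly_Mapping.lookup a k = 0)"

definition nonneg_degrees :: "laurent \<Rightarrow> bool" where
  "nonneg_degrees a \<longleftrightarrow> (\<forall>k < 0. Poly_Mapping.lookup a k = 0)"

lemma positive_degrees_iff_keys: "positive_degrees a \<longleftrightarrow> (\<forall>k\<in>Poly_Mapping.keys a. k > 0)"
  unfolding positive_degrees_def Ball_def in_keys_iff not_le[symmetric] by blast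

lemma positive_degrees_simps:
  "positive_degrees 0" "positive_degrees a \<Longrightarrow> positive_degrees b \<Longrightarrow> positive_degrees (a + b)"
  "positive_degrees a \<Longrightarrow> positive_degrees b \<Longrightarrow> positive_degrees (a - b)"
  "positive_degrees a \<Longrightarrow> positive_degrees (of_int c * a)"
  by (simp_all add: positive_degrees_def lookup_add lookup_minus lookup_of_int_mult)

lemma positive_degrees_sum: "(\<And>z. z \<in> Z \<Longrightarrow> positive_degrees (f z)) \<Longrightarrow> positive_degrees (sum f Z)"
  by (induction Z rule: infinite_finite_induct) (auto intro: positive_degrees_simps)

text \<open>The bar negates degrees, so an invariant element without terms of degree at most 0 has
  no terms of positive degree either.\<close>

lemma positive_degrees_bar_eq_0:
  assumes "positive_degrees a" "laurent_bar a = a" shows "a = 0"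
proof (rule poly_mapping_eqI)
  fix k
  show "Poly_Mapping.lookup a k = Poly_Mapping.lookup 0 k"
    using assms map_key_uminus_lookup[of a k]
    by (cases "k \<le> 0") (auto simp: positive_degrees_def)
qed

section \<open>The Hecke algebra\<close>

text \<open>The coefficient in the quadratic relation
  \<open>H_s H_s = 1 + \<xi> H_s\<close>.\<close>

definition \<xi> :: laurent where "\<xi> = v_pow 1 - v_pow (- 1)"

lemma laurent_bar_\<xi> [simp]: "laurent_bar \<xi> = - \<xi>"
  by (simp add: \<xi>_def)

text \<open>Right multiplication by \<open>H_s\<close>, written coefficientwise: the coefficient at
  \<open>x\<close> collects \<open>H_{xs} H_s\<close>, and in addition \<open>\<xi> H_x\<close> if
  \<open>x\<close> has a right descent at \<open>i\<close>. \<open>left_op\<close> is the mirror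
  image, where the inverse of \<open>x\<close> detects the descent. This form makes relations
  between the two checkable pointwise.\<close>

definition right_op :: "nat \<Rightarrow> hecke \<Rightarrow> hecke" where
  "right_op i h = (\<lambda>x. h (x \<circ> simple_refl i) + (if x (Suc i) < x i then \<xi> * h x else 0))"

definition left_op :: "nat \<Rightarrow> hecke \<Rightarrow> hecke" where
  "left_op i h = (\<lambda>x. h (simple_refl i \<circ> x) + (if pinv x (Suc i) < pinv x i then \<xi> * h x else 0))"

abbreviation perms :: "nat \<Rightarrow> (nat \<Rightarrow> nat) set" where
  "perms n \<equiv> {w. w permutes {1..n}}"

definition hecke_carrier :: "nat \<Rightarrow> hecke set" where
  "hecke_carrier n = {h. \<forall>w. h w \<noteq> 0 \<longrightarrow> w permutes {1..n}}"

lemma finite_perms [simp]: "finite (perms n)"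
  by (rule finite_permutations) simp

lemma hecke_carrier_0: "h \<in> hecke_carrier n \<Longrightarrow> \<not> x permutes {1..n} \<Longrightarrow> h x = 0"
  unfolding hecke_carrier_def by blast

lemma hecke_carrierI: "(\<And>x. \<not> x permutes {1..n} \<Longrightarrow> h x = 0) \<Longrightarrow> h \<in> hecke_carrier n"
  unfolding hecke_carrier_def by blast

lemma hecke_std_carrier: "w permutes {1..n} \<Longrightarrow> hecke_std w \<in> hecke_carrier n"
  by (rule hecke_carrierI) (auto simp: hecke_std_def)

lemma hecke_std_comp_simple_refl: "hecke_std y (x \<circ> simple_refl i) = hecke_std (y \<circ> simple_refl i) x"
  unfolding hecke_std_def by (metis comp_simple_refl_twice)

lemma hecke_std_simple_refl_comp: "hecke_std y (simple_refl i \<circ> x) = hecke_std (simple_refl i \<circ> y) x"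
  unfolding hecke_std_def by (metis simple_refl_comp_twice)

lemma comp_simple_refl_permutes_iff:
  assumes "i \<in> {1..<n}" shows "x \<circ> simple_refl i permutes {1..n} \<longleftrightarrow> x permutes {1..n}"
  using comp_simple_refl_permutes[OF _ assms, of x] comp_simple_refl_permutes[OF _ assms, of "x \<circ> simple_refl i"]
  by auto

lemma simple_refl_comp_permutes_iff:
  assumes "i \<in> {1..<n}" shows "simple_refl i \<circ> x permutes {1..n} \<longleftrightarrow> x permutes {1..n}"
  using simple_refl_comp_permutes[OF _ assms, of x] simple_refl_comp_permutes[OF _ assms, of "simple_refl i \<circ> x"]
  by auto

lemma right_op_carrier:
  assumes "i \<in> {1..<n}" "h \<in> hecke_carrier n" shows "right_op i h \<in> hecke_carrier n"
proof (rule hecke_carrierI)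
  fix w assume w: "\<not> w permutes {1..n}"
  have "h (w \<circ> simple_refl i) = 0" "h w = 0"
    using hecke_carrier_0[OF assms(2)] w comp_simple_refl_permutes_iff[OF assms(1)] by blast+
  then show "right_op i h w = 0" by (simp add: right_op_def)
qed

lemma left_op_carrier:
  assumes "i \<in> {1..<n}" "h \<in> hecke_carrier n" shows "left_op i h \<in> hecke_carrier n"
proof (rule hecke_carrierI)
  fix w assume w: "\<not> w permutes {1..n}"
  have "h (simple_refl i \<circ> w) = 0" "h w = 0"
    using hecke_carrier_0[OF assms(2)] w simple_refl_comp_permutes_iff[OF assms(1)] by blast+
  then show "left_op i h w = 0" by (simp add: left_op_def)
qed

lemma hecke_expand:
  assumes "h \<in> hecke_carrier n" shows "h x = (\<Sum>y\<in>perms n. h y * hecke_std y x)"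
proof -
  have "(\<Sum>y\<in>perms n. h y * hecke_std y x) = (\<Sum>y\<in>perms n. if x = y then h y else 0)"
    by (rule sum.cong) (simp_all add: hecke_std_def)
  also have "\<dots> = h x"
    using hecke_carrier_0[OF assms] by (subst sum.delta'[OF finite_perms]) simp
  finally show ?thesis by simp
qed

lemma right_op_std_ascent:
  "y i < y (Suc i) \<Longrightarrow> right_op i (hecke_std y) = hecke_std (y \<circ> simple_refl i)"
  unfolding right_op_def hecke_std_comp_simple_refl by (rule ext) (auto simp: hecke_std_def)

lemma left_op_std_ascent:
  "pinv y i < pinv y (Suc i) \<Longrightarrow> left_op i (hecke_std y) = hecke_std (simple_refl i \<circ> y)"
  unfolding left_op_def hecke_std_simple_refl_comp by (rule ext) (auto simp: hecke_std_def)

lemma hecke_times_gen_eq: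
  assumes i: "i \<in> {1..<n}" and h: "h \<in> hecke_carrier n"
  shows "hecke_times_gen n i h = right_op i h"
proof
  fix x
  have std: "hecke_std_times_gen n y i x = right_op i (hecke_std y) x" if y: "y permutes {1..n}" for y
  proof -
    have "y (Suc i) < y i \<longleftrightarrow> \<not> perm_length n (y \<circ> simple_refl i) > perm_length n y"
      using perm_length_ascent[OF y i] perm_length_descent[OF y i] perm_ascent_or_descent[OF y, of i] by auto
    moreover have "hecke_std y x = 0 \<or> x = y" by (auto simp: hecke_std_def)
    ultimately show ?thesis
      unfolding hecke_std_times_gen_def right_op_def hecke_std_comp_simple_refl \<xi>_def[symmetric] by auto
  qed
  have "hecke_times_gen n i h x = (\<Sum>y\<in>perms n. h y * right_op i (hecke_std y) x)"
    unfolding hecke_times_gen_def by (rule sum.cong) (simp_all add: std)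
  also have "\<dots> = right_op i h x"
    unfolding right_op_def hecke_expand[OF h, of "x \<circ> simple_refl i"] hecke_expand[OF h, of x]
    by (auto simp: sum.distrib sum_distrib_left algebra_simps)
  finally show "hecke_times_gen n i h x = right_op i h x" .
qed

lemma simple_refl_comp_eq:
  assumes x: "x permutes S" and xi: "{x i, x (Suc i)} = {j, Suc j}"
  shows "simple_refl j \<circ> x = x \<circ> simple_refl i"
proof
  fix k
  have inj: "x k = x l \<longleftrightarrow> k = l" for l using permutes_inj[OF x] by (simp add: inj_eq)
  show "(simple_refl j \<circ> x) k = (x \<circ> simple_refl i) k"
  proof (cases "k = i \<or> k = Suc i")
    case True
    then show ?thesis using xi by (auto simp: doubleton_eq_iff)
  next
    case False
    then have "x k \<noteq> x i" "x k \<noteq> x (Suc i)" using inj by auto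
    then have "x k \<noteq> j" "x k \<noteq> Suc j" using xi by auto
    then show ?thesis using False by (simp add: simple_refl_other)
  qed
qed

lemma simple_refl_less_iff:
  assumes "a \<noteq> b" "{a, b} \<noteq> {i, Suc i}"
  shows "simple_refl i a < simple_refl i b \<longleftrightarrow> a < b"
proof -
  have "(a, b) \<noteq> (i, Suc i)" "(b, a) \<noteq> (i, Suc i)" using assms(2) by auto
  then show ?thesis
    using simple_refl_less[of a b i] simple_refl_less[of b a i] assms(1)
    by (cases "a < b") auto
qed

text \<open>Multiplications by a generator from the left and from the right commute; the only
  nontrivial case is \<open>s\<^sub>j x = x s\<^sub>i\<close>, where both descent conditions flip together.\<close>

lemma left_right_op_commute:
  assumes i: "i \<in> {1..<n}" and j: "j \<in> {1..<n}" and h: "h \<in> hecke_carrier n"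
  shows "right_op i (left_op j h) = left_op j (right_op i h)"
proof
  fix x
  show "right_op i (left_op j h) x = left_op j (right_op i h) x"
  proof (cases "x permutes {1..n}")
    case False
    have "right_op i (left_op j h) \<in> hecke_carrier n" "left_op j (right_op i h) \<in> hecke_carrier n"
      using i j h by (simp_all add: right_op_carrier left_op_carrier)
    then show ?thesis using False hecke_carrier_0 by metis
  next
    case x: True
    have inv: "pinv (x \<circ> simple_refl i) = simple_refl i \<circ> pinv x" by (rule inv_comp_simple_refl[OF x])
    have assoc: "simple_refl j \<circ> (x \<circ> simple_refl i) = simple_refl j \<circ> x \<circ> simple_refl i" by (rule o_assoc)
    show ?thesis
    proof (cases "simple_refl j \<circ> x = x \<circ> simple_refl i")
      case eq: True
      have "x (Suc i) = simple_refl j (x i)" "x i = simple_refl j (x (Suc i))"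
        using fun_cong[OF eq, of i] fun_cong[OF eq, of "Suc i"] by simp_all
      moreover have "x (Suc i) \<noteq> x i" using permutes_inj[OF x] by (simp add: inj_eq)
      ultimately have "x i = j \<and> x (Suc i) = Suc j \<or> x i = Suc j \<and> x (Suc i) = j"
        by (metis simple_refl_apply simple_refl_other)
      then have "x i = j \<and> x (Suc i) = Suc j \<and> pinv x j = i \<and> pinv x (Suc j) = Suc i \<or>
          x i = Suc j \<and> x (Suc i) = j \<and> pinv x j = Suc i \<and> pinv x (Suc j) = i"
        using permutes_inverses(2)[OF x] by metis
      then have d: "pinv x (Suc j) < pinv x j \<longleftrightarrow> x (Suc i) < x i"
        "simple_refl i (pinv x (Suc j)) < simple_refl i (pinv x j) \<longleftrightarrow> \<not> x (Suc i) < x i"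
        "simple_refl j (x (Suc i)) < simple_refl j (x i) \<longleftrightarrow> \<not> x (Suc i) < x i"
        "x i < x (Suc i) \<longleftrightarrow> \<not> x (Suc i) < x i"
        by (elim disjE conjE; simp)+
      define y where "y = x \<circ> simple_refl i"
      then have y: "x \<circ> simple_refl i = y" "simple_refl j \<circ> x = y" "y \<circ> simple_refl i = x" "simple_refl j \<circ> y = x"
        "y i = x (Suc i)" "y (Suc i) = x i" "pinv y = simple_refl i \<circ> pinv x"
        using eq inv simple_refl_comp_twice[of j x] by simp_all
      show ?thesis
        unfolding right_op_def left_op_def y comp_apply d
        by (cases "x (Suc i) < x i") (simp_all add: algebra_simps)
    next
      case ne: False
      have "{x i, x (Suc i)} \<noteq> {j, Suc j}" using simple_refl_comp_eq[OF x] ne by blast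
      moreover have "x i \<noteq> x (Suc i)" using permutes_inj[OF x] by (simp add: inj_eq)
      ultimately have 2: "(simple_refl j \<circ> x) (Suc i) < (simple_refl j \<circ> x) i \<longleftrightarrow> x (Suc i) < x i"
        by (simp add: simple_refl_less_iff insert_commute)
      have "{pinv x j, pinv x (Suc j)} \<noteq> {i, Suc i}"
      proof
        assume "{pinv x j, pinv x (Suc j)} = {i, Suc i}"
        then have "x ` {pinv x j, pinv x (Suc j)} = {x i, x (Suc i)}" by simp
        then show False
          using \<open>{x i, x (Suc i)} \<noteq> {j, Suc j}\<close> by (simp add: permutes_inverses(1)[OF x])
      qed
      moreover have "pinv x j \<noteq> pinv x (Suc j)"
        using permutes_inj[OF permutes_inv[OF x]] by (simp add: inj_eq)
      ultimately have 1: "pinv (x \<circ> simple_refl i) (Suc j) < pinv (x \<circ> simple_refl i) j \<longleftrightarrow> pinv x (Suc j) < pinv x j"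
        unfolding inv by (simp add: simple_refl_less_iff insert_commute)
      show ?thesis
        unfolding right_op_def left_op_def 1 2 assoc by (simp add: algebra_simps)
    qed
  qed
qed

lemma left_op_quadratic:
  assumes x: "h \<in> hecke_carrier n" and j: "j \<in> {1..<n}"
  shows "left_op j (left_op j h) = (\<lambda>x. h x + \<xi> * left_op j h x)"
proof
  fix x
  show "left_op j (left_op j h) x = h x + \<xi> * left_op j h x"
  proof (cases "x permutes {1..n}")
    case False
    then have "h x = 0" "left_op j h x = 0" "left_op j (left_op j h) x = 0"
      using hecke_carrier_0 left_op_carrier[OF j] assms(1) by metis+
    then show ?thesis by simp
  next
    case x: True
    have "pinv x j \<noteq> pinv x (Suc j)" using permutes_inj[OF permutes_inv[OF x]] by (simp add: inj_eq)
    then show ?thesis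
      by (auto simp: left_op_def inv_simple_refl_comp[OF x] algebra_simps)
  qed
qed

lemma right_op_quadratic:
  assumes x: "h \<in> hecke_carrier n" and j: "j \<in> {1..<n}"
  shows "right_op j (right_op j h) = (\<lambda>x. h x + \<xi> * right_op j h x)"
proof
  fix x
  show "right_op j (right_op j h) x = h x + \<xi> * right_op j h x"
  proof (cases "x permutes {1..n}")
    case False
    then have "h x = 0" "right_op j h x = 0" "right_op j (right_op j h) x = 0"
      using hecke_carrier_0 right_op_carrier[OF j] assms(1) by metis+
    then show ?thesis by simp
  next
    case x: True
    have "x j \<noteq> x (Suc j)" using permutes_inj[OF x] by (simp add: inj_eq)
    then show ?thesis by (auto simp: right_op_def algebra_simps)
  qed
qed

section \<open>Linear operators that commute with the left multiplications\<close>

definition hecke_linear :: "nat \<Rightarrow> (hecke \<Rightarrow> hecke) \<Rightarrow> bool" where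
  "hecke_linear n \<phi> \<longleftrightarrow> (\<forall>h\<in>hecke_carrier n. \<phi> h \<in> hecke_carrier n \<and>
     (\<forall>x. \<phi> h x = (\<Sum>y\<in>perms n. h y * \<phi> (hecke_std y) x)))"

lemma hecke_linear_carrier: "hecke_linear n \<phi> \<Longrightarrow> h \<in> hecke_carrier n \<Longrightarrow> \<phi> h \<in> hecke_carrier n"
  by (simp add: hecke_linear_def)

lemma hecke_linear_expand:
  "hecke_linear n \<phi> \<Longrightarrow> h \<in> hecke_carrier n \<Longrightarrow> \<phi> h x = (\<Sum>y\<in>perms n. h y * \<phi> (hecke_std y) x)"
  by (simp add: hecke_linear_def)

lemma hecke_linear_right_op: "i \<in> {1..<n} \<Longrightarrow> hecke_linear n (right_op i)"
  unfolding hecke_linear_def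
proof (intro ballI conjI allI)
  fix h x assume i: "i \<in> {1..<n}" and h: "h \<in> hecke_carrier n"
  show "right_op i h \<in> hecke_carrier n" by (rule right_op_carrier[OF i h])
  show "right_op i h x = (\<Sum>y\<in>perms n. h y * right_op i (hecke_std y) x)"
    unfolding right_op_def hecke_expand[OF h, of "x \<circ> simple_refl i"] hecke_expand[OF h, of x]
    by (auto simp: sum.distrib sum_distrib_left algebra_simps)
qed

lemma hecke_linear_left_op: "i \<in> {1..<n} \<Longrightarrow> hecke_linear n (left_op i)"
  unfolding hecke_linear_def
proof (intro ballI conjI allI)
  fix h x assume i: "i \<in> {1..<n}" and h: "h \<in> hecke_carrier n"
  show "left_op i h \<in> hecke_carrier n" by (rule left_op_carrier[OF i h])
  show "left_op i h x = (\<Sum>y\<in>perms n. h y * left_op i (hecke_std y) x)"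
    unfolding left_op_def hecke_expand[OF h, of "simple_refl i \<circ> x"] hecke_expand[OF h, of x]
    by (auto simp: sum.distrib sum_distrib_left algebra_simps)
qed

lemma hecke_linear_id: "hecke_linear n (\<lambda>h. h)"
  unfolding hecke_linear_def using hecke_expand by blast

lemma hecke_linear_comp:
  assumes \<phi>: "hecke_linear n \<phi>" and \<psi>: "hecke_linear n \<psi>"
  shows "hecke_linear n (\<lambda>h. \<phi> (\<psi> h))"
  unfolding hecke_linear_def
proof (intro ballI conjI allI)
  fix h x assume h: "h \<in> hecke_carrier n"
  note \<psi>h = hecke_linear_carrier[OF \<psi> h]
  show "\<phi> (\<psi> h) \<in> hecke_carrier n" by (rule hecke_linear_carrier[OF \<phi> \<psi>h])
  have "\<phi> (\<psi> h) x = (\<Sum>z\<in>perms n. (\<Sum>y\<in>perms n. h y * \<psi> (hecke_std y) z) * \<phi> (hecke_std z) x)"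
    unfolding hecke_linear_expand[OF \<phi> \<psi>h] hecke_linear_expand[OF \<psi> h] ..
  also have "\<dots> = (\<Sum>y\<in>perms n. \<Sum>z\<in>perms n. h y * (\<psi> (hecke_std y) z * \<phi> (hecke_std z) x))"
    unfolding sum_distrib_right by (subst sum.swap) (simp add: mult.assoc)
  also have "\<dots> = (\<Sum>y\<in>perms n. h y * \<phi> (\<psi> (hecke_std y)) x)"
  proof (rule sum.cong)
    fix y assume "y \<in> perms n"
    then have "\<psi> (hecke_std y) \<in> hecke_carrier n"
      using hecke_linear_carrier[OF \<psi>] hecke_std_carrier by blast
    then show "(\<Sum>z\<in>perms n. h y * (\<psi> (hecke_std y) z * \<phi> (hecke_std z) x)) = h y * \<phi> (\<psi> (hecke_std y)) x"
      by (simp add: hecke_linear_expand[OF \<phi>] sum_distrib_left)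
  qed simp
  finally show "\<phi> (\<psi> h) x = (\<Sum>y\<in>perms n. h y * \<phi> (\<psi> (hecke_std y)) x)" .
qed

definition left_commuting :: "nat \<Rightarrow> (hecke \<Rightarrow> hecke) \<Rightarrow> bool" where
  "left_commuting n \<phi> \<longleftrightarrow> (\<forall>j\<in>{1..<n}. \<forall>h\<in>hecke_carrier n. \<phi> (left_op j h) = left_op j (\<phi> h))"

lemma left_commutingD:
  "left_commuting n \<phi> \<Longrightarrow> j \<in> {1..<n} \<Longrightarrow> h \<in> hecke_carrier n \<Longrightarrow> \<phi> (left_op j h) = left_op j (\<phi> h)"
  by (simp add: left_commuting_def)

lemma left_descent_exists:
  assumes w: "w permutes {1..n}" and "w \<noteq> id"
  obtains j where "j \<in> {1..<n}" "pinv w (Suc j) < pinv w j"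
proof -
  have "pinv w \<noteq> id"
  proof
    assume "pinv w = id"
    then have "w = id" using permutes_inverses(1)[OF w] by (auto simp: fun_eq_iff)
    then show False using assms(2) by simp
  qed
  then show ?thesis
    using that perm_no_descent_id[OF permutes_inv[OF w]] perm_ascent_or_descent[OF permutes_inv[OF w]] by blast
qed

text \<open>The induction matches \<open>H_w = H_s H_u\<close> for a left ascent of
  \<open>u\<close>, so that each standard basis element is reached from the unit by left
  multiplications only.\<close>

lemma perm_left_induct [consumes 1, case_names id step]:
  assumes w: "w permutes {1..n}" and id: "\<And>w. w = id \<Longrightarrow> P w"
    and step: "\<And>j u w. j \<in> {1..<n} \<Longrightarrow> u permutes {1..n} \<Longrightarrow> pinv u j < pinv u (Suc j) \<Longrightarrow>
      w = simple_refl j \<circ> u \<Longrightarrow> P u \<Longrightarrow> P w"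
  shows "P w"
  using w
proof (induction "perm_length n w" arbitrary: w rule: less_induct)
  case less
  show ?case
  proof (cases "w = id")
    case False
    obtain j where j: "j \<in> {1..<n}" "pinv w (Suc j) < pinv w j"
      using left_descent_exists[OF less.prems False] .
    let ?u = "simple_refl j \<circ> w"
    have u: "?u permutes {1..n}" by (rule simple_refl_comp_permutes[OF less.prems j(1)])
    have "P ?u" using less.hyps[OF _ u] perm_length_left_descent[OF less.prems j] by simp
    moreover have "pinv ?u j < pinv ?u (Suc j)"
      using j inv_simple_refl_comp[OF less.prems] by simp
    ultimately show ?thesis using step[OF j(1) u, of w] by simp
  qed (use id in simp)
qed

text \<open>The algebra is generated from the unit by left multiplications with generators, so an
  operator commuting with these is determined by its value at the unit.\<close>

lemma left_commuting_unique:
  assumes \<phi>: "hecke_linear n \<phi>" "left_commuting n \<phi>" and \<psi>: "hecke_linear n \<psi>" "left_commuting n \<psi>"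
    and one: "\<phi> (hecke_std id) = \<psi> (hecke_std id)" and h: "h \<in> hecke_carrier n"
  shows "\<phi> h = \<psi> h"
proof -
  have "\<phi> (hecke_std y) = \<psi> (hecke_std y)" if "y permutes {1..n}" for y
    using that
  proof (induction rule: perm_left_induct)
    case (step j u w)
    show ?case
      unfolding step(4) left_op_std_ascent[OF step(3), symmetric]
      using left_commutingD[OF \<phi>(2) step(1)] left_commutingD[OF \<psi>(2) step(1)]
        hecke_std_carrier[OF step(2)] step(5) by simp
  next
    case (id w)
    show ?case unfolding id by (rule one)
  qed
  then show ?thesis
    by (intro ext) (simp add: hecke_linear_expand[OF \<phi>(1) h] hecke_linear_expand[OF \<psi>(1) h])
qed

lemma left_commuting_right_op: "i \<in> {1..<n} \<Longrightarrow> left_commuting n (right_op i)"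
  unfolding left_commuting_def using left_right_op_commute by blast

lemma left_commuting_id: "left_commuting n (\<lambda>h. h)"
  by (simp add: left_commuting_def)

lemma left_commuting_comp:
  "left_commuting n \<phi> \<Longrightarrow> hecke_linear n \<psi> \<Longrightarrow> left_commuting n \<psi> \<Longrightarrow> left_commuting n (\<lambda>h. \<phi> (\<psi> h))"
  unfolding left_commuting_def by (metis hecke_linear_carrier)

section \<open>Reduced words and the ring structure\<close>

definition word_prod :: "nat list \<Rightarrow> nat \<Rightarrow> nat" where
  "word_prod is = foldr (\<lambda>i u. simple_refl i \<circ> u) is id"

lemma word_prod_Nil [simp]: "word_prod [] = id"
  by (simp add: word_prod_def)

lemma word_prod_Cons: "word_prod (i # is) = simple_refl i \<circ> word_prod is"
  unfolding word_prod_def foldr.simps comp_apply ..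

lemma word_prod_snoc: "word_prod (is @ [i]) = word_prod is \<circ> simple_refl i"
  by (induction "is") (simp_all only: append.simps word_prod_Cons word_prod_Nil o_assoc comp_id id_comp)

lemma word_prod_permutes: "set is \<subseteq> {1..<n} \<Longrightarrow> word_prod is permutes {1..n}"
proof (induction "is")
  case (Cons a "is")
  then show ?case unfolding word_prod_Cons by (intro simple_refl_comp_permutes) simp_all
qed (simp add: permutes_id)

lemma reduced_word_exists:
  assumes "w permutes {1..n}"
  shows "\<exists>is. set is \<subseteq> {1..<n} \<and> word_prod is = w \<and> length is = perm_length n w"
  using assms
proof (induction rule: perm_left_induct)
  case (id w)
  show ?case
    unfolding id by (rule exI[of _ "[]"]) (simp only: word_prod_Nil perm_length_id list.size list.set empty_subsetI simp_thms)
next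
  case (step j u w)
  then obtain "is" where "set is \<subseteq> {1..<n}" "word_prod is = u" "length is = perm_length n u" by blast
  then have "set (j # is) \<subseteq> {1..<n}" "word_prod (j # is) = w" "length (j # is) = perm_length n w"
    using step(1,4) perm_length_left_ascent[OF step(2,1,3)] by (simp_all add: word_prod_Cons)
  then show ?case by blast
qed

lemma reduced_word:
  assumes "w permutes {1..n}"
  shows "set (reduced_word n w) \<subseteq> {1..<n}" "word_prod (reduced_word n w) = w"
    "length (reduced_word n w) = perm_length n w"
  unfolding reduced_word_def word_prod_def[symmetric] using someI_ex[OF reduced_word_exists[OF assms]] by blast+

lemma perm_length_comp_le:
  assumes "u permutes {1..n}" "i \<in> {1..<n}"
  shows "perm_length n (u \<circ> simple_refl i) \<le> Suc (perm_length n u)"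
  using perm_length_ascent[OF assms] perm_length_descent[OF assms] perm_ascent_or_descent[OF assms(1), of i]
  by auto

lemma perm_length_word_prod: "set is \<subseteq> {1..<n} \<Longrightarrow> perm_length n (word_prod is) \<le> length is"
proof (induction "is" rule: rev_induct)
  case (snoc i "is")
  then have "set is \<subseteq> {1..<n}" "i \<in> {1..<n}" by auto
  then show ?case
    unfolding word_prod_snoc length_append_singleton
    using snoc.IH perm_length_comp_le[OF word_prod_permutes[of "is" n], of i] by linarith
qed (simp only: word_prod_Nil perm_length_id)

text \<open>A product of \<open>k\<close> generators has length at most \<open>k\<close>; hence in a
  reduced word every letter lengthens the product, and each right multiplication meets an ascent and
  produces a single basis element.\<close>

lemma fold_right_op_std:
  assumes "set is \<subseteq> {1..<n}" "length is = perm_length n (word_prod is)"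
  shows "fold right_op is (hecke_std id) = hecke_std (word_prod is)"
  using assms
proof (induction "is" rule: rev_induct)
  case (snoc i "is")
  let ?u = "word_prod is"
  have u: "?u permutes {1..n}" using word_prod_permutes snoc.prems by simp
  have i: "i \<in> {1..<n}" and si: "set is \<subseteq> {1..<n}" using snoc.prems(1) by auto
  have len: "Suc (length is) = perm_length n (?u \<circ> simple_refl i)"
    using snoc.prems(2) unfolding word_prod_snoc length_append_singleton .
  have le: "perm_length n ?u \<le> length is" by (rule perm_length_word_prod[OF si])
  have asc: "?u i < ?u (Suc i)"
    using perm_length_descent[OF u i] perm_ascent_or_descent[OF u, of i] len le by auto
  have "length is = perm_length n ?u" using perm_length_ascent[OF u i asc] len by simp
  then have "fold right_op is (hecke_std id) = hecke_std ?u" using snoc.IH si by blast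
  then have "right_op i (fold right_op is (hecke_std id)) = hecke_std (word_prod (is @ [i]))"
    unfolding word_prod_snoc right_op_std_ascent[OF asc, symmetric] by (rule arg_cong)
  moreover have "fold right_op (is @ [i]) k = right_op i (fold right_op is k)" for k by simp
  ultimately show ?case by (simp only:)
qed (simp only: fold_simps word_prod_Nil)

lemma fold_right_op_linear:
  "set is \<subseteq> {1..<n} \<Longrightarrow> hecke_linear n (fold right_op is) \<and> left_commuting n (fold right_op is)"
proof (induction "is" rule: rev_induct)
  case Nil
  then show ?case using hecke_linear_id left_commuting_id by (simp add: id_def)
next
  case (snoc i "is")
  then have "hecke_linear n (\<lambda>h. right_op i (fold right_op is h))" "left_commuting n (\<lambda>h. right_op i (fold right_op is h))"
    by (auto intro!: hecke_linear_comp[OF hecke_linear_right_op] left_commuting_comp[OF left_commuting_right_op])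
  then show ?case by (simp add: o_def)
qed

lemma hecke_times_std_eq:
  assumes w: "w permutes {1..n}" and h: "h \<in> hecke_carrier n"
  shows "hecke_times_std n h w = fold right_op (reduced_word n w) h"
proof -
  have "fold (hecke_times_gen n) is h = fold right_op is h \<and> fold right_op is h \<in> hecke_carrier n"
    if "set is \<subseteq> {1..<n}" for "is"
    using that
  proof (induction "is" rule: rev_induct)
    case (snoc i "is")
    then show ?case using hecke_times_gen_eq[of i n] right_op_carrier[of i n] by simp
  qed (use h in simp)
  then show ?thesis unfolding hecke_times_std_def using reduced_word(1)[OF w] by blast
qed

definition hecke_mult :: "nat \<Rightarrow> hecke \<Rightarrow> hecke \<Rightarrow> hecke" where
  "hecke_mult n h k = (\<lambda>x. \<Sum>w\<in>perms n. k w * fold right_op (reduced_word n w) h x)"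

lemma fold_reduced_word:
  assumes w: "w permutes {1..n}"
  shows "hecke_linear n (fold right_op (reduced_word n w))" "left_commuting n (fold right_op (reduced_word n w))"
    "fold right_op (reduced_word n w) (hecke_std id) = hecke_std w"
  using fold_right_op_linear[OF reduced_word(1)[OF w]] fold_right_op_std[OF reduced_word(1)[OF w]]
    reduced_word[OF w] by auto

lemma hecke_mult_linear: "hecke_linear n (\<lambda>h. hecke_mult n h k)"
  unfolding hecke_linear_def
proof (intro ballI conjI allI)
  fix h assume h: "h \<in> hecke_carrier n"
  show "hecke_mult n h k \<in> hecke_carrier n"
  proof (rule hecke_carrierI)
    fix x assume x: "\<not> x permutes {1..n}"
    have "fold right_op (reduced_word n w) h x = 0" if "w \<in> perms n" for w
      using hecke_carrier_0[OF hecke_linear_carrier[OF fold_reduced_word(1) h] x] that by simp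
    then show "hecke_mult n h k x = 0" by (simp add: hecke_mult_def)
  qed
  fix x
  have "hecke_mult n h k x =
      (\<Sum>w\<in>perms n. \<Sum>y\<in>perms n. h y * (k w * fold right_op (reduced_word n w) (hecke_std y) x))"
    unfolding hecke_mult_def
    by (rule sum.cong) (simp_all add: hecke_linear_expand[OF fold_reduced_word(1) h] sum_distrib_left ac_simps)
  also have "\<dots> = (\<Sum>y\<in>perms n. h y * hecke_mult n (hecke_std y) k x)"
    by (subst sum.swap) (simp add: hecke_mult_def sum_distrib_left)
  finally show "hecke_mult n h k x = (\<Sum>y\<in>perms n. h y * hecke_mult n (hecke_std y) k x)" .
qed

lemma left_op_sum:
  "left_op j (\<lambda>x. \<Sum>w\<in>A. c w * g w x) = (\<lambda>x. \<Sum>w\<in>A. c w * left_op j (g w) x)"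
  by (auto simp: left_op_def sum.distrib sum_distrib_left algebra_simps)

lemma hecke_mult_left_commuting: "left_commuting n (\<lambda>h. hecke_mult n h k)"
  unfolding left_commuting_def
proof (intro ballI)
  fix j h assume j: "j \<in> {1..<n}" and h: "h \<in> hecke_carrier n"
  show "hecke_mult n (left_op j h) k = left_op j (hecke_mult n h k)"
    unfolding hecke_mult_def left_op_sum
    by (intro ext sum.cong) (simp_all add: left_commutingD[OF fold_reduced_word(2) j h])
qed

lemma hecke_mult_std_id:
  assumes k: "k \<in> hecke_carrier n" shows "hecke_mult n (hecke_std id) k = k"
proof (rule ext)
  fix x
  have "hecke_mult n (hecke_std id) k x = (\<Sum>w\<in>perms n. k w * hecke_std w x)"
    unfolding hecke_mult_def by (rule sum.cong) (simp_all add: fold_reduced_word(3))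
  also have "\<dots> = k x" by (rule hecke_expand[OF k, symmetric])
  finally show "hecke_mult n (hecke_std id) k x = k x" .
qed

lemma hecke_mult_carrier: "h \<in> hecke_carrier n \<Longrightarrow> hecke_mult n h k \<in> hecke_carrier n"
  using hecke_linear_carrier[OF hecke_mult_linear] .

lemma hecke_std_id_carrier: "hecke_std id \<in> hecke_carrier n"
  by (rule hecke_std_carrier[OF permutes_id])

text \<open>Right multiplication by \<open>k\<close> is the only linear operator that commutes with the left
  multiplications by generators and maps \<open>1\<close> to \<open>k\<close>; all ring laws follow from this.\<close>

lemma hecke_mult_unique:
  assumes "hecke_linear n \<phi>" "left_commuting n \<phi>" "h \<in> hecke_carrier n"
  shows "\<phi> h = hecke_mult n h (\<phi> (hecke_std id))"
  using left_commuting_unique[OF assms(1,2) hecke_mult_linear hecke_mult_left_commuting _ assms(3)]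
    hecke_mult_std_id[OF hecke_linear_carrier[OF assms(1) hecke_std_id_carrier]] by simp

lemma hecke_mult_assoc:
  assumes "h \<in> hecke_carrier n" "k \<in> hecke_carrier n" "l \<in> hecke_carrier n"
  shows "hecke_mult n (hecke_mult n h k) l = hecke_mult n h (hecke_mult n k l)"
  using hecke_mult_unique[OF hecke_linear_comp[OF hecke_mult_linear hecke_mult_linear]
      left_commuting_comp[OF hecke_mult_left_commuting hecke_mult_linear hecke_mult_left_commuting], of h n k l]
    assms by (simp add: hecke_mult_std_id)

lemma hecke_mult_std_id_right: "h \<in> hecke_carrier n \<Longrightarrow> hecke_mult n h (hecke_std id) = h"
  using hecke_mult_unique[OF hecke_linear_id left_commuting_id] by simp

lemma left_op_std_id: "i \<in> {1..<n} \<Longrightarrow> left_op i (hecke_std id) = hecke_std (simple_refl i)"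
  using left_op_std_ascent[of id i] by simp

lemma right_op_eq_mult:
  "i \<in> {1..<n} \<Longrightarrow> h \<in> hecke_carrier n \<Longrightarrow> right_op i h = hecke_mult n h (hecke_std (simple_refl i))"
  using hecke_mult_unique[OF hecke_linear_right_op[of i] left_commuting_right_op[of i], of n h]
    right_op_std_ascent[of id i] by simp

lemma left_op_eq_mult:
  assumes "j \<in> {1..<n}" "h \<in> hecke_carrier n"
  shows "left_op j h = hecke_mult n (hecke_std (simple_refl j)) h"
  using left_commutingD[OF hecke_mult_left_commuting assms(1) hecke_std_id_carrier, of h]
    hecke_mult_std_id[OF assms(2)] left_op_std_id[OF assms(1)] by simp

lemma hecke_algebra_simps:
  "carrier (hecke_algebra n) = hecke_carrier n" "one (hecke_algebra n) = hecke_std id"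
  "h \<in> hecke_carrier n \<Longrightarrow> mult (hecke_algebra n) h k = hecke_mult n h k"
  by (auto simp: hecke_algebra_def hecke_carrier_def hecke_mult_def hecke_times_std_eq intro!: ext sum.cong)

lemma hecke_monoid: "monoid (hecke_algebra n)"
  by (rule monoidI)
    (simp_all add: hecke_algebra_simps hecke_mult_carrier hecke_std_id_carrier hecke_mult_assoc
      hecke_mult_std_id hecke_mult_std_id_right)

section \<open>The bar involution\<close>

text \<open>Left multiplication by the inverse of \<open>H_s\<close>, which is
  \<open>H_s - \<xi>\<close> by the quadratic relation.\<close>

definition left_inv_op :: "nat \<Rightarrow> hecke \<Rightarrow> hecke" where
  "left_inv_op j h = (\<lambda>x. left_op j h x - \<xi> * h x)"

lemma left_op_diff:
  "left_op j (\<lambda>x. f x - c * g x) = (\<lambda>x. left_op j f x - c * left_op j g x)"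
  by (auto simp: left_op_def algebra_simps)

lemma left_inv_op_carrier: "j \<in> {1..<n} \<Longrightarrow> h \<in> hecke_carrier n \<Longrightarrow> left_inv_op j h \<in> hecke_carrier n"
  using hecke_carrier_0[OF left_op_carrier, of j n h] hecke_carrier_0[of h n]
  by (intro hecke_carrierI) (simp add: left_inv_op_def)

lemma left_op_left_inv_op:
  assumes "h \<in> hecke_carrier n" "j \<in> {1..<n}"
  shows "left_op j (left_inv_op j h) = h" "left_inv_op j (left_op j h) = h"
  unfolding left_inv_op_def left_op_diff left_op_quadratic[OF assms] by simp_all

lemma hecke_linear_diff:
  assumes \<phi>: "hecke_linear n \<phi>" and f: "f \<in> hecke_carrier n" and g: "g \<in> hecke_carrier n"
  shows "\<phi> (\<lambda>x. f x - c * g x) = (\<lambda>x. \<phi> f x - c * \<phi> g x)"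
proof
  fix x
  have "(\<lambda>x. f x - c * g x) \<in> hecke_carrier n"
    by (rule hecke_carrierI) (simp add: hecke_carrier_0[OF f] hecke_carrier_0[OF g])
  then show "\<phi> (\<lambda>x. f x - c * g x) x = \<phi> f x - c * \<phi> g x"
    by (simp add: hecke_linear_expand[OF \<phi>] f g sum_subtractf sum_distrib_left algebra_simps)
qed

lemma hecke_mult_left_inv_op:
  assumes "j \<in> {1..<n}" "h \<in> hecke_carrier n"
  shows "hecke_mult n (left_inv_op j h) k = left_inv_op j (hecke_mult n h k)"
  unfolding left_inv_op_def
  using hecke_linear_diff[OF hecke_mult_linear left_op_carrier[OF assms] assms(2)]
    left_commutingD[OF hecke_mult_left_commuting assms] by simp

text \<open>The image of \<open>H_w\<close> under the bar involution.\<close>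

definition std_inv :: "nat \<Rightarrow> (nat \<Rightarrow> nat) \<Rightarrow> hecke" where
  "std_inv n w = m_inv (hecke_algebra n) (hecke_std (pinv w))"

definition is_std_inv :: "nat \<Rightarrow> (nat \<Rightarrow> nat) \<Rightarrow> hecke \<Rightarrow> bool" where
  "is_std_inv n w X \<longleftrightarrow> X \<in> hecke_carrier n \<and>
     hecke_mult n (hecke_std (pinv w)) X = hecke_std id \<and> hecke_mult n X (hecke_std (pinv w)) = hecke_std id"

lemma std_inv_eqI:
  assumes "w permutes {1..n}" and X: "is_std_inv n w X"
  shows "std_inv n w = X"
proof -
  interpret monoid "hecke_algebra n" by (rule hecke_monoid)
  have "hecke_std (pinv w) \<in> hecke_carrier n" by (rule hecke_std_carrier[OF permutes_inv[OF assms(1)]])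
  then show ?thesis
    unfolding std_inv_def using X
    by (intro inv_unique'[symmetric]) (simp_all add: hecke_algebra_simps is_std_inv_def)
qed

lemma is_std_inv_id: "is_std_inv n id (hecke_std id)"
  by (simp add: is_std_inv_def hecke_std_id_carrier hecke_mult_std_id)

text \<open>At a left ascent of \<open>w\<close> the element to be inverted is the product of
  \<open>H\<close> at \<open>pinv w\<close> with \<open>H_s\<close>, so its inverse is
  \<open>H_s\<close> inverted times \<open>I\<close>.\<close>

lemma is_std_inv_step:
  assumes w: "w permutes {1..n}" and j: "j \<in> {1..<n}" and asc: "pinv w j < pinv w (Suc j)"
    and I: "is_std_inv n w I"
  shows "is_std_inv n (simple_refl j \<circ> w) (left_inv_op j I)"
proof -
  let ?s = "hecke_std (simple_refl j)" and ?w = "simple_refl j \<circ> w" and ?X = "left_inv_op j I"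
  have Ic: "I \<in> hecke_carrier n" and IM: "hecke_mult n (hecke_std (pinv w)) I = hecke_std id"
    "hecke_mult n I (hecke_std (pinv w)) = hecke_std id" using I unfolding is_std_inv_def by blast+
  have sc: "?s \<in> hecke_carrier n" by (rule hecke_std_carrier[OF simple_refl_permutes[OF j]])
  have pc: "hecke_std (pinv w) \<in> hecke_carrier n" by (rule hecke_std_carrier[OF permutes_inv[OF w]])
  have inv: "hecke_std (pinv ?w) = hecke_mult n (hecke_std (pinv w)) ?s"
    unfolding inv_simple_refl_comp[OF w] right_op_std_ascent[OF asc, symmetric] by (rule right_op_eq_mult[OF j pc])
  have X: "?X \<in> hecke_carrier n" by (rule left_inv_op_carrier[OF j Ic])
  have "hecke_mult n (hecke_std (pinv ?w)) ?X = hecke_mult n (hecke_std (pinv w)) (hecke_mult n ?s ?X)"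
    unfolding inv by (rule hecke_mult_assoc[OF pc sc X])
  also have "hecke_mult n ?s ?X = I"
    unfolding left_op_eq_mult[OF j X, symmetric] by (rule left_op_left_inv_op(1)[OF Ic j])
  finally have 1: "hecke_mult n (hecke_std (pinv ?w)) ?X = hecke_std id" unfolding IM .
  have "hecke_mult n ?X (hecke_std (pinv ?w)) = left_inv_op j (hecke_mult n I (hecke_std (pinv ?w)))"
    by (rule hecke_mult_left_inv_op[OF j Ic])
  also have "hecke_mult n I (hecke_std (pinv ?w)) = ?s"
    unfolding inv hecke_mult_assoc[OF Ic pc sc, symmetric] IM by (rule hecke_mult_std_id[OF sc])
  also have "left_inv_op j ?s = hecke_std id"
    unfolding left_op_std_id[OF j, symmetric] by (rule left_op_left_inv_op(2)[OF hecke_std_id_carrier j])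
  finally show ?thesis using X 1 unfolding is_std_inv_def by blast
qed

lemma is_std_inv_std_inv:
  assumes w: "w permutes {1..n}" shows "is_std_inv n w (std_inv n w)"
proof -
  have "\<exists>X. is_std_inv n w X"
    using w
  proof (induction rule: perm_left_induct)
    case (id w)
    show ?case unfolding id by (intro exI) (rule is_std_inv_id)
  next
    case (step j u w)
    from step(5) obtain X where "is_std_inv n u X" ..
    then show ?case unfolding step(4) by (intro exI) (rule is_std_inv_step[OF step(2,1,3)])
  qed
  then obtain X where "is_std_inv n w X" ..
  then show ?thesis using std_inv_eqI[OF w] by simp
qed

lemma std_inv_id: "std_inv n id = hecke_std id"
  by (rule std_inv_eqI[OF permutes_id is_std_inv_id])

lemma std_inv_carrier: "w permutes {1..n} \<Longrightarrow> std_inv n w \<in> hecke_carrier n"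
  using is_std_inv_std_inv unfolding is_std_inv_def by blast

lemma std_inv_left_ascent:
  assumes "w permutes {1..n}" "j \<in> {1..<n}" "pinv w j < pinv w (Suc j)"
  shows "std_inv n (simple_refl j \<circ> w) = left_inv_op j (std_inv n w)"
  by (rule std_inv_eqI[OF simple_refl_comp_permutes[OF assms(1,2)]
      is_std_inv_step[OF assms is_std_inv_std_inv[OF assms(1)]]])

lemma perm_length_left_le:
  assumes "y permutes {1..n}" "j \<in> {1..<n}"
  shows "perm_length n y \<le> Suc (perm_length n (simple_refl j \<circ> y))"
  using perm_length_left_ascent[OF assms] perm_length_left_descent[OF assms]
    perm_ascent_or_descent[OF permutes_inv[OF assms(1)], of j] by auto

text \<open>Each factor \<open>H_s - \<xi>\<close> from the left leaves the support inside the old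
  support and its translate by \<open>s\<close>, so the length grows by at most one.
  Unitriangularity with respect to length replaces the finer statement for the Bruhat order
  throughout.\<close>

lemma std_inv_triangular:
  assumes "w permutes {1..n}"
  shows "std_inv n w w = 1 \<and> (\<forall>x. std_inv n w x \<noteq> 0 \<longrightarrow> x = w \<or> perm_length n x < perm_length n w)"
  using assms
proof (induction rule: perm_left_induct)
  case (id w)
  have "std_inv n id id = 1 \<and> (\<forall>x. std_inv n id x \<noteq> 0 \<longrightarrow> x = id \<or> perm_length n x < perm_length n id)"
    by (simp add: std_inv_id hecke_std_def)
  then show ?case unfolding id .
next
  case (step j u w)
  note u = step(2) and j = step(1)
  have lw: "perm_length n w = Suc (perm_length n u)"
    unfolding step(4) by (rule perm_length_left_ascent[OF u j step(3)])
  have val: "std_inv n w x = std_inv n u (simple_refl j \<circ> x)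
      + (if pinv x (Suc j) < pinv x j then \<xi> * std_inv n u x else 0) - \<xi> * std_inv n u x" for x
    unfolding step(4) std_inv_left_ascent[OF u j step(3)] by (simp add: left_inv_op_def left_op_def)
  have "w \<noteq> u" using lw by auto
  then have "std_inv n u w = 0" using step(5) lw by (metis Suc_n_not_le_n less_imp_le)
  moreover have sw: "simple_refl j \<circ> w = u" unfolding step(4) by simp
  ultimately have "std_inv n w w = 1" using step(5) unfolding val by simp
  moreover have "x = w \<or> perm_length n x < perm_length n w" if nz: "std_inv n w x \<noteq> 0" for x
  proof -
    have wp: "w permutes {1..n}" unfolding step(4) by (rule simple_refl_comp_permutes[OF u j])
    have x: "x permutes {1..n}" using hecke_carrier_0[OF std_inv_carrier[OF wp]] nz by blast
    have "std_inv n u (simple_refl j \<circ> x) \<noteq> 0 \<or> std_inv n u x \<noteq> 0"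
      using nz unfolding val by (cases "pinv x (Suc j) < pinv x j") auto
    moreover have "perm_length n x \<le> perm_length n u" if "std_inv n u x \<noteq> 0"
      using step(5)[THEN conjunct2, rule_format, OF that] by auto
    ultimately consider "simple_refl j \<circ> x = u" | "perm_length n (simple_refl j \<circ> x) < perm_length n u"
      | "perm_length n x \<le> perm_length n u" using step(5)[THEN conjunct2, rule_format] by blast
    then show ?thesis
    proof cases
      case 1
      then have "x = w" unfolding step(4) using simple_refl_comp_twice[of j x] by simp
      then show ?thesis ..
    next
      case 2
      then show ?thesis using perm_length_left_le[OF x j] lw by simp
    next
      case 3
      then show ?thesis using lw by simp
    qed
  qed
  ultimately show ?case by blast
qed

lemma hecke_bar_eq: "hecke_bar n h = (\<lambda>x. \<Sum>w\<in>perms n. laurent_bar (h w) * std_inv n w x)"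
  unfolding hecke_bar_def std_inv_def ..

lemma left_inv_op_sum:
  "left_inv_op j (\<lambda>x. \<Sum>w\<in>A. c w * g w x) = (\<lambda>x. \<Sum>w\<in>A. c w * left_inv_op j (g w) x)"
  unfolding left_inv_op_def left_op_sum
  by (rule ext) (simp add: sum_subtractf sum_distrib_left right_diff_distrib mult.left_commute)

text \<open>Semilinearity of the bar, in the form that the bar of \<open>H_s h\<close> is the
  inverse of \<open>H_s\<close> times the bar of \<open>h\<close>. Reindexing the sum by
  \<open>w \<mapsto> sw\<close> moves the action from the coefficients to the basis elements, where
  \<open>key\<close> compares the two sides for a single \<open>w\<close>; the sign there comes from
  the bar negating \<xi>.\<close>

lemma hecke_bar_left_op:
  assumes j: "j \<in> {1..<n}" and h: "h \<in> hecke_carrier n"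
  shows "hecke_bar n (left_op j h) = left_inv_op j (hecke_bar n h)"
proof
  fix x
  let ?s = "\<lambda>w. simple_refl j \<circ> w"
  have key: "std_inv n (?s w) x - (if pinv w (Suc j) < pinv w j then \<xi> * std_inv n w x else 0)
      = left_inv_op j (std_inv n w) x" if w: "w permutes {1..n}" for w
  proof (cases "pinv w (Suc j) < pinv w j")
    case False
    then have "pinv w j < pinv w (Suc j)" using perm_ascent_or_descent[OF permutes_inv[OF w], of j] by simp
    then show ?thesis using std_inv_left_ascent[OF w j] False by simp
  next
    case True
    have sw: "?s w permutes {1..n}" by (rule simple_refl_comp_permutes[OF w j])
    have "pinv (?s w) j < pinv (?s w) (Suc j)" using True inv_simple_refl_comp[OF w] by simp
    then have eq: "std_inv n w = left_inv_op j (std_inv n (?s w))"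
      using std_inv_left_ascent[OF sw j] by simp
    have "left_op j (std_inv n w) = std_inv n (?s w)"
      unfolding eq by (rule left_op_left_inv_op(1)[OF std_inv_carrier[OF sw] j])
    then show ?thesis using True by (simp add: left_inv_op_def)
  qed
  have "(\<Sum>w\<in>perms n. laurent_bar (h (?s w)) * std_inv n w x) = (\<Sum>w\<in>perms n. laurent_bar (h w) * std_inv n (?s w) x)"
  proof (rule sum.reindex_bij_witness[of _ ?s ?s])
    fix w assume "w \<in> perms n"
    then show "?s w \<in> perms n" using simple_refl_comp_permutes[OF _ j] by blast
    show "?s (?s w) = w" by (rule simple_refl_comp_twice)
    show "laurent_bar (h (?s w)) * std_inv n (?s (?s w)) x = laurent_bar (h (?s w)) * std_inv n w x" by simp
  qed (use simple_refl_comp_permutes[OF _ j] in \<open>auto simp del: One_nat_def\<close>)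
  moreover have "hecke_bar n (left_op j h) x = (\<Sum>w\<in>perms n. laurent_bar (h (?s w)) * std_inv n w x)
      + (\<Sum>w\<in>perms n. laurent_bar (if pinv w (Suc j) < pinv w j then \<xi> * h w else 0) * std_inv n w x)"
    unfolding hecke_bar_eq left_op_def laurent_bar_simps distrib_right sum.distrib ..
  ultimately have "hecke_bar n (left_op j h) x = (\<Sum>w\<in>perms n. laurent_bar (h w) * std_inv n (?s w) x
      + laurent_bar (if pinv w (Suc j) < pinv w j then \<xi> * h w else 0) * std_inv n w x)"
    unfolding sum.distrib by (simp only:)
  also have "\<dots> = (\<Sum>w\<in>perms n. laurent_bar (h w) * (std_inv n (?s w) x -
      (if pinv w (Suc j) < pinv w j then \<xi> * std_inv n w x else 0)))"
    by (rule sum.cong) (simp_all add: algebra_simps)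
  also have "\<dots> = (\<Sum>w\<in>perms n. laurent_bar (h w) * left_inv_op j (std_inv n w) x)"
    by (rule sum.cong) (simp_all only: key mem_Collect_eq)
  finally show "hecke_bar n (left_op j h) x = left_inv_op j (hecke_bar n h) x"
    unfolding hecke_bar_eq left_inv_op_sum .
qed

lemma hecke_bar_diff_scale:
  "hecke_bar n (\<lambda>x. f x - c * g x) = (\<lambda>x. hecke_bar n f x - laurent_bar c * hecke_bar n g x)"
  unfolding hecke_bar_eq by (simp add: sum_subtractf sum_distrib_left algebra_simps)

lemma hecke_bar_diff_sum:
  "hecke_bar n (\<lambda>x. f x - (\<Sum>z\<in>Z. c z * g z x)) =
    (\<lambda>x. hecke_bar n f x - (\<Sum>z\<in>Z. laurent_bar (c z) * hecke_bar n (g z) x))"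
proof (induction Z arbitrary: f rule: infinite_finite_induct)
  case (insert z Z)
  have "hecke_bar n (\<lambda>x. f x - (\<Sum>z\<in>insert z Z. c z * g z x)) =
      hecke_bar n (\<lambda>x. (f x - c z * g z x) - (\<Sum>z\<in>Z. c z * g z x))"
    using insert by (simp add: algebra_simps)
  then show ?case
    unfolding insert.IH hecke_bar_diff_scale using insert by (simp add: algebra_simps)
qed simp_all

lemma finite_has_max:
  fixes f :: "'a \<Rightarrow> nat"
  assumes "finite Z" "Z \<noteq> {}" shows "\<exists>x\<in>Z. \<forall>y\<in>Z. f y \<le> f x"
proof -
  have "Max (f ` Z) \<in> f ` Z" using assms by (intro Max_in) auto
  then obtain x where "x \<in> Z" "f x = Max (f ` Z)" by auto
  then show ?thesis using assms(1) by (intro bexI[of _ x]) auto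
qed

lemma hecke_max_support:
  assumes h: "h \<in> hecke_carrier n" and "h \<noteq> (\<lambda>_. 0)"
  obtains x where "x permutes {1..n}" "h x \<noteq> 0" "\<And>y. h y \<noteq> 0 \<Longrightarrow> perm_length n y \<le> perm_length n x"
proof -
  let ?Z = "{x. h x \<noteq> 0}"
  have "?Z \<subseteq> perms n" using h unfolding hecke_carrier_def by blast
  then have "finite ?Z" using finite_perms finite_subset by blast
  moreover have "?Z \<noteq> {}" using assms(2) by auto
  ultimately obtain x where "x \<in> ?Z" "\<forall>y\<in>?Z. perm_length n y \<le> perm_length n x"
    using finite_has_max[of ?Z "perm_length n"] by blast
  then show thesis using that h unfolding hecke_carrier_def by blast
qed

text \<open>At a longest element of the support, triangularity leaves only one summand of the bar,
  so the coefficient there is bar-invariant and has positive degrees, hence is zero. This is the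
  uniqueness of Kazhdan-Lusztig elements.\<close>

lemma hecke_bar_invariant_eq_0:
  assumes h: "h \<in> hecke_carrier n" and bar: "hecke_bar n h = h" and pos: "\<And>y. positive_degrees (h y)"
  shows "h = (\<lambda>_. 0)"
proof (rule ccontr)
  assume "h \<noteq> (\<lambda>_. 0)"
  then obtain x where x: "x permutes {1..n}" "h x \<noteq> 0"
    and max: "\<And>y. h y \<noteq> 0 \<Longrightarrow> perm_length n y \<le> perm_length n x"
    using hecke_max_support[OF h] by blast
  have "h x = (\<Sum>w\<in>perms n. laurent_bar (h w) * std_inv n w x)"
    using fun_cong[OF bar, of x] unfolding hecke_bar_eq by (rule sym)
  also have "\<dots> = (\<Sum>w\<in>perms n. if w = x then laurent_bar (h x) else 0)"
  proof (rule sum.cong)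
    fix w assume "w \<in> perms n"
    then have w: "w permutes {1..n}" by blast
    note tri = std_inv_triangular[OF w]
    consider "w = x" | "w \<noteq> x" "h w = 0" | "w \<noteq> x" "h w \<noteq> 0" by blast
    then show "laurent_bar (h w) * std_inv n w x = (if w = x then laurent_bar (h x) else 0)"
    proof cases
      case 1
      then show ?thesis using tri[THEN conjunct1] by simp
    next
      case 3
      then have "std_inv n w x = 0" using tri[THEN conjunct2] max[of w] by (metis not_le)
      then show ?thesis using 3 by simp
    qed simp
  qed simp
  also have "\<dots> = laurent_bar (h x)" using x(1) by (subst sum.delta[OF finite_perms]) simp
  finally show False using positive_degrees_bar_eq_0[OF pos, of x] x(2) by simp
qed

section \<open>The Kazhdan-Lusztig basis\<close>

definition kl_element :: "nat \<Rightarrow> (nat \<Rightarrow> nat) \<Rightarrow> hecke \<Rightarrow> bool" where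
  "kl_element n w C \<longleftrightarrow> C \<in> hecke_carrier n \<and> hecke_bar n C = C \<and> C w = 1 \<and>
     (\<forall>y. y \<noteq> w \<longrightarrow> positive_degrees (C y))"

text \<open>The eigenvalue is the one that \<open>H_s\<close> has on left multiples of
  \<open>C_s = H_s - v\<close>. Being an eigenvector is how the elements \<open>C_w\<close> remember
  the left descents of \<open>w\<close>.\<close>

definition left_eigen :: "nat \<Rightarrow> hecke \<Rightarrow> bool" where
  "left_eigen j C \<longleftrightarrow> left_op j C = (\<lambda>x. - v_pow (- 1) * C x)"

definition lower_support :: "nat \<Rightarrow> (nat \<Rightarrow> nat) \<Rightarrow> hecke \<Rightarrow> bool" where
  "lower_support n w C \<longleftrightarrow> (\<forall>y. C y \<noteq> 0 \<longrightarrow> y = w \<or> perm_length n y < perm_length n w)"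

lemma kl_element_unique:
  assumes C: "kl_element n w C" and D: "kl_element n w D" shows "C = D"
proof -
  have "(\<lambda>x. C x - 1 * D x) = (\<lambda>_. 0)"
  proof (rule hecke_bar_invariant_eq_0)
    show "(\<lambda>x. C x - 1 * D x) \<in> hecke_carrier n"
      using C D unfolding kl_element_def hecke_carrier_def by force
    show "hecke_bar n (\<lambda>x. C x - 1 * D x) = (\<lambda>x. C x - 1 * D x)"
      unfolding hecke_bar_diff_scale using C D by (simp add: kl_element_def)
    fix y
    show "positive_degrees (C y - 1 * D y)"
      using C D by (cases "y = w") (auto simp: kl_element_def intro: positive_degrees_simps)
  qed
  then show ?thesis by (simp add: fun_eq_iff)
qed

lemma kl_basis_eqI:
  assumes "kl_element n w C" shows "kl_basis n w = C"
proof -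
  have "kl_basis n w = (THE C. kl_element n w C)"
    unfolding kl_basis_def kl_element_def positive_degrees_iff_keys hecke_algebra_simps ..
  also have "\<dots> = C" using assms kl_element_unique by (intro the_equality)
  finally show ?thesis .
qed

text \<open>At a left ascent \<open>y\<close> the coefficient of an eigenvector is tied to the one
  at the longer element \<open>simple_refl j \<circ> y\<close>. It supplies a factor
  \<open>v\<close> in the construction of the basis and forces coefficients to vanish at the top of
  the support.\<close>

lemma left_eigen_not_descent:
  assumes "left_eigen j C" "\<not> pinv y (Suc j) < pinv y j"
  shows "C y = - v_pow 1 * C (simple_refl j \<circ> y)"
proof -
  have "C (simple_refl j \<circ> y) = - v_pow (- 1) * C y"
    using fun_cong[OF assms(1)[unfolded left_eigen_def], of y] assms(2) by (simp add: left_op_def)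
  then show ?thesis by simp
qed

lemma left_eigen_diff_sum:
  assumes "left_eigen j f" "\<And>z. z \<in> Z \<Longrightarrow> left_eigen j (g z)"
  shows "left_eigen j (\<lambda>x. f x - (\<Sum>z\<in>Z. c z * g z x))"
proof -
  have "left_op j (\<lambda>x. f x - 1 * (\<Sum>z\<in>Z. c z * g z x)) =
      (\<lambda>x. left_op j f x - 1 * (\<Sum>z\<in>Z. c z * left_op j (g z) x))"
    unfolding left_op_diff left_op_sum ..
  also have "\<dots> = (\<lambda>x. - v_pow (- 1) * (f x - (\<Sum>z\<in>Z. c z * g z x)))"
    using assms by (auto simp: left_eigen_def sum_distrib_left algebra_simps intro!: sum.cong)
  finally show ?thesis by (simp add: left_eigen_def)
qed

lemma nonneg_minus_constant:
  "nonneg_degrees a \<Longrightarrow> positive_degrees (a - of_int (Poly_Mapping.lookup a 0))"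
  by (auto simp: nonneg_degrees_def positive_degrees_def lookup_minus lookup_of_int)

lemma kl_element_id: "kl_element n id (hecke_std id)"
proof -
  have "hecke_bar n (hecke_std id) x = hecke_std id x" for x
  proof -
    have "hecke_bar n (hecke_std id) x = (\<Sum>w\<in>perms n. if w = id then std_inv n id x else 0)"
      unfolding hecke_bar_eq by (rule sum.cong) (auto simp: hecke_std_def)
    also have "\<dots> = std_inv n id x" by (subst sum.delta[OF finite_perms]) (simp add: permutes_id)
    finally show ?thesis by (simp add: std_inv_id)
  qed
  then have "hecke_bar n (hecke_std id) = hecke_std id" by (rule ext)
  moreover have "hecke_std id id = 1" "y \<noteq> id \<Longrightarrow> positive_degrees (hecke_std id y)" for y
    by (simp_all add: hecke_std_def positive_degrees_simps)
  ultimately show ?thesis using hecke_std_id_carrier unfolding kl_element_def by blast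
qed

text \<open>The recursion \<open>C\<^sub>s C\<^sub>s\<^sub>w\<close> minus multiples of lower \<open>C\<^sub>z\<close> with \<open>sz < z\<close> stays inside the
  eigenspace of \<open>H\<^sub>s\<close>, so that it also yields \<open>H\<^sub>s C\<^sub>w = - C\<^sub>w / v\<close> for every left descent \<open>s\<close> of \<open>w\<close>.\<close>

lemma kl_element_step:
  assumes w: "w permutes {1..n}" and j: "j \<in> {1..<n}" and desc: "pinv w (Suc j) < pinv w j"
    and below: "\<And>z. z permutes {1..n} \<Longrightarrow> perm_length n z < perm_length n w \<Longrightarrow>
      kl_element n z (B z) \<and> lower_support n z (B z) \<and>
      (\<forall>j\<in>{1..<n}. pinv z (Suc j) < pinv z j \<longrightarrow> left_eigen j (B z))"
  shows "\<exists>C. kl_element n w C \<and> lower_support n w C \<and> left_eigen j C"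
proof -
  let ?l = "perm_length n" and ?s = "\<lambda>y. simple_refl j \<circ> y"
  define u where "u = ?s w"
  have u: "u permutes {1..n}" unfolding u_def by (rule simple_refl_comp_permutes[OF w j])
  have lw: "?l w = Suc (?l u)" unfolding u_def by (rule perm_length_left_descent[OF w j desc])
  have su: "?s u = w" unfolding u_def by simp
  have sy: "?s y = u \<longleftrightarrow> y = w" for y
  proof
    assume "?s y = u"
    then have "?s (?s y) = ?s (?s w)" unfolding u_def by (rule arg_cong)
    then show "y = w" unfolding simple_refl_comp_twice .
  qed (simp add: u_def)
  have u_asc: "\<not> pinv u (Suc j) < pinv u j"
    unfolding u_def inv_simple_refl_comp[OF w] using desc by simp
  define E where "E = B u"
  have E: "kl_element n u E" "lower_support n u E" using below[OF u] lw unfolding E_def by auto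
  have Ec: "E \<in> hecke_carrier n" and Ebar: "hecke_bar n E = E" and Eu: "E u = 1"
    and Epos: "\<And>y. y \<noteq> u \<Longrightarrow> positive_degrees (E y)" using E(1) by (auto simp: kl_element_def)
  have Esup: "y = u \<or> ?l y < ?l u" if "E y \<noteq> 0" for y using E(2) that by (auto simp: lower_support_def)
  \<comment> \<open>\<open>D\<close> is \<open>C_s E\<close> with \<open>C_s = H_s - v\<close>. The
    bar sends \<open>H_s - v\<close> to \<open>H_s - \<xi> - 1/v\<close>, which is the same element,
    and the quadratic relation makes \<open>D\<close> an eigenvector.\<close>
  define D where "D = (\<lambda>x. left_op j E x - v_pow 1 * E x)"
  have Dc: "D y = 0" if "\<not> y permutes {1..n}" for y
    using that hecke_carrier_0[OF Ec] hecke_carrier_0[OF left_op_carrier[OF j Ec]] by (simp add: D_def)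
  have Dbar: "hecke_bar n D = D"
    unfolding D_def hecke_bar_diff_scale hecke_bar_left_op[OF j Ec] Ebar
    by (rule ext) (simp add: left_inv_op_def \<xi>_def v_pow_mult algebra_simps)
  have Deig: "left_eigen j D"
    unfolding left_eigen_def D_def left_op_diff left_op_quadratic[OF Ec j]
    by (rule ext) (simp add: \<xi>_def v_pow_mult algebra_simps)
  have Ddesc: "D y = E (?s y) - v_pow (- 1) * E y" if "pinv y (Suc j) < pinv y j" for y
    using that by (simp add: D_def left_op_def \<xi>_def algebra_simps)
  have Dw: "D w = 1"
  proof -
    have "E w = 0" using Esup[of w] lw by force
    then show ?thesis unfolding Ddesc[OF desc] u_def[symmetric] Eu by simp
  qed
  have Dsup: "y = w \<or> ?l y < ?l w" if nz: "D y \<noteq> 0" for y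
  proof -
    have y: "y permutes {1..n}" using Dc nz by blast
    have "E (?s y) \<noteq> 0 \<or> E y \<noteq> 0"
      using nz unfolding D_def left_op_def by (cases "pinv y (Suc j) < pinv y j") auto
    then show ?thesis
    proof
      assume "E y \<noteq> 0"
      then show ?thesis using Esup[of y] lw by auto
    next
      assume "E (?s y) \<noteq> 0"
      then have "?s y = u \<or> ?l (?s y) < ?l u" by (rule Esup)
      then have "y = w \<or> ?l (?s y) < ?l u" unfolding sy .
      moreover have "?l y < ?l w" if "?l (?s y) < ?l u"
        using perm_length_left_le[OF y j] that unfolding lw by linarith
      ultimately show ?thesis by blast
    qed
  qed
  have Dnonneg: "nonneg_degrees (D y)" if d: "pinv y (Suc j) < pinv y j" for y
  proof (cases "y = w")
    case True
    then show ?thesis using Dw by (simp add: nonneg_degrees_def lookup_one)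
  next
    case False
    then have "?s y \<noteq> u" using sy by simp
    moreover have "y \<noteq> u" using d u_asc by auto
    ultimately have "positive_degrees (E (?s y))" "positive_degrees (E y)" using Epos by auto
    then show ?thesis
      unfolding Ddesc[OF d] by (auto simp: positive_degrees_def nonneg_degrees_def lookup_minus lookup_v_pow_mult)
  qed
  have Dasc: "positive_degrees (D y)" if y: "y permutes {1..n}" and d: "\<not> pinv y (Suc j) < pinv y j" for y
  proof -
    have "pinv (?s y) (Suc j) < pinv (?s y) j"
      unfolding inv_simple_refl_comp[OF y] using d perm_ascent_or_descent[OF permutes_inv[OF y], of j] by simp
    then have "nonneg_degrees (D (?s y))" by (rule Dnonneg)
    then show ?thesis
      unfolding left_eigen_not_descent[OF Deig d]
      by (auto simp: positive_degrees_def nonneg_degrees_def lookup_v_pow_mult)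
  qed
  \<comment> \<open>Only constant terms can violate positivity, and only at left descents: at a left
    ascent the eigenvector relation multiplies a coefficient without negative degrees by
    \<open>v\<close> (\<open>Dasc\<close>). Integer multiples of bar-invariant elements are
    bar-invariant, so subtracting them is harmless.\<close>
  define c where "c z = Poly_Mapping.lookup (D z) 0" for z
  define Z where "Z = {z. z permutes {1..n} \<and> pinv z (Suc j) < pinv z j \<and> ?l z < ?l w}"
  have fin: "finite Z" by (rule finite_subset[OF _ finite_perms[of n]]) (auto simp: Z_def)
  have B: "kl_element n z (B z)" "lower_support n z (B z)" "left_eigen j (B z)" if "z \<in> Z" for z
    using below[of z] that j by (auto simp: Z_def)
  have Bpos: "positive_degrees (B z y)" if "z \<in> Z" "y \<noteq> z" for z y
    using B(1)[OF that(1)] that(2) by (simp add: kl_element_def)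
  have Bsup: "y = z \<or> ?l y < ?l z" if "z \<in> Z" "B z y \<noteq> 0" for z y
    using B(2)[OF that(1)] that(2) by (simp add: lower_support_def)
  define C where "C = (\<lambda>x. D x - (\<Sum>z\<in>Z. of_int (c z) * B z x))"
  have Ccar: "C \<in> hecke_carrier n"
  proof (rule hecke_carrierI)
    fix x assume x: "\<not> x permutes {1..n}"
    have "B z x = 0" if "z \<in> Z" for z
      using B(1)[OF that] hecke_carrier_0[OF _ x] by (auto simp: kl_element_def)
    then show "C x = 0" unfolding C_def using Dc[OF x] by simp
  qed
  have Cbar: "hecke_bar n C = C"
    unfolding C_def hecke_bar_diff_sum Dbar using B(1) by (simp add: kl_element_def)
  have Bzero: "(\<Sum>z\<in>Z. of_int (c z) * B z y) = 0" if "?l w \<le> ?l y" for y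
  proof (rule sum.neutral, rule ballI)
    fix z assume z: "z \<in> Z"
    then have "?l z < ?l w" by (simp add: Z_def)
    then have "B z y = 0" using Bsup[OF z, of y] that by force
    then show "of_int (c z) * B z y = 0" by simp
  qed
  have Csup: "lower_support n w C"
    unfolding lower_support_def
  proof (intro allI impI, rule ccontr)
    fix y assume "C y \<noteq> 0" "\<not> (y = w \<or> ?l y < ?l w)"
    then show False using Bzero[of y] Dsup[of y] by (auto simp: C_def)
  qed
  have Cpos: "positive_degrees (C y)" if "y \<noteq> w" for y
  proof (cases "y permutes {1..n}")
    case False
    then show ?thesis using hecke_carrier_0[OF Ccar] by (simp add: positive_degrees_simps)
  next
    case y: True
    consider "\<not> pinv y (Suc j) < pinv y j" | "y \<in> Z" | "?l w \<le> ?l y"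
      using y unfolding Z_def mem_Collect_eq by linarith
    then show ?thesis
    proof cases
      case 1
      then have "y \<notin> Z" by (simp add: Z_def)
      then have "positive_degrees (B z y)" if "z \<in> Z" for z using Bpos[OF that, of y] that by metis
      then show ?thesis
        unfolding C_def using Dasc[OF y 1]
        by (intro positive_degrees_simps(3) positive_degrees_sum positive_degrees_simps(4))
    next
      case 2
      have "B y y = 1" using B(1)[OF 2] by (simp add: kl_element_def)
      then have "C y = (D y - of_int (c y)) - (\<Sum>z\<in>Z - {y}. of_int (c z) * B z y)"
        unfolding C_def using sum.remove[OF fin 2, of "\<lambda>z. of_int (c z) * B z y"] by simp
      moreover have "positive_degrees (D y - of_int (c y))"
        unfolding c_def using Dnonneg 2 by (intro nonneg_minus_constant) (simp add: Z_def)
      moreover have "positive_degrees (\<Sum>z\<in>Z - {y}. of_int (c z) * B z y)"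
        by (intro positive_degrees_sum positive_degrees_simps(4) Bpos) auto
      ultimately show ?thesis by (simp add: positive_degrees_simps(3))
    next
      case 3
      then have "C y = 0" using Csup that by (force simp: lower_support_def)
      then show ?thesis by (simp add: positive_degrees_simps)
    qed
  qed
  have "C w = 1" unfolding C_def using Dw Bzero[of w] by simp
  then have "kl_element n w C" using Ccar Cbar Cpos by (simp add: kl_element_def)
  moreover have "left_eigen j C" unfolding C_def by (rule left_eigen_diff_sum[OF Deig B(3)])
  ultimately show ?thesis using Csup by blast
qed

text \<open>The construction uses one left descent \<open>j\<close> at a time and yields an
  eigenvector for that \<open>j\<close> only; uniqueness identifies the elements obtained from
  different \<open>j\<close>, so the eigenvector property holds for all left descents at
  once.\<close>

lemma kl_basis:
  assumes "w permutes {1..n}"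
  shows "kl_element n w (kl_basis n w) \<and> lower_support n w (kl_basis n w) \<and>
    (\<forall>j\<in>{1..<n}. pinv w (Suc j) < pinv w j \<longrightarrow> left_eigen j (kl_basis n w))"
  using assms
proof (induction "perm_length n w" arbitrary: w rule: less_induct)
  case less
  have step: "\<exists>C. kl_element n w C \<and> lower_support n w C \<and> left_eigen j C"
    if "j \<in> {1..<n}" "pinv w (Suc j) < pinv w j" for j
    by (rule kl_element_step[OF less.prems that]) (rule less.hyps)
  have eig: "kl_element n w (kl_basis n w) \<and> lower_support n w (kl_basis n w) \<and> left_eigen j (kl_basis n w)"
    if j: "j \<in> {1..<n}" "pinv w (Suc j) < pinv w j" for j
  proof -
    obtain C where C: "kl_element n w C \<and> lower_support n w C \<and> left_eigen j C" using step[OF j] ..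
    then have "kl_basis n w = C" using kl_basis_eqI by blast
    then show ?thesis using C by (simp only:)
  qed
  show ?case
  proof (cases "w = id")
    case True
    have "kl_basis n w = hecke_std id" unfolding True by (rule kl_basis_eqI[OF kl_element_id])
    moreover have "lower_support n id (hecke_std id)" by (auto simp: lower_support_def hecke_std_def)
    moreover have "\<not> pinv id (Suc j) < pinv id j" for j :: nat by simp
    ultimately show ?thesis using kl_element_id True by (simp only: simp_thms ball_triv)
  next
    case False
    then obtain j where "j \<in> {1..<n}" "pinv w (Suc j) < pinv w j"
      using left_descent_exists[OF less.prems] by blast
    then show ?thesis using eig by blast
  qed
qed

lemma kl_basis_facts:
  assumes "w permutes {1..n}"
  shows "kl_basis n w \<in> hecke_carrier n" "kl_basis n w w = 1"
    "\<And>y. kl_basis n w y \<noteq> 0 \<Longrightarrow> y = w \<or> perm_length n y < perm_length n w"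
    "\<And>j. j \<in> {1..<n} \<Longrightarrow> pinv w (Suc j) < pinv w j \<Longrightarrow> left_eigen j (kl_basis n w)"
  using kl_basis[OF assms] by (auto simp: kl_element_def lower_support_def)

section \<open>The Kazhdan-Lusztig order\<close>

text \<open>Unitriangularity: subtracting \<open>h z * C_z\<close> for all \<open>z\<close> of the
  greatest possible length \<open>m\<close> removes the coefficients of length \<open>m\<close> and
  creates only shorter ones.\<close>

lemma kl_expansion_exists:
  assumes "h \<in> hecke_carrier n"
  shows "\<exists>a :: hecke. h = (\<lambda>x. \<Sum>z\<in>perms n. a z * kl_basis n z x)"
proof -
  have *: "\<exists>a :: hecke. h = (\<lambda>x. \<Sum>z\<in>perms n. a z * kl_basis n z x)"
    if "h \<in> hecke_carrier n" "\<And>x. h x \<noteq> 0 \<Longrightarrow> perm_length n x < m" for m h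
    using that
  proof (induction m arbitrary: h)
    case 0
    then have "h = (\<lambda>x. \<Sum>z\<in>perms n. 0 * kl_basis n z x)" by (auto simp: fun_eq_iff)
    then show ?case by (rule exI[of _ "\<lambda>_. 0"])
  next
    case (Suc m)
    let ?Z = "{z \<in> perms n. perm_length n z = m}"
    define k where "k = (\<lambda>x. h x - (\<Sum>z\<in>?Z. h z * kl_basis n z x))"
    have fin: "finite ?Z" using finite_perms by (rule rev_finite_subset) blast
    have kc: "k \<in> hecke_carrier n"
    proof (rule hecke_carrierI)
      fix x assume x: "\<not> x permutes {1..n}"
      have "kl_basis n z x = 0" if "z \<in> ?Z" for z
        using hecke_carrier_0[OF kl_basis_facts(1) x] that by blast
      then show "k x = 0" unfolding k_def using hecke_carrier_0[OF Suc.prems(1) x] by simp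
    qed
    have "perm_length n x < m" if nz: "k x \<noteq> 0" for x
    proof (rule ccontr)
      assume ge: "\<not> perm_length n x < m"
      have x: "x permutes {1..n}" using hecke_carrier_0[OF kc] nz by blast
      have "(\<Sum>z\<in>?Z. h z * kl_basis n z x) = (\<Sum>z\<in>?Z. if z = x then h x else 0)"
      proof (rule sum.cong)
        fix z assume z: "z \<in> ?Z"
        then have zp: "z permutes {1..n}" by blast
        have "kl_basis n z x = 0" if "z \<noteq> x"
          using kl_basis_facts(3)[OF zp, of x] that ge z by force
        then show "h z * kl_basis n z x = (if z = x then h x else 0)"
          using kl_basis_facts(2)[OF zp] by (cases "z = x") simp_all
      qed simp
      also have "\<dots> = (if x \<in> ?Z then h x else 0)" using fin by (rule sum.delta)
      also have "\<dots> = h x"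
      proof (cases "perm_length n x = m")
        case False
        then have "h x = 0" using Suc.prems(2)[of x] ge by force
        then show ?thesis by simp
      qed (use x in simp)
      finally show False using nz by (simp add: k_def)
    qed
    then obtain a where a: "k = (\<lambda>x. \<Sum>z\<in>perms n. a z * kl_basis n z x)" using Suc.IH[OF kc] by blast
    have "h x = (\<Sum>z\<in>perms n. (a z + (if perm_length n z = m then h z else 0)) * kl_basis n z x)" for x
    proof -
      have "(\<Sum>z\<in>perms n. (if perm_length n z = m then h z else 0) * kl_basis n z x)
          = (\<Sum>z\<in>?Z. h z * kl_basis n z x)"
        by (rule sum.mono_neutral_cong_right[OF finite_perms]) auto
      moreover have "h x = k x + (\<Sum>z\<in>?Z. h z * kl_basis n z x)" by (simp add: k_def)
      ultimately show ?thesis unfolding a by (simp add: distrib_right sum.distrib)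
    qed
    then show ?case by (intro exI ext)
  qed
  have "finite (perm_length n ` perms n)" by (rule finite_imageI[OF finite_perms])
  then obtain m where m: "\<forall>l\<in>perm_length n ` perms n. l < m"
    unfolding finite_nat_set_iff_bounded by blast
  have "perm_length n x < m" if "h x \<noteq> 0" for x using m hecke_carrier_0[OF assms] that by blast
  then show ?thesis by (rule *[OF assms])
qed

text \<open>At a longest \<open>z\<close> with nonzero coefficient, the sum has that coefficient.\<close>

lemma kl_sum_leading:
  assumes z: "z permutes {1..n}"
    and max: "\<And>y. y permutes {1..n} \<Longrightarrow> a y \<noteq> 0 \<Longrightarrow> perm_length n y \<le> perm_length n z"
  shows "(\<Sum>y\<in>perms n. a y * kl_basis n y z) = a z"
proof -
  have "(\<Sum>y\<in>perms n. a y * kl_basis n y z) = (\<Sum>y\<in>perms n. if y = z then a z else 0)"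
  proof (rule sum.cong)
    fix y assume "y \<in> perms n"
    then have y: "y permutes {1..n}" by blast
    have "kl_basis n y z = 0" if "y \<noteq> z" "a y \<noteq> 0"
      using kl_basis_facts(3)[OF y, of z] max[OF y that(2)] that(1) by force
    then show "a y * kl_basis n y z = (if y = z then a z else 0)"
      using kl_basis_facts(2)[OF y] by (cases "y = z"; cases "a y = 0") simp_all
  qed simp
  then show ?thesis using z by (simp add: sum.delta[OF finite_perms] del: One_nat_def)
qed

text \<open>Whatever is shorter than \<open>simple_refl i\<close> has length 0, hence no left
  descent, hence is the identity; triangularity therefore leaves one unknown coefficient.\<close>

lemma kl_basis_simple_refl:
  assumes i: "i \<in> {1..<n}"
  obtains c where "kl_basis n (simple_refl i) = (\<lambda>x. hecke_std (simple_refl i) x + c * hecke_std id x)"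
proof -
  let ?C = "kl_basis n (simple_refl i)"
  note s = simple_refl_permutes[OF i]
  have ls: "perm_length n (simple_refl i) = 1"
    using perm_length_ascent[OF permutes_id i] by simp
  have "?C x = hecke_std (simple_refl i) x + ?C id * hecke_std id x" for x
  proof -
    have ne: "simple_refl i \<noteq> id"
      using simple_refl_apply(1)[of i] by (metis id_apply n_not_Suc_n)
    consider "x = simple_refl i" | "x = id" | "x \<noteq> simple_refl i" "x \<noteq> id" by blast
    then show ?thesis
    proof cases
      case 1
      then show ?thesis using kl_basis_facts(2)[OF s] ne by (simp add: hecke_std_def)
    next
      case 2
      then show ?thesis using ne by (simp add: hecke_std_def)
    next
      case 3
      have "?C x = 0"
      proof (rule ccontr)
        assume nz: "?C x \<noteq> 0"
        then have x: "x permutes {1..n}" using hecke_carrier_0[OF kl_basis_facts(1)[OF s]] by blast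
        have "perm_length n x = 0" using kl_basis_facts(3)[OF s nz] 3 ls by simp
        moreover obtain j where "j \<in> {1..<n}" "pinv x (Suc j) < pinv x j"
          using left_descent_exists[OF x 3(2)] by blast
        ultimately show False using perm_length_left_descent[OF x] by simp
      qed
      then show ?thesis using 3 by (simp add: hecke_std_def)
    qed
  qed
  then show thesis using that by blast
qed

lemma kl_product:
  assumes i: "i \<in> {1..<n}" and \<sigma>: "\<sigma> permutes {1..n}"
  obtains c where "mult (hecke_algebra n) (kl_basis n \<sigma>) (kl_basis n (simple_refl i)) =
    (\<lambda>x. right_op i (kl_basis n \<sigma>) x + c * kl_basis n \<sigma> x)"
proof -
  obtain c where c: "kl_basis n (simple_refl i) = (\<lambda>x. hecke_std (simple_refl i) x + c * hecke_std id x)"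
    using kl_basis_simple_refl[OF i] .
  note \<sigma>c = kl_basis_facts(1)[OF \<sigma>]
  have lin: "hecke_mult n h (\<lambda>x. f x + c * g x) = (\<lambda>x. hecke_mult n h f x + c * hecke_mult n h g x)" for h f g
    by (rule ext) (simp add: hecke_mult_def sum.distrib sum_distrib_left algebra_simps)
  show thesis
    by (rule that[of c])
      (simp only: hecke_algebra_simps(3)[OF \<sigma>c] c lin right_op_eq_mult[OF i \<sigma>c] hecke_mult_std_id_right[OF \<sigma>c])
qed

text \<open>The product \<open>C_\<sigma> C_s\<close> has coefficient 1 at \<open>\<sigma>s\<close>
  and nothing longer in its support. A longest \<open>z\<close> occurring in its expansion has the
  same coefficient in the product, so it is no longer than \<open>\<sigma>s\<close>; the leading
  coefficient argument then applies to \<open>\<sigma>s\<close> itself and shows that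
  \<open>C_{\<sigma>s}\<close> occurs with coefficient 1.\<close>

lemma kl_right_step_ascent:
  assumes \<sigma>: "\<sigma> permutes {1..n}" and i: "i \<in> {1..<n}" and asc: "\<sigma> i < \<sigma> (Suc i)"
  shows "kl_right_step n (\<sigma> \<circ> simple_refl i) \<sigma>"
proof -
  let ?t = "\<sigma> \<circ> simple_refl i" and ?C = "kl_basis n \<sigma>"
  have t: "?t permutes {1..n}" by (rule comp_simple_refl_permutes[OF \<sigma> i])
  have lt: "perm_length n ?t = Suc (perm_length n \<sigma>)" by (rule perm_length_ascent[OF \<sigma> i asc])
  obtain c where c: "mult (hecke_algebra n) ?C (kl_basis n (simple_refl i)) = (\<lambda>x. right_op i ?C x + c * ?C x)"
    using kl_product[OF i \<sigma>] .
  let ?p = "\<lambda>x. right_op i ?C x + c * ?C x"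
  have pc: "?p \<in> hecke_carrier n"
    using hecke_carrier_0[OF right_op_carrier[OF i kl_basis_facts(1)[OF \<sigma>]]]
      hecke_carrier_0[OF kl_basis_facts(1)[OF \<sigma>]] by (intro hecke_carrierI) simp
  obtain a where a: "?p = (\<lambda>x. \<Sum>z\<in>perms n. a z * kl_basis n z x)"
    using kl_expansion_exists[OF pc] by blast
  have Ct: "?C ?t = 0" using kl_basis_facts(3)[OF \<sigma>, of ?t] lt by force
  have pt: "?p ?t = 1"
    using Ct kl_basis_facts(2)[OF \<sigma>] asc by (simp add: right_op_def)
  have psup: "perm_length n x \<le> perm_length n ?t" if "?p x \<noteq> 0" for x
  proof -
    have x: "x permutes {1..n}" using hecke_carrier_0[OF pc] that by blast
    have le: "perm_length n y \<le> perm_length n \<sigma>" if "?C y \<noteq> 0" for y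
      using kl_basis_facts(3)[OF \<sigma> that] by auto
    have "?C (x \<circ> simple_refl i) \<noteq> 0 \<or> ?C x \<noteq> 0"
      using that unfolding right_op_def by (cases "x (Suc i) < x i") auto
    moreover have "perm_length n x \<le> Suc (perm_length n (x \<circ> simple_refl i))"
      using perm_length_comp_le[OF comp_simple_refl_permutes[OF x i] i] by simp
    ultimately show ?thesis using le[of "x \<circ> simple_refl i"] le[of x] lt by linarith
  qed
  let ?A = "{z. z permutes {1..n} \<and> a z \<noteq> 0}"
  have "finite ?A" using finite_perms by (rule rev_finite_subset) blast
  moreover have "?A \<noteq> {}"
  proof
    assume "?A = {}"
    then have "(\<Sum>z\<in>perms n. a z * kl_basis n z ?t) = 0" by (intro sum.neutral) auto
    then show False using fun_cong[OF a, of ?t] pt by simp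
  qed
  ultimately obtain z where z: "z \<in> ?A" "\<forall>y\<in>?A. perm_length n y \<le> perm_length n z"
    using finite_has_max[of ?A "perm_length n"] by blast
  have "?p z = a z"
    using fun_cong[OF a, of z] kl_sum_leading[of z n a] z by simp
  then have "perm_length n z \<le> perm_length n ?t" using psup[of z] z(1) by simp
  then have "\<And>y. y permutes {1..n} \<Longrightarrow> a y \<noteq> 0 \<Longrightarrow> perm_length n y \<le> perm_length n ?t"
    using z(2) order_trans by blast
  then have "a ?t = 1" using kl_sum_leading[OF t, of a] fun_cong[OF a, of ?t] pt by simp
  then show ?thesis
    unfolding kl_right_step_def using \<sigma> t i c a by (intro conjI bexI[of _ i] exI[of _ a]) simp_all
qed

lemma perm_weak_le_imp_kl_right_le:
  assumes "perm_weak_le n \<sigma> \<tau>" "\<sigma> permutes {1..n}"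
  shows "kl_right_le n \<tau> \<sigma>"
proof -
  have "\<tau> permutes {1..n} \<and> kl_right_le n \<tau> \<sigma>"
    using assms(1) unfolding perm_weak_le_def
  proof (induction rule: rtranclp_induct)
    case base
    show ?case using assms(2) by (simp add: kl_right_le_def)
  next
    case (step \<tau> \<tau>')
    then obtain i where i: "i \<in> {1..<n}" "\<tau> i < \<tau> (Suc i)" and t: "\<tau>' = \<tau> \<circ> simple_refl i"
      by (auto simp: perm_weak_step_def)
    have "kl_right_step n \<tau>' \<tau>" unfolding t using kl_right_step_ascent step i by blast
    moreover have "\<tau>' permutes {1..n}" unfolding t using comp_simple_refl_permutes step i by blast
    ultimately show ?case
      using step unfolding kl_right_le_def by (meson converse_rtranclp_into_rtranclp)
  qed
  then show ?thesis ..
qed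

text \<open>Right and left multiplications commute, so the product stays an eigenvector for
  \<open>j\<close>. Removing all \<open>C_z\<close> for which \<open>j\<close> is a left descent of
  \<open>z\<close> leaves an eigenvector. If something remains, take a longest \<open>z\<close> in
  it: the remainder vanishes at the longer element \<open>simple_refl j \<circ> z\<close>, so by the
  eigenvector relation also at \<open>z\<close>, contradicting its leading coefficient.\<close>

lemma kl_right_step_descent:
  assumes step: "kl_right_step n \<tau> \<sigma>" and j: "j \<in> {1..<n}" and desc: "pinv \<sigma> (Suc j) < pinv \<sigma> j"
  shows "pinv \<tau> (Suc j) < pinv \<tau> j"
proof (rule ccontr)
  assume nd: "\<not> ?thesis"
  have \<sigma>: "\<sigma> permutes {1..n}" and \<tau>: "\<tau> permutes {1..n}" using step by (simp_all add: kl_right_step_def)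
  obtain i a where i: "i \<in> {1..<n}" and a: "mult (hecke_algebra n) (kl_basis n \<sigma>) (kl_basis n (simple_refl i)) =
      (\<lambda>x. \<Sum>z\<in>perms n. a z * kl_basis n z x)" and at: "a \<tau> \<noteq> 0"
    using step unfolding kl_right_step_def by blast
  let ?p = "\<lambda>x. \<Sum>z\<in>perms n. a z * kl_basis n z x"
  have eig: "left_eigen j (kl_basis n \<sigma>)" by (rule kl_basis_facts(4)[OF \<sigma> j desc])
  obtain c where c: "?p = (\<lambda>x. right_op i (kl_basis n \<sigma>) x + c * kl_basis n \<sigma> x)"
    using kl_product[OF i \<sigma>] a by metis
  have "left_eigen j (\<lambda>x. right_op i (kl_basis n \<sigma>) x - (\<Sum>z\<in>{\<sigma>}. (- c) * kl_basis n z x))"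
  proof (rule left_eigen_diff_sum)
    show "left_eigen j (right_op i (kl_basis n \<sigma>))"
      using eig unfolding left_eigen_def left_right_op_commute[OF i j kl_basis_facts(1)[OF \<sigma>], symmetric]
      by (simp add: right_op_def algebra_simps fun_eq_iff)
  qed (use eig in simp)
  then have peig: "left_eigen j ?p" unfolding c by simp
  let ?D = "{z \<in> perms n. pinv z (Suc j) < pinv z j}"
  define b where "b z = (if pinv z (Suc j) < pinv z j then 0 else a z)" for z
  let ?q = "\<lambda>x. \<Sum>z\<in>perms n. b z * kl_basis n z x"
  have "?q = (\<lambda>x. ?p x - (\<Sum>z\<in>?D. a z * kl_basis n z x))"
  proof
    fix x
    have "(\<Sum>z\<in>?D. a z * kl_basis n z x) = (\<Sum>z\<in>perms n. (a z - b z) * kl_basis n z x)"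
      by (rule sum.mono_neutral_cong_left[OF finite_perms]) (auto simp: b_def)
    then show "?q x = ?p x - (\<Sum>z\<in>?D. a z * kl_basis n z x)"
      by (simp add: left_diff_distrib sum_subtractf)
  qed
  moreover have "left_eigen j (\<lambda>x. ?p x - (\<Sum>z\<in>?D. a z * kl_basis n z x))"
    by (rule left_eigen_diff_sum[OF peig]) (use kl_basis_facts(4) j in blast)
  ultimately have qeig: "left_eigen j ?q" by simp
  let ?A = "{z. z permutes {1..n} \<and> b z \<noteq> 0}"
  have "finite ?A" using finite_perms by (rule rev_finite_subset) blast
  moreover have "\<tau> \<in> ?A" using \<tau> at nd by (simp add: b_def)
  ultimately obtain z where z: "z \<in> ?A" and max: "\<forall>y\<in>?A. perm_length n y \<le> perm_length n z"
    using finite_has_max[of ?A "perm_length n"] by blast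
  have zp: "z permutes {1..n}" and znd: "\<not> pinv z (Suc j) < pinv z j"
    using z by (auto simp: b_def split: if_splits)
  have "pinv z j < pinv z (Suc j)" using znd perm_ascent_or_descent[OF permutes_inv[OF zp], of j] by simp
  then have lz: "perm_length n (simple_refl j \<circ> z) = Suc (perm_length n z)"
    by (rule perm_length_left_ascent[OF zp j])
  have "b y * kl_basis n y (simple_refl j \<circ> z) = 0" if "y \<in> perms n" for y
  proof (cases "b y = 0")
    case False
    then have yz: "perm_length n y \<le> perm_length n z" and y: "y permutes {1..n}" using max that by auto
    have "kl_basis n y (simple_refl j \<circ> z) = 0"
      using kl_basis_facts(3)[OF y, of "simple_refl j \<circ> z"] yz lz by force
    then show ?thesis by simp
  qed simp
  then have "?q (simple_refl j \<circ> z) = 0" by (rule sum.neutral[rule_format])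
  then have "?q z = 0" using left_eigen_not_descent[OF qeig znd] by simp
  moreover have "?q z = b z" using kl_sum_leading[OF zp, of b] max by blast
  ultimately show False using z by simp
qed

lemma kl_right_le_descent:
  assumes "kl_right_le n \<tau> \<sigma>" and j: "j \<in> {1..<n}" and "pinv \<sigma> (Suc j) < pinv \<sigma> j"
  shows "pinv \<tau> (Suc j) < pinv \<tau> j"
  using assms(1,3) unfolding kl_right_le_def
  by (induction rule: converse_rtranclp_induct) (auto intro: kl_right_step_descent[OF _ j])

lemma interval_kl_le:
  assumes n: "n \<ge> 1" and mu: "is_partition n mu"
  shows "interval n (kl_le n) (one_row n) (row_canonical mu) = compat_tableaux n mu"
proof (intro equalityI subsetI)
  fix T assume "T \<in> interval n (kl_le n) (one_row n) (row_canonical mu)"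
  then have T: "T \<in> YT n" "kl_le n T (row_canonical mu)" by (auto simp: interval_def)
  then obtain \<sigma> \<tau> where st: "\<sigma> permutes {1..n}" "\<tau> permutes {1..n}" "insertion_tableau n \<sigma> = T"
    "insertion_tableau n \<tau> = row_canonical mu" "kl_right_le n \<tau> \<sigma>" by (auto simp: kl_le_def)
  have "ascent T i" if i: "i \<in> {1..<n}" and asc: "ascent (row_canonical mu) i" for i
  proof -
    have "pinv \<tau> i < pinv \<tau> (Suc i)"
      using ascent_insertion_tableau[OF st(2) i] asc row_canonical_YT[OF mu] st(4) by simp
    then have "\<not> pinv \<sigma> (Suc i) < pinv \<sigma> i" using kl_right_le_descent[OF st(5) i] by force
    then have "pinv \<sigma> i < pinv \<sigma> (Suc i)"
      using perm_ascent_or_descent[OF permutes_inv[OF st(1)], of i] by simp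
    then show ?thesis using ascent_insertion_tableau[OF st(1) i] st(3) T by simp
  qed
  then show "T \<in> compat_tableaux n mu" using T by (simp add: compat_tableaux_def)
next
  fix T assume T: "T \<in> compat_tableaux n mu"
  then have TY: "T \<in> YT n" by (simp add: compat_tableaux_def)
  note CY = row_canonical_YT[OF mu]
  have "kl_le n (one_row n) T"
    unfolding kl_le_def
    using one_row_below_perm[OF n TY] perm_weak_le_imp_kl_right_le by blast
  moreover have "kl_le n T (row_canonical mu)"
    unfolding kl_le_def
    using one_row_below_perm[OF n TY] one_row_below_perm[OF n CY] row_perm_weak_le[OF mu T]
      perm_weak_le_imp_kl_right_le by blast
  ultimately show "T \<in> interval n (kl_le n) (one_row n) (row_canonical mu)"
    using TY by (simp add: interval_def)
qed

section \<open>Jeu de taquin\<close>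

definition down_closed :: "(nat \<times> nat) set \<Rightarrow> bool" where
  "down_closed D \<longleftrightarrow> (\<forall>r c r' c'. (r, c) \<in> D \<and> r' \<le> r \<and> c' \<le> c \<longrightarrow> (r', c') \<in> D)"

definition increasing_filling :: "filling \<Rightarrow> bool" where
  "increasing_filling F \<longleftrightarrow> (\<forall>r c r' c' x y.
     F (r, c) = Some x \<and> F (r', c') = Some y \<and> r \<le> r' \<and> c \<le> c' \<and> (r, c) \<noteq> (r', c') \<longrightarrow> x < y)"

definition injective_filling :: "filling \<Rightarrow> bool" where
  "injective_filling F \<longleftrightarrow> (\<forall>p q x. F p = Some x \<and> F q = Some x \<longrightarrow> p = q)"

text \<open>A standard filling of \<open>D - I\<close> except for an empty cell (the hole) in \<open>H\<close>, where \<open>H\<close> has at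
  most one element.\<close>

definition skew_filling :: "(nat \<times> nat) set \<Rightarrow> (nat \<times> nat) set \<Rightarrow> (nat \<times> nat) set \<Rightarrow> filling \<Rightarrow> bool" where
  "skew_filling D I H F \<longleftrightarrow> finite D \<and> down_closed D \<and> down_closed I \<and> I \<union> H \<subseteq> D \<and> I \<inter> H = {} \<and>
     dom F = D - I - H \<and> increasing_filling F \<and> injective_filling F"

definition in_row :: "filling \<Rightarrow> nat \<Rightarrow> nat \<Rightarrow> bool" where
  "in_row F x r \<longleftrightarrow> (\<exists>c. F (r, c) = Some x)"

text \<open>Ascents in their row form, which a horizontal move visibly preserves.\<close>

definition filling_ascent :: "filling \<Rightarrow> nat \<Rightarrow> bool" where
  "filling_ascent F i \<longleftrightarrow> (\<exists>r r'. in_row F i r \<and> in_row F (Suc i) r' \<and> r' \<le> r)"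

text \<open>The invariants of jeu de taquin on which the chain order rests: ascents and the set of
  entries are unchanged, and no entry moves to the right.\<close>

definition slid :: "filling \<Rightarrow> filling \<Rightarrow> bool" where
  "slid F F' \<longleftrightarrow> (\<forall>i. filling_ascent F' i = filling_ascent F i) \<and> ran F' = ran F \<and>
     (\<forall>r c x. F (r, c) = Some x \<longrightarrow> (\<exists>r' c'. F' (r', c') = Some x \<and> c' \<le> c))"

lemma slid_refl: "slid F F"
  by (auto simp: slid_def)

lemma slid_trans: "slid F F' \<Longrightarrow> slid F' F'' \<Longrightarrow> slid F F''"
  unfolding slid_def by (metis le_trans)

lemma down_closedD: "down_closed D \<Longrightarrow> (r, c) \<in> D \<Longrightarrow> r' \<le> r \<Longrightarrow> c' \<le> c \<Longrightarrow> (r', c') \<in> D"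
  by (auto simp: down_closed_def)

lemma increasing_fillingD:
  "increasing_filling F \<Longrightarrow> F (r, c) = Some x \<Longrightarrow> F (r', c') = Some y \<Longrightarrow> r \<le> r' \<Longrightarrow> c \<le> c' \<Longrightarrow>
    (r, c) \<noteq> (r', c') \<Longrightarrow> x < y"
  unfolding increasing_filling_def by blast

lemma injective_fillingD: "injective_filling F \<Longrightarrow> F p = Some x \<Longrightarrow> F q = Some x \<Longrightarrow> p = q"
  unfolding injective_filling_def by blast

lemma skew_filling_above_hole:
  assumes "skew_filling D I {(r, c)} F" "(a, b) \<in> D" "r \<le> a" "c \<le> b" "(a, b) \<noteq> (r, c)"
  shows "\<exists>x. F (a, b) = Some x"
proof -
  have "(a, b) \<notin> I" using assms down_closedD[of I a b r c] by (auto simp: skew_filling_def)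
  then have "(a, b) \<in> dom F" using assms by (auto simp: skew_filling_def)
  then show ?thesis by auto
qed

text \<open>Moving \<open>x\<close> into the hole keeps the filling increasing because
  \<open>x\<close> is the smallest entry weakly above and to the right of the hole, while whatever
  lies weakly below and to the left of the hole also lies so with respect to the old place of
  \<open>x\<close>.\<close>

lemma skew_filling_move:
  assumes sk: "skew_filling D I {h} F" and Fq: "F q = Some x"
    and le: "fst h \<le> fst q" "snd h \<le> snd q"
    and up: "\<And>p y. F p = Some y \<Longrightarrow> p \<noteq> q \<Longrightarrow> fst h \<le> fst p \<Longrightarrow> snd h \<le> snd p \<Longrightarrow> x < y"
  shows "skew_filling D I {q} (F(h := Some x, q := None))"
proof -
  let ?F = "F(h := Some x, q := None)"
  have domF: "dom F = D - I - {h}" and incr: "increasing_filling F" and inj: "injective_filling F"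
    using sk by (simp_all add: skew_filling_def)
  have q: "q \<in> D" "q \<notin> I" "q \<noteq> h" using Fq domF by blast+
  have h: "h \<in> D" "h \<notin> I" using sk by (auto simp: skew_filling_def)
  have "dom ?F = D - I - {q}" using domF q h by auto
  moreover have "injective_filling ?F"
    unfolding injective_filling_def
  proof (intro allI impI, elim conjE)
    fix p p' y assume y: "?F p = Some y" "?F p' = Some y"
    then have nq: "p \<noteq> q" "p' \<noteq> q" by auto
    consider "p = h" "p' = h" | "p = h" "p' \<noteq> h" | "p \<noteq> h" "p' = h" | "p \<noteq> h" "p' \<noteq> h" by blast
    then show "p = p'"
    proof cases
      case 2
      then have "F p' = Some x" using y nq by simp
      then show ?thesis using injective_fillingD[OF inj _ Fq, of p'] nq by simp
    next
      case 3
      then have "F p = Some x" using y nq by simp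
      then show ?thesis using injective_fillingD[OF inj _ Fq, of p] nq by simp
    next
      case 4
      then have "F p = Some y" "F p' = Some y" using y nq by simp_all
      then show ?thesis by (rule injective_fillingD[OF inj])
    qed simp
  qed
  moreover have "increasing_filling ?F"
    unfolding increasing_filling_def
  proof (intro allI impI, elim conjE)
    fix a b a' b' y z
    assume y: "?F (a, b) = Some y" and z: "?F (a', b') = Some z"
      and ord: "a \<le> a'" "b \<le> b'" "(a, b) \<noteq> (a', b')"
    have nq: "(a, b) \<noteq> q" "(a', b') \<noteq> q" using y z by auto
    consider "(a, b) = h" "(a', b') \<noteq> h" | "(a', b') = h" "(a, b) \<noteq> h" | "(a, b) \<noteq> h" "(a', b') \<noteq> h"
      using ord by blast
    then show "y < z"
    proof cases
      case 1
      then have "y = x" "F (a', b') = Some z" using y z nq by auto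
      then show ?thesis using up[of "(a', b')" z] nq ord 1(1) by auto
    next
      case 2
      then have "z = x" "F (a, b) = Some y" using y z nq by auto
      moreover have "a \<le> fst q" "b \<le> snd q" using ord le 2(1) by auto
      ultimately show ?thesis
        using increasing_fillingD[OF incr, of a b y "fst q" "snd q" x] Fq nq by simp
    next
      case 3
      then have "F (a, b) = Some y" "F (a', b') = Some z" using y z nq by auto
      then show ?thesis using increasing_fillingD[OF incr] ord by blast
    qed
  qed
  ultimately show ?thesis using sk q h by (auto simp: skew_filling_def)
qed

lemma slid_move:
  assumes asc: "\<And>i. filling_ascent (F(h := Some x, q := None)) i = filling_ascent F i"
    and h: "F h = None" and Fq: "F q = Some x" and le: "snd h \<le> snd q"
  shows "slid F (F(h := Some x, q := None))"
proof -
  let ?F = "F(h := Some x, q := None)"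
  have hq: "h \<noteq> q" using h Fq by auto
  have "\<exists>r' c'. ?F (r', c') = Some y \<and> c' \<le> c" if "F (r, c) = Some y" for r c y
  proof (cases "(r, c) = q")
    case True
    then have "?F (fst h, snd h) = Some y" "snd h \<le> c" using that Fq hq le by auto
    then show ?thesis by blast
  next
    case False
    then have "?F (r, c) = Some y" using that h by auto
    then show ?thesis by blast
  qed
  moreover have "ran ?F = ran F"
  proof
    show "ran ?F \<subseteq> ran F"
    proof
      fix y assume "y \<in> ran ?F"
      then obtain p where "?F p = Some y" unfolding ran_def by blast
      then have "F p = Some y \<or> F q = Some y" using Fq by (auto split: if_splits)
      then show "y \<in> ran F" by (auto intro: ranI)
    qed
    show "ran F \<subseteq> ran ?F"
    proof
      fix y assume "y \<in> ran F"
      then obtain r c where "F (r, c) = Some y" by (auto simp: ran_def)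
      then show "y \<in> ran ?F" using calculation ranI by metis
    qed
  qed
  ultimately show ?thesis using asc by (auto simp: slid_def)
qed

text \<open>Entries keep their rows, hence the ascents. That \<open>x\<close> is minimal beyond the
  hole follows by comparison with the entry directly above the hole, which starts the only part of
  the region not beyond \<open>x\<close> itself.\<close>

lemma slide_right:
  assumes sk: "skew_filling D I {(r, c)} F" and x: "F (r, Suc c) = Some x"
    and min: "\<And>y. F (Suc r, c) = Some y \<Longrightarrow> x < y"
  defines "F' \<equiv> F((r, c) := Some x, (r, Suc c) := None)"
  shows "skew_filling D I {(r, Suc c)} F'" "slid F F'"
proof -
  have h: "F (r, c) = None" using sk by (auto simp: skew_filling_def domIff[symmetric] simp del: domIff)
  show "skew_filling D I {(r, Suc c)} F'"
    unfolding F'_def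
  proof (rule skew_filling_move[OF sk x])
    fix p y assume p: "F p = Some y" "p \<noteq> (r, Suc c)" "fst (r, c) \<le> fst p" "snd (r, c) \<le> snd p"
    obtain a b where ab: "p = (a, b)" by fastforce
    have incr: "increasing_filling F" using sk by (simp add: skew_filling_def)
    show "x < y"
    proof (cases "b = c")
      case False
      then show ?thesis using increasing_fillingD[OF incr x, of a b y] p ab by auto
    next
      case True
      then have a: "Suc r \<le> a" using p ab h by (cases "a = r") auto
      have "(a, b) \<in> D" using p(1) ab sk by (auto simp: skew_filling_def)
      then have "(Suc r, c) \<in> D"
        using a True down_closedD[of D a b "Suc r" c] sk by (auto simp: skew_filling_def)
      then obtain z where z: "F (Suc r, c) = Some z" using skew_filling_above_hole[OF sk, of "Suc r" c] by auto
      have "z \<le> y"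
      proof (cases "a = Suc r")
        case True
        then show ?thesis using z p(1) ab \<open>b = c\<close> by simp
      next
        case False
        then show ?thesis using increasing_fillingD[OF incr z, of a b y] p(1) ab a \<open>b = c\<close> by auto
      qed
      then show ?thesis using min[OF z] by simp
    qed
  qed simp_all
  have "in_row F' y a = in_row F y a" for y a
  proof
    assume "in_row F' y a"
    then obtain b where "F' (a, b) = Some y" by (auto simp: in_row_def)
    then have "F (a, b) = Some y \<or> (a, b) = (r, c) \<and> y = x" by (auto simp: F'_def split: if_splits)
    then show "in_row F y a" using x by (auto simp: in_row_def)
  next
    assume "in_row F y a"
    then obtain b where b: "F (a, b) = Some y" by (auto simp: in_row_def)
    show "in_row F' y a"
    proof (cases "(a, b) = (r, Suc c)")
      case True
      then have "F' (a, c) = Some y" using b x by (simp add: F'_def)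
      then show ?thesis by (auto simp: in_row_def)
    next
      case False
      then have "F' (a, b) = Some y" using b h by (auto simp: F'_def)
      then show ?thesis by (auto simp: in_row_def)
    qed
  qed
  then have "\<And>i. filling_ascent F' i = filling_ascent F i" by (simp add: filling_ascent_def)
  then show "slid F F'" unfolding F'_def by (rule slid_move[OF _ h x]) simp
qed

text \<open>The vertical moves are the ones that could destroy an ascent or create one; the entries to the
  right of the hole and to the left of the moving entry \<open>y\<close> show that \<open>y + 1\<close> and \<open>y - 1\<close> are not in
  the critical row.\<close>

lemma slide_above:
  assumes sk: "skew_filling D I {(r, c)} F" and y: "F (Suc r, c) = Some y"
    and min: "\<And>x. F (r, Suc c) = Some x \<Longrightarrow> y < x"
  defines "F' \<equiv> F((r, c) := Some y, (Suc r, c) := None)"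
  shows "skew_filling D I {(Suc r, c)} F'" "slid F F'"
proof -
  have h: "F (r, c) = None" using sk by (auto simp: skew_filling_def domIff[symmetric] simp del: domIff)
  have incr: "increasing_filling F" and inj: "injective_filling F" and dcD: "down_closed D"
    and dcI: "down_closed I" and domF: "dom F = D - I - {(r, c)}"
    using sk by (simp_all add: skew_filling_def)
  have inD: "p \<in> D" "p \<notin> I" if "F p = Some v" for p v using that domF by auto
  have right: "\<exists>x. F (r, Suc c) = Some x" if "(a, b) \<in> D" "r \<le> a" "c < b" for a b
    using that down_closedD[OF dcD, of a b r "Suc c"] skew_filling_above_hole[OF sk, of r "Suc c"] by auto
  show "skew_filling D I {(Suc r, c)} F'"
    unfolding F'_def
  proof (rule skew_filling_move[OF sk y])
    fix p z assume p: "F p = Some z" "p \<noteq> (Suc r, c)" "fst (r, c) \<le> fst p" "snd (r, c) \<le> snd p"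
    obtain a b where ab: "p = (a, b)" by fastforce
    show "y < z"
    proof (cases "a = r")
      case False
      then show ?thesis using increasing_fillingD[OF incr y, of a b z] p ab by auto
    next
      case True
      then have b: "Suc c \<le> b" using p ab h by (cases "b = c") auto
      then obtain x where x: "F (r, Suc c) = Some x" using right[of a b] inD(1)[OF p(1)] ab True by auto
      have "x \<le> z"
      proof (cases "b = Suc c")
        case True
        then show ?thesis using x p(1) ab \<open>a = r\<close> by simp
      next
        case False
        then show ?thesis using increasing_fillingD[OF incr x, of a b z] p(1) ab b \<open>a = r\<close> by auto
      qed
      then show ?thesis using min[OF x] by simp
    qed
  qed simp_all
  have row_F': "in_row F' z a \<longleftrightarrow> (if z = y then a = r else in_row F z a)" for z a
  proof (cases "z = y")
    case True
    have "F' (a, b) = Some y \<Longrightarrow> (a, b) = (r, c)" for b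
      using injective_fillingD[OF inj y, of "(a, b)"] by (auto simp: F'_def split: if_splits)
    moreover have "F' (r, c) = Some y" by (simp add: F'_def)
    ultimately show ?thesis using True by (auto simp: in_row_def)
  next
    case False
    have "F' (a, b) = Some z \<longleftrightarrow> F (a, b) = Some z" for b
      using False y h by (auto simp: F'_def)
    then show ?thesis using False by (simp add: in_row_def)
  qed
  have row_F: "in_row F y a \<longleftrightarrow> a = Suc r" for a
    using y injective_fillingD[OF inj y] by (auto simp: in_row_def)
  have suc: "\<not> in_row F (Suc y) (Suc r)"
  proof
    assume "in_row F (Suc y) (Suc r)"
    then obtain b where b: "F (Suc r, b) = Some (Suc y)" by (auto simp: in_row_def)
    then have "b \<noteq> c" using y by auto
    moreover have "\<not> b < c" using increasing_fillingD[OF incr b y] by auto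
    ultimately have bc: "c < b" by simp
    then obtain x where x: "F (r, Suc c) = Some x" using right[of "Suc r" b] inD(1)[OF b] by auto
    have "x < Suc y" using increasing_fillingD[OF incr x b] bc by auto
    then show False using min[OF x] by simp
  qed
  have pred: "\<not> in_row F i r" if "Suc i = y" for i
  proof
    assume "in_row F i r"
    then obtain b where b: "F (r, b) = Some i" by (auto simp: in_row_def)
    then have "b \<noteq> c" using h by auto
    then consider "c < b" | "b < c" by linarith
    then show False
    proof cases
      case 1
      then obtain x where x: "F (r, Suc c) = Some x" using right[of r b] inD(1)[OF b] by auto
      have "x \<le> i" using increasing_fillingD[OF incr x b] x b 1 by (cases "b = Suc c") auto
      then show False using min[OF x] that by simp
    next
      case 2
      have "(Suc r, b) \<in> D" using down_closedD[OF dcD inD(1)[OF y], of "Suc r" b] 2 by simp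
      moreover have "(Suc r, b) \<notin> I" using down_closedD[OF dcI, of "Suc r" b r b] inD(2)[OF b] by auto
      ultimately have "(Suc r, b) \<in> dom F" using domF by simp
      then obtain z where z: "F (Suc r, b) = Some z" by auto
      have "i < z" "z < y"
        using increasing_fillingD[OF incr b z] increasing_fillingD[OF incr z y] 2 by auto
      then show False using that by simp
    qed
  qed
  have "filling_ascent F' i = filling_ascent F i" for i
  proof -
    consider "i = y" | "Suc i = y" | "i \<noteq> y" "Suc i \<noteq> y" by blast
    then show ?thesis
    proof cases
      case 1
      have "a \<le> Suc r \<longleftrightarrow> a \<le> r" if "in_row F (Suc y) a" for a
        using that suc by (metis le_Suc_eq)
      then show ?thesis unfolding filling_ascent_def row_F' 1 row_F by auto
    next
      case 2
      have "Suc r \<le> a \<longleftrightarrow> r \<le> a" if "in_row F i a" for a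
        using that pred[OF 2] by (metis Suc_leD Suc_leI le_neq_implies_less)
      moreover have "i \<noteq> y" using 2 by auto
      ultimately show ?thesis unfolding filling_ascent_def row_F' 2 row_F by auto
    next
      case 3
      then show ?thesis unfolding filling_ascent_def row_F' by simp
    qed
  qed
  then show "slid F F'" unfolding F'_def by (rule slid_move[OF _ h y]) simp
qed

text \<open>When a slide stops, the hole has no occupied neighbour to its right or above it, so it
  is an outer corner and deleting it leaves a diagram.\<close>

lemma jdt_slide_skew_filling:
  assumes "jdt_slide h F F'" "skew_filling D I {h} F"
  shows "\<exists>h'. skew_filling (D - {h'}) I {} F' \<and> slid F F'"
  using assms
proof (induction rule: jdt_slide.induct)
  case (stop F r c)
  have "down_closed (D - {(r, c)})"
    unfolding down_closed_def
  proof (intro allI impI, elim conjE)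
    fix a b a' b' assume ab: "(a, b) \<in> D - {(r, c)}" "a' \<le> a" "b' \<le> b"
    have dc: "down_closed D" using stop.prems by (simp add: skew_filling_def)
    then have "(a', b') \<in> D" using ab down_closedD by blast
    moreover have "(a', b') \<noteq> (r, c)"
    proof
      assume eq: "(a', b') = (r, c)"
      then have "(Suc r, c) \<in> D \<or> (r, Suc c) \<in> D"
        using ab down_closedD[OF dc, of a b "Suc r" c] down_closedD[OF dc, of a b r "Suc c"] by force
      then show False
        using skew_filling_above_hole[OF stop.prems, of "Suc r" c]
          skew_filling_above_hole[OF stop.prems, of r "Suc c"] stop.hyps by auto
    qed
    ultimately show "(a', b') \<in> D - {(r, c)}" by blast
  qed
  then have "skew_filling (D - {(r, c)}) I {} F"
    using stop.prems by (auto simp: skew_filling_def)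
  then show ?case using slid_refl by blast
next
  case (from_right F r c x F')
  then show ?case using slide_right[of D I r c F x] slid_trans by blast
next
  case (from_above F r c y F')
  then show ?case using slide_above[of D I r c F y] slid_trans by blast
qed

lemma jdt_slide_exists:
  assumes "skew_filling D I {h} F" shows "\<exists>F'. jdt_slide h F F'"
  using assms
\<comment> \<open>The region weakly above and to the right of the hole shrinks with every
  move.\<close>
proof (induction "card {q \<in> D. fst h \<le> fst q \<and> snd h \<le> snd q}" arbitrary: h F rule: less_induct)
  case less
  obtain r c where h: "h = (r, c)" by fastforce
  let ?S = "\<lambda>h. {q \<in> D. fst h \<le> fst q \<and> snd h \<le> snd q}"
  have fin: "finite (?S h)" and hD: "h \<in> D"
    using less.prems by (auto simp: skew_filling_def)
  have smaller: "card (?S h') < card (?S h)" if "h' = (r, Suc c) \<or> h' = (Suc r, c)" for h'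
  proof (rule psubset_card_mono[OF fin])
    have "h \<in> ?S h" "h \<notin> ?S h'" using that hD h by auto
    moreover have "?S h' \<subseteq> ?S h" using that h by auto
    ultimately show "?S h' \<subset> ?S h" by blast
  qed
  show ?case
  proof (cases "F (r, Suc c)")
    case None
    show ?thesis
    proof (cases "F (Suc r, c)")
      case None
      then show ?thesis using \<open>F (r, Suc c) = None\<close> jdt_slide.stop h by blast
    next
      case (Some y)
      then have "\<exists>F'. jdt_slide (Suc r, c) (F((r, c) := Some y, (Suc r, c) := None)) F'"
        using less.hyps[OF smaller[of "(Suc r, c)"]] slide_above(1)[of D I r c F y] less.prems h None by auto
      then show ?thesis using jdt_slide.from_above[of F r c y] Some None h by auto
    qed
  next
    case (Some x)
    show ?thesis
    proof (cases "\<exists>y. F (Suc r, c) = Some y \<and> y < x")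
      case True
      then obtain y where y: "F (Suc r, c) = Some y" "y < x" by blast
      then have "\<exists>F'. jdt_slide (Suc r, c) (F((r, c) := Some y, (Suc r, c) := None)) F'"
        using less.hyps[OF smaller[of "(Suc r, c)"]] slide_above(1)[of D I r c F y] less.prems h Some by auto
      then show ?thesis using jdt_slide.from_above[of F r c y] y Some h by auto
    next
      case False
      have lt: "x < y" if "F (Suc r, c) = Some y" for y
      proof -
        have "x \<noteq> y"
          using less.prems injective_fillingD[of F "(Suc r, c)" y "(r, Suc c)"] that Some
          by (auto simp: skew_filling_def)
        then show ?thesis using False that by force
      qed
      then have "\<exists>F'. jdt_slide (r, Suc c) (F((r, c) := Some x, (r, Suc c) := None)) F'"
        using less.hyps[OF smaller[of "(r, Suc c)"]] slide_right(1)[of D I r c F x] less.prems h Some by auto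
      then show ?thesis using jdt_slide.from_right[of F r c x] lt Some h by auto
    qed
  qed
qed

lemma skew_filling_corner:
  assumes sk: "skew_filling D I {} F" and "(r, c) \<in> I" "(r, Suc c) \<notin> I" "(Suc r, c) \<notin> I"
  shows "skew_filling D (I - {(r, c)}) {(r, c)} F"
proof -
  have dc: "down_closed I" using sk by (simp add: skew_filling_def)
  have "down_closed (I - {(r, c)})"
    unfolding down_closed_def
  proof (intro allI impI, elim conjE)
    fix a b a' b' assume ab: "(a, b) \<in> I - {(r, c)}" "a' \<le> a" "b' \<le> b"
    have "(a', b') \<in> I" using ab down_closedD[OF dc] by blast
    moreover have "(a', b') \<noteq> (r, c)"
    proof
      assume "(a', b') = (r, c)"
      then have "(Suc r, c) \<in> I \<or> (r, Suc c) \<in> I"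
        using ab down_closedD[OF dc, of a b "Suc r" c] down_closedD[OF dc, of a b r "Suc c"] by force
      then show False using assms by blast
    qed
    ultimately show "(a', b') \<in> I - {(r, c)}" by blast
  qed
  then show ?thesis using sk assms(2) by (auto simp: skew_filling_def)
qed

lemma rectifies_skew_filling:
  assumes "rectifies I F F'" "skew_filling D I {} F"
  shows "\<exists>D'. skew_filling D' {} {} F' \<and> slid F F'"
  using assms
proof (induction arbitrary: D rule: rectifies.induct)
  case (normal F)
  then show ?case using slid_refl by blast
next
  case (slide r c I F F' F'')
  obtain h' where "skew_filling (D - {h'}) (I - {(r, c)}) {} F'" "slid F F'"
    using jdt_slide_skew_filling[OF slide.hyps(4) skew_filling_corner[OF slide.prems slide.hyps(1-3)]] by blast
  then show ?case using slide.IH slid_trans by blast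
qed

lemma rectifies_exists:
  assumes "skew_filling D I {} F" shows "\<exists>F'. rectifies I F F'"
  using assms
proof (induction "card I" arbitrary: I D F)
  case 0
  then have "I = {}" using finite_subset[of I D] by (auto simp: skew_filling_def)
  then show ?case using rectifies.normal by blast
next
  case (Suc m)
  have fin: "finite I" using Suc.prems finite_subset[of I D] by (auto simp: skew_filling_def)
  have "I \<noteq> {}" using Suc.hyps(2) by auto
  \<comment> \<open>A cell of the inner shape with maximal \<open>r + c\<close> is a corner, so a
    slide can start there.\<close>
  have "finite ((\<lambda>(r, c). r + c) ` I)" using fin by simp
  then have "Max ((\<lambda>(r, c). r + c) ` I) \<in> (\<lambda>(r, c). r + c) ` I" using \<open>I \<noteq> {}\<close> by (intro Max_in) auto
  then obtain r c where rc: "(r, c) \<in> I" "r + c = Max ((\<lambda>(r, c). r + c) ` I)" by auto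
  have le: "a + b \<le> r + c" if "(a, b) \<in> I" for a b
    unfolding rc(2) using that fin by (intro Max_ge) force+
  have corner: "(r, Suc c) \<notin> I" "(Suc r, c) \<notin> I" using le[of r "Suc c"] le[of "Suc r" c] by auto
  note sk = skew_filling_corner[OF Suc.prems rc(1) corner]
  obtain F' where F': "jdt_slide (r, c) F F'" using jdt_slide_exists[OF sk] by blast
  then obtain h' where "skew_filling (D - {h'}) (I - {(r, c)}) {} F'"
    using jdt_slide_skew_filling[OF F' sk] by blast
  moreover have "m = card (I - {(r, c)})" using Suc.hyps(2) rc(1) by simp
  ultimately obtain F'' where "rectifies (I - {(r, c)}) F' F''" using Suc.hyps(1) by blast
  then show ?case using rectifies.slide[OF rc(1) corner F'] by blast
qed

section \<open>The chain order\<close>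

lemma down_closed_nat_set:
  assumes "finite S" "\<And>a b. a \<in> S \<Longrightarrow> b \<le> a \<Longrightarrow> b \<in> S" shows "S = {..<card S}"
proof -
  obtain m where m: "S = {..<m}"
  proof (cases "S = {}")
    case True
    then show ?thesis using that[of 0] by simp
  next
    case False
    have "S = {..<Suc (Max S)}"
    proof (intro equalityI subsetI)
      fix a assume "a \<in> S"
      then show "a \<in> {..<Suc (Max S)}" using Max_ge[OF assms(1)] by (simp add: less_Suc_eq_le)
    next
      fix a assume "a \<in> {..<Suc (Max S)}"
      then show "a \<in> S" using assms(2)[OF Max_in[OF assms(1) False], of a] by (simp add: less_Suc_eq_le)
    qed
    then show ?thesis by (rule that)
  qed
  then show ?thesis by simp
qed

section \<open>Counting the cells of a diagram by rows and columns\<close>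

lemma card_by_columns:
  assumes "finite X" "finite C" "snd ` X \<subseteq> C"
  shows "card X = (\<Sum>c\<in>C. card {p \<in> X. snd p = c})"
proof -
  have "X = (\<Union>c\<in>C. {p \<in> X. snd p = c})" using assms(3) by auto
  then have "card X = card (\<Union>c\<in>C. {p \<in> X. snd p = c})" by simp
  also have "\<dots> = (\<Sum>c\<in>C. card {p \<in> X. snd p = c})"
    by (rule card_UN_disjoint) (use assms in auto)
  finally show ?thesis .
qed

text \<open>The easy half of Greene's theorem. A column of a diagram is an initial segment, so the
  first \<open>k\<close> rows contain as many of its cells as any set can that meets the column at
  most \<open>k\<close> times.\<close>

lemma column_bound:
  assumes D: "finite D" "down_closed D" and "X \<subseteq> D" and col: "\<And>c. card {p \<in> X. snd p = c} \<le> k"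
  shows "card X \<le> card {p \<in> D. fst p < k}"
proof -
  have fX: "finite X" using assms finite_subset by blast
  have "card X = (\<Sum>c\<in>snd ` D. card {p \<in> X. snd p = c})"
    by (rule card_by_columns) (use fX assms in auto)
  also have "\<dots> \<le> (\<Sum>c\<in>snd ` D. card {p \<in> {p \<in> D. fst p < k}. snd p = c})"
  proof (rule sum_mono)
    fix c
    let ?H = "{r. (r, c) \<in> D}"
    have "?H \<subseteq> fst ` D" by force
    then have fH: "finite ?H" using D(1) finite_subset by blast
    have H: "?H = {..<card ?H}"
      using down_closedD[OF D(2)] by (intro down_closed_nat_set[OF fH]) blast
    have "card {p \<in> X. snd p = c} \<le> card ?H"
      using fH assms(3) by (intro card_inj_on_le[of fst]) (auto simp: inj_on_def)
    then have "card {p \<in> X. snd p = c} \<le> min k (card ?H)" using col[of c] by simp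
    also have "\<dots> = card ((\<lambda>r. (r, c)) ` {..<min k (card ?H)})"
      by (subst card_image) (auto simp: inj_on_def)
    also have "\<dots> \<le> card {p \<in> {p \<in> D. fst p < k}. snd p = c}"
    proof (rule card_mono)
      show "finite {p \<in> {p \<in> D. fst p < k}. snd p = c}" using D(1) by simp
      show "(\<lambda>r. (r, c)) ` {..<min k (card ?H)} \<subseteq> {p \<in> {p \<in> D. fst p < k}. snd p = c}"
      proof
        fix p assume "p \<in> (\<lambda>r. (r, c)) ` {..<min k (card ?H)}"
        then obtain r where r: "p = (r, c)" "r < k" "r \<in> {..<card ?H}" by auto
        then have "r \<in> ?H" using H by blast
        then show "p \<in> {p \<in> {p \<in> D. fst p < k}. snd p = c}" using r by simp
      qed
    qed
    finally show "card {p \<in> X. snd p = c} \<le> card {p \<in> {p \<in> D. fst p < k}. snd p = c}" .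
  qed
  also have "\<dots> = card {p \<in> D. fst p < k}"
    by (rule card_by_columns[symmetric]) (use D in auto)
  finally show ?thesis .
qed

lemma sum_list_take_normal_shape:
  assumes sk: "skew_filling D {} {} F" and k: "k \<le> length (normal_shape F)"
  shows "sum_list (take k (normal_shape F)) = card {p \<in> D. fst p < k}"
proof -
  have domF: "dom F = D" and fin: "finite D" using sk by (simp_all add: skew_filling_def)
  have finr: "finite {c. (r, c) \<in> D}" for r
    by (rule finite_subset[of _ "snd ` D"]) (use fin in force)+
  have "sum_list (take k (normal_shape F)) = (\<Sum>r<k. card {c. (r, c) \<in> D})"
    using k by (simp add: normal_shape_def take_map domF sum_list_distinct_conv_sum_set lessThan_atLeast0)
  also have "\<dots> = card (SIGMA r:{..<k}. {c. (r, c) \<in> D})" using finr by simp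
  also have "(SIGMA r:{..<k}. {c. (r, c) \<in> D}) = {p \<in> D. fst p < k}" by auto
  finally show ?thesis .
qed

definition filling_col :: "filling \<Rightarrow> nat \<Rightarrow> nat" where
  "filling_col F x = snd (SOME p. F p = Some x)"

lemma filling_col_eq:
  assumes "injective_filling F" "F (r, c) = Some x" shows "filling_col F x = c"
proof -
  have "(SOME p. F p = Some x) = (r, c)"
    using assms by (intro some_equality) (auto dest: injective_fillingD)
  then show ?thesis by (simp add: filling_col_def)
qed

lemma filling_ascent_col_less:
  assumes sk: "skew_filling D {} {} F" and asc: "filling_ascent F i"
  shows "filling_col F i < filling_col F (Suc i)"
proof -
  have incr: "increasing_filling F" and inj: "injective_filling F" using sk by (simp_all add: skew_filling_def)
  obtain r c r' c' where F: "F (r, c) = Some i" "F (r', c') = Some (Suc i)" "r' \<le> r"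
    using asc by (auto simp: filling_ascent_def in_row_def)
  have "\<not> c' \<le> c"
  proof
    assume "c' \<le> c"
    moreover have "(r', c') \<noteq> (r, c)" using F by auto
    ultimately show False using increasing_fillingD[OF incr F(2,1,3)] by auto
  qed
  then show ?thesis using filling_col_eq[OF inj F(1)] filling_col_eq[OF inj F(2)] by simp
qed

lemma skew_part_eq:
  "skew_part T i j (r, c) = Some v \<longleftrightarrow> (r, c) \<in> cells T \<and> i \<le> T ! r ! c \<and> T ! r ! c \<le> j \<and> v = T ! r ! c - (i - 1)"
  by (auto simp: skew_part_def filling_of_def)

lemma skew_filling_skew_part:
  assumes T: "T \<in> YT n" and ij: "1 \<le> i" "i \<le> j"
  shows "skew_filling {p \<in> cells T. T ! fst p ! snd p \<le> j} (inner_cells T i) {} (skew_part T i j)"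
proof -
  have I: "inner_cells T i = {p \<in> cells T. T ! fst p ! snd p < i}"
    by (auto simp: inner_cells_def filling_of_def split: if_splits)
  have dc: "down_closed {p \<in> cells T. T ! fst p ! snd p \<le> m}" for m
    unfolding down_closed_def
  proof (intro allI impI, elim conjE)
    fix r c r' c' assume h: "(r, c) \<in> {p \<in> cells T. T ! fst p ! snd p \<le> m}" "r' \<le> r" "c' \<le> c"
    then have "(r', c') \<in> cells T" using YT_row_length[OF T, of r' r] by auto
    moreover have "T ! r' ! c' \<le> T ! r ! c"
      using YT_entry_less[OF T, of r c r' c'] h by (cases "(r', c') = (r, c)") auto
    ultimately show "(r', c') \<in> {p \<in> cells T. T ! fst p ! snd p \<le> m}" using h by auto
  qed
  have "cells T \<subseteq> (\<Union>r<length T. (\<lambda>c. (r, c)) ` {..<length (T ! r)})" by auto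
  then have fin: "finite (cells T)" by (rule finite_subset) simp
  have eqI: "inner_cells T i = {p \<in> cells T. T ! fst p ! snd p \<le> i - 1}" unfolding I using ij by auto
  have dom: "dom (skew_part T i j) = {p \<in> cells T. i \<le> T ! fst p ! snd p \<and> T ! fst p ! snd p \<le> j}"
    using skew_part_eq[of T i j] by (auto simp: dom_def)
  have "increasing_filling (skew_part T i j)"
    unfolding increasing_filling_def skew_part_eq using YT_entry_less[OF T] by fastforce
  moreover have "injective_filling (skew_part T i j)"
    unfolding injective_filling_def
  proof (intro allI impI, elim conjE)
    fix p q x assume "skew_part T i j p = Some x" "skew_part T i j q = Some x"
    then show "p = q"
      using skew_part_eq[of T i j "fst p" "snd p" x] skew_part_eq[of T i j "fst q" "snd q" x]
        YT_entry_inj[OF T, of "fst p" "snd p" "fst q" "snd q"] by auto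
  qed
  moreover have "down_closed (inner_cells T i)" unfolding eqI by (rule dc)
  moreover have "dom (skew_part T i j) = {p \<in> cells T. T ! fst p ! snd p \<le> j} - inner_cells T i"
    unfolding dom I by auto
  moreover have "inner_cells T i \<subseteq> {p \<in> cells T. T ! fst p ! snd p \<le> j}" unfolding I using ij by auto
  ultimately show ?thesis using fin dc[of j] by (simp add: skew_filling_def)
qed

text \<open>No confluence of jeu de taquin is needed: the following properties hold for whatever
  rectification the choice operator in \<open>chain_shape\<close> picks.\<close>

lemma chain_shape_filling:
  assumes T: "T \<in> YT n" and ij: "1 \<le> i" "i \<le> j" "j \<le> n"
  obtains D F where "chain_shape T i j = normal_shape F" "skew_filling D {} {} F" "card D = Suc j - i"
    "ran F = {1..Suc j - i}"
    "\<And>v. 1 \<le> v \<Longrightarrow> v < Suc j - i \<Longrightarrow> filling_ascent F v \<longleftrightarrow> ascent T (v + (i - 1))"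
    "\<And>r c v. F (r, c) = Some v \<Longrightarrow> c \<le> entry_col T (v + (i - 1))"
proof -
  let ?F0 = "skew_part T i j" and ?I = "inner_cells T i"
  note sk0 = skew_filling_skew_part[OF T ij(1,2)]
  define F where "F = (SOME F. rectifies ?I ?F0 F)"
  have "rectifies ?I ?F0 F" unfolding F_def using someI_ex[OF rectifies_exists[OF sk0]] .
  then obtain D where sk: "skew_filling D {} {} F" and sl: "slid ?F0 F"
    using rectifies_skew_filling[OF _ sk0] by blast
  have inj: "injective_filling F" and dom: "dom F = D" and fin: "finite D" using sk by (simp_all add: skew_filling_def)
  \<comment> \<open>The window is renumbered from 1, so \<open>v\<close> stands for the entry
    \<open>v + (i - 1)\<close> of \<open>T\<close>.\<close>
  have F0: "?F0 (r, c) = Some v \<longleftrightarrow> v \<in> {1..Suc j - i} \<and> entry_pos T (v + (i - 1)) = (r, c)" for r c v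
  proof
    assume "?F0 (r, c) = Some v"
    then have h: "(r, c) \<in> cells T" "i \<le> T ! r ! c" "T ! r ! c \<le> j" "v = T ! r ! c - (i - 1)"
      by (simp_all add: skew_part_eq)
    then have "T ! r ! c = v + (i - 1)" using ij by linarith
    then show "v \<in> {1..Suc j - i} \<and> entry_pos T (v + (i - 1)) = (r, c)"
      using entry_pos_eq[OF T h(1)] h ij by auto
  next
    assume h: "v \<in> {1..Suc j - i} \<and> entry_pos T (v + (i - 1)) = (r, c)"
    then have "v + (i - 1) \<in> {1..n}" using ij by auto
    then show "?F0 (r, c) = Some v"
      using entry_pos_cell[OF T, of "v + (i - 1)"] h ij by (auto simp: skew_part_eq)
  qed
  have ran0: "ran ?F0 = {1..Suc j - i}"
  proof
    show "ran ?F0 \<subseteq> {1..Suc j - i}" using F0 by (auto simp: ran_def simp del: atLeastAtMost_iff)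
    show "{1..Suc j - i} \<subseteq> ran ?F0"
      using F0 ranI by (metis prod.collapse subsetI)
  qed
  then have ran: "ran F = {1..Suc j - i}" using sl by (simp add: slid_def)
  have "bij_betw (\<lambda>p. the (F p)) D (ran F)"
    unfolding bij_betw_def
  proof
    show "inj_on (\<lambda>p. the (F p)) D"
    proof (rule inj_onI)
      fix p q assume "p \<in> D" "q \<in> D" "the (F p) = the (F q)"
      moreover from this obtain x where "F p = Some x" using dom by blast
      moreover obtain y where "F q = Some y" using dom calculation(2) by blast
      ultimately show "p = q" using injective_fillingD[OF inj] by simp
    qed
    show "(\<lambda>p. the (F p)) ` D = ran F" unfolding dom[symmetric] by (force simp: ran_def dom_def)
  qed
  then have card: "card D = Suc j - i" using ran bij_betw_same_card by fastforce
  have row: "in_row ?F0 v r \<longleftrightarrow> r = entry_row T (v + (i - 1))" if "v \<in> {1..Suc j - i}" for v r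
    unfolding in_row_def F0 using that by (auto simp: prod_eq_iff)
  have asc: "filling_ascent F v \<longleftrightarrow> ascent T (v + (i - 1))" if v: "1 \<le> v" "v < Suc j - i" for v
  proof -
    have "filling_ascent F v \<longleftrightarrow> filling_ascent ?F0 v" using sl by (simp add: slid_def)
    also have "\<dots> \<longleftrightarrow> entry_row T (Suc (v + (i - 1))) \<le> entry_row T (v + (i - 1))"
      using row[of v] row[of "Suc v"] v by (auto simp: filling_ascent_def)
    also have "\<dots> \<longleftrightarrow> ascent T (v + (i - 1))"
    proof (rule ascent_iff_row[OF T, symmetric])
      show "v + (i - 1) \<in> {1..<n}" unfolding atLeastLessThan_iff using v ij by linarith
    qed
    finally show ?thesis .
  qed
  have col: "c \<le> entry_col T (v + (i - 1))" if Fv: "F (r, c) = Some v" for r c v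
  proof -
    have "v \<in> {1..Suc j - i}" using ranI[where m=F, OF Fv] unfolding ran .
    then have "?F0 (entry_pos T (v + (i - 1))) = Some v" using F0 by (metis prod.collapse)
    then obtain r' c' where "F (r', c') = Some v" "c' \<le> entry_col T (v + (i - 1))"
      using sl unfolding slid_def by (metis prod.collapse)
    then show ?thesis using injective_fillingD[OF inj Fv] by blast
  qed
  have "chain_shape T i j = normal_shape F" by (simp add: chain_shape_def F_def)
  then show thesis using that sk card ran asc col by blast
qed

text \<open>\<open>R\<close> consists of \<open>k\<close> elements with the largest values of
  \<open>f\<close>, or of everything if there are fewer. Adding a maximal remaining element keeps
  the count right for all thresholds \<open>c\<close> simultaneously.\<close>

lemma top_subset_exists:
  fixes f :: "'a \<Rightarrow> nat"
  assumes "finite B"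
  shows "\<exists>R\<subseteq>B. card R \<le> k \<and> (\<forall>c. card {b \<in> R. c < f b} = min k (card {b \<in> B. c < f b}))"
proof (induction k)
  case 0
  show ?case by (rule exI[of _ "{}"]) auto
next
  case (Suc k)
  then obtain R where R: "R \<subseteq> B" "card R \<le> k" "\<And>c. card {b \<in> R. c < f b} = min k (card {b \<in> B. c < f b})"
    by blast
  have finR: "finite R" using R(1) assms finite_subset by blast
  show ?case
  proof (cases "R = B")
    case True
    have "card {b \<in> B. c < f b} \<le> k" for c using R(3)[of c] True by simp
    then have "card {b \<in> B. c < f b} = min (Suc k) (card {b \<in> B. c < f b})" for c
      by (intro min_absorb2[symmetric] le_SucI)
    then show ?thesis using R True by (intro exI[of _ B]) auto
  next
    case False
    obtain b where b: "b \<in> B - R" and max: "\<forall>b'\<in>B - R. f b' \<le> f b"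
      using finite_has_max[of "B - R" f] assms R(1) False by blast
    have "card {x \<in> insert b R. c < f x} = min (Suc k) (card {b \<in> B. c < f b})" for c
    proof (cases "c < f b")
      case True
      have "k < card {b \<in> B. c < f b}"
      proof (rule ccontr)
        assume "\<not> ?thesis"
        then have "card {x \<in> R. c < f x} = card {b \<in> B. c < f b}" using R(3)[of c] by simp
        then have "{x \<in> R. c < f x} = {b \<in> B. c < f b}"
          using R(1) assms by (intro card_subset_eq) auto
        then show False using b True by blast
      qed
      moreover have "{x \<in> insert b R. c < f x} = insert b {x \<in> R. c < f x}" using True by auto
      ultimately show ?thesis using R(3)[of c] b finR by simp
    next
      case False
      then have "{b \<in> B. c < f b} = {x \<in> R. c < f x}" using max R(1) b by force
      moreover have "{x \<in> insert b R. c < f x} = {x \<in> R. c < f x}" using False by auto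
      ultimately show ?thesis using R(3)[of c] by simp
    qed
    moreover have "card (insert b R) \<le> Suc k" using R(2) b finR by simp
    moreover have "insert b R \<subseteq> B" using R(1) b by blast
    ultimately show ?thesis by blast
  qed
qed

text \<open>If \<open>\<beta>\<close> sorts the entries into classes that meet every column at most once, any \<open>k\<close> classes fit
  into the first \<open>k\<close> rows.\<close>

lemma strips_bound:
  assumes sk: "skew_filling D {} {} F" and R: "finite R" "card R \<le> k"
    and strip: "\<And>v v'. v \<in> ran F \<Longrightarrow> v' \<in> ran F \<Longrightarrow> v < v' \<Longrightarrow> \<beta> v = \<beta> v' \<Longrightarrow> filling_col F v < filling_col F v'"
  shows "card {v \<in> ran F. \<beta> v \<in> R} \<le> card {p \<in> D. fst p < k}"
proof -
  have inj: "injective_filling F" and dom: "dom F = D" and D: "finite D" "down_closed D"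
    using sk by (simp_all add: skew_filling_def)
  let ?X = "{p \<in> D. \<beta> (the (F p)) \<in> R}"
  have val: "\<exists>v. F p = Some v" if "p \<in> D" for p using that dom by blast
  have "{v \<in> ran F. \<beta> v \<in> R} \<subseteq> (\<lambda>p. the (F p)) ` ?X"
  proof
    fix v assume v: "v \<in> {v \<in> ran F. \<beta> v \<in> R}"
    then obtain p where p: "F p = Some v" by (auto simp: ran_def)
    then have "p \<in> ?X" using v dom by auto
    then show "v \<in> (\<lambda>p. the (F p)) ` ?X" using p by force
  qed
  then have "card {v \<in> ran F. \<beta> v \<in> R} \<le> card ?X" using D(1) by (intro surj_card_le) auto
  also have "\<dots> \<le> card {p \<in> D. fst p < k}"
  proof (rule column_bound[OF D])
    fix c
    have "inj_on (\<lambda>p. \<beta> (the (F p))) {p \<in> ?X. snd p = c}"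
    proof (rule inj_onI, rule ccontr)
      fix p q assume h: "p \<in> {p \<in> ?X. snd p = c}" "q \<in> {p \<in> ?X. snd p = c}"
        "\<beta> (the (F p)) = \<beta> (the (F q))" "p \<noteq> q"
      obtain v w where vw: "F p = Some v" "F q = Some w" using val h by blast
      have cols: "filling_col F v = c" "filling_col F w = c"
        using filling_col_eq[OF inj, of "fst p" "snd p" v] filling_col_eq[OF inj, of "fst q" "snd q" w] vw h by auto
      have "v \<noteq> w" using injective_fillingD[OF inj vw(1), of q] vw(2) h(4) by blast
      then consider "v < w" | "w < v" by linarith
      then show False
        using strip[OF ranI[where m=F, OF vw(1)] ranI[where m=F, OF vw(2)]]
          strip[OF ranI[where m=F, OF vw(2)] ranI[where m=F, OF vw(1)]] cols h(3) vw by cases simp_all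
    qed
    then have "card {p \<in> ?X. snd p = c} \<le> card R"
      using R(1) by (intro card_inj_on_le) auto
    then show "card {p \<in> ?X. snd p = c} \<le> k" using R(2) by simp
  qed auto
  finally show ?thesis .
qed

text \<open>A class consists of the entries of one row of \<open>row_canonical mu\<close> that lie
  in the window. If it is the first class, which the window may cut on the left, its entries cannot
  have anything below them, since that would be a smaller entry of the same class in the same
  column; so they lie in the bottom row, with only members of the class to their left. Any later
  class starts inside the window, and an entry in column \<open>q\<close> of
  \<open>row_canonical mu\<close> then has \<open>q\<close> predecessors in its class; rectification
  does not move it to the right.\<close>

lemma row_canonical_chain_column:
  assumes mu: "is_partition n mu" and ij: "1 \<le> i" "i \<le> j" "j \<le> n"
    and sk: "skew_filling D {} {} F" and ran: "ran F = {1..Suc j - i}"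
    and strip: "\<And>v v'. v \<in> ran F \<Longrightarrow> v' \<in> ran F \<Longrightarrow> v < v' \<Longrightarrow> \<beta> v = \<beta> v' \<Longrightarrow> filling_col F v < filling_col F v'"
    and col: "\<And>r c v. F (r, c) = Some v \<Longrightarrow> c \<le> entry_col (row_canonical mu) (v + (i - 1))"
    and F: "F (r, c) = Some v" and \<beta>_def: "\<And>v. \<beta> v = entry_row (row_canonical mu) (v + (i - 1))"
  shows "c < card {v' \<in> {1..Suc j - i}. \<beta> v' = \<beta> v}"
proof -
  let ?C = "row_canonical mu" and ?S = "{v' \<in> {1..Suc j - i}. \<beta> v' = \<beta> v}"
  have incr: "increasing_filling F" and inj: "injective_filling F" and dom: "dom F = D"
    and dc: "down_closed D" using sk by (simp_all add: skew_filling_def)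
  have v: "v \<in> {1..Suc j - i}" using ranI[where m=F, OF F] ran by simp
  have mono: "\<beta> a \<le> \<beta> b" if "a \<in> {1..Suc j - i}" "b \<in> {1..Suc j - i}" "a \<le> b" for a b
    unfolding \<beta>_def using that ij by (intro row_canonical_row_mono[OF mu]) auto
  have one: "1 \<in> {1..Suc j - i}" using ij by simp
  show ?thesis
  proof (cases "\<beta> v = \<beta> 1")
    case True
    have r0: "r = 0"
    proof (rule ccontr)
      assume "r \<noteq> 0"
      have "(r, c) \<in> D" using F dom by blast
      then have "(r - 1, c) \<in> dom F" using down_closedD[OF dc, of r c "r - 1" c] dom by simp
      then obtain u where u: "F (r - 1, c) = Some u" by blast
      have uv: "u < v" using increasing_fillingD[OF incr u F] \<open>r \<noteq> 0\<close> by simp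
      have ur: "u \<in> {1..Suc j - i}" using ranI[where m=F, OF u] ran by simp
      have "\<beta> u = \<beta> v" using mono[OF one ur] mono[OF ur v] uv ur True by auto
      then have "filling_col F u < filling_col F v" using strip[of u v] ur v uv ran by simp
      then show False using filling_col_eq[OF inj u] filling_col_eq[OF inj F] by simp
    qed
    have "\<exists>w. F (0, a) = Some w \<and> w \<in> ?S" if "a \<le> c" for a
    proof -
      have "(0, a) \<in> dom F" using down_closedD[OF dc, of r c 0 a] F dom that by blast
      then obtain w where w: "F (0, a) = Some w" by blast
      have wr: "w \<in> {1..Suc j - i}" using ranI[where m=F, OF w] ran by simp
      have "w \<le> v" using increasing_fillingD[OF incr w F] that r0 w F by (cases "a = c") auto
      then have "\<beta> w = \<beta> v" using mono[OF one wr] mono[OF wr v] wr True by auto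
      then show ?thesis using w wr by blast
    qed
    then obtain g where g: "\<And>a. a \<le> c \<Longrightarrow> F (0, a) = Some (g a) \<and> g a \<in> ?S" by metis
    have "inj_on g {..c}"
    proof (rule inj_onI)
      fix a b assume "a \<in> {..c}" "b \<in> {..c}" "g a = g b"
      then have "F (0, a) = Some (g a)" "F (0, b) = Some (g a)" using g by auto
      then show "a = b" using injective_fillingD[OF inj] by blast
    qed
    then have "card {..c} \<le> card ?S" using g by (intro card_inj_on_le) auto
    then show ?thesis by simp
  next
    case False
    have mem: "v + (i - 1) \<in> {1..n}" "i \<in> {1..n}" using v ij unfolding atLeastAtMost_iff by linarith+
    obtain b q where bq: "b < length mu" "q < mu ! b" "v + (i - 1) = Suc (offset mu b + q)"
      "entry_pos ?C (v + (i - 1)) = (b, q)"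
      by (rule row_canonical_posE[OF mu mem(1)])
    obtain b0 q0 where bq0: "b0 < length mu" "q0 < mu ! b0" "i = Suc (offset mu b0 + q0)"
      "entry_pos ?C i = (b0, q0)"
      by (rule row_canonical_posE[OF mu mem(2)])
    have "\<beta> 1 < \<beta> v" using mono[OF one v] v False by auto
    then have "b0 < b" using bq bq0 ij by (simp add: \<beta>_def)
    then have "offset mu (Suc b0) \<le> offset mu b" by (intro offset_mono) simp
    then have ge: "i \<le> offset mu b" using bq0 by (simp add: offset_Suc)
    let ?g = "\<lambda>a. Suc (offset mu b + a) - (i - 1)"
    have "?g ` {..q} \<subseteq> ?S"
    proof
      fix w assume "w \<in> ?g ` {..q}"
      then obtain a where a: "a \<le> q" "w = ?g a" by auto
      then have wi: "w + (i - 1) = Suc (offset mu b + a)" using ge by simp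
      have "entry_pos ?C (Suc (offset mu b + a)) = (b, a)" using row_canonical_pos[OF mu bq(1)] a bq(2) by simp
      then have "\<beta> w = \<beta> v" using bq(4) wi by (simp add: \<beta>_def)
      moreover have "w \<le> v" "1 \<le> w" using wi bq(3) a ge ij by linarith+
      ultimately show "w \<in> ?S" using v by auto
    qed
    moreover have "inj_on ?g {..q}" using ge by (auto simp: inj_on_def)
    ultimately have "card {..q} \<le> card ?S" by (intro card_inj_on_le[of ?g]) auto
    moreover have "c \<le> q" using col[OF F] bq(4) by simp
    ultimately show ?thesis by simp
  qed
qed

lemma sum_card_fibres:
  assumes "finite R" "finite V"
  shows "card {v \<in> V. \<beta> v \<in> R} = (\<Sum>b\<in>R. card {v \<in> V. \<beta> v = b})"
proof -
  have "{v \<in> V. \<beta> v \<in> R} = (\<Union>b\<in>R. {v \<in> V. \<beta> v = b})" by auto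
  then have "card {v \<in> V. \<beta> v \<in> R} = card (\<Union>b\<in>R. {v \<in> V. \<beta> v = b})" by simp
  also have "\<dots> = (\<Sum>b\<in>R. card {v \<in> V. \<beta> v = b})" by (rule card_UN_disjoint) (use assms in auto)
  finally show ?thesis .
qed

text \<open>Summing a partition through its conjugate.\<close>

lemma sum_eq_sum_card_greater:
  fixes f :: "'a \<Rightarrow> nat"
  assumes "finite R" "\<And>b. b \<in> R \<Longrightarrow> f b \<le> m"
  shows "(\<Sum>b\<in>R. f b) = (\<Sum>c<m. card {b \<in> R. c < f b})"
proof -
  have "(\<Sum>b\<in>R. f b) = (\<Sum>b\<in>R. \<Sum>c<m. if c < f b then 1 else 0)"
  proof (rule sum.cong)
    fix b assume "b \<in> R"
    then have "{c \<in> {..<m}. c < f b} = {..<f b}" using assms(2)[of b] by auto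
    then show "f b = (\<Sum>c<m. if c < f b then 1 else 0)" by (simp add: sum.If_cases Int_def)
  qed simp
  also have "\<dots> = (\<Sum>c<m. card {b \<in> R. c < f b})"
    by (subst sum.swap) (simp add: sum.If_cases assms(1) Int_def)
  finally show ?thesis .
qed

text \<open>The rows of \<open>row_canonical mu\<close>, cut to the window, sort the entries into
  classes of sizes \<nu>. Compatibility makes these classes strips in the rectification
  \<open>F\<close> of \<open>S\<close> as well as in the rectification \<open>G\<close> of
  \<open>row_canonical mu\<close>. The sum of the \<open>k\<close> largest values of \<nu> is at
  least the size of the first \<open>k\<close> rows of \<open>G\<close> and at most that of
  \<open>F\<close>.\<close>

lemma chain_shape_compat_dominates:
  assumes mu: "is_partition n mu" and S: "S \<in> compat_tableaux n mu" and ij: "1 \<le> i" "i \<le> j" "j \<le> n"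
  shows "dom_ge (chain_shape S i j) (chain_shape (row_canonical mu) i j)"
proof -
  let ?C = "row_canonical mu"
  define m where "m = Suc j - i"
  define \<beta> where "\<beta> v = entry_row ?C (v + (i - 1))" for v
  have SY: "S \<in> YT n" using S by (simp add: compat_tableaux_def)
  note CY = row_canonical_YT[OF mu]
  obtain D F where DF: "chain_shape S i j = normal_shape F" "skew_filling D {} {} F" "card D = m" "ran F = {1..m}"
    and ascF: "\<And>v. 1 \<le> v \<Longrightarrow> v < m \<Longrightarrow> filling_ascent F v \<longleftrightarrow> ascent S (v + (i - 1))"
    unfolding m_def using chain_shape_filling[OF SY ij] by metis
  obtain E G where EG: "chain_shape ?C i j = normal_shape G" "skew_filling E {} {} G" "card E = m" "ran G = {1..m}"
    and ascG: "\<And>v. 1 \<le> v \<Longrightarrow> v < m \<Longrightarrow> filling_ascent G v \<longleftrightarrow> ascent ?C (v + (i - 1))"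
    and colG: "\<And>r c v. G (r, c) = Some v \<Longrightarrow> c \<le> entry_col ?C (v + (i - 1))"
    unfolding m_def using chain_shape_filling[OF CY ij] by metis
  have block: "ascent ?C (u + (i - 1))"
    if "v \<in> {1..m}" "v' \<in> {1..m}" "\<beta> v = \<beta> v'" "v \<le> u" "u < v'" for v v' u
    by (rule row_canonical_ascent[OF mu, of "v + (i - 1)" "v' + (i - 1)"])
      (use that ij in \<open>auto simp: m_def \<beta>_def\<close>)
  have stripG: "filling_col G v < filling_col G v'"
    if "v \<in> ran G" "v' \<in> ran G" "v < v'" "\<beta> v = \<beta> v'" for v v'
  proof (rule less_chain[OF _ that(3)])
    fix u assume "v \<le> u" "u < v'"
    then have "filling_ascent G u" using that block[of v v' u] ascG[of u] unfolding EG(4) by auto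
    then show "filling_col G u < filling_col G (Suc u)" by (rule filling_ascent_col_less[OF EG(2)])
  qed
  have stripF: "filling_col F v < filling_col F v'"
    if "v \<in> ran F" "v' \<in> ran F" "v < v'" "\<beta> v = \<beta> v'" for v v'
  proof (rule less_chain[OF _ that(3)])
    fix u assume u: "v \<le> u" "u < v'"
    then have "ascent ?C (u + (i - 1))" using that block[of v v' u] unfolding DF(4) by auto
    moreover have "u + (i - 1) \<in> {1..<n}" using u that ij unfolding DF(4) m_def by auto
    ultimately have "ascent S (u + (i - 1))" using S by (auto simp: compat_tableaux_def)
    then have "filling_ascent F u" using u that ascF[of u] unfolding DF(4) by auto
    then show "filling_col F u < filling_col F (Suc u)" by (rule filling_ascent_col_less[OF DF(2)])
  qed
  let ?B = "\<beta> ` {1..m}"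
  define \<nu> where "\<nu> b = card {v \<in> {1..m}. \<beta> v = b}" for b
  have colE: "c < \<nu> (\<beta> v)" if "G (r, c) = Some v" for r c v
    unfolding \<nu>_def m_def
    by (rule row_canonical_chain_column[OF mu ij EG(2) EG(4)[unfolded m_def] stripG colG that \<beta>_def])
  have \<nu>_le: "\<nu> b \<le> m" for b
  proof -
    have "\<nu> b \<le> card {1..m}" unfolding \<nu>_def by (rule card_mono) auto
    then show ?thesis by simp
  qed
  show ?thesis
    unfolding dom_ge_def DF(1) EG(1)
  proof (intro allI impI, elim conjE)
    fix k assume k: "k \<le> min (length (normal_shape F)) (length (normal_shape G))"
    obtain R where R: "R \<subseteq> ?B" "card R \<le> k" "\<And>c. card {b \<in> R. c < \<nu> b} = min k (card {b \<in> ?B. c < \<nu> b})"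
      using top_subset_exists[of ?B k \<nu>] by auto
    have finR: "finite R" using R(1) finite_subset by blast
    have inj: "injective_filling G" and domG: "dom G = E" and E: "finite E"
      using EG(2) by (simp_all add: skew_filling_def)
    have "sum_list (take k (normal_shape G)) = card {p \<in> E. fst p < k}"
      using sum_list_take_normal_shape[OF EG(2)] k by simp
    also have "\<dots> = (\<Sum>c<m. card {p \<in> {p \<in> E. fst p < k}. snd p = c})"
    proof (rule card_by_columns)
      show "snd ` {p \<in> E. fst p < k} \<subseteq> {..<m}"
      proof clarsimp
        fix r c assume "(r, c) \<in> E"
        then obtain v where "G (r, c) = Some v" using domG by blast
        then show "c < m" using colE \<nu>_le by (meson less_le_trans)
      qed
    qed (use E in auto)
    \<comment> \<open>The cells of column \<open>c\<close> in the first \<open>k\<close> rows number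
      at most \<open>k\<close>, and their entries belong to different classes, each having more than
      \<open>c\<close> elements.\<close>
    also have "\<dots> \<le> (\<Sum>c<m. min k (card {b \<in> ?B. c < \<nu> b}))"
    proof (rule sum_mono)
      fix c
      let ?P = "{p \<in> {p \<in> E. fst p < k}. snd p = c}"
      have "card ?P \<le> card {..<k}" by (rule card_inj_on_le[of fst]) (auto simp: inj_on_def)
      moreover have "card ?P \<le> card {b \<in> ?B. c < \<nu> b}"
      proof (rule card_inj_on_le[of "\<lambda>p. \<beta> (the (G p))"])
        show "inj_on (\<lambda>p. \<beta> (the (G p))) ?P"
        proof (rule inj_onI, rule ccontr)
          fix p q assume h: "p \<in> ?P" "q \<in> ?P" "\<beta> (the (G p)) = \<beta> (the (G q))" "p \<noteq> q"
          then have "p \<in> dom G" "q \<in> dom G" using domG by auto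
          then obtain v w where vw: "G p = Some v" "G q = Some w" by blast
          have cols: "filling_col G v = c" "filling_col G w = c"
            using filling_col_eq[OF inj, of "fst p" "snd p" v] filling_col_eq[OF inj, of "fst q" "snd q" w] vw h by auto
          have "v \<noteq> w" using injective_fillingD[OF inj vw(1), of q] vw(2) h(4) by blast
          then consider "v < w" | "w < v" by linarith
          then show False
            using stripG[OF ranI[where m=G, OF vw(1)] ranI[where m=G, OF vw(2)]]
              stripG[OF ranI[where m=G, OF vw(2)] ranI[where m=G, OF vw(1)]] cols h(3) vw by cases simp_all
        qed
        show "(\<lambda>p. \<beta> (the (G p))) ` ?P \<subseteq> {b \<in> ?B. c < \<nu> b}"
        proof
          fix b assume "b \<in> (\<lambda>p. \<beta> (the (G p))) ` ?P"
          then obtain p where p: "p \<in> E" "snd p = c" "b = \<beta> (the (G p))" by auto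
          then obtain v where v: "G (fst p, c) = Some v" using domG by (metis domD prod.collapse)
          then have "b = \<beta> v" using p by (metis option.sel prod.collapse)
          moreover have "v \<in> {1..m}" using ranI[where m=G, OF v] unfolding EG(4) .
          ultimately show "b \<in> {b \<in> ?B. c < \<nu> b}" using colE[OF v] by blast
        qed
      qed simp
      ultimately show "card ?P \<le> min k (card {b \<in> ?B. c < \<nu> b})" by simp
    qed
    also have "\<dots> = (\<Sum>c<m. card {b \<in> R. c < \<nu> b})" using R(3) by simp
    also have "\<dots> = (\<Sum>b\<in>R. \<nu> b)" using sum_eq_sum_card_greater[OF finR, of \<nu> m] \<nu>_le by simp
    also have "\<dots> = card {v \<in> ran F. \<beta> v \<in> R}"
      unfolding DF(4) \<nu>_def by (rule sum_card_fibres[symmetric]) (use finR in auto)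
    also have "\<dots> \<le> card {p \<in> D. fst p < k}" by (rule strips_bound[OF DF(2) finR R(2) stripF])
    also have "\<dots> = sum_list (take k (normal_shape F))"
      using sum_list_take_normal_shape[OF DF(2)] k by simp
    finally show "sum_list (take k (normal_shape G)) \<le> sum_list (take k (normal_shape F))" .
  qed
qed

text \<open>All entries together form one strip, so the bound for strips applies with a single class
  and \<open>k = 1\<close>.\<close>

lemma all_ascents_first_row:
  assumes sk: "skew_filling D {} {} F" and ran: "ran F = {1..m}"
    and asc: "\<And>v. 1 \<le> v \<Longrightarrow> v < m \<Longrightarrow> filling_ascent F v"
  shows "m \<le> card {p \<in> D. fst p < 1}"
proof -
  have "filling_col F v < filling_col F v'" if "v \<in> ran F" "v' \<in> ran F" "v < v'" for v v'
    by (rule less_chain[OF _ that(3)])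
      (use that ran asc filling_ascent_col_less[OF sk] in auto)
  then have "card {v \<in> ran F. () \<in> {()}} \<le> card {p \<in> D. fst p < 1}"
    by (intro strips_bound[OF sk, of "{()}" 1 "\<lambda>_. ()"]) auto
  moreover have "{v \<in> ran F. () \<in> {()}} = {1..m}" unfolding ran by auto
  ultimately show ?thesis by (simp only: card_atLeastAtMost diff_Suc_1 One_nat_def)
qed

lemma length_normal_shape_pos:
  assumes sk: "skew_filling D {} {} F" and "D \<noteq> {}" shows "1 \<le> length (normal_shape F)"
proof -
  have dc: "down_closed D" and fin: "finite D" and dom: "dom F = D" using sk by (simp_all add: skew_filling_def)
  obtain r c where "(r, c) \<in> D" using assms(2) by auto
  then have "(0, 0) \<in> D" using down_closedD[OF dc] by blast
  moreover have "finite {r. (r, 0) \<in> D}" by (rule finite_subset[of _ "fst ` D"]) (use fin in force)+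
  ultimately have "0 < card {r. (r, 0) \<in> D}" by (auto simp: card_gt_0_iff)
  then show ?thesis by (simp add: normal_shape_def dom)
qed

lemma chain_le_one_row:
  assumes n: "n \<ge> 1" and T: "T \<in> YT n" shows "chain_le n (one_row n) T"
  unfolding chain_le_def
proof (intro conjI allI impI)
  show OY: "one_row n \<in> YT n" using one_row_in_compat[OF n] by (auto simp: compat_tableaux_def)
  show "T \<in> YT n" by (rule T)
  fix i j assume "1 \<le> i \<and> i \<le> j \<and> j \<le> n"
  then have ij: "1 \<le> i" "i \<le> j" "j \<le> n" by auto
  define m where "m = Suc j - i"
  obtain D F where DF: "chain_shape (one_row n) i j = normal_shape F" "skew_filling D {} {} F" "card D = m" "ran F = {1..m}"
    and ascF: "\<And>v. 1 \<le> v \<Longrightarrow> v < m \<Longrightarrow> filling_ascent F v \<longleftrightarrow> ascent (one_row n) (v + (i - 1))"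
    unfolding m_def using chain_shape_filling[OF OY ij] by metis
  obtain E G where EG: "chain_shape T i j = normal_shape G" "skew_filling E {} {} G" "card E = m"
    unfolding m_def using chain_shape_filling[OF T ij] by metis
  have "filling_ascent F v" if "1 \<le> v" "v < m" for v
  proof -
    have "v + (i - 1) \<in> {1..<n}" unfolding atLeastLessThan_iff using that ij unfolding m_def by linarith
    then show ?thesis using ascF[OF that] one_row_ascent[OF n] by blast
  qed
  then have row: "m \<le> card {p \<in> D. fst p < 1}" by (rule all_ascents_first_row[OF DF(2,4)])
  show "dom_ge (chain_shape (one_row n) i j) (chain_shape T i j)"
    unfolding dom_ge_def DF(1) EG(1)
  proof (intro allI impI, elim conjE)
    fix k assume k: "1 \<le> k" "k \<le> min (length (normal_shape F)) (length (normal_shape G))"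
    have "sum_list (take k (normal_shape G)) = card {p \<in> E. fst p < k}"
      using sum_list_take_normal_shape[OF EG(2)] k by simp
    also have "\<dots> \<le> card E" using EG(2) by (intro card_mono) (auto simp: skew_filling_def)
    also have "\<dots> \<le> card {p \<in> D. fst p < 1}" using EG(3) row by simp
    also have "\<dots> \<le> card {p \<in> D. fst p < k}" using DF(2) k by (intro card_mono) (auto simp: skew_filling_def)
    also have "\<dots> = sum_list (take k (normal_shape F))" using sum_list_take_normal_shape[OF DF(2)] k by simp
    finally show "sum_list (take k (normal_shape G)) \<le> sum_list (take k (normal_shape F))" .
  qed
qed

text \<open>The window \<open>[i, Suc i]\<close> has shape (2) if \<open>i\<close> is an ascent and
  (1,1) otherwise, and (1,1) does not dominate (2). As \<open>dom_ge\<close> only compares up to the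
  smaller number of parts, both shapes must be known to be non-empty.\<close>

lemma chain_le_ascent:
  assumes le: "chain_le n S T" and i: "i \<in> {1..<n}" and asc: "ascent T i"
  shows "ascent S i"
proof (rule ccontr)
  assume nasc: "\<not> ascent S i"
  have S: "S \<in> YT n" and T: "T \<in> YT n" using le by (simp_all add: chain_le_def)
  have ij: "1 \<le> i" "i \<le> Suc i" "Suc i \<le> n" using i by auto
  have m: "Suc (Suc i) - i = 2" by simp
  obtain D F where DF: "chain_shape S i (Suc i) = normal_shape F" "skew_filling D {} {} F" "card D = 2" "ran F = {1..2}"
    and ascF: "\<And>v. 1 \<le> v \<Longrightarrow> v < 2 \<Longrightarrow> filling_ascent F v \<longleftrightarrow> ascent S (v + (i - 1))"
    using chain_shape_filling[OF S ij] unfolding m by metis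
  obtain E G where EG: "chain_shape T i (Suc i) = normal_shape G" "skew_filling E {} {} G" "card E = 2" "ran G = {1..2}"
    and ascG: "\<And>v. 1 \<le> v \<Longrightarrow> v < 2 \<Longrightarrow> filling_ascent G v \<longleftrightarrow> ascent T (v + (i - 1))"
    using chain_shape_filling[OF T ij] unfolding m by metis
  have "filling_ascent G v" if "1 \<le> v" "v < 2" for v
  proof -
    have "v + (i - 1) = i" using that ij by simp
    then show ?thesis using ascG[OF that] asc by simp
  qed
  then have "2 \<le> card {p \<in> E. fst p < 1}" by (rule all_ascents_first_row[OF EG(2,4)])
  moreover have "D \<noteq> {}" "E \<noteq> {}" using DF(3) EG(3) by auto
  then have len: "1 \<le> length (normal_shape F)" "1 \<le> length (normal_shape G)"
    using length_normal_shape_pos[OF DF(2)] length_normal_shape_pos[OF EG(2)] by blast+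
  moreover have "dom_ge (normal_shape F) (normal_shape G)"
    using le ij unfolding chain_le_def DF(1)[symmetric] EG(1)[symmetric] by blast
  ultimately have "card D \<le> card {p \<in> D. fst p < 1}"
    using sum_list_take_normal_shape[OF DF(2) len(1)] sum_list_take_normal_shape[OF EG(2) len(2)] DF(3)
    unfolding dom_ge_def by (metis le_trans min.boundedI order_refl)
  moreover have "finite D" using DF(2) by (simp add: skew_filling_def)
  ultimately have "{p \<in> D. fst p < 1} = D" by (intro card_seteq) auto
  then have row: "fst p = 0" if "p \<in> D" for p using that by auto
  have dom: "dom F = D" using DF(2) by (simp add: skew_filling_def)
  have "1 \<in> ran F" "2 \<in> ran F" unfolding DF(4) by auto
  then obtain p q where pq: "F p = Some 1" "F q = Some 2" by (auto simp: ran_def)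
  then have "fst p = 0" "fst q = 0" using row dom by blast+
  then have "in_row F 1 0" "in_row F (Suc 1) 0" using pq by (auto simp: in_row_def numeral_2_eq_2) (metis prod.collapse)+
  then have "filling_ascent F 1" by (auto simp: filling_ascent_def)
  then show False using ascF[of 1] nasc ij by simp
qed

lemma interval_chain_le:
  assumes n: "n \<ge> 1" and mu: "is_partition n mu"
  shows "interval n (chain_le n) (one_row n) (row_canonical mu) = compat_tableaux n mu"
proof (intro equalityI subsetI)
  fix T assume "T \<in> interval n (chain_le n) (one_row n) (row_canonical mu)"
  then show "T \<in> compat_tableaux n mu"
    using chain_le_ascent unfolding interval_def compat_tableaux_def by blast
next
  fix T assume T: "T \<in> compat_tableaux n mu"
  then have TY: "T \<in> YT n" by (simp add: compat_tableaux_def)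
  have "chain_le n T (row_canonical mu)"
    using TY row_canonical_YT[OF mu] chain_shape_compat_dominates[OF mu T] by (simp add: chain_le_def)
  then show "T \<in> interval n (chain_le n) (one_row n) (row_canonical mu)"
    using TY chain_le_one_row[OF n TY] by (simp add: interval_def)
qed

section \<open>Jordan types of strictly upper triangular matrices\<close>

lemma jordan_matrix_diagonal:
  "jordan_matrix (map (\<lambda>a. (1, a)) as) = mat (length as) (length as) (\<lambda>(i, j). if i = j then as ! i else 0)"
proof (induction as)
  case Nil
  show ?case by (rule eq_matI) (simp_all add: jordan_matrix_def)
next
  case (Cons a as)
  have len: "sum_list (map fst (map (\<lambda>a. (1 :: nat, a)) as)) = length as" by (induction as) auto
  show ?case
    unfolding list.map jordan_matrix_Cons Cons.IH len
    by (rule eq_matI) (auto simp: four_block_mat_def Let_def jordan_block_def nth_Cons split: nat.split)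
qed

lemma mult_mat_vec_index_sum:
  "A \<in> carrier_mat a b \<Longrightarrow> v \<in> carrier_vec b \<Longrightarrow> i < a \<Longrightarrow> (A *\<^sub>v v) $ i = (\<Sum>j = 0..<b. A $$ (i, j) * v $ j)"
  by (simp add: scalar_prod_def)

definition kernel_leading :: "complex mat \<Rightarrow> nat \<Rightarrow> bool" where
  "kernel_leading A y \<longleftrightarrow> (\<exists>v\<in>carrier_vec (dim_col A). A *\<^sub>v v = 0\<^sub>v (dim_row A) \<and> v $ y \<noteq> 0 \<and>
     (\<forall>j < dim_col A. y < j \<longrightarrow> v $ j = 0))"

lemma unitriangular_inverse:
  fixes P :: "complex mat"
  assumes P: "P \<in> carrier_mat m m" "upper_triangular P" "\<And>i. i < m \<Longrightarrow> P $$ (i, i) \<noteq> 0"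
  obtains Q where "Q \<in> carrier_mat m m" "P * Q = 1\<^sub>m m" "Q * P = 1\<^sub>m m"
proof -
  have "det P \<noteq> 0"
    using upper_triangular_imp_det_eq_0_iff[OF P(1,2)] P(1,3) by (auto simp: diag_mat_def)
  then have "P \<in> Units (ring_mat TYPE(complex) m ())" by (rule det_non_zero_imp_unit[OF P(1)])
  then show thesis using that by (auto simp: Units_def ring_mat_def)
qed

text \<open>The dimension of a kernel is the number of positions at which a kernel vector can end. To see
  it, the kernel is written as that of a projection conjugated by a triangular matrix whose columns
  are kernel vectors, and the dimension of the latter is read off its Jordan form.\<close>

lemma kernel_dim_leading:
  fixes A :: "complex mat"
  assumes A: "A \<in> carrier_mat m m"
  shows "kernel_dim A = card {y. y < m \<and> kernel_leading A y}"
proof -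
  define v where "v y = (SOME v. v \<in> carrier_vec m \<and> A *\<^sub>v v = 0\<^sub>v m \<and> v $ y \<noteq> 0 \<and>
    (\<forall>j < m. y < j \<longrightarrow> v $ j = 0))" for y
  have v: "v y \<in> carrier_vec m" "A *\<^sub>v v y = 0\<^sub>v m" "v y $ y \<noteq> 0" "\<And>j. j < m \<Longrightarrow> y < j \<Longrightarrow> v y $ j = 0"
    if "kernel_leading A y" for y
  proof -
    have "\<exists>v. v \<in> carrier_vec m \<and> A *\<^sub>v v = 0\<^sub>v m \<and> v $ y \<noteq> 0 \<and> (\<forall>j < m. y < j \<longrightarrow> v $ j = 0)"
      using that A unfolding kernel_leading_def by auto
    from someI_ex[OF this] show "v y \<in> carrier_vec m" "A *\<^sub>v v y = 0\<^sub>v m" "v y $ y \<noteq> 0"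
      "\<And>j. j < m \<Longrightarrow> y < j \<Longrightarrow> v y $ j = 0" unfolding v_def by blast+
  qed
  \<comment> \<open>A triangular basis of the whole space: at each position a kernel vector ending
    there if there is one, and the unit vector otherwise.\<close>
  define P where "P = mat m m (\<lambda>(r, y). if kernel_leading A y then v y $ r else if r = y then 1 else 0)"
  define E where "E = mat m m (\<lambda>(r, y). if r = y \<and> \<not> kernel_leading A y then 1 else 0 :: complex)"
  have P: "P \<in> carrier_mat m m" and E: "E \<in> carrier_mat m m" by (simp_all add: P_def E_def)
  have "upper_triangular P" using v(4) by (intro upper_triangularI) (auto simp: P_def)
  moreover have "P $$ (i, i) \<noteq> 0" if "i < m" for i using that v(3) by (auto simp: P_def)
  ultimately obtain Q where Q: "Q \<in> carrier_mat m m" "P * Q = 1\<^sub>m m" "Q * P = 1\<^sub>m m"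
    using unitriangular_inverse[OF P] by blast
  define B where "B = P * E * Q"
  have B: "B \<in> carrier_mat m m" using P E Q(1) by (simp add: B_def)
  have kerB: "B *\<^sub>v w = 0\<^sub>v m \<longleftrightarrow> (\<forall>y<m. \<not> kernel_leading A y \<longrightarrow> (Q *\<^sub>v w) $ y = 0)"
    if w: "w \<in> carrier_vec m" for w
  proof -
    have Qw: "Q *\<^sub>v w \<in> carrier_vec m" using Q(1) w by simp
    have EQw: "E *\<^sub>v (Q *\<^sub>v w) \<in> carrier_vec m" using E Qw by simp
    have Bw: "B *\<^sub>v w = P *\<^sub>v (E *\<^sub>v (Q *\<^sub>v w))"
      unfolding B_def using assoc_mult_mat_vec[OF _ Q(1) w, of "P * E" m] assoc_mult_mat_vec[OF P E Qw] P E by simp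
    have "B *\<^sub>v w = 0\<^sub>v m \<longleftrightarrow> E *\<^sub>v (Q *\<^sub>v w) = 0\<^sub>v m"
    proof
      assume "B *\<^sub>v w = 0\<^sub>v m"
      then have "Q *\<^sub>v (P *\<^sub>v (E *\<^sub>v (Q *\<^sub>v w))) = 0\<^sub>v m"
        unfolding Bw using Q(1) by (auto intro!: eq_vecI simp: scalar_prod_def)
      then show "E *\<^sub>v (Q *\<^sub>v w) = 0\<^sub>v m"
        unfolding assoc_mult_mat_vec[OF Q(1) P EQw, symmetric] Q(3) using EQw by simp
    qed (use P Bw in \<open>auto intro!: eq_vecI simp: scalar_prod_def\<close>)
    also have "\<dots> \<longleftrightarrow> (\<forall>y<m. \<not> kernel_leading A y \<longrightarrow> (Q *\<^sub>v w) $ y = 0)"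
    proof -
      have "(E *\<^sub>v (Q *\<^sub>v w)) $ y = (if kernel_leading A y then 0 else (Q *\<^sub>v w) $ y)" if y: "y < m" for y
      proof -
        have "(E *\<^sub>v (Q *\<^sub>v w)) $ y = (\<Sum>j = 0..<m. E $$ (y, j) * (Q *\<^sub>v w) $ j)"
          by (rule mult_mat_vec_index_sum[OF E Qw y])
        also have "\<dots> = (\<Sum>j = 0..<m. if j = y then (if kernel_leading A y then 0 else (Q *\<^sub>v w) $ y) else 0)"
          by (rule sum.cong) (use y in \<open>auto simp: E_def\<close>)
        finally show ?thesis using y by simp
      qed
      then show ?thesis using EQw E by (auto simp: vec_eq_iff)
    qed
    finally show ?thesis .
  qed
  have PQ: "P *\<^sub>v (Q *\<^sub>v w) = w" if "w \<in> carrier_vec m" for w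
    using assoc_mult_mat_vec[OF P Q(1) that] Q(2) that by simp
  have AP: "(A * P) $$ (r, y) = 0" if "r < m" "y < m" "kernel_leading A y" for r y
  proof -
    have "col P y = v y" using that v(1)[OF that(3)] by (intro eq_vecI) (simp_all add: P_def)
    then have "(A * P) $$ (r, y) = (A *\<^sub>v v y) $ r" using that A P by simp
    then show ?thesis using v(2)[OF that(3)] that by simp
  qed
  have APu: "A *\<^sub>v (P *\<^sub>v u) = A *\<^sub>v (P *\<^sub>v u')"
    if u: "u \<in> carrier_vec m" "u' \<in> carrier_vec m" and eq: "\<And>y. y < m \<Longrightarrow> \<not> kernel_leading A y \<Longrightarrow> u $ y = u' $ y"
    for u u'
  proof -
    have "(A * P) *\<^sub>v u = (A * P) *\<^sub>v u'"
    proof (rule eq_vecI)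
      fix r assume "r < dim_vec ((A * P) *\<^sub>v u')"
      then have r: "r < m" using A by simp
      have "((A * P) *\<^sub>v z) $ r = (\<Sum>y = 0..<m. (A * P) $$ (r, y) * z $ y)" if "z \<in> carrier_vec m" for z
        by (rule mult_mat_vec_index_sum[OF mult_carrier_mat[OF A P] that r])
      moreover have "(\<Sum>y = 0..<m. (A * P) $$ (r, y) * u $ y) = (\<Sum>y = 0..<m. (A * P) $$ (r, y) * u' $ y)"
      proof (rule sum.cong)
        fix y assume "y \<in> {0..<m}"
        then show "(A * P) $$ (r, y) * u $ y = (A * P) $$ (r, y) * u' $ y"
          using AP[OF r, of y] eq[of y] by (cases "kernel_leading A y") (auto simp del: index_mult_mat(1))
      qed simp
      ultimately show "((A * P) *\<^sub>v u) $ r = ((A * P) *\<^sub>v u') $ r" using u by simp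
    qed (use A in simp)
    then show ?thesis using assoc_mult_mat_vec[OF A P] u by simp
  qed
  have ker: "A *\<^sub>v w = 0\<^sub>v m \<longleftrightarrow> B *\<^sub>v w = 0\<^sub>v m" if w: "w \<in> carrier_vec m" for w
  proof
    have Qw: "Q *\<^sub>v w \<in> carrier_vec m" using Q(1) w by simp
    {
      assume "B *\<^sub>v w = 0\<^sub>v m"
      then have "\<forall>y<m. \<not> kernel_leading A y \<longrightarrow> (Q *\<^sub>v w) $ y = 0" using kerB[OF w] by blast
      then have "A *\<^sub>v (P *\<^sub>v (Q *\<^sub>v w)) = A *\<^sub>v (P *\<^sub>v 0\<^sub>v m)" by (intro APu[OF Qw]) auto
      moreover have "P *\<^sub>v 0\<^sub>v m = 0\<^sub>v m" "A *\<^sub>v 0\<^sub>v m = 0\<^sub>v m" using P A by (auto intro!: eq_vecI simp: scalar_prod_def)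
      ultimately show "A *\<^sub>v w = 0\<^sub>v m" unfolding PQ[OF w] by simp
    next
      assume Aw: "A *\<^sub>v w = 0\<^sub>v m"
      \<comment> \<open>Dropping the coordinates at leading positions does not change the image
        under \<open>A * P\<close>, and \<open>P\<close> fixes what is left. Hence \<open>u\<close>
        is itself a kernel vector; its last non-zero position would be a leading one, where
        \<open>u\<close> is zero by construction, so \<open>u = 0\<close>.\<close>
      define u where "u = vec m (\<lambda>y. if kernel_leading A y then 0 else (Q *\<^sub>v w) $ y)"
      have u: "u \<in> carrier_vec m" by (simp add: u_def)
      have "A *\<^sub>v (P *\<^sub>v u) = A *\<^sub>v (P *\<^sub>v (Q *\<^sub>v w))" by (rule APu[OF u Qw]) (simp add: u_def)
      moreover have "P *\<^sub>v u = u"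
      proof (rule eq_vecI)
        fix r assume "r < dim_vec u"
        then have r: "r < m" using u by simp
        have "(P *\<^sub>v u) $ r = (\<Sum>y = 0..<m. P $$ (r, y) * u $ y)"
          by (rule mult_mat_vec_index_sum[OF P u r])
        also have "\<dots> = (\<Sum>y = 0..<m. if y = r then u $ r else 0)"
          by (rule sum.cong) (use r in \<open>auto simp: P_def u_def\<close>)
        finally show "(P *\<^sub>v u) $ r = u $ r" using r by simp
      qed (use P u in simp)
      ultimately have Au: "A *\<^sub>v u = 0\<^sub>v m" using Aw PQ[OF w] by simp
      have u0: "u $ y = 0" if "y < m" for y
      proof (rule ccontr)
        assume nz: "u $ y \<noteq> 0"
        define z where "z = Max {z. z < m \<and> u $ z \<noteq> 0}"
        have fin: "finite {z. z < m \<and> u $ z \<noteq> 0}" by simp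
        have "z \<in> {z. z < m \<and> u $ z \<noteq> 0}" unfolding z_def using that nz by (intro Max_in[OF fin]) auto
        then have z: "z < m" "u $ z \<noteq> 0" by auto
        have "u $ j = 0" if "j < m" "z < j" for j
          using Max_ge[OF fin, of j] that unfolding z_def[symmetric] by force
        then have "kernel_leading A z"
          unfolding kernel_leading_def using A u Au z by (intro bexI[of _ u]) auto
        then show False using z by (simp add: u_def)
      qed
      have "(Q *\<^sub>v w) $ y = 0" if "y < m" "\<not> kernel_leading A y" for y
        using u0[OF that(1)] that unfolding u_def by (simp split: if_splits)
      then have "\<forall>y<m. \<not> kernel_leading A y \<longrightarrow> (Q *\<^sub>v w) $ y = 0" by blast
      then show "B *\<^sub>v w = 0\<^sub>v m" using kerB[OF w] by blast
    }
  qed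
  have "mat_kernel A = mat_kernel B" unfolding mat_kernel[OF A] mat_kernel[OF B] using ker by blast
  then have "kernel_dim A = kernel_dim B" unfolding kernel_dim_def using A B by simp
  also have "\<dots> = dim_gen_eigenspace B 0 1"
  proof -
    have "char_matrix B 0 = B" using B by (intro eq_matI) (auto simp: char_matrix_def)
    then show ?thesis using B by (simp add: dim_gen_eigenspace_def)
  qed
  also have "\<dots> = dim_gen_eigenspace E 0 1"
  proof -
    have "similar_mat_wit B E P Q"
      by (rule similar_mat_witI[OF Q(2,3) B_def B E P Q(1)])
    then show ?thesis using dim_gen_eigenspace_similar[of B E] unfolding similar_mat_def by metis
  qed
  also have "\<dots> = card {y. y < m \<and> kernel_leading A y}"
  proof -
    define as where "as = map (\<lambda>y. if kernel_leading A y then 0 else 1 :: complex) [0..<m]"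
    have "E = jordan_matrix (map (\<lambda>a. (1, a)) as)"
      unfolding jordan_matrix_diagonal by (rule eq_matI) (auto simp: E_def as_def)
    then have "dim_gen_eigenspace E 0 1 = (\<Sum>n\<leftarrow>map fst (filter (\<lambda>(n, e). e = 0) (map (\<lambda>a. (1, a)) as)). min 1 n)"
      using dim_gen_eigenspace_jordan_matrix by simp
    also have "\<dots> = length (filter (\<lambda>a. a = 0) as)" by (induction as) auto
    also have "\<dots> = card {y. y < m \<and> kernel_leading A y}"
      unfolding length_filter_conv_card by (rule arg_cong[where f = card]) (auto simp: as_def split: if_splits)
    finally show ?thesis .
  qed
  finally show ?thesis .
qed

text \<open>First differences in \<open>k\<close> count the parts larger than \<open>k\<close>, and
  second differences give the multiplicities.\<close>

lemma sum_min_eq_imp_mset_eq: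
  assumes eq: "\<And>k. (\<Sum>x\<leftarrow>p. min k x) = (\<Sum>x\<leftarrow>q. min k x)" and "0 \<notin> set p" "0 \<notin> set q"
  shows "mset p = mset (q :: nat list)"
proof (rule multiset_eqI)
  fix k
  have diff: "(\<Sum>x\<leftarrow>p. min (Suc k) x) = (\<Sum>x\<leftarrow>p. min k x) + length (filter (\<lambda>x. k < x) p)" for p :: "nat list" and k
    by (induction p) (auto simp: min_def)
  have gt: "length (filter (\<lambda>x. k < x) p) = length (filter (\<lambda>x. k < x) q)" for k
    using eq[of "Suc k"] eq[of k] unfolding diff by simp
  show "count (mset p) k = count (mset q) k"
  proof (cases k)
    case 0
    then show ?thesis using assms(2,3) by (metis not_in_iff set_mset_mset)
  next
    case (Suc l)
    have "length (filter (\<lambda>x. l < x) p) = length (filter (\<lambda>x. Suc l < x) p) + count (mset p) (Suc l)" for p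
      by (induction p) auto
    from this[of p] this[of q] gt[of l] gt[of "Suc l"] show ?thesis using Suc by simp
  qed
qed

text \<open>A strictly triangular matrix has 0 as its only eigenvalue, so its Jordan blocks are
  determined by the kernel dimensions of its powers, a block of size \<open>x\<close> contributing
  \<open>min k x\<close> to the \<open>k\<close>-th power.\<close>

lemma has_jordan_type_strictly_upper:
  assumes A: "A \<in> carrier_mat m m" and su: "\<And>r c. r < m \<Longrightarrow> c \<le> r \<Longrightarrow> A $$ (r, c) = 0" and p: "0 \<notin> set p"
  shows "has_jordan_type A p \<longleftrightarrow> (\<forall>k. kernel_dim (A ^\<^sub>m k) = (\<Sum>x\<leftarrow>p. min k x))"
proof -
  have ut: "upper_triangular A" using su A by (intro upper_triangularI) auto
  have cp: "char_poly A = (\<Prod>a\<leftarrow>diag_mat A. [:- a, 1:])" by (rule char_poly_upper_triangular[OF A ut])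
  have diag: "set (diag_mat A) \<subseteq> {0}" using A su by (auto simp: diag_mat_def)
  have char0: "char_matrix A 0 = A" using A by (intro eq_matI) (auto simp: char_matrix_def)
  have dims: "kernel_dim (A ^\<^sub>m k) = (\<Sum>x\<leftarrow>map fst n_as. min k x)" if jnf: "jordan_nf A n_as" for n_as k
  proof -
    have ev: "a = 0" if "(l, a) \<in> set n_as" for l a
    proof -
      have l: "l \<noteq> 0" using jnf that by (force simp: jordan_nf_def)
      have "poly (char_poly A) a = 0"
      proof -
        have "[:- a, 1:] ^ l \<in> set (map (\<lambda>(l, a). [:- a, 1:] ^ l) n_as)" using that by force
        then have "[:- a, 1:] ^ l dvd char_poly A"
          unfolding jordan_nf_char_poly[OF jnf] by (rule prod_list_dvd)
        then have "[:- a, 1:] dvd char_poly A" using l by (meson dvd_power dvd_trans gr0I)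
        then show ?thesis by (simp add: poly_eq_0_iff_dvd)
      qed
      then show ?thesis unfolding cp poly_prod_list prod_list_zero_iff using diag by auto
    qed
    have "filter (\<lambda>(n, e). e = 0) n_as = n_as" using ev by (auto simp: filter_id_conv)
    then show ?thesis
      using dim_gen_eigenspace[OF jnf, of 0 k] unfolding dim_gen_eigenspace_def char0 by simp
  qed
  show ?thesis
  proof
    assume "has_jordan_type A p"
    then obtain n_as where n_as: "jordan_nf A n_as" "mset (map fst n_as) = mset p" by (auto simp: has_jordan_type_def)
    have "(\<Sum>x\<leftarrow>map fst n_as. min k x) = (\<Sum>x\<leftarrow>p. min k x)" for k
      using n_as(2) by (metis mset_map sum_mset_sum_list)
    then show "\<forall>k. kernel_dim (A ^\<^sub>m k) = (\<Sum>x\<leftarrow>p. min k x)" using dims[OF n_as(1)] by simp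
  next
    assume dim: "\<forall>k. kernel_dim (A ^\<^sub>m k) = (\<Sum>x\<leftarrow>p. min k x)"
    obtain n_as where jnf: "jordan_nf A n_as" using jordan_nf_exists[OF A cp] by blast
    have "mset (map fst n_as) = mset p"
      using dims[OF jnf] dim p jnf by (intro sum_min_eq_imp_mset_eq) (auto simp: jordan_nf_def)
    then show "has_jordan_type A p" using jnf by (auto simp: has_jordan_type_def)
  qed
qed

section \<open>Operators on finitely supported functions\<close>

text \<open>Vectors are functions on all of \<open>nat\<close>, so that the leading blocks of a strictly upper triangular
  matrix act on the same space; \<open>mat_ap n N\<close> is the operator of \<open>N\<close>.\<close>

definition mat_ap :: "nat \<Rightarrow> complex mat \<Rightarrow> (nat \<Rightarrow> complex) \<Rightarrow> nat \<Rightarrow> complex" where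
  "mat_ap n N v = (\<lambda>r. if r < n then \<Sum>c<n. N $$ (r, c) * v c else 0)"

definition strictly_upper :: "nat \<Rightarrow> complex mat \<Rightarrow> bool" where
  "strictly_upper n N \<longleftrightarrow> N \<in> carrier_mat n n \<and> (\<forall>r<n. \<forall>c<n. c \<le> r \<longrightarrow> N $$ (r, c) = 0)"

definition leads :: "nat \<Rightarrow> (nat \<Rightarrow> complex) \<Rightarrow> bool" where
  "leads y v \<longleftrightarrow> v y \<noteq> 0 \<and> (\<forall>j>y. v j = 0)"

text \<open>Equivalently, the kernel of the \<open>k\<close>-th power grows when the standard flag
  passes from its first \<open>y\<close> to its first \<open>y + 1\<close> basis vectors. Positions
  count from 0, so \<open>y\<close> corresponds to the tableau entry \<open>Suc y\<close>.\<close>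

definition killed :: "nat \<Rightarrow> complex mat \<Rightarrow> nat \<Rightarrow> nat \<Rightarrow> bool" where
  "killed n N k y \<longleftrightarrow> (\<exists>v. leads y v \<and> (mat_ap n N ^^ k) v = (\<lambda>_. 0))"

lemma mat_ap_sum: "mat_ap n N (\<lambda>r. \<Sum>z\<in>Z. u z * f z r) = (\<lambda>r. \<Sum>z\<in>Z. u z * mat_ap n N (f z) r)"
proof
  fix r
  have "(\<Sum>c<n. N $$ (r, c) * (\<Sum>z\<in>Z. u z * f z c)) = (\<Sum>z\<in>Z. u z * (\<Sum>c<n. N $$ (r, c) * f z c))"
    unfolding sum_distrib_left by (subst sum.swap) (simp add: mult.left_commute)
  then show "mat_ap n N (\<lambda>r. \<Sum>z\<in>Z. u z * f z r) r = (\<Sum>z\<in>Z. u z * mat_ap n N (f z) r)"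
    by (simp add: mat_ap_def)
qed

lemma mat_ap_power_sum:
  "(mat_ap n N ^^ k) (\<lambda>r. \<Sum>z\<in>Z. u z * f z r) = (\<lambda>r. \<Sum>z\<in>Z. u z * (mat_ap n N ^^ k) (f z) r)"
  by (induction k arbitrary: f) (simp_all add: funpow_swap1 mat_ap_sum)

lemma mat_ap_diff_scale:
  "mat_ap n N (\<lambda>r. f r - a * g r) = (\<lambda>r. mat_ap n N f r - a * mat_ap n N g r)"
  by (rule ext) (simp add: mat_ap_def sum_subtractf sum_distrib_left algebra_simps)

lemma mat_ap_power_diff_scale:
  "(mat_ap n N ^^ k) (\<lambda>r. f r - a * g r) = (\<lambda>r. (mat_ap n N ^^ k) f r - a * (mat_ap n N ^^ k) g r)"
  by (induction k arbitrary: f g) (simp_all add: funpow_swap1 mat_ap_diff_scale)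

lemma mat_ap_zero [simp]: "mat_ap n N (\<lambda>_. 0) = (\<lambda>_. 0)"
  by (rule ext) (simp add: mat_ap_def)

lemma mat_ap_power_zero [simp]: "(mat_ap n N ^^ k) (\<lambda>_. 0) = (\<lambda>_. 0)"
  by (induction k) simp_all

lemma mat_ap_power_add: "(mat_ap n N ^^ (k + l)) v = (mat_ap n N ^^ k) ((mat_ap n N ^^ l) v)"
  by (simp add: funpow_add)

lemma mat_ap_power_mono:
  "(mat_ap n N ^^ k) v = (\<lambda>_. 0) \<Longrightarrow> k \<le> l \<Longrightarrow> (mat_ap n N ^^ l) v = (\<lambda>_. 0)"
  by (metis le_add_diff_inverse2 mat_ap_power_add mat_ap_power_zero)

lemma strictly_upper_support:
  assumes N: "strictly_upper n N" and v: "\<And>j. Suc i \<le> j \<Longrightarrow> v j = 0" and j: "i \<le> j"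
  shows "mat_ap n N v j = 0"
proof (cases "j < n")
  case True
  have "N $$ (j, c) * v c = 0" if "c < n" for c
    using N True that v[of c] j by (cases "c \<le> j") (auto simp: strictly_upper_def)
  then have "(\<Sum>c<n. N $$ (j, c) * v c) = 0" by (intro sum.neutral) auto
  then show ?thesis by (simp add: mat_ap_def)
qed (simp add: mat_ap_def)

lemma strictly_upper_superdiagonal:
  assumes N: "strictly_upper n N" and v: "\<And>j. Suc y < j \<Longrightarrow> v j = 0" and y: "Suc y < n"
  shows "mat_ap n N v y = N $$ (y, Suc y) * v (Suc y)"
proof -
  have "(\<Sum>c<n. N $$ (y, c) * v c) = (\<Sum>c<n. if c = Suc y then N $$ (y, Suc y) * v (Suc y) else 0)"
  proof (rule sum.cong)
    fix c assume "c \<in> {..<n}"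
    then show "N $$ (y, c) * v c = (if c = Suc y then N $$ (y, Suc y) * v (Suc y) else 0)"
      using N v[of c] y by (cases "c \<le> y") (auto simp: strictly_upper_def)
  qed simp
  then show ?thesis using y by (simp add: mat_ap_def)
qed

lemma leads_less_zero: "(\<And>j. i \<le> j \<Longrightarrow> v j = 0) \<Longrightarrow> v \<noteq> (\<lambda>_. 0) \<Longrightarrow> \<exists>y<i. leads y v"
proof (induction i)
  case (Suc i)
  show ?case
  proof (cases "v i = 0")
    case True
    then have "\<And>j. i \<le> j \<Longrightarrow> v j = 0" using Suc.prems(1) le_eq_less_or_eq by (metis Suc_leI)
    then show ?thesis using Suc less_SucI by blast
  next
    case False
    then show ?thesis using Suc.prems(1) by (intro exI[of _ i]) (auto simp: leads_def)
  qed
qed auto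

section \<open>The cells of the geometric order\<close>

lemma kernel_leading_block:
  assumes N: "strictly_upper n N" and i: "i \<le> n" and y: "y < i"
  defines "A \<equiv> mat i i (\<lambda>(r, c). N $$ (r, c))"
  shows "kernel_leading (A ^\<^sub>m k) y \<longleftrightarrow> killed n N k y"
proof -
  define ext where "ext v = (\<lambda>r. if r < i then v $ r else 0)" for v :: "complex vec"
  have A: "A \<in> carrier_mat i i" by (simp add: A_def)
  have step: "ext (A *\<^sub>v v) = mat_ap n N (ext v)" if v: "v \<in> carrier_vec i" for v
  proof
    fix r
    show "ext (A *\<^sub>v v) r = mat_ap n N (ext v) r"
    proof (cases "r < i")
      case True
      have "ext (A *\<^sub>v v) r = (\<Sum>j = 0..<i. N $$ (r, j) * v $ j)"
        using mult_mat_vec_index_sum[OF A v True] True by (simp add: ext_def A_def)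
      also have "\<dots> = (\<Sum>j<n. N $$ (r, j) * ext v j)"
        by (rule sum.mono_neutral_cong_left) (use i in \<open>auto simp: ext_def\<close>)
      finally show ?thesis using True i by (simp add: mat_ap_def)
    next
      case False
      have "ext v j = 0" if "Suc r \<le> j" for j using that False by (simp add: ext_def)
      then have "mat_ap n N (ext v) r = 0" using strictly_upper_support[OF N, of r "ext v" r] by blast
      then show ?thesis using False by (simp add: ext_def)
    qed
  qed
  have pow: "ext (A ^\<^sub>m k *\<^sub>v v) = (mat_ap n N ^^ k) (ext v) \<and> A ^\<^sub>m k *\<^sub>v v \<in> carrier_vec i"
    if "v \<in> carrier_vec i" for v k
    using that
  proof (induction k arbitrary: v)
    case 0
    then show ?case using A by simp
  next
    case (Suc k)
    have Av: "A *\<^sub>v v \<in> carrier_vec i" using A Suc.prems by simp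
    have "A ^\<^sub>m Suc k *\<^sub>v v = A ^\<^sub>m k *\<^sub>v (A *\<^sub>v v)"
      using assoc_mult_mat_vec[OF pow_carrier_mat[OF A] A Suc.prems] by simp
    then show ?case using Suc.IH[OF Av] step[OF Suc.prems] by (simp add: funpow_swap1)
  qed
  have dims: "dim_col (A ^\<^sub>m k) = i" "dim_row (A ^\<^sub>m k) = i" using A by simp_all
  have zero: "A ^\<^sub>m k *\<^sub>v v = 0\<^sub>v i \<longleftrightarrow> (mat_ap n N ^^ k) (ext v) = (\<lambda>_. 0)" if v: "v \<in> carrier_vec i" for v
  proof -
    have "w = 0\<^sub>v i \<longleftrightarrow> ext w = (\<lambda>_. 0)" if "w \<in> carrier_vec i" for w
    proof
      assume 0: "ext w = (\<lambda>_. 0)"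
      have "w $ r = 0" if "r < i" for r using fun_cong[OF 0, of r] that unfolding ext_def by simp
      then show "w = 0\<^sub>v i" using \<open>w \<in> carrier_vec i\<close> by (intro eq_vecI) auto
    qed (auto simp: ext_def)
    then show ?thesis using pow[OF v, of k] by metis
  qed
  show ?thesis
  proof
    assume "kernel_leading (A ^\<^sub>m k) y"
    then obtain v where v: "v \<in> carrier_vec i" "A ^\<^sub>m k *\<^sub>v v = 0\<^sub>v i" "v $ y \<noteq> 0" "\<forall>j<i. y < j \<longrightarrow> v $ j = 0"
      unfolding kernel_leading_def dims by blast
    have "leads y (ext v)" using v y by (auto simp: leads_def ext_def)
    then show "killed n N k y" using zero[OF v(1)] v(2) by (auto simp: killed_def)
  next
    assume "killed n N k y"
    then obtain u where u: "leads y u" "(mat_ap n N ^^ k) u = (\<lambda>_. 0)" by (auto simp: killed_def)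
    have "ext (vec i u) = u" using u(1) y by (auto simp: ext_def leads_def fun_eq_iff)
    then show "kernel_leading (A ^\<^sub>m k) y"
      unfolding kernel_leading_def dims using zero[of "vec i u"] u y
      by (intro bexI[of _ "vec i u"]) (auto simp: leads_def)
  qed
qed

text \<open>Both sides count the cells in the first \<open>k\<close> columns with entries at most
  \<open>i\<close>: the left one row by row, the right one entry by entry.\<close>

lemma sum_min_shape_tableau_upto:
  assumes T: "T \<in> YT n" and i: "i \<le> n"
  shows "(\<Sum>x\<leftarrow>shape (tableau_upto i T). min k x) = card {y. y < i \<and> entry_col T (Suc y) < k}"
proof -
  let ?S = "\<lambda>r. {c. c < length (T ! r) \<and> T ! r ! c \<le> i}"
  have "(\<Sum>x\<leftarrow>shape (tableau_upto i T). min k x) = (\<Sum>row\<leftarrow>T. min k (length (filter (\<lambda>x. x \<le> i) row)))"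
    unfolding tableau_upto_def shape_def by (induction T) auto
  also have "\<dots> = (\<Sum>r<length T. min k (length (filter (\<lambda>x. x \<le> i) (T ! r))))"
    by (simp add: sum_list_sum_nth lessThan_atLeast0)
  also have "\<dots> = (\<Sum>r<length T. card {c \<in> ?S r. c < k})"
  proof (rule sum.cong)
    fix r assume "r \<in> {..<length T}"
    then have r: "r < length T" by simp
    have S: "?S r = {..<card (?S r)}"
      by (rule down_closed_nat_set) (use YT_row_mono[OF T r] in \<open>auto intro: order_trans\<close>)
    have "min k (length (filter (\<lambda>x. x \<le> i) (T ! r))) = card {..<min k (card (?S r))}"
      by (simp add: length_filter_conv_card)
    also have "{..<min k (card (?S r))} = {c \<in> {..<card (?S r)}. c < k}" by auto
    finally show "min k (length (filter (\<lambda>x. x \<le> i) (T ! r))) = card {c \<in> ?S r. c < k}"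
      unfolding S[symmetric] .
  qed simp
  also have "\<dots> = card (SIGMA r:{..<length T}. {c \<in> ?S r. c < k})" by simp
  also have "\<dots> = card {y. y < i \<and> entry_col T (Suc y) < k}"
  proof (rule bij_betw_same_card[of "\<lambda>(r, c). T ! r ! c - 1"], rule bij_betwI[where g = "\<lambda>y. entry_pos T (Suc y)"])
    have val: "1 \<le> T ! r ! c" if "(r, c) \<in> cells T" for r c using YT_entry_range[OF T that] by simp
    show "(\<lambda>(r, c). T ! r ! c - 1) \<in> (SIGMA r:{..<length T}. {c \<in> ?S r. c < k}) \<rightarrow> {y. y < i \<and> entry_col T (Suc y) < k}"
    proof clarsimp
      fix r c assume h: "r < length T" "c < length (T ! r)" "T ! r ! c \<le> i" "c < k"
      then have "Suc (T ! r ! c - Suc 0) = T ! r ! c" using val[of r c] by simp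
      then show "T ! r ! c - Suc 0 < i \<and> entry_col T (Suc (T ! r ! c - Suc 0)) < k"
        using entry_pos_eq[OF T, of r c] h by auto
    qed
    show "(\<lambda>y. entry_pos T (Suc y)) \<in> {y. y < i \<and> entry_col T (Suc y) < k} \<rightarrow> (SIGMA r:{..<length T}. {c \<in> ?S r. c < k})"
    proof
      fix y assume y: "y \<in> {y. y < i \<and> entry_col T (Suc y) < k}"
      then have "Suc y \<in> {1..n}" using i by auto
      note c = entry_pos_cell[OF T this]
      show "entry_pos T (Suc y) \<in> (SIGMA r:{..<length T}. {c \<in> ?S r. c < k})"
        using c y by (cases "entry_pos T (Suc y)") auto
    qed
    show "entry_pos T (Suc ((\<lambda>(r, c). T ! r ! c - 1) p)) = p" if "p \<in> (SIGMA r:{..<length T}. {c \<in> ?S r. c < k})" for p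
      using that val[of "fst p" "snd p"] entry_pos_eq[OF T, of "fst p" "snd p"] by auto
    show "(\<lambda>(r, c). T ! r ! c - 1) (entry_pos T (Suc y)) = y" if "y \<in> {y. y < i \<and> entry_col T (Suc y) < k}" for y
      using that i entry_pos_cell[OF T, of "Suc y"] by (auto simp: split_beta)
  qed
  finally show ?thesis .
qed

text \<open>The Jordan types of all leading blocks amount to the kernel dimensions of all their
  powers, and these count killed positions. Differences between consecutive blocks turn the equality
  of counts into a condition for each single position. All further work on cells uses this
  form.\<close>

lemma geom_cell_iff:
  assumes T: "T \<in> YT n"
  shows "N \<in> geom_cell n T \<longleftrightarrow> strictly_upper n N \<and> (\<forall>y<n. \<forall>k. killed n N k y \<longleftrightarrow> entry_col T (Suc y) < k)"
proof (cases "strictly_upper n N")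
  case False
  then show ?thesis by (auto simp: geom_cell_def strictly_upper_def)
next
  case N: True
  let ?A = "\<lambda>i. mat i i (\<lambda>(r, c). N $$ (r, c))"
  let ?C = "\<lambda>i k. card {y. y < i \<and> killed n N k y}" and ?D = "\<lambda>i k. card {y. y < i \<and> entry_col T (Suc y) < k}"
  have type: "has_jordan_type (?A i) (shape (tableau_upto i T)) \<longleftrightarrow> (\<forall>k. ?C i k = ?D i k)" if i: "i \<le> n" for i
  proof -
    have "kernel_dim (?A i ^\<^sub>m k) = ?C i k" for k
      using kernel_dim_leading[OF pow_carrier_mat, of "?A i" i k] kernel_leading_block[OF N i, of _ k]
      by (simp cong: conj_cong)
    moreover have "0 \<notin> set (shape (tableau_upto i T))" by (auto simp: shape_def tableau_upto_def)
    moreover have "?A i $$ (r, c) = 0" if "r < i" "c \<le> r" for r c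
      using that N i by (auto simp: strictly_upper_def)
    ultimately show ?thesis
      using has_jordan_type_strictly_upper[of "?A i" i] sum_min_shape_tableau_upto[OF T i] by simp
  qed
  have "N \<in> geom_cell n T \<longleftrightarrow> (\<forall>i\<in>{1..n}. \<forall>k. ?C i k = ?D i k)"
    using N type by (auto simp: geom_cell_def strictly_upper_def)
  also have "\<dots> \<longleftrightarrow> (\<forall>y<n. \<forall>k. killed n N k y \<longleftrightarrow> entry_col T (Suc y) < k)"
  proof
    assume eq: "\<forall>i\<in>{1..n}. \<forall>k. ?C i k = ?D i k"
    show "\<forall>y<n. \<forall>k. killed n N k y \<longleftrightarrow> entry_col T (Suc y) < k"
    proof (intro allI impI)
      fix y k assume y: "y < n"
      have cd: "?C y k = ?D y k" using eq y by (cases "y = 0") auto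
      have suc: "card {z. z < Suc y \<and> P z} = card {z. z < y \<and> P z} + (if P y then 1 else 0)" for P
      proof -
        have "{z. z < Suc y \<and> P z} = (if P y then insert y {z. z < y \<and> P z} else {z. z < y \<and> P z})"
          by (auto simp: less_Suc_eq)
        then show ?thesis by simp
      qed
      have "?C (Suc y) k = ?D (Suc y) k" using eq y by simp
      then show "killed n N k y \<longleftrightarrow> entry_col T (Suc y) < k"
        unfolding suc cd by (simp split: if_splits)
    qed
  next
    assume h: "\<forall>y<n. \<forall>k. killed n N k y \<longleftrightarrow> entry_col T (Suc y) < k"
    show "\<forall>i\<in>{1..n}. \<forall>k. ?C i k = ?D i k"
      using h by (auto intro!: arg_cong[where f = card])
  qed
  finally show ?thesis using N by simp
qed

section \<open>Triangular changes of basis\<close>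

definition comb :: "nat \<Rightarrow> (nat \<Rightarrow> nat \<Rightarrow> complex) \<Rightarrow> (nat \<Rightarrow> complex) \<Rightarrow> nat \<Rightarrow> complex" where
  "comb n f u = (\<lambda>r. \<Sum>z<n. u z * f z r)"

lemma comb_above:
  assumes f: "\<And>y. y < n \<Longrightarrow> leads y (f y)" and u: "\<And>j. i \<le> j \<Longrightarrow> u j = 0" and r: "i \<le> r"
  shows "comb n f u r = 0"
  unfolding comb_def
proof (rule sum.neutral, rule ballI)
  fix z assume "z \<in> {..<n}"
  then show "u z * f z r = 0" using f[of z] u[of z] r by (cases "i \<le> z") (auto simp: leads_def)
qed

lemma leads_comb:
  assumes f: "\<And>y. y < n \<Longrightarrow> leads y (f y)" and y: "y < n" and u: "leads y u"
  shows "leads y (comb n f u)"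
proof -
  have "comb n f u y = (\<Sum>z<n. if z = y then u y * f y y else 0)"
    unfolding comb_def
  proof (rule sum.cong)
    fix z assume "z \<in> {..<n}"
    then show "u z * f z y = (if z = y then u y * f y y else 0)"
      using f[of z] u by (cases z y rule: linorder_cases) (auto simp: leads_def)
  qed simp
  also have "\<dots> = u y * f y y" using y by simp
  finally have "comb n f u y \<noteq> 0" using u f[OF y] by (simp add: leads_def)
  moreover have "comb n f u j = 0" if "y < j" for j
    using comb_above[where n = n and f = f and i = "Suc y" and u = u and r = j] f u that by (auto simp: leads_def)
  ultimately show ?thesis by (simp add: leads_def)
qed

lemma comb_surj:
  assumes f: "\<And>y. y < n \<Longrightarrow> leads y (f y)" and "m \<le> n" and "\<And>j. m \<le> j \<Longrightarrow> v j = 0"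
  shows "\<exists>u. v = comb n f u \<and> (\<forall>j\<ge>m. u j = 0)"
  using assms(2,3)
proof (induction m arbitrary: v)
  case 0
  then have "v = comb n f (\<lambda>_. 0)" by (auto simp: comb_def fun_eq_iff)
  then show ?case by (intro exI[of _ "\<lambda>_. 0"]) simp
next
  case (Suc m)
  define a where "a = v m / f m m"
  have fm: "f m m \<noteq> 0" "\<And>j. m < j \<Longrightarrow> f m j = 0" using f[of m] Suc.prems(1) by (auto simp: leads_def)
  have "v j - a * f m j = 0" if "m \<le> j" for j
    using that Suc.prems(2)[of j] fm by (cases "j = m") (auto simp: a_def)
  then obtain u where u: "(\<lambda>j. v j - a * f m j) = comb n f u" "\<forall>j\<ge>m. u j = 0"
    using Suc.IH[of "\<lambda>j. v j - a * f m j"] Suc.prems(1) by auto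
  have "v r = comb n f (u(m := a)) r" for r
  proof -
    have "comb n f (u(m := a)) r = (\<Sum>z<n. u z * f z r + (if z = m then a * f m r else 0))"
      unfolding comb_def by (rule sum.cong) (use u(2) in auto)
    also have "\<dots> = comb n f u r + a * f m r" using Suc.prems(1) by (simp add: comb_def sum.distrib)
    finally show ?thesis using fun_cong[OF u(1), of r] by (simp add: algebra_simps)
  qed
  then have "v = comb n f (u(m := a))" by (rule ext)
  moreover have "(u(m := a)) j = 0" if "Suc m \<le> j" for j using u(2) that by simp
  ultimately show ?case by blast
qed

lemma comb_inj:
  assumes f: "\<And>y. y < n \<Longrightarrow> leads y (f y)" and "comb n f u = (\<lambda>_. 0)" "\<And>j. n \<le> j \<Longrightarrow> u j = 0"
  shows "u = (\<lambda>_. 0)"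
proof (rule ccontr)
  assume "u \<noteq> (\<lambda>_. 0)"
  then obtain y where "y < n" "leads y u" using leads_less_zero[of n u] assms(3) by blast
  then have "leads y (comb n f u)" using leads_comb[where n = n and f = f] f by blast
  then show False unfolding assms(2) by (simp add: leads_def)
qed

lemma leads_as_comb:
  assumes f: "\<And>y. y < n \<Longrightarrow> leads y (f y)" and y: "y < n" and v: "leads y v"
  obtains u where "leads y u" "v = comb n f u"
proof -
  obtain u where u: "v = comb n f u" "\<forall>j\<ge>Suc y. u j = 0"
    using comb_surj[where n = n and f = f and m = "Suc y" and v = v] f y v by (auto simp: leads_def)
  have "u y \<noteq> 0"
  proof
    assume "u y = 0"
    then have "u j = 0" if "y \<le> j" for j using u(2) that by (cases "j = y") auto
    then have "comb n f u y = 0" using comb_above[where n = n and f = f and i = y and u = u and r = y] f by blast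
    then show False using v u(1) by (simp add: leads_def)
  qed
  then have "leads y u" using u(2) by (simp add: leads_def)
  then show thesis using that u(1) by blast
qed

text \<open>\<open>W\<close> is the matrix of \<open>N\<close> in the basis \<open>f\<close>. Since
  \<open>f y\<close> ends at position \<open>y\<close>, this change of basis respects the standard
  flag, so strict triangularity and \<open>killed\<close> can be read off from
  \<open>W\<close>.\<close>

context
  fixes n :: nat and f :: "nat \<Rightarrow> nat \<Rightarrow> complex" and N :: "complex mat" and W :: "nat \<Rightarrow> nat \<Rightarrow> complex"
  assumes f: "\<And>y. y < n \<Longrightarrow> leads y (f y)" and N: "N \<in> carrier_mat n n"
    and NW: "\<And>y. y < n \<Longrightarrow> mat_ap n N (f y) = comb n f (\<lambda>x. W x y)"
begin

lemma mat_ap_comb: "mat_ap n N (comb n f u) = comb n f (mat_ap n (mat n n (\<lambda>(x, y). W x y)) u)"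
proof
  fix r
  have "mat_ap n N (comb n f u) r = (\<Sum>z<n. u z * comb n f (\<lambda>x. W x z) r)"
    unfolding comb_def[of n f u] mat_ap_sum by (simp add: NW)
  also have "\<dots> = (\<Sum>x<n. (\<Sum>z<n. W x z * u z) * f x r)"
    unfolding comb_def sum_distrib_left sum_distrib_right by (subst sum.swap) (simp add: ac_simps)
  also have "\<dots> = comb n f (mat_ap n (mat n n (\<lambda>(x, y). W x y)) u) r"
    unfolding comb_def by (rule sum.cong) (simp_all add: mat_ap_def)
  finally show "mat_ap n N (comb n f u) r = comb n f (mat_ap n (mat n n (\<lambda>(x, y). W x y)) u) r" .
qed

lemma mat_ap_power_comb:
  "(mat_ap n N ^^ k) (comb n f u) = comb n f ((mat_ap n (mat n n (\<lambda>(x, y). W x y)) ^^ k) u)"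
  by (induction k) (simp_all add: mat_ap_comb)

lemma killed_conj:
  assumes y: "y < n" shows "killed n N k y \<longleftrightarrow> killed n (mat n n (\<lambda>(x, y). W x y)) k y"
proof
  let ?W = "mat n n (\<lambda>(x, y). W x y)"
  {
    assume "killed n N k y"
    then obtain v where v: "leads y v" "(mat_ap n N ^^ k) v = (\<lambda>_. 0)" by (auto simp: killed_def)
    obtain u where u: "leads y u" "v = comb n f u"
      using leads_as_comb[where n = n and f = f and y = y and v = v] f y v(1) by blast
    have "comb n f ((mat_ap n ?W ^^ k) u) = (\<lambda>_. 0)" using v(2) unfolding u(2) mat_ap_power_comb .
    moreover have "(mat_ap n ?W ^^ k) u j = 0" if "n \<le> j" for j
      using that u(1) y by (cases k) (auto simp: mat_ap_def leads_def)
    ultimately have "(mat_ap n ?W ^^ k) u = (\<lambda>_. 0)"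
      using comb_inj[where n = n and f = f and u = "(mat_ap n ?W ^^ k) u"] f by blast
    then show "killed n ?W k y" using u(1) by (auto simp: killed_def)
  next
    assume "killed n ?W k y"
    then obtain u where u: "leads y u" "(mat_ap n ?W ^^ k) u = (\<lambda>_. 0)" by (auto simp: killed_def)
    have "(mat_ap n N ^^ k) (comb n f u) = (\<lambda>_. 0)"
      unfolding mat_ap_power_comb u(2) by (simp add: comb_def)
    moreover have "leads y (comb n f u)" using leads_comb[where n = n and f = f] f y u(1) by blast
    ultimately show "killed n N k y" by (auto simp: killed_def)
  }
qed

lemma strictly_upper_conj:
  assumes W: "\<And>x y. y \<le> x \<Longrightarrow> W x y = 0" shows "strictly_upper n N"
  unfolding strictly_upper_def
proof (intro conjI allI impI)
  let ?W = "mat n n (\<lambda>(x, y). W x y)"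
  have su: "strictly_upper n ?W" using W by (auto simp: strictly_upper_def)
  fix r c assume rc: "r < n" "c < n" "c \<le> r"
  let ?e = "\<lambda>j. if j = c then 1 else 0 :: complex"
  obtain u where u: "?e = comb n f u" "\<forall>j\<ge>Suc c. u j = 0"
    using comb_surj[where n = n and f = f and m = "Suc c" and v = ?e] f rc by auto
  have "mat_ap n ?W u j = 0" if "c \<le> j" for j
    using strictly_upper_support[OF su, of c u j] u(2) that by blast
  then have "comb n f (mat_ap n ?W u) r = 0"
    using comb_above[where n = n and f = f and i = c and u = "mat_ap n ?W u" and r = r] f rc by blast
  then have "mat_ap n N ?e r = 0" unfolding u(1) mat_ap_comb .
  then show "N $$ (r, c) = 0" using rc by (simp add: mat_ap_def if_distrib cong: if_cong)
qed (fact N)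

end

section \<open>Generic elements of a cell\<close>

text \<open>Polynomial dependence on the parameter of a line of matrices.\<close>

definition poly_fun :: "(complex \<Rightarrow> complex) \<Rightarrow> bool" where
  "poly_fun h \<longleftrightarrow> (\<exists>p. \<forall>s. h s = poly p s)"

lemma poly_fun_const: "poly_fun (\<lambda>s. a)"
  unfolding poly_fun_def by (intro exI[of _ "[:a:]"]) simp

lemma poly_fun_id: "poly_fun (\<lambda>s. s)"
  unfolding poly_fun_def by (intro exI[of _ "[:0, 1:]"]) simp

lemma poly_fun_add: "poly_fun g \<Longrightarrow> poly_fun h \<Longrightarrow> poly_fun (\<lambda>s. g s + h s)"
  unfolding poly_fun_def by (metis poly_add)

lemma poly_fun_mult: "poly_fun g \<Longrightarrow> poly_fun h \<Longrightarrow> poly_fun (\<lambda>s. g s * h s)"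
  unfolding poly_fun_def by (metis poly_mult)

lemma poly_fun_sum: "(\<And>i. i \<in> I \<Longrightarrow> poly_fun (g i)) \<Longrightarrow> poly_fun (\<lambda>s. \<Sum>i\<in>I. g i s)"
  by (induction I rule: infinite_finite_induct) (simp_all add: poly_fun_const poly_fun_add)

lemma poly_fun_prod: "(\<And>i. i \<in> I \<Longrightarrow> poly_fun (g i)) \<Longrightarrow> poly_fun (\<lambda>s. \<Prod>i\<in>I. g i s)"
  by (induction I rule: infinite_finite_induct) (simp_all add: poly_fun_const poly_fun_mult)

lemma poly_fun_det:
  assumes "\<And>s. Q s \<in> carrier_mat n n" "\<And>i j. i < n \<Longrightarrow> j < n \<Longrightarrow> poly_fun (\<lambda>s. Q s $$ (i, j))"
  shows "poly_fun (\<lambda>s. det (Q s))"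
proof -
  have "det (Q s) = (\<Sum>p\<in>{p. p permutes {0..<n}}. signof p * (\<Prod>i = 0..<n. Q s $$ (i, p i)))" for s
    using assms(1)[of s] by (simp add: det_def)
  then show ?thesis
    using assms(2) by (auto intro!: poly_fun_sum poly_fun_mult poly_fun_const poly_fun_prod dest: permutes_in_image)
qed

lemma poly_fun_mat_ap_power:
  assumes "\<And>r c. r < n \<Longrightarrow> c < n \<Longrightarrow> poly_fun (\<lambda>s. M s $$ (r, c))"
  shows "poly_fun (\<lambda>s. (mat_ap n (M s) ^^ k) u r)"
proof (induction k arbitrary: r)
  case 0
  show ?case by (simp add: poly_fun_const)
next
  case (Suc k)
  show ?case
    using Suc assms by (cases "r < n") (auto simp: mat_ap_def intro!: poly_fun_sum poly_fun_mult poly_fun_const)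
qed

lemma poly_fun_mat_poly_fun:
  assumes "h \<in> mat_poly_fun n" "\<And>r c. r < n \<Longrightarrow> c < n \<Longrightarrow> poly_fun (\<lambda>s. M s $$ (r, c))"
  shows "poly_fun (\<lambda>s. h (M s))"
  using assms(1) by induction (auto intro: poly_fun_const poly_fun_add poly_fun_mult assms(2))

lemma poly_fun_finite_zeros:
  assumes "poly_fun h" "h a \<noteq> 0" shows "finite {s. h s = 0}"
proof -
  obtain p where p: "\<And>s. h s = poly p s" using assms(1) by (auto simp: poly_fun_def)
  then have "p \<noteq> 0" using assms(2) by auto
  then show ?thesis using poly_roots_finite[of p] by (simp add: p)
qed

abbreviation unit_fun :: "nat \<Rightarrow> nat \<Rightarrow> complex" where
  "unit_fun z \<equiv> (\<lambda>r. if r = z then 1 else 0)"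

section \<open>The row shift of a tableau and points in the closure of its cell\<close>

context
  fixes n :: nat and T :: tableau
  assumes T: "T \<in> YT n"
begin

abbreviation (input) K :: "nat \<Rightarrow> nat" where
  "K y \<equiv> entry_col T (Suc y)"

text \<open>The position of the entry \<open>k\<close> places to the left of \<open>Suc z\<close> in
  its row, meant for \<open>k \<le> K z\<close>; the final \<open>- 1\<close> converts from entries
  to positions.\<close>

definition row_shift :: "nat \<Rightarrow> nat \<Rightarrow> nat" where
  "row_shift k z = T ! entry_row T (Suc z) ! (K z - k) - 1"

lemma row_shift:
  assumes z: "z < n" and k: "k \<le> K z"
  shows "row_shift k z < n" "entry_pos T (Suc (row_shift k z)) = (entry_row T (Suc z), K z - k)"
proof -
  have "Suc z \<in> {1..n}" using z by simp
  note c = entry_pos_cell[OF T this]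
  have cell: "(entry_row T (Suc z), K z - k) \<in> cells T" using c by auto
  then have v: "T ! entry_row T (Suc z) ! (K z - k) \<in> {1..n}" by (rule YT_entry_range[OF T])
  then show "row_shift k z < n" by (auto simp: row_shift_def)
  have "T ! entry_row T (Suc z) ! (K z - k) = Suc (row_shift k z)" using v by (auto simp: row_shift_def)
  then show "entry_pos T (Suc (row_shift k z)) = (entry_row T (Suc z), K z - k)"
    by (rule entry_pos_eq[OF T cell])
qed

text \<open>The matrix that sends each basis vector to its left neighbour in the row of
  \<open>T\<close>, and the first vector of each row to 0; its Jordan blocks are the rows. It serves
  as base point of the cell of \<open>T\<close>.\<close>

definition shift_entry :: "nat \<Rightarrow> nat \<Rightarrow> complex" where
  "shift_entry x y = (if entry_row T (Suc x) = entry_row T (Suc y) \<and> K y = Suc (K x) then 1 else 0)"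

lemma entry_pos_inj:
  assumes "x < n" "y < n" "entry_pos T (Suc x) = entry_pos T (Suc y)" shows "x = y"
proof -
  have "Suc x \<in> {1..n}" "Suc y \<in> {1..n}" using assms by auto
  then have "Suc x = Suc y" using entry_pos_cell(3)[OF T] assms(3) by metis
  then show ?thesis by simp
qed

lemma shift_power:
  assumes y: "y < n"
  shows "(mat_ap n (mat n n (\<lambda>(x, y). shift_entry x y)) ^^ k) (unit_fun y) =
    (if k \<le> K y then unit_fun (row_shift k y) else (\<lambda>_. 0))"
proof (induction k)
  case 0
  have "row_shift 0 y = y" using entry_pos_inj[OF row_shift(1)[OF y, of 0] y] row_shift(2)[OF y, of 0] by simp
  then show ?case by simp
next
  case (Suc k)
  let ?L = "mat n n (\<lambda>(x, y). shift_entry x y)"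
  show ?case
  proof (cases "k \<le> K y")
    case False
    then show ?thesis using Suc by simp
  next
    case True
    let ?z = "row_shift k y"
    note z = row_shift[OF y True]
    have val: "mat_ap n ?L (unit_fun ?z) r = (if r < n then shift_entry r ?z else 0)" for r
      using z(1) by (simp add: mat_ap_def if_distrib cong: if_cong)
    have "mat_ap n ?L (unit_fun ?z) r = (if Suc k \<le> K y then unit_fun (row_shift (Suc k) y) r else 0)" for r
    proof (cases "Suc k \<le> K y")
      case False
      then have "shift_entry r ?z = 0" using z(2) by (simp add: shift_entry_def)
      then show ?thesis unfolding val using False by simp
    next
      case True
      note z' = row_shift[OF y True]
      have "entry_row T (Suc r) = entry_row T (Suc ?z) \<and> K ?z = Suc (K r) \<longleftrightarrow> r = row_shift (Suc k) y" if "r < n"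
      proof
        assume "entry_row T (Suc r) = entry_row T (Suc ?z) \<and> K ?z = Suc (K r)"
        then have "entry_pos T (Suc r) = entry_pos T (Suc (row_shift (Suc k) y))"
          using z(2) z'(2) True by (auto simp: prod_eq_iff)
        then show "r = row_shift (Suc k) y" using entry_pos_inj[OF that z'(1)] by simp
      next
        assume "r = row_shift (Suc k) y"
        then show "entry_row T (Suc r) = entry_row T (Suc ?z) \<and> K ?z = Suc (K r)"
          using z(2) z'(2) True by auto
      qed
      then have "shift_entry r ?z = unit_fun (row_shift (Suc k) y) r" if "r < n"
        using that unfolding shift_entry_def by simp
      then show ?thesis unfolding val using True z'(1) by (cases "r < n") auto
    qed
    then have "mat_ap n ?L (unit_fun ?z) = (if Suc k \<le> K y then unit_fun (row_shift (Suc k) y) else (\<lambda>_. 0))" by auto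
    then show ?thesis using Suc True by simp
  qed
qed

text \<open>Nonsingularity of this matrix says that the \<open>k\<close>-th power of \<open>W\<close> is injective on the span of
  the entries in the columns from \<open>k\<close> on; it is an identity matrix when \<open>W\<close> is the row shift.\<close>

definition rank_matrix :: "complex mat \<Rightarrow> nat \<Rightarrow> complex mat" where
  "rank_matrix W k = mat n n (\<lambda>(z, z').
     if k \<le> K z then (mat_ap n W ^^ k) (unit_fun z') (row_shift k z) else unit_fun z z')"

lemma det_rank_matrix_shift: "det (rank_matrix (mat n n (\<lambda>(x, y). shift_entry x y)) k) = 1"
proof -
  have "rank_matrix (mat n n (\<lambda>(x, y). shift_entry x y)) k = 1\<^sub>m n"
  proof (rule eq_matI)
    fix z z' assume "z < dim_row (1\<^sub>m n)" "z' < dim_col (1\<^sub>m n)"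
    then have z: "z < n" and z': "z' < n" by simp_all
    show "rank_matrix (mat n n (\<lambda>(x, y). shift_entry x y)) k $$ (z, z') = 1\<^sub>m n $$ (z, z')"
    proof (cases "k \<le> K z")
      case False
      then show ?thesis using z z' by (simp add: rank_matrix_def)
    next
      case True
      have "row_shift k z = row_shift k z' \<longleftrightarrow> z = z'" if "k \<le> K z'"
      proof
        assume "row_shift k z = row_shift k z'"
        then have "entry_row T (Suc z) = entry_row T (Suc z')" "K z - k = K z' - k"
          using row_shift(2)[OF z True] row_shift(2)[OF z' that] by auto
        then have "entry_pos T (Suc z) = entry_pos T (Suc z')" using True that by (simp add: prod_eq_iff)
        then show "z = z'" by (rule entry_pos_inj[OF z z'])
      qed simp
      then show ?thesis using z z' True by (auto simp: rank_matrix_def shift_power)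
    qed
  qed (simp_all add: rank_matrix_def)
  then show ?thesis by simp
qed

text \<open>Every application of \<open>W\<close> lowers the column, so the \<open>k\<close>-th
  power annihilates whatever is supported in the first \<open>k\<close> columns. Conversely, suppose
  it annihilates a vector ending at a position in column \<open>k\<close> or later. The part of this
  vector in those columns is non-zero and annihilated too, which contradicts the nonsingularity of
  the rank matrix.\<close>

lemma killed_iff_col:
  assumes W: "\<And>x y. x < n \<Longrightarrow> y < n \<Longrightarrow> W $$ (x, y) \<noteq> 0 \<Longrightarrow> K x < K y"
    and det: "\<And>k. k < n \<Longrightarrow> det (rank_matrix W k) \<noteq> 0" and y: "y < n"
  shows "killed n W k y \<longleftrightarrow> K y < k"
proof -
  have step: "mat_ap n W v x = 0" if v: "\<And>z. z < n \<Longrightarrow> m \<le> K z \<Longrightarrow> v z = 0" and x: "m \<le> Suc (K x)" for v m x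
  proof (cases "x < n")
    case True
    have "W $$ (x, c) * v c = 0" if "c < n" for c using W[OF True that] v[OF that] x by (cases "W $$ (x, c) = 0") auto
    then have "(\<Sum>c<n. W $$ (x, c) * v c) = 0" by (intro sum.neutral) auto
    then show ?thesis by (simp add: mat_ap_def)
  qed (simp add: mat_ap_def)
  have vanish: "(mat_ap n W ^^ k) v = (\<lambda>_. 0)"
    if v: "\<And>z. z < n \<Longrightarrow> k \<le> K z \<Longrightarrow> v z = 0" and supp: "\<And>z. n \<le> z \<Longrightarrow> v z = 0" for v k
  proof -
    have "(mat_ap n W ^^ l) v z = 0" if "k \<le> K z + l" "l \<le> k" for l z
      using that
    proof (induction l arbitrary: z)
      case 0
      then show ?case using v[of z] supp[of z] by (cases "z < n") auto
    next
      case (Suc l)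
      have "mat_ap n W ((mat_ap n W ^^ l) v) z = 0"
        by (rule step[of "k - l"]) (use Suc in auto)
      then show ?case by simp
    qed
    then show ?thesis by (auto simp: fun_eq_iff)
  qed
  show ?thesis
  proof
    assume "K y < k"
    then have "(mat_ap n W ^^ k) (unit_fun y) = (\<lambda>_. 0)" by (intro vanish) (use y in auto)
    moreover have "leads y (unit_fun y)" by (simp add: leads_def)
    ultimately show "killed n W k y" unfolding killed_def by blast
  next
    assume "killed n W k y"
    then obtain v where v: "leads y v" "(mat_ap n W ^^ k) v = (\<lambda>_. 0)" by (auto simp: killed_def)
    show "K y < k"
    proof (rule ccontr)
      assume "\<not> K y < k"
      then have Ky: "k \<le> K y" by simp
      \<comment> \<open>The row of \<open>Suc z\<close> contains \<open>K z + 1\<close> distinct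
        entries, so column numbers stay below \<open>n\<close> and finitely many determinants
        suffice.\<close>
      have Kn: "K z < n" if "z < n" for z
      proof -
        let ?r = "entry_row T (Suc z)"
        have "Suc z \<in> {1..n}" using that by simp
        note c = entry_pos_cell(1,2)[OF T this]
        have "inj_on (\<lambda>c. T ! ?r ! c) {..K z}"
        proof (rule linorder_inj_onI)
          fix a b assume "a < b" "a \<in> {..K z}" "b \<in> {..K z}"
          then show "T ! ?r ! a \<noteq> T ! ?r ! b" using YT_row_less[OF T c(1), of a b] c(2) by simp
        qed auto
        moreover have "(\<lambda>c. T ! ?r ! c) ` {..K z} \<subseteq> {1..n}"
        proof (rule image_subsetI)
          fix a assume "a \<in> {..K z}"
          then show "T ! ?r ! a \<in> {1..n}" using YT_entry_range[OF T, of ?r a] c by simp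
        qed
        ultimately have "card {..K z} \<le> card {1..n}" by (intro card_inj_on_le) auto
        then show ?thesis by simp
      qed
      define v' where "v' = (\<lambda>z. if k \<le> K z \<and> z < n then v z else 0)"
      have supp: "v z = 0" if "n \<le> z" for z using v(1) y that by (auto simp: leads_def)
      have "(mat_ap n W ^^ k) (\<lambda>z. v z - 1 * v' z) = (\<lambda>_. 0)"
        by (rule vanish) (use supp in \<open>auto simp: v'_def\<close>)
      then have v'0: "(mat_ap n W ^^ k) v' = (\<lambda>_. 0)"
        unfolding mat_ap_power_diff_scale v(2) by (simp add: fun_eq_iff)
      have v'sum: "v' = (\<lambda>r. \<Sum>z\<in>{..<n}. v' z * unit_fun z r)"
      proof
        fix r
        have "(\<Sum>z\<in>{..<n}. v' z * unit_fun z r) = (\<Sum>z\<in>{..<n}. if z = r then v' r else 0)"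
          by (rule sum.cong) auto
        also have "\<dots> = v' r" by (simp add: v'_def)
        finally show "v' r = (\<Sum>z\<in>{..<n}. v' z * unit_fun z r)" by (rule sym)
      qed
      have Q: "rank_matrix W k \<in> carrier_mat n n" by (simp add: rank_matrix_def)
      have "rank_matrix W k *\<^sub>v vec n v' = 0\<^sub>v n"
      proof (rule eq_vecI)
        fix z assume "z < dim_vec (0\<^sub>v n)"
        then have z: "z < n" by simp
        have "(rank_matrix W k *\<^sub>v vec n v') $ z = (\<Sum>j<n. rank_matrix W k $$ (z, j) * v' j)"
          using mult_mat_vec_index_sum[OF Q _ z, of "vec n v'"] by (simp add: lessThan_atLeast0)
        also have "\<dots> = 0"
        proof (cases "k \<le> K z")
          case True
          have "(\<Sum>j<n. rank_matrix W k $$ (z, j) * v' j) =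
              (\<Sum>j<n. v' j * (mat_ap n W ^^ k) (unit_fun j) (row_shift k z))"
            by (rule sum.cong) (use z True in \<open>auto simp: rank_matrix_def\<close>)
          also have "\<dots> = (mat_ap n W ^^ k) v' (row_shift k z)"
            by (subst (2) v'sum) (simp only: mat_ap_power_sum)
          finally show ?thesis using v'0 by simp
        next
          case False
          then have "rank_matrix W k $$ (z, j) * v' j = 0" if "j < n" for j
            using z that by (auto simp: rank_matrix_def v'_def)
          then show ?thesis by (intro sum.neutral) auto
        qed
        finally show "(rank_matrix W k *\<^sub>v vec n v') $ z = 0\<^sub>v n $ z" using z by simp
      qed (use Q in simp)
      moreover have "vec n v' $ y \<noteq> 0\<^sub>v n $ y" using y Ky v(1) by (simp add: v'_def leads_def)
      then have "vec n v' \<noteq> 0\<^sub>v n" by metis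
      ultimately have "det (rank_matrix W k) = 0"
        unfolding det_0_iff_vec_prod_zero_field[OF Q] by (intro exI[of _ "vec n v'"] conjI vec_carrier)
      moreover have "k < n" using Ky Kn[OF y] by simp
      ultimately show False using det by blast
    qed
  qed
qed

lemma shift_entry_less: "x < n \<Longrightarrow> y < n \<Longrightarrow> shift_entry x y \<noteq> 0 \<Longrightarrow> x < y \<and> K x < K y"
proof -
  assume xy: "x < n" "y < n" and "shift_entry x y \<noteq> 0"
  then have r: "entry_row T (Suc x) = entry_row T (Suc y)" and c: "K y = Suc (K x)"
    by (auto simp: shift_entry_def split: if_splits)
  have "\<not> Suc y \<le> Suc x"
  proof
    assume "Suc y \<le> Suc x"
    moreover have "x \<noteq> y" using c by auto
    ultimately show False using entry_less_cases[OF T, of "Suc y" "Suc x"] xy r c by auto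
  qed
  then show "x < y \<and> K x < K y" using c by simp
qed

text \<open>In the basis \<open>f\<close>, take the line from \<open>U\<close> at
  \<open>s = 0\<close> to the row shift of \<open>T\<close> at \<open>s = 1\<close>. All its
  matrices raise neither position nor column, and their rank determinants are polynomials in
  \<open>s\<close> that do not vanish at 1. So all but finitely many of them lie in the cell of
  \<open>T\<close>. A polynomial function vanishing on the cell thus has infinitely many zeros along
  the line and vanishes at \<open>s = 0\<close>, that is, at \<open>N\<close>.\<close>

lemma closure_criterion:
  assumes f: "\<And>y. y < n \<Longrightarrow> leads y (f y)" and N: "N \<in> carrier_mat n n"
    and U: "\<And>x y. U x y \<noteq> 0 \<Longrightarrow> x < n \<and> y < n \<and> x < y \<and> K x < K y"
    and NU: "\<And>y. y < n \<Longrightarrow> mat_ap n N (f y) = comb n f (\<lambda>x. U x y)"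
  shows "N \<in> zariski_closure n (geom_cell n T)"
proof -
  define G where "G = mat n n (\<lambda>(r, y). f y r)"
  have G: "G \<in> carrier_mat n n" by (simp add: G_def)
  obtain Gi where Gi: "Gi \<in> carrier_mat n n" "G * Gi = 1\<^sub>m n" "Gi * G = 1\<^sub>m n"
  proof (rule unitriangular_inverse[OF G])
    show "upper_triangular G" using f by (intro upper_triangularI) (auto simp: G_def leads_def)
    show "G $$ (i, i) \<noteq> 0" if "i < n" for i using f[OF that] that by (simp add: G_def leads_def)
  qed
  define W where "W s x y = (if x < n \<and> y < n then (1 - s) * U x y + s * shift_entry x y else 0)" for s x y
  define Wm where "Wm s = mat n n (\<lambda>(x, y). W s x y)" for s
  define M where "M s = G * Wm s * Gi" for s
  have Wm: "Wm s \<in> carrier_mat n n" for s by (simp add: Wm_def)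
  have M: "M s \<in> carrier_mat n n" for s using G Wm[of s] Gi(1) by (simp add: M_def)
  have W_less: "x < y \<and> K x < K y" if "W s x y \<noteq> 0" for s x y
  proof -
    have "x < n" "y < n" "U x y \<noteq> 0 \<or> shift_entry x y \<noteq> 0" using that by (auto simp: W_def split: if_splits)
    then show ?thesis using U shift_entry_less by blast
  qed
  have prod: "(A * B) $$ (r, c) = (\<Sum>z<n. A $$ (r, z) * B $$ (z, c))"
    if "A \<in> carrier_mat n n" "B \<in> carrier_mat n n" "r < n" "c < n" for A B :: "complex mat" and r c
    using that by (simp add: scalar_prod_def lessThan_atLeast0)
  have MW: "mat_ap n (M s) (f y) = comb n f (\<lambda>x. W s x y)" if y: "y < n" for s y
  proof
    fix r
    have MG: "M s * G = G * Wm s"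
    proof -
      have "M s * G = G * Wm s * (Gi * G)"
        unfolding M_def by (rule assoc_mult_mat[OF mult_carrier_mat[OF G Wm] Gi(1) G])
      then show ?thesis using Gi(3) right_mult_one_mat[OF mult_carrier_mat[OF G Wm]] by simp
    qed
    show "mat_ap n (M s) (f y) r = comb n f (\<lambda>x. W s x y) r"
    proof (cases "r < n")
      case True
      have "mat_ap n (M s) (f y) r = (M s * G) $$ (r, y)"
        using prod[OF M G True y] True y by (simp add: mat_ap_def G_def)
      also have "\<dots> = comb n f (\<lambda>x. W s x y) r"
        unfolding MG using prod[OF G Wm True y] True y by (simp add: comb_def G_def Wm_def mult.commute)
      finally show ?thesis .
    next
      case False
      have "W s x y * f x r = 0" if "x < n" for x using f[OF that] that False by (auto simp: leads_def)
      then have "comb n f (\<lambda>x. W s x y) r = 0" unfolding comb_def by (intro sum.neutral) auto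
      then show ?thesis using False by (simp add: mat_ap_def)
    qed
  qed
  have M0: "M 0 = N"
  proof -
    have "N * G = G * Wm 0"
    proof (rule eq_matI)
      fix r y assume "r < dim_row (G * Wm 0)" "y < dim_col (G * Wm 0)"
      then have ry: "r < n" "y < n" using G Wm[of 0] by auto
      have "(N * G) $$ (r, y) = mat_ap n N (f y) r" using prod[OF N G ry] ry by (simp add: mat_ap_def G_def)
      also have "\<dots> = comb n f (\<lambda>x. U x y) r" using NU[OF ry(2)] by simp
      also have "\<dots> = (G * Wm 0) $$ (r, y)"
        using prod[OF G Wm ry] ry by (simp add: comb_def G_def Wm_def W_def mult.commute)
      finally show "(N * G) $$ (r, y) = (G * Wm 0) $$ (r, y)" .
    qed (use N G Wm[of 0] in auto)
    then have "M 0 = N * G * Gi" by (simp add: M_def)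
    also have "\<dots> = N" using assoc_mult_mat[OF N G Gi(1)] Gi(2) right_mult_one_mat[OF N] by simp
    finally show ?thesis .
  qed
  have polyWm: "poly_fun (\<lambda>s. Wm s $$ (x, y))" if "x < n" "y < n" for x y
  proof -
    have "poly_fun (\<lambda>s. (1 + (-1) * s) * U x y + s * shift_entry x y)"
      by (intro poly_fun_add poly_fun_mult poly_fun_const poly_fun_id)
    then show ?thesis using that by (simp add: Wm_def W_def)
  qed
  have polyM: "poly_fun (\<lambda>s. M s $$ (r, c))" if "r < n" "c < n" for r c
  proof -
    have "M s $$ (r, c) = (\<Sum>y<n. (\<Sum>x<n. G $$ (r, x) * Wm s $$ (x, y)) * Gi $$ (y, c))" for s
      unfolding M_def using prod[OF mult_carrier_mat[OF G Wm] Gi(1) that] prod[OF G Wm that(1)] by simp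
    moreover have "poly_fun (\<lambda>s. \<Sum>y<n. (\<Sum>x<n. G $$ (r, x) * Wm s $$ (x, y)) * Gi $$ (y, c))"
      by (intro poly_fun_sum poly_fun_mult poly_fun_const polyWm) auto
    ultimately show ?thesis by simp
  qed
  have Wm1: "Wm 1 = mat n n (\<lambda>(x, y). shift_entry x y)" by (rule eq_matI) (auto simp: Wm_def W_def)
  have "finite {s. det (rank_matrix (Wm s) k) = 0}" for k
  proof (rule poly_fun_finite_zeros[of _ 1])
    show "poly_fun (\<lambda>s. det (rank_matrix (Wm s) k))"
    proof (rule poly_fun_det)
      fix i j assume "i < n" "j < n"
      then show "poly_fun (\<lambda>s. rank_matrix (Wm s) k $$ (i, j))"
        using poly_fun_mat_ap_power[where n = n and M = Wm and k = k and u = "unit_fun j" and r = "row_shift k i", OF polyWm]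
        by (cases "k \<le> K i") (simp_all add: rank_matrix_def poly_fun_const)
    qed (simp add: rank_matrix_def)
    show "det (rank_matrix (Wm 1) k) \<noteq> 0" unfolding Wm1 det_rank_matrix_shift by simp
  qed
  then have bad: "finite (\<Union>k<n. {s. det (rank_matrix (Wm s) k) = 0})" (is "finite ?Bad") by simp
  have cell: "M s \<in> geom_cell n T" if "s \<notin> ?Bad" for s
  proof -
    have "strictly_upper n (M s)"
    proof (rule strictly_upper_conj[where f = f and W = "W s"])
      show "W s x y = 0" if "y \<le> x" for x y using W_less[of s x y] that by (meson not_le)
    qed (use f M MW in auto)
    moreover have "killed n (M s) k y \<longleftrightarrow> K y < k" if y: "y < n" for y k
    proof -
      have "killed n (M s) k y \<longleftrightarrow> killed n (Wm s) k y"
        unfolding Wm_def by (rule killed_conj[where f = f]) (use f M MW y in auto)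
      also have "\<dots> \<longleftrightarrow> K y < k"
      proof (rule killed_iff_col[OF _ _ y])
        show "K a < K b" if "a < n" "b < n" "Wm s $$ (a, b) \<noteq> 0" for a b
          using W_less[of s a b] that by (simp add: Wm_def)
      qed (use \<open>s \<notin> ?Bad\<close> in blast)
      finally show ?thesis .
    qed
    ultimately show ?thesis using geom_cell_iff[OF T] by blast
  qed
  show ?thesis
    unfolding zariski_closure_def
  proof (rule InterI, elim CollectE conjE)
    fix Z assume "zariski_closed n Z" and sub: "geom_cell n T \<subseteq> Z"
    then obtain F where F: "F \<subseteq> mat_poly_fun n" "Z = {N \<in> carrier_mat n n. \<forall>h\<in>F. h N = 0}"
      unfolding zariski_closed_def by blast
    have "h N = 0" if h: "h \<in> F" for h
    proof (rule ccontr)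
      assume "h N \<noteq> 0"
      have "poly_fun (\<lambda>s. h (M s))" by (rule poly_fun_mat_poly_fun[OF _ polyM]) (use F h in auto)
      then have "finite {s. h (M s) = 0}"
        by (rule poly_fun_finite_zeros[of _ 0]) (use \<open>h N \<noteq> 0\<close> M0 in simp)
      moreover have "- ?Bad \<subseteq> {s. h (M s) = 0}" using cell sub h F(2) by blast
      ultimately have "finite (- ?Bad)" using finite_subset by blast
      then have "finite (UNIV :: complex set)" using bad by (metis Compl_partition finite_Un)
      then show False using infinite_UNIV_char_0 by blast
    qed
    then show "N \<in> Z" using N F(2) by blast
  qed
qed

end

section \<open>The geometric order\<close>

lemma leads_mat_ap:
  assumes N: "strictly_upper n N" and y: "Suc y < n" and v: "leads (Suc y) v" and nz: "N $$ (y, Suc y) \<noteq> 0"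
  shows "leads y (mat_ap n N v)"
proof -
  have "mat_ap n N v y = N $$ (y, Suc y) * v (Suc y)"
    by (rule strictly_upper_superdiagonal[OF N _ y]) (use v in \<open>simp add: leads_def\<close>)
  moreover have "mat_ap n N v j = 0" if "y < j" for j
    using strictly_upper_support[OF N, of "Suc y" v j] v that by (auto simp: leads_def)
  ultimately show ?thesis using v nz by (simp add: leads_def)
qed

text \<open>With a non-zero superdiagonal entry, \<open>N\<close> maps a vector ending at
  \<open>Suc y\<close> to one ending at \<open>y\<close>, which is killed by one power less. This
  puts the entry \<open>Suc y\<close> strictly to the left of \<open>Suc (Suc y)\<close>.\<close>

lemma geom_cell_superdiagonal:
  assumes S: "S \<in> YT n" and N: "N \<in> geom_cell n S" and i: "Suc y < n" and desc: "\<not> ascent S (Suc y)"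
  shows "N $$ (y, Suc y) = 0"
proof (rule ccontr)
  assume nz: "N $$ (y, Suc y) \<noteq> 0"
  let ?c = "entry_col S (Suc (Suc y))"
  have su: "strictly_upper n N" and kl: "\<And>y k. y < n \<Longrightarrow> killed n N k y \<longleftrightarrow> entry_col S (Suc y) < k"
    using N geom_cell_iff[OF S] by blast+
  have "killed n N (Suc ?c) (Suc y)" using kl[OF i] by simp
  then obtain v where v: "leads (Suc y) v" "(mat_ap n N ^^ Suc ?c) v = (\<lambda>_. 0)" by (auto simp: killed_def)
  have "(mat_ap n N ^^ ?c) (mat_ap n N v) = (\<lambda>_. 0)" using v(2) by (simp add: funpow_swap1)
  then have "killed n N ?c y" using leads_mat_ap[OF su i v(1) nz] by (auto simp: killed_def)
  then show False using kl[of y ?c] i desc by (simp add: ascent_def)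
qed

text \<open>A concrete point of each cell; for \<open>row_canonical mu\<close> its superdiagonal
  entries within the rows are non-zero, which later separates closures.\<close>

lemma shift_in_geom_cell:
  assumes T: "T \<in> YT n" shows "mat n n (\<lambda>(x, y). shift_entry T x y) \<in> geom_cell n T"
  unfolding geom_cell_iff[OF T]
proof (intro conjI allI impI)
  let ?L = "mat n n (\<lambda>(x, y). shift_entry T x y)"
  have less: "x < y \<and> entry_col T (Suc x) < entry_col T (Suc y)" if "x < n" "y < n" "shift_entry T x y \<noteq> 0" for x y
    using shift_entry_less[OF T that] .
  show "strictly_upper n ?L" using less by (force simp: strictly_upper_def not_less[symmetric])
  fix y k assume y: "y < n"
  show "killed n ?L k y \<longleftrightarrow> entry_col T (Suc y) < k"
  proof (rule killed_iff_col[OF T _ _ y])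
    show "entry_col T (Suc a) < entry_col T (Suc b)" if "a < n" "b < n" "?L $$ (a, b) \<noteq> 0" for a b
      using less[of a b] that by simp
    show "det (rank_matrix n T ?L k) \<noteq> 0" for k unfolding det_rank_matrix_shift[OF T] by simp
  qed
qed

lemma zariski_closure_subset: "V \<subseteq> zariski_closure n V"
  by (auto simp: zariski_closure_def)

lemma zariski_closure_least: "zariski_closed n Z \<Longrightarrow> V \<subseteq> Z \<Longrightarrow> zariski_closure n V \<subseteq> Z"
  unfolding zariski_closure_def by blast

lemma zariski_closure_mono_closure:
  "V \<subseteq> zariski_closure n V' \<Longrightarrow> zariski_closure n V \<subseteq> zariski_closure n V'"
  unfolding zariski_closure_def by blast

lemma row_canonical_indexE:
  assumes mu: "is_partition n mu" and y: "y < n"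
  obtains b c where "b < length mu" "c < mu ! b" "y = offset mu b + c"
    "entry_pos (row_canonical mu) (Suc y) = (b, c)"
  using row_canonical_posE[OF mu, of "Suc y"] y by auto

lemma row_canonical_index_less:
  assumes mu: "is_partition n mu" and "b < length mu" "c < mu ! b"
  shows "offset mu b + c < n"
proof -
  have "(b, c) \<in> cells (row_canonical mu)" using assms by simp
  from YT_entry_range[OF row_canonical_YT[OF mu] this] show ?thesis
    using row_canonical_entry[OF assms(2,3)] by simp
qed

lemma row_canonical_ascentE:
  assumes mu: "is_partition n mu" and y: "Suc y < n" and asc: "ascent (row_canonical mu) (Suc y)"
  obtains b c where "b < length mu" "Suc c < mu ! b" "y = offset mu b + c"
proof -
  let ?C = "row_canonical mu"
  have "entry_row ?C (Suc (Suc y)) \<le> entry_row ?C (Suc y)"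
    using ascent_iff_row[OF row_canonical_YT[OF mu], of "Suc y"] asc y by auto
  moreover have "entry_row ?C (Suc y) \<le> entry_row ?C (Suc (Suc y))"
    by (rule row_canonical_row_mono[OF mu]) (use y in auto)
  moreover obtain b c where bc: "b < length mu" "c < mu ! b" "y = offset mu b + c" "entry_pos ?C (Suc y) = (b, c)"
    using row_canonical_indexE[OF mu, of y] y by auto
  moreover obtain b' c' where bc': "b' < length mu" "c' < mu ! b'" "Suc y = offset mu b' + c'"
    "entry_pos ?C (Suc (Suc y)) = (b', c')"
    using row_canonical_indexE[OF mu y] by blast
  ultimately have "b' = b" by simp
  then show thesis using that[of b c] bc bc' by simp
qed

text \<open>The superdiagonal entries inside the blocks do not vanish on the cell of \<open>row_canonical mu\<close>:
  otherwise a vector ending at position \<open>y + 1\<close> would be killed one power too early, since what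
  \<open>N\<close> maps it to can be corrected by images of earlier vectors; here the earlier blocks are at least
  as long as the current one.\<close>

lemma row_canonical_superdiagonal:
  assumes mu: "is_partition n mu" and N: "N \<in> geom_cell n (row_canonical mu)"
    and "b < length mu" "Suc c < mu ! b"
  shows "N $$ (offset mu b + c, Suc (offset mu b + c)) \<noteq> 0"
  using assms(3,4)
proof (induction "offset mu b + c" arbitrary: b c rule: less_induct)
  case less
  let ?C = "row_canonical mu" and ?A = "mat_ap n N"
  define y where "y = offset mu b + c"
  have su: "strictly_upper n N" and kl: "\<And>y k. y < n \<Longrightarrow> killed n N k y \<longleftrightarrow> entry_col ?C (Suc y) < k"
    using N geom_cell_iff[OF row_canonical_YT[OF mu]] by blast+
  have sy: "Suc y < n" using row_canonical_index_less[OF mu less.prems] by (simp add: y_def)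
  have Ky: "entry_col ?C (Suc (Suc y)) = Suc c"
    using row_canonical_pos[OF mu less.prems] by (simp add: y_def)
  \<comment> \<open>A vector supported before position \<open>y\<close> and killed by the power
    \<open>c + 1\<close> becomes killed by the power \<open>c\<close> after subtracting the image of
    a vector supported up to \<open>y\<close>. The induction on the support bound \<open>i\<close>
    cancels the last coordinate of \<open>v\<close> by some \<open>z\<close>; in
    \<open>reduce\<close>, the assumption \<open>fin\<close> says how the multiple of
    \<open>z\<close> is absorbed.\<close>
  have correct: "\<exists>u. (\<forall>j\<ge>Suc y. u j = 0) \<and> (?A ^^ c) (\<lambda>r. v r - 1 * ?A u r) = (\<lambda>_. 0)"
    if "i \<le> y" "\<And>j. i \<le> j \<Longrightarrow> v j = 0" "(?A ^^ Suc c) v = (\<lambda>_. 0)" for i v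
    using that
  proof (induction i arbitrary: v)
    case 0
    then have "v = (\<lambda>_. 0)" by auto
    then show ?case by (intro exI[of _ "\<lambda>_. 0"]) simp
  next
    case (Suc i)
    let ?G = ?case
    have reduce: ?case
      if z: "z i \<noteq> 0" "\<And>j. i < j \<Longrightarrow> z j = 0" "(?A ^^ Suc c) z = (\<lambda>_. 0)"
        and fin: "\<And>u a. (\<forall>j\<ge>Suc y. u j = 0) \<Longrightarrow> (?A ^^ c) (\<lambda>r. (v r - a * z r) - 1 * ?A u r) = (\<lambda>_. 0) \<Longrightarrow> ?case" for z
    proof -
      define a where "a = v i / z i"
      have "v j - a * z j = 0" if "i \<le> j" for j
        using that Suc.prems(2)[of j] z(1,2) by (cases "j = i") (auto simp: a_def)
      moreover have "(?A ^^ Suc c) (\<lambda>r. v r - a * z r) = (\<lambda>_. 0)"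
        unfolding mat_ap_power_diff_scale z(3) Suc.prems(3) by simp
      ultimately obtain u where "\<forall>j\<ge>Suc y. u j = 0" "(?A ^^ c) (\<lambda>r. (v r - a * z r) - 1 * ?A u r) = (\<lambda>_. 0)"
        using Suc.IH[of "\<lambda>r. v r - a * z r"] Suc.prems(1) by auto
      then show ?case by (rule fin)
    qed
    show ?case
    proof (cases "v i = 0")
      case True
      have "v j = 0" if "i \<le> j" for j using Suc.prems(2)[of j] True that by (cases "j = i") auto
      then show ?thesis using Suc by simp
    next
      case False
      have iy: "i < y" and i_n: "i < n" using Suc.prems(1) sy by auto
      obtain b' c' where bc': "b' < length mu" "c' < mu ! b'" "i = offset mu b' + c'" "entry_pos ?C (Suc i) = (b', c')"
        using row_canonical_indexE[OF mu i_n] by blast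
      have "leads i v" using False Suc.prems(2) by (auto simp: leads_def)
      then have "killed n N (Suc c) i" using Suc.prems(3) unfolding killed_def by blast
      then have c': "c' \<le> c" using kl[OF i_n] bc'(4) by simp
      have rows: "entry_row ?C (Suc i) \<le> entry_row ?C (Suc y)"
        by (rule row_canonical_row_mono[OF mu]) (use iy sy in auto)
      have "entry_pos ?C (Suc y) = (b, c)" using row_canonical_pos[OF mu less.prems(1)] less.prems(2) by (simp add: y_def)
      then have "b' \<le> b" using rows bc'(4) by simp
      show ?thesis
      proof (cases "b' = b")
        case True
        \<comment> \<open>Within the current block, \<open>z\<close> can be chosen killed already by
          the power \<open>c\<close>, so it needs no correction.\<close>
        then have "c' < c" using iy bc'(3) by (simp add: y_def)
        then have "killed n N c i" using kl[OF i_n] bc'(4) by simp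
        then obtain z where z: "leads i z" "(?A ^^ c) z = (\<lambda>_. 0)" by (auto simp: killed_def)
        show ?thesis
        proof (rule reduce)
          show "z i \<noteq> 0" "\<And>j. i < j \<Longrightarrow> z j = 0" using z(1) by (auto simp: leads_def)
          show "(?A ^^ Suc c) z = (\<lambda>_. 0)" using z(2) by simp
          fix u a assume u: "\<forall>j\<ge>Suc y. u j = 0" "(?A ^^ c) (\<lambda>r. (v r - a * z r) - 1 * ?A u r) = (\<lambda>_. 0)"
          have "(?A ^^ c) (\<lambda>r. v r - 1 * ?A u r) r = 0" for r
            using fun_cong[OF u(2), of r] unfolding mat_ap_power_diff_scale z(2) by simp
          then show ?G using u(1) by blast
        qed
      next
        case False
        \<comment> \<open>In an earlier block, which is at least as long, position \<open>i\<close>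
          has a successor in its row. By induction the superdiagonal entry there is non-zero, so the
          vector ending at \<open>i\<close> can be taken to be an image under
          \<open>N\<close>.\<close>
        then have "mu ! b \<le> mu ! b'" using partition_nth_mono[OF mu _ less.prems(1), of b'] \<open>b' \<le> b\<close> by simp
        then have sc': "Suc c' < mu ! b'" using c' less.prems(2) by simp
        have nz: "N $$ (i, Suc i) \<noteq> 0"
          using less.hyps[OF _ bc'(1) sc'] iy bc'(3) by (simp add: y_def)
        have si: "Suc i < n" using iy sy by simp
        have "entry_col ?C (Suc (Suc i)) = Suc c'" using row_canonical_pos[OF mu bc'(1) sc'] bc'(3) by simp
        then have "killed n N (Suc (Suc c')) (Suc i)" using kl[OF si] by simp
        then obtain z where z: "leads (Suc i) z" "(?A ^^ Suc (Suc c')) z = (\<lambda>_. 0)" by (auto simp: killed_def)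
        have zc: "(?A ^^ Suc (Suc c)) z = (\<lambda>_. 0)" by (rule mat_ap_power_mono[OF z(2)]) (use c' in simp)
        have lz: "leads i (?A z)" by (rule leads_mat_ap[OF su si z(1) nz])
        show ?thesis
        proof (rule reduce)
          show "?A z i \<noteq> 0" "\<And>j. i < j \<Longrightarrow> ?A z j = 0" using lz by (auto simp: leads_def)
          show "(?A ^^ Suc c) (?A z) = (\<lambda>_. 0)" using zc by (simp add: funpow_swap1)
          fix u a assume u: "\<forall>j\<ge>Suc y. u j = 0" "(?A ^^ c) (\<lambda>r. (v r - a * ?A z r) - 1 * ?A u r) = (\<lambda>_. 0)"
          let ?u = "\<lambda>r. u r - (- a) * z r"
          have "(\<lambda>r. v r - 1 * ?A ?u r) = (\<lambda>r. (v r - a * ?A z r) - 1 * ?A u r)"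
            unfolding mat_ap_diff_scale by (rule ext) simp
          moreover have "\<forall>j\<ge>Suc y. ?u j = 0" using u(1) z(1) iy by (auto simp: leads_def)
          ultimately show ?G using u(2) by (intro exI[of _ ?u]) simp
        qed
      qed
    qed
  qed
  show ?case
  proof (rule ccontr)
    assume "\<not> ?thesis"
    then have zero: "N $$ (y, Suc y) = 0" by (simp add: y_def)
    have "killed n N (Suc (Suc c)) (Suc y)" using kl[OF sy] Ky by simp
    then obtain w where w: "leads (Suc y) w" "(?A ^^ Suc (Suc c)) w = (\<lambda>_. 0)" by (auto simp: killed_def)
    have "?A w j = 0" if "y \<le> j" for j
    proof (cases "j = y")
      case True
      have "?A w y = N $$ (y, Suc y) * w (Suc y)"
        by (rule strictly_upper_superdiagonal[OF su _ sy]) (use w(1) in \<open>simp add: leads_def\<close>)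
      then show ?thesis using zero True by simp
    next
      case False
      then show ?thesis using strictly_upper_support[OF su, of "Suc y" w j] w(1) that by (auto simp: leads_def)
    qed
    moreover have "(?A ^^ Suc c) (?A w) = (\<lambda>_. 0)" using w(2) by (simp add: funpow_swap1)
    ultimately obtain u where u: "\<forall>j\<ge>Suc y. u j = 0" "(?A ^^ c) (\<lambda>r. ?A w r - 1 * ?A u r) = (\<lambda>_. 0)"
      using correct[of y "?A w"] by blast
    have "(?A ^^ Suc c) (\<lambda>r. w r - 1 * u r) = (\<lambda>_. 0)"
      using u(2) unfolding funpow_Suc_right comp_apply mat_ap_diff_scale .
    moreover have "leads (Suc y) (\<lambda>r. w r - 1 * u r)" using w(1) u(1) by (auto simp: leads_def)
    ultimately have "killed n N (Suc c) (Suc y)" unfolding killed_def by blast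
    then show False using kl[OF sy] Ky by simp
  qed
qed

text \<open>For each row of \<open>row_canonical mu\<close> take a vector ending at the last
  position of the row and killed by the power equal to the row length, and apply \<open>N\<close>
  repeatedly. The non-vanishing superdiagonal entries make these images end at the successive
  positions of the row, so they form a triangular Jordan basis. In it \<open>N\<close> is the row
  shift of \<open>row_canonical mu\<close>, whose non-zero entries join consecutive members of a
  row; these lie in increasing columns of \<open>S\<close>, as the closure criterion
  demands.\<close>

lemma row_canonical_cell_closure:
  assumes mu: "is_partition n mu" and S: "S \<in> compat_tableaux n mu"
  shows "geom_cell n (row_canonical mu) \<subseteq> zariski_closure n (geom_cell n S)"
proof
  let ?C = "row_canonical mu"
  fix N assume N: "N \<in> geom_cell n ?C"
  let ?A = "mat_ap n N"
  have SY: "S \<in> YT n" using S by (simp add: compat_tableaux_def)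
  have su: "strictly_upper n N" and kl: "\<And>y k. y < n \<Longrightarrow> killed n N k y \<longleftrightarrow> entry_col ?C (Suc y) < k"
    using N geom_cell_iff[OF row_canonical_YT[OF mu]] by blast+
  define h where "h y = (SOME v. leads y v \<and> (?A ^^ Suc (entry_col ?C (Suc y))) v = (\<lambda>_. 0))" for y
  have h: "leads y (h y) \<and> (?A ^^ Suc (entry_col ?C (Suc y))) (h y) = (\<lambda>_. 0)" if "y < n" for y
  proof -
    have "killed n N (Suc (entry_col ?C (Suc y))) y" using kl[OF that] by simp
    then show ?thesis unfolding h_def killed_def by (rule someI_ex)
  qed
  \<comment> \<open>The distance from \<open>y\<close> to the end of its row, from where
    \<open>f\<close> walks back by applying \<open>N\<close>.\<close>
  define d where "d y = mu ! entry_row ?C (Suc y) - 1 - entry_col ?C (Suc y)" for y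
  define f where "f y = (?A ^^ d y) (h (y + d y))" for y
  have pos: "entry_pos ?C (Suc (offset mu b + c)) = (b, c)" if "b < length mu" "c < mu ! b" for b c
    by (rule row_canonical_pos[OF mu that])
  have f_eq: "f (offset mu b + c) = (?A ^^ (mu ! b - 1 - c)) (h (offset mu b + (mu ! b - 1)))"
    if "b < length mu" "c < mu ! b" for b c
  proof -
    have eq: "offset mu b + c + (mu ! b - 1 - c) = offset mu b + (mu ! b - 1)" using that by simp
    then show ?thesis unfolding f_def d_def pos[OF that] by (simp only: fst_conv snd_conv eq)
  qed
  have lead: "leads (offset mu b + (mu ! b - 1 - k)) ((?A ^^ k) (h (offset mu b + (mu ! b - 1))))"
    if b: "b < length mu" and k: "k < mu ! b" for b k
    using k
  proof (induction k)
    case 0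
    have "offset mu b + (mu ! b - 1) < n" by (rule row_canonical_index_less[OF mu b]) (use 0 in simp)
    then show ?case using h by simp
  next
    case (Suc k)
    let ?y = "offset mu b + (mu ! b - 1 - Suc k)"
    have y: "Suc ?y = offset mu b + (mu ! b - 1 - k)" using Suc.prems by simp
    have "Suc ?y < n" unfolding y by (rule row_canonical_index_less[OF mu b]) (use Suc.prems in simp)
    moreover have "leads (Suc ?y) ((?A ^^ k) (h (offset mu b + (mu ! b - 1))))"
      unfolding y using Suc by simp
    moreover have "N $$ (?y, Suc ?y) \<noteq> 0"
      by (rule row_canonical_superdiagonal[OF mu N b]) (use Suc.prems in simp)
    ultimately show ?case using leads_mat_ap[OF su] by simp
  qed
  have fl: "leads y (f y)" if y: "y < n" for y
  proof -
    obtain b c where bc: "b < length mu" "c < mu ! b" "y = offset mu b + c"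
      using row_canonical_indexE[OF mu y] by blast
    show ?thesis
      unfolding bc(3) f_eq[OF bc(1,2)] using lead[OF bc(1), of "mu ! b - 1 - c"] bc(2) by simp
  qed
  define U where "U x y = (if y < n \<and> y = Suc x \<and> entry_row ?C (Suc x) = entry_row ?C (Suc y) then 1 else 0 :: complex)" for x y
  show "N \<in> zariski_closure n (geom_cell n S)"
  proof (rule closure_criterion[OF SY fl])
    show "N \<in> carrier_mat n n" using su by (simp add: strictly_upper_def)
    fix x y assume "U x y \<noteq> 0"
    then have xy: "y < n" "y = Suc x" and row: "entry_row ?C (Suc x) = entry_row ?C (Suc y)"
      by (auto simp: U_def split: if_splits)
    have "entry_col S (Suc x) < entry_col S (Suc y)"
      by (rule compat_tableaux_col_less[OF mu S _ _ _ row]) (use xy in auto)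
    then show "x < n \<and> y < n \<and> x < y \<and> entry_col S (Suc x) < entry_col S (Suc y)" using xy by simp
  next
    fix y assume y: "y < n"
    obtain b c where bc: "b < length mu" "c < mu ! b" "y = offset mu b + c" "entry_pos ?C (Suc y) = (b, c)"
      using row_canonical_indexE[OF mu y] by blast
    show "?A (f y) = comb n f (\<lambda>x. U x y)"
    proof (cases c)
      case 0
      have "U x y = 0" for x
      proof (rule ccontr)
        assume "U x y \<noteq> 0"
        then have x: "y = Suc x" and row: "entry_row ?C (Suc x) = entry_row ?C (Suc y)"
          by (auto simp: U_def split: if_splits)
        have "entry_col ?C (Suc x) < entry_col ?C (Suc y)"
        proof -
          have "ascent ?C (Suc x)"
            by (rule row_canonical_ascent[OF mu _ _ row]) (use x y in auto)
          then show ?thesis using x by (simp add: ascent_def)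
        qed
        then show False using bc(4) 0 by simp
      qed
      moreover have "?A (f y) = (\<lambda>_. 0)"
      proof -
        have e: "offset mu b + (mu ! b - 1) < n" by (rule row_canonical_index_less[OF mu bc(1)]) (use bc(2) in simp)
        have "entry_col ?C (Suc (offset mu b + (mu ! b - 1))) = mu ! b - 1"
          using pos[OF bc(1), of "mu ! b - 1"] bc(2) by simp
        then have "(?A ^^ Suc (mu ! b - 1)) (h (offset mu b + (mu ! b - 1))) = (\<lambda>_. 0)" using h[OF e] by simp
        moreover have "f y = (?A ^^ (mu ! b - 1)) (h (offset mu b + (mu ! b - 1)))"
          using f_eq[OF bc(1), of 0] bc(2,3) 0 by simp
        ultimately show ?thesis by simp
      qed
      ultimately show ?thesis by (simp add: comb_def)
    next
      case (Suc c')
      have c': "c' < mu ! b" and x: "y = Suc (offset mu b + c')" using bc Suc by auto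
      let ?x = "offset mu b + c'"
      have U: "U z y = (if z = ?x then 1 else 0)" for z
        using y x pos[OF bc(1) c'] bc(4) by (auto simp: U_def)
      have "comb n f (\<lambda>x. U x y) r = (\<Sum>z<n. if z = ?x then f ?x r else 0)" for r
        unfolding comb_def by (rule sum.cong) (auto simp: U)
      then have "comb n f (\<lambda>x. U x y) = f ?x" using x y by (intro ext) simp
      moreover have "f ?x = ?A (f y)"
      proof -
        have "mu ! b - 1 - c' = Suc (mu ! b - 1 - c)" using bc(2) Suc by simp
        then show ?thesis unfolding f_eq[OF bc(1) c'] bc(3) f_eq[OF bc(1,2)] by simp
      qed
      ultimately show ?thesis by simp
    qed
  qed
qed

text \<open>Columns of the one-row tableau increase with the entries, so every strictly upper
  triangular matrix meets the closure criterion in the standard basis.\<close>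

lemma geom_le_one_row:
  assumes n: "n \<ge> 1" and T: "T \<in> YT n" shows "geom_le n (one_row n) T"
proof -
  have O: "one_row n \<in> YT n" using one_row_in_compat[OF n] by (auto simp: compat_tableaux_def)
  have mono: "entry_col (one_row n) (Suc x) < entry_col (one_row n) (Suc y)" if "x < y" "y < n" for x y
  proof (rule less_chain[where f = "entry_col (one_row n)"])
    fix i assume "Suc x \<le> i" "i < Suc y"
    then have "i \<in> {1..<n}" using that by auto
    from one_row_ascent[OF n this] show "entry_col (one_row n) i < entry_col (one_row n) (Suc i)"
      by (simp add: ascent_def)
  qed (use that in simp)
  have "geom_cell n T \<subseteq> zariski_closure n (geom_cell n (one_row n))"
  proof
    fix N assume "N \<in> geom_cell n T"
    then have su: "strictly_upper n N" using geom_cell_iff[OF T] by blast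
    let ?U = "\<lambda>x y. if x < n \<and> y < n then N $$ (x, y) else 0"
    show "N \<in> zariski_closure n (geom_cell n (one_row n))"
    proof (rule closure_criterion[OF O, where f = unit_fun and U = ?U])
      show "leads y (unit_fun y)" for y by (simp add: leads_def)
      show "N \<in> carrier_mat n n" using su by (simp add: strictly_upper_def)
      show "x < n \<and> y < n \<and> x < y \<and> entry_col (one_row n) (Suc x) < entry_col (one_row n) (Suc y)"
        if "?U x y \<noteq> 0" for x y
      proof -
        have xy: "x < n" "y < n" "N $$ (x, y) \<noteq> 0" using that by (auto split: if_splits)
        then have "x < y" using su unfolding strictly_upper_def by (meson not_le)
        then show ?thesis using xy mono by blast
      qed
      show "mat_ap n N (unit_fun y) = comb n unit_fun (\<lambda>x. ?U x y)" if y: "y < n" for y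
      proof
        fix r
        have "(\<Sum>c<n. N $$ (r, c) * unit_fun y c) = (\<Sum>c<n. if c = y then N $$ (r, y) else 0)"
          by (rule sum.cong) auto
        moreover have "comb n unit_fun (\<lambda>x. ?U x y) r = (\<Sum>z<n. if z = r then ?U r y else 0)"
          unfolding comb_def by (rule sum.cong) auto
        ultimately show "mat_ap n N (unit_fun y) r = comb n unit_fun (\<lambda>x. ?U x y) r"
          using y by (simp add: mat_ap_def)
      qed
    qed
  qed
  then show ?thesis unfolding geom_le_def using O T zariski_closure_mono_closure by blast
qed

lemma interval_geom_le:
  assumes n: "n \<ge> 1" and mu: "is_partition n mu"
  shows "interval n (geom_le n) (one_row n) (row_canonical mu) = compat_tableaux n mu"
proof (intro equalityI subsetI)
  let ?C = "row_canonical mu"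
  note CY = row_canonical_YT[OF mu]
  fix T assume "T \<in> interval n (geom_le n) (one_row n) ?C"
  then have T: "T \<in> YT n" and le: "zariski_closure n (geom_cell n ?C) \<subseteq> zariski_closure n (geom_cell n T)"
    by (auto simp: interval_def geom_le_def)
  have "ascent T i" if i: "i \<in> {1..<n}" and asc: "ascent ?C i" for i
  proof (rule ccontr)
    assume nasc: "\<not> ascent T i"
    obtain y where y: "i = Suc y" "Suc y < n" using i by (cases i) auto
    obtain b c where bc: "b < length mu" "Suc c < mu ! b" "y = offset mu b + c"
      using row_canonical_ascentE[OF mu y(2)] asc y(1) by blast
    \<comment> \<open>The vanishing of this superdiagonal entry is a closed condition. It holds on
      the cell of \<open>T\<close>, but the row shift of \<open>?C\<close> violates it.\<close>
    let ?Z = "{N \<in> carrier_mat n n. \<forall>h\<in>{\<lambda>N. N $$ (y, Suc y)}. h N = (0 :: complex)}"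
    have "zariski_closed n ?Z"
      unfolding zariski_closed_def
      by (rule exI[of _ "{\<lambda>N. N $$ (y, Suc y)}"]) (use y(2) in \<open>auto intro: mat_poly_fun.entry\<close>)
    moreover have "geom_cell n T \<subseteq> ?Z"
      using geom_cell_superdiagonal[OF T _ y(2)] nasc y(1) by (auto simp: geom_cell_def)
    ultimately have "zariski_closure n (geom_cell n T) \<subseteq> ?Z" by (rule zariski_closure_least)
    then have Z: "zariski_closure n (geom_cell n ?C) \<subseteq> ?Z" by (rule subset_trans[OF le])
    have "mat n n (\<lambda>(x, y). shift_entry ?C x y) \<in> zariski_closure n (geom_cell n ?C)"
      by (rule subsetD[OF zariski_closure_subset shift_in_geom_cell[OF CY]])
    then have "mat n n (\<lambda>(x, y). shift_entry ?C x y) \<in> ?Z" by (rule subsetD[OF Z])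
    then have "shift_entry ?C y (Suc y) = 0" using y(2) by simp
    moreover have "entry_pos ?C (Suc y) = (b, c)" "entry_pos ?C (Suc (Suc y)) = (b, Suc c)"
      using row_canonical_pos[OF mu bc(1), of c] row_canonical_pos[OF mu bc(1,2)] bc(2,3) by simp_all
    ultimately show False by (simp add: shift_entry_def[OF CY])
  qed
  then show "T \<in> compat_tableaux n mu" using T by (simp add: compat_tableaux_def)
next
  fix T assume T: "T \<in> compat_tableaux n mu"
  then have TY: "T \<in> YT n" by (simp add: compat_tableaux_def)
  have "geom_le n T (row_canonical mu)"
    unfolding geom_le_def
    using TY row_canonical_YT[OF mu] zariski_closure_mono_closure[OF row_canonical_cell_closure[OF mu T]] by blast
  then show "T \<in> interval n (geom_le n) (one_row n) (row_canonical mu)"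
    using TY geom_le_one_row[OF n TY] by (simp add: interval_def)
qed

section \<open>Standardization\<close>

abbreviation entry_at :: "tableau \<Rightarrow> nat \<times> nat \<Rightarrow> nat" where
  "entry_at T p \<equiv> T ! fst p ! snd p"

definition cell_list :: "tableau \<Rightarrow> (nat \<times> nat) list" where
  "cell_list T = concat (map (\<lambda>r. map (Pair r) [0..<length (T ! r)]) [0..<length T])"

lemma set_cell_list: "set (cell_list T) = cells T"
  by (auto simp: cell_list_def cells_def)

lemma distinct_cell_list: "distinct (cell_list T)"
proof -
  have "distinct (concat (map (\<lambda>r. map (Pair r) [0..<f r]) [0..<k]))" for f :: "nat \<Rightarrow> nat" and k :: nat
    by (induction k) (auto simp: distinct_map inj_on_def)
  then show ?thesis by (simp add: cell_list_def)
qed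

lemma map_cell_list: "map (entry_at T) (cell_list T) = concat T"
proof -
  have "map (entry_at T) (cell_list T) = concat (map (\<lambda>r. map ((!) (T ! r)) [0..<length (T ! r)]) [0..<length T])"
    unfolding cell_list_def by (simp add: map_concat comp_def)
  also have "\<dots> = concat (map ((!) T) [0..<length T])" by (simp only: map_nth)
  finally show ?thesis by (simp only: map_nth)
qed

lemma finite_cells [simp]: "finite (cells T)"
  using set_cell_list[of T] by (metis List.finite_set)

lemma set_concat_cells: "set (concat T) = entry_at T ` cells T"
  using map_cell_list[of T] set_cell_list[of T] by (metis set_map)

lemma card_cells: "card (cells T) = length (concat T)"
  using distinct_card[OF distinct_cell_list[of T]] map_cell_list[of T] set_cell_list[of T] by (metis length_map)

lemma count_list_distinct:
  assumes "distinct xs" shows "count_list (map f xs) v = card {x \<in> set xs. f x = v}"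
proof -
  have "count_list (map f xs) v = length (filter (\<lambda>x. f x = v) xs)" by (induction xs) auto
  also have "\<dots> = card (set (filter (\<lambda>x. f x = v) xs))" using distinct_card[OF distinct_filter[OF assms]] by simp
  finally show ?thesis by simp
qed

lemma count_list_cells: "count_list (concat T) v = card {p \<in> cells T. entry_at T p = v}"
  using count_list_distinct[OF distinct_cell_list, of "entry_at T" T v]
  by (simp only: map_cell_list set_cell_list)

lemma shape_eqD:
  assumes "shape S = shape T"
  shows "length S = length T" "r < length T \<Longrightarrow> length (S ! r) = length (T ! r)"
proof -
  show l: "length S = length T" using arg_cong[OF assms, of length] by (simp add: shape_def)
  show "length (S ! r) = length (T ! r)" if "r < length T"
    using arg_cong[OF assms, of "\<lambda>x. x ! r"] that l by (simp add: shape_def)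
qed

lemma cells_shape_cong: "shape S = shape T \<Longrightarrow> cells S = cells T"
  using shape_eqD[of S T] by (auto simp: cells_def)

lemma tableau_eqI:
  assumes sh: "shape S = shape T" and eq: "\<And>p. p \<in> cells T \<Longrightarrow> entry_at S p = entry_at T p"
  shows "S = T"
proof (rule nth_equalityI)
  show l: "length S = length T" by (rule shape_eqD[OF sh])
  fix r assume r: "r < length S"
  then have lr: "length (S ! r) = length (T ! r)" using shape_eqD[OF sh] by simp
  show "S ! r = T ! r"
  proof (rule nth_equalityI[OF lr])
    show "S ! r ! c = T ! r ! c" if "c < length (S ! r)" for c
      using eq[of "(r, c)"] that r l lr by simp
  qed
qed

definition rank :: "('a \<Rightarrow> 'a \<Rightarrow> bool) \<Rightarrow> 'a set \<Rightarrow> 'a \<Rightarrow> nat" where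
  "rank R A p = card {q \<in> A. R q p}"

lemma rank_less:
  assumes "finite A" "transp R" "irreflp R" "p \<in> A" "R p q"
  shows "rank R A p < rank R A q"
  unfolding rank_def
proof (rule psubset_card_mono)
  show "finite {r \<in> A. R r q}" using assms(1) by simp
  show "{r \<in> A. R r p} \<subset> {r \<in> A. R r q}"
    using assms(4,5) transpD[OF assms(2) _ assms(5)] irreflpD[OF assms(3)] by blast
qed

lemma rank_bij_betw:
  assumes fin: "finite A" and tr: "transp R" and irr: "irreflp R" and tot: "totalp_on A R"
  shows "bij_betw (rank R A) A {..<card A}"
proof (rule bij_betw_imageI)
  show inj: "inj_on (rank R A) A"
  proof (rule inj_onI, rule ccontr)
    fix p q assume pq: "p \<in> A" "q \<in> A" "rank R A p = rank R A q" "p \<noteq> q"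
    then have "R p q \<or> R q p" by (intro totalp_onD[OF tot])
    then show False using rank_less[OF fin tr irr] pq by fastforce
  qed
  have "rank R A p < card A" if "p \<in> A" for p
    unfolding rank_def by (rule psubset_card_mono) (use fin irreflpD[OF irr] that in auto)
  then have "rank R A ` A \<subseteq> {..<card A}" by auto
  then show "rank R A ` A = {..<card A}"
    by (intro card_subset_eq) (simp_all add: card_image[OF inj])
qed

text \<open>Equal entries are numbered from left to right; this is the order in which a
  semistandard tableau is standardized.\<close>

definition fill_less :: "tableau \<Rightarrow> nat \<times> nat \<Rightarrow> nat \<times> nat \<Rightarrow> bool" where
  "fill_less Q p q \<longleftrightarrow> entry_at Q p < entry_at Q q \<or> entry_at Q p = entry_at Q q \<and> snd p < snd q"

definition standardize :: "tableau \<Rightarrow> tableau" where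
  "standardize Q = map (\<lambda>r. map (\<lambda>c. Suc (rank (fill_less Q) (cells Q) (r, c))) [0..<length (Q ! r)]) [0..<length Q]"

lemma shape_standardize [simp]: "shape (standardize Q) = shape Q"
  by (rule nth_equalityI) (simp_all add: shape_def standardize_def)

lemma cells_standardize [simp]: "cells (standardize Q) = cells Q"
  by (rule cells_shape_cong) simp

lemma entry_at_standardize:
  assumes "p \<in> cells Q" shows "entry_at (standardize Q) p = Suc (rank (fill_less Q) (cells Q) p)"
  using assms by (cases p) (simp add: standardize_def)

lemma fill_less_transp: "transp (fill_less Q)"
  by (rule transpI) (auto simp: fill_less_def)

lemma fill_less_irreflp: "irreflp (fill_less Q)"
  by (rule irreflpI) (simp add: fill_less_def)

lemma columns_increasing_less:
  assumes part: "is_partition m (shape Q)" and col: "columns_increasing Q"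
    and "r < r'" "r' < length Q" "c < length (Q ! r')"
  shows "Q ! r ! c < Q ! r' ! c"
  using assms(3-)
proof (induction r')
  case (Suc r')
  have step: "Q ! r' ! c < Q ! Suc r' ! c"
    using col Suc.prems unfolding columns_increasing_def by blast
  have "length (Q ! Suc r') \<le> length (Q ! r')"
    using partition_nth_mono[OF part, of r' "Suc r'"] Suc.prems by (simp add: shape_def)
  then have "c < length (Q ! r')" using Suc.prems by simp
  then show ?case using Suc.IH Suc.prems step by (cases "r = r'") auto
qed simp

lemma fill_less_totalp:
  assumes ss: "semistandard Q" shows "totalp_on (cells Q) (fill_less Q)"
proof (rule totalp_onI)
  fix p q assume p: "p \<in> cells Q" and q: "q \<in> cells Q" and ne: "p \<noteq> q"
  obtain r c r' c' where pq: "p = (r, c)" "q = (r', c')" by (cases p, cases q)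
  have part: "is_partition (length (concat Q)) (shape Q)" and col: "columns_increasing Q"
    using ss by (auto simp: semistandard_def)
  show "fill_less Q p q \<or> fill_less Q q p"
  proof (cases "c = c'")
    case True
    then have "r < r' \<or> r' < r" using ne pq by auto
    then show ?thesis
      using columns_increasing_less[OF part col, of r r' c] columns_increasing_less[OF part col, of r' r c]
        p q pq True by (auto simp: fill_less_def)
  qed (auto simp: fill_less_def pq)
qed

text \<open>The letter that \<open>x\<close> becomes in the semistandard tableau; letters start from
  1, rows from 0.\<close>

definition block :: "nat list \<Rightarrow> nat \<Rightarrow> nat" where
  "block mu x = Suc (entry_row (row_canonical mu) x)"

lemma block_range: "is_partition n mu \<Longrightarrow> x \<in> {1..n} \<Longrightarrow> block mu x \<in> {1..length mu}"
  using entry_pos_cell(1)[OF row_canonical_YT] by (fastforce simp: block_def)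

lemma block_mono: "is_partition n mu \<Longrightarrow> x \<in> {1..n} \<Longrightarrow> y \<in> {1..n} \<Longrightarrow> x \<le> y \<Longrightarrow> block mu x \<le> block mu y"
  using row_canonical_row_mono by (simp add: block_def)

lemma card_block:
  assumes mu: "is_partition n mu" and b: "b < length mu"
  shows "card {x \<in> {1..n}. block mu x = Suc b} = mu ! b"
proof -
  have "{x \<in> {1..n}. block mu x = Suc b} = (\<lambda>c. Suc (offset mu b + c)) ` {..<mu ! b}"
  proof (intro equalityI subsetI)
    fix x assume "x \<in> {x \<in> {1..n}. block mu x = Suc b}"
    then have x: "x \<in> {1..n}" "entry_row (row_canonical mu) x = b" by (auto simp: block_def)
    obtain b' c where "b' < length mu" "c < mu ! b'" "x = Suc (offset mu b' + c)" "entry_pos (row_canonical mu) x = (b', c)"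
      using row_canonical_posE[OF mu x(1)] .
    then show "x \<in> (\<lambda>c. Suc (offset mu b + c)) ` {..<mu ! b}" using x(2) by auto
  next
    fix x assume "x \<in> (\<lambda>c. Suc (offset mu b + c)) ` {..<mu ! b}"
    then obtain c where c: "c < mu ! b" "x = Suc (offset mu b + c)" by blast
    then have "x \<in> {1..n}"
      using YT_entry_range[OF row_canonical_YT[OF mu], of b c] b by (simp add: row_canonical_entry)
    moreover have "block mu x = Suc b" using row_canonical_pos[OF mu b c(1)] c(2) by (simp add: block_def)
    ultimately show "x \<in> {x \<in> {1..n}. block mu x = Suc b}" by blast
  qed
  moreover have "inj_on (\<lambda>c. Suc (offset mu b + c)) {..<mu ! b}" by (simp add: inj_on_def)
  ultimately show ?thesis by (simp add: card_image)
qed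

section \<open>The bijection with semistandard tableaux\<close>

definition kostka_tableaux :: "nat list \<Rightarrow> nat list \<Rightarrow> tableau set" where
  "kostka_tableaux lam mu = {T. semistandard T \<and> shape T = lam \<and>
     set (concat T) \<subseteq> {1..length mu} \<and>
     (\<forall>i < length mu. count_list (concat T) (Suc i) = mu ! i)}"

definition destandardize :: "nat list \<Rightarrow> tableau \<Rightarrow> tableau" where
  "destandardize mu T = map (map (block mu)) T"

lemma shape_destandardize [simp]: "shape (destandardize mu T) = shape T"
  by (simp add: shape_def destandardize_def comp_def)

lemma cells_destandardize [simp]: "cells (destandardize mu T) = cells T"
  by (rule cells_shape_cong) simp

lemma concat_destandardize: "concat (destandardize mu T) = map (block mu) (concat T)"
  by (simp add: destandardize_def map_concat)

lemma entry_at_destandardize: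
  "p \<in> cells T \<Longrightarrow> entry_at (destandardize mu T) p = block mu (entry_at T p)"
  by (cases p) (simp add: destandardize_def)

lemma length_concat_YT: "T \<in> YT n \<Longrightarrow> length (concat T) = n"
  using distinct_card[of "concat T"] by (simp add: YT_def)

text \<open>Rows stay weakly increasing because \<open>block mu\<close> is monotone. Columns stay
  strictly increasing because the entries of one block form a horizontal strip of \<open>T\<close>,
  so that no two of them share a column.\<close>

lemma destandardize_kostka:
  assumes mu: "is_partition n mu" and T: "T \<in> compat_tableaux n mu"
  shows "destandardize mu T \<in> kostka_tableaux (shape T) mu"
proof -
  have TY: "T \<in> YT n" using T by (simp add: compat_tableaux_def)
  have sc: "set (concat T) = {1..n}" and dc: "distinct (concat T)" using TY by (simp_all add: YT_def)
  have "is_partition (length (concat (destandardize mu T))) (shape (destandardize mu T))"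
    using TY length_concat_YT[OF TY] unfolding concat_destandardize length_map shape_destandardize
    by (simp add: YT_def)
  moreover have "sorted_wrt (\<le>) r" if r: "r \<in> set (destandardize mu T)" for r
  proof -
    obtain r' where r': "r' \<in> set T" "r = map (block mu) r'" using r unfolding destandardize_def set_map by blast
    have "sorted_wrt (<) r'" using TY r'(1) by (auto simp: YT_def)
    moreover have "set r' \<subseteq> {1..n}" using sc r'(1) by (auto simp del: atLeastAtMost_iff)
    ultimately have "sorted_wrt (\<lambda>x y. block mu x \<le> block mu y) r'"
      by (rule_tac sorted_wrt_mono_rel[where P = "(<)"]) (auto intro!: block_mono[OF mu] simp: subset_iff)
    then show ?thesis by (simp add: r'(2) sorted_wrt_map)
  qed
  moreover have "columns_increasing (destandardize mu T)"
    unfolding columns_increasing_def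
  proof (intro allI impI, elim conjE)
    fix r c assume "Suc r < length (destandardize mu T)" "c < length (destandardize mu T ! Suc r)"
    then have rc: "Suc r < length T" "c < length (T ! Suc r)" by (simp_all add: destandardize_def)
    have "c < length (T ! r)" using YT_row_length[OF TY, of r "Suc r"] rc by simp
    then have cl: "(r, c) \<in> cells T" "(Suc r, c) \<in> cells T" using rc by simp_all
    let ?x = "T ! r ! c" and ?y = "T ! Suc r ! c"
    have xy: "?x \<in> {1..n}" "?y \<in> {1..n}" using YT_entry_range[OF TY] cl by blast+
    have lt: "?x < ?y" using YT_col_less[OF TY, of r "Suc r" c] rc by simp
    have pos: "entry_pos T ?x = (r, c)" "entry_pos T ?y = (Suc r, c)"
      by (rule entry_pos_eq[OF TY cl(1) refl], rule entry_pos_eq[OF TY cl(2) refl])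
    have "block mu ?x \<noteq> block mu ?y"
      using compat_tableaux_col_less[OF mu T xy lt] pos by (auto simp: block_def)
    then have "block mu ?x < block mu ?y" using block_mono[OF mu xy] lt by simp
    then show "destandardize mu T ! r ! c < destandardize mu T ! Suc r ! c"
      using entry_at_destandardize[OF cl(1), of mu] entry_at_destandardize[OF cl(2), of mu] by simp
  qed
  moreover have "set (concat (destandardize mu T)) \<subseteq> {1..length mu}"
    unfolding concat_destandardize set_map sc using block_range[OF mu] by blast
  moreover have "count_list (concat (destandardize mu T)) (Suc i) = mu ! i" if "i < length mu" for i
    unfolding concat_destandardize count_list_distinct[OF dc] sc by (rule card_block[OF mu that])
  ultimately show ?thesis unfolding kostka_tableaux_def semistandard_def by simp
qed

text \<open>Inside a block the entries of \<open>T\<close> increase with the column, so comparing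
  letters and then columns orders the cells exactly as the entries of \<open>T\<close> do, and ranks
  recover the entries.\<close>

lemma standardize_destandardize:
  assumes mu: "is_partition n mu" and T: "T \<in> compat_tableaux n mu"
  shows "standardize (destandardize mu T) = T"
proof (rule tableau_eqI)
  let ?Q = "destandardize mu T"
  have TY: "T \<in> YT n" using T by (simp add: compat_tableaux_def)
  have img: "entry_at T ` cells T = {1..n}" using TY set_concat_cells[of T] by (simp add: YT_def)
  have inj: "inj_on (entry_at T) (cells T)"
    by (rule inj_onI) (metis YT_entry_inj[OF TY] prod.collapse)
  show "shape (standardize ?Q) = shape T" by simp
  fix q assume q: "q \<in> cells T"
  have lessI: "fill_less ?Q a b" if ab: "a \<in> cells T" "b \<in> cells T" "entry_at T a < entry_at T b" for a b
  proof -
    have r: "entry_at T a \<in> {1..n}" "entry_at T b \<in> {1..n}" using ab(1,2) img by blast+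
    have pos: "entry_pos T (entry_at T a) = a" "entry_pos T (entry_at T b) = b"
      using entry_pos_eq[OF TY, of "fst a" "snd a"] entry_pos_eq[OF TY, of "fst b" "snd b"] ab(1,2) by auto
    have "block mu (entry_at T a) = block mu (entry_at T b) \<Longrightarrow> snd a < snd b"
      using compat_tableaux_col_less[OF mu T r ab(3)] pos by (simp add: block_def)
    then show ?thesis
      unfolding fill_less_def entry_at_destandardize[OF ab(1)] entry_at_destandardize[OF ab(2)]
      using block_mono[OF mu r] ab(3) by (simp add: le_less) blast
  qed
  have less: "fill_less ?Q a q \<longleftrightarrow> entry_at T a < entry_at T q" if a: "a \<in> cells T" for a
    using lessI[OF a q] lessI[OF q a] transpD[OF fill_less_transp, of ?Q a q a] irreflpD[OF fill_less_irreflp, of ?Q] inj_onD[OF inj _ a q]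
    by (metis linorder_less_linear)
  have eqs: "{a \<in> cells T. fill_less ?Q a q} = {a \<in> cells T. entry_at T a < entry_at T q}"
    using less by blast
  have "entry_at T ` {a \<in> cells T. entry_at T a < entry_at T q} = {x \<in> {1..n}. x < entry_at T q}"
    unfolding img[symmetric] by blast
  also have "\<dots> = {1..<entry_at T q}"
  proof -
    have "entry_at T q \<in> {1..n}" using q img by blast
    then show ?thesis by auto
  qed
  finally have im: "entry_at T ` {a \<in> cells T. fill_less ?Q a q} = {1..<entry_at T q}" unfolding eqs .
  have "inj_on (entry_at T) {a \<in> cells T. fill_less ?Q a q}" by (rule inj_on_subset[OF inj]) blast
  then have "rank (fill_less ?Q) (cells T) q = card {1..<entry_at T q}"
    unfolding rank_def im[symmetric] by (rule card_image[symmetric])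
  moreover have "entry_at T q \<in> {1..n}" using q img by blast
  ultimately show "entry_at (standardize ?Q) q = entry_at T q"
    using entry_at_standardize[of q ?Q] q by simp
qed

lemma kostka_card_le:
  assumes Q: "Q \<in> kostka_tableaux lam mu" and "k \<le> length mu"
  shows "card {p \<in> cells Q. entry_at Q p \<le> k} = offset mu k"
  using assms(2)
proof (induction k)
  case 0
  have "entry_at Q p \<noteq> 0" if "p \<in> cells Q" for p
    using Q that set_concat_cells[of Q] by (fastforce simp: kostka_tableaux_def)
  then have "{p \<in> cells Q. entry_at Q p \<le> 0} = {}" by auto
  then show ?case by (simp only: card.empty) simp
next
  case (Suc k)
  have "{p \<in> cells Q. entry_at Q p \<le> Suc k} = {p \<in> cells Q. entry_at Q p \<le> k} \<union> {p \<in> cells Q. entry_at Q p = Suc k}"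
    by auto
  then have "card {p \<in> cells Q. entry_at Q p \<le> Suc k} =
      card {p \<in> cells Q. entry_at Q p \<le> k} + card {p \<in> cells Q. entry_at Q p = Suc k}"
    by (simp only:) (rule card_Un_disjoint, auto)
  also have "card {p \<in> cells Q. entry_at Q p = Suc k} = mu ! k"
    unfolding count_list_cells[symmetric] using Q Suc.prems by (simp add: kostka_tableaux_def)
  finally show ?case using Suc offset_Suc[of k mu] by simp
qed

text \<open>The rank of a cell with letter \<open>Suc b\<close> is at least the number of letters up
  to \<open>b\<close> and less than the number up to \<open>Suc b\<close>. The content of
  \<open>Q\<close> turns these numbers into the offsets that delimit row \<open>b\<close> of
  \<open>row_canonical mu\<close>.\<close>

lemma block_standardize:
  assumes mu: "is_partition n mu" and Q: "Q \<in> kostka_tableaux lam mu" and q: "q \<in> cells Q"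
  shows "block mu (entry_at (standardize Q) q) = entry_at Q q"
proof -
  have "entry_at Q q \<in> {1..length mu}" using Q q set_concat_cells[of Q] by (fastforce simp: kostka_tableaux_def)
  then obtain b where b: "entry_at Q q = Suc b" "b < length mu" by (cases "entry_at Q q") auto
  have "{p \<in> cells Q. entry_at Q p \<le> b} \<subseteq> {p \<in> cells Q. fill_less Q p q}"
    by (auto simp: fill_less_def b(1))
  then have "card {p \<in> cells Q. entry_at Q p \<le> b} \<le> card {p \<in> cells Q. fill_less Q p q}"
    by (rule card_mono[rotated]) simp
  moreover have "card {p \<in> cells Q. entry_at Q p \<le> b} = offset mu b"
    by (rule kostka_card_le[OF Q]) (use b(2) in simp)
  ultimately have lo: "offset mu b \<le> rank (fill_less Q) (cells Q) q" by (simp add: rank_def)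
  have "{p \<in> cells Q. fill_less Q p q} \<subset> {p \<in> cells Q. entry_at Q p \<le> Suc b}"
  proof (rule psubsetI)
    show "{p \<in> cells Q. fill_less Q p q} \<subseteq> {p \<in> cells Q. entry_at Q p \<le> Suc b}"
      by (auto simp: fill_less_def b(1))
    have "q \<in> {p \<in> cells Q. entry_at Q p \<le> Suc b}" "q \<notin> {p \<in> cells Q. fill_less Q p q}"
      using q b(1) irreflpD[OF fill_less_irreflp] by auto
    then show "{p \<in> cells Q. fill_less Q p q} \<noteq> {p \<in> cells Q. entry_at Q p \<le> Suc b}" by blast
  qed
  then have "card {p \<in> cells Q. fill_less Q p q} < card {p \<in> cells Q. entry_at Q p \<le> Suc b}"
    by (rule psubset_card_mono[rotated]) simp
  moreover have "card {p \<in> cells Q. entry_at Q p \<le> Suc b} = offset mu (Suc b)"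
    by (rule kostka_card_le[OF Q]) (use b(2) in simp)
  ultimately have "rank (fill_less Q) (cells Q) q < offset mu (Suc b)" by (simp add: rank_def)
  then have "rank (fill_less Q) (cells Q) q - offset mu b < mu ! b" using lo offset_Suc[OF b(2)] by linarith
  then have "entry_pos (row_canonical mu) (Suc (rank (fill_less Q) (cells Q) q)) =
      (b, rank (fill_less Q) (cells Q) q - offset mu b)"
    using row_canonical_pos[OF mu b(2), of "rank (fill_less Q) (cells Q) q - offset mu b"] lo by simp
  then show ?thesis
    using b(1) entry_at_standardize[OF q] by (simp add: block_def)
qed

lemma destandardize_standardize:
  assumes "is_partition n mu" "Q \<in> kostka_tableaux lam mu"
  shows "destandardize mu (standardize Q) = Q"
  by (rule tableau_eqI) (use block_standardize[OF assms] in \<open>simp_all add: entry_at_destandardize\<close>)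

lemma standardize_less:
  assumes "p \<in> cells Q" "q \<in> cells Q" "fill_less Q p q"
  shows "entry_at (standardize Q) p < entry_at (standardize Q) q"
  using rank_less[OF finite_cells fill_less_transp fill_less_irreflp assms(1,3)] entry_at_standardize assms by simp

lemma standardize_YT:
  assumes lam: "is_partition n (shape Q)" and ss: "semistandard Q"
  shows "standardize Q \<in> YT n"
proof -
  let ?S = "standardize Q"
  have len: "length (concat Q) = n" using lam by (simp add: is_partition_def shape_def length_concat)
  have len': "length (concat ?S) = n" using card_cells[of ?S] card_cells[of Q] len by simp
  have bij: "bij_betw (rank (fill_less Q) (cells Q)) (cells Q) {..<n}"
    using rank_bij_betw[OF finite_cells fill_less_transp fill_less_irreflp fill_less_totalp[OF ss]] len
    unfolding card_cells by blast
  have "set (concat ?S) = (\<lambda>p. Suc (rank (fill_less Q) (cells Q) p)) ` cells Q"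
    unfolding set_concat_cells cells_standardize by (rule image_cong[OF refl entry_at_standardize])
  also have "\<dots> = Suc ` rank (fill_less Q) (cells Q) ` cells Q" by (simp add: image_image)
  also have "\<dots> = {1..n}" using bij by (simp add: bij_betw_def image_Suc_lessThan)
  finally have st: "set (concat ?S) = {1..n}" .
  then have dis: "distinct (concat ?S)" using card_distinct[of "concat ?S"] len' by simp
  have ln: "length ?S = length Q" "\<And>r. r < length Q \<Longrightarrow> length (?S ! r) = length (Q ! r)"
    by (simp_all add: standardize_def)
  have "sorted_wrt (<) r" if r: "r \<in> set ?S" for r
  proof -
    obtain k where k: "k < length Q" "r = ?S ! k" using r ln(1) by (auto simp: in_set_conv_nth)
    have "?S ! k ! c < ?S ! k ! c'" if "c < c'" "c' < length (Q ! k)" for c c'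
    proof -
      have "sorted_wrt (\<le>) (Q ! k)" using ss k(1) by (simp add: semistandard_def)
      then have "Q ! k ! c \<le> Q ! k ! c'" using that by (simp add: sorted_wrt_iff_nth_less)
      then have "fill_less Q (k, c) (k, c')" using that by (auto simp: fill_less_def)
      then show ?thesis using standardize_less[of "(k, c)" Q "(k, c')"] k(1) that by simp
    qed
    then show ?thesis using k ln(2) by (simp add: sorted_wrt_iff_nth_less)
  qed
  moreover have "columns_increasing ?S"
    unfolding columns_increasing_def
  proof (intro allI impI, elim conjE)
    fix r c assume "Suc r < length ?S" "c < length (?S ! Suc r)"
    then have rc: "Suc r < length Q" "c < length (Q ! Suc r)" using ln by auto
    have "length (Q ! Suc r) \<le> length (Q ! r)"
      using partition_nth_mono[OF lam, of r "Suc r"] rc by (simp add: shape_def)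
    then have cl: "(r, c) \<in> cells Q" "(Suc r, c) \<in> cells Q" using rc by auto
    have "Q ! r ! c < Q ! Suc r ! c" using ss rc by (auto simp: semistandard_def columns_increasing_def)
    then have "fill_less Q (r, c) (Suc r, c)" by (simp add: fill_less_def)
    then show "?S ! r ! c < ?S ! Suc r ! c" using standardize_less[OF cl] by simp
  qed
  ultimately show ?thesis using lam dis st by (simp add: YT_def)
qed

text \<open>If \<open>i\<close> is an ascent of \<open>row_canonical mu\<close>, then
  \<open>i\<close> and \<open>Suc i\<close> come from equal letters of \<open>Q\<close>. Those are
  numbered from left to right, so \<open>Suc i\<close> ends up in a later column.\<close>

lemma standardize_compat:
  assumes mu: "is_partition n mu" and lam: "is_partition n lam" and Q: "Q \<in> kostka_tableaux lam mu"
  shows "standardize Q \<in> compat_tableaux n mu"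
proof -
  let ?S = "standardize Q"
  have ss: "semistandard Q" and sh: "shape Q = lam" using Q by (auto simp: kostka_tableaux_def)
  have SY: "?S \<in> YT n" using standardize_YT ss lam sh by blast
  have "ascent ?S i" if i: "i \<in> {1..<n}" and asc: "ascent (row_canonical mu) i" for i
  proof -
    have ii: "i \<in> {1..n}" "Suc i \<in> {1..n}" using i by auto
    have "entry_row (row_canonical mu) (Suc i) \<le> entry_row (row_canonical mu) i"
      using asc ascent_iff_row[OF row_canonical_YT[OF mu] i] by blast
    then have blk: "block mu i = block mu (Suc i)"
      using block_mono[OF mu ii] by (simp add: block_def)
    obtain r c where p: "(r, c) \<in> cells Q" "?S ! r ! c = i"
      using YT_entry_exists[OF SY ii(1)] unfolding cells_standardize .
    obtain r' c' where q: "(r', c') \<in> cells Q" "?S ! r' ! c' = Suc i"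
      using YT_entry_exists[OF SY ii(2)] unfolding cells_standardize .
    have "entry_at Q (r, c) = entry_at Q (r', c')"
      using block_standardize[OF mu Q p(1)] block_standardize[OF mu Q q(1)] p(2) q(2) blk by simp
    moreover have "\<not> fill_less Q (r', c') (r, c)"
      using standardize_less[OF q(1) p(1)] p(2) q(2) by auto
    moreover have "fill_less Q (r, c) (r', c') \<or> fill_less Q (r', c') (r, c)"
      by (rule totalp_onD[OF fill_less_totalp[OF ss] p(1) q(1)]) (use p(2) q(2) in auto)
    ultimately have "c < c'" by (auto simp: fill_less_def)
    moreover have "entry_pos ?S i = (r, c)" "entry_pos ?S (Suc i) = (r', c')"
      using entry_pos_eq[OF SY _ p(2)] entry_pos_eq[OF SY _ q(2)] p(1) q(1) unfolding cells_standardize by blast+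
    ultimately show ?thesis by (simp add: ascent_def)
  qed
  then show ?thesis using SY by (simp add: compat_tableaux_def)
qed

theorem kostka_eq_card_compat:
  assumes mu: "is_partition n mu" and lam: "is_partition n lam"
  shows "kostka lam mu = card {T \<in> compat_tableaux n mu. shape T = lam}"
proof -
  have "bij_betw standardize (kostka_tableaux lam mu) {T \<in> compat_tableaux n mu. shape T = lam}"
  proof (rule bij_betw_byWitness[where f' = "destandardize mu"])
    show "\<forall>Q\<in>kostka_tableaux lam mu. destandardize mu (standardize Q) = Q"
      using destandardize_standardize[OF mu] by blast
    show "\<forall>T\<in>{T \<in> compat_tableaux n mu. shape T = lam}. standardize (destandardize mu T) = T"
      using standardize_destandardize[OF mu] by blast
    show "standardize ` kostka_tableaux lam mu \<subseteq> {T \<in> compat_tableaux n mu. shape T = lam}"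
    proof (rule image_subsetI)
      fix Q assume Q: "Q \<in> kostka_tableaux lam mu"
      then have "shape (standardize Q) = lam" by (simp add: kostka_tableaux_def)
      then show "standardize Q \<in> {T \<in> compat_tableaux n mu. shape T = lam}"
        using standardize_compat[OF mu lam Q] by blast
    qed
    show "destandardize mu ` {T \<in> compat_tableaux n mu. shape T = lam} \<subseteq> kostka_tableaux lam mu"
      using destandardize_kostka[OF mu] by blast
  qed
  then show ?thesis unfolding kostka_def kostka_tableaux_def[symmetric] by (rule bij_betw_same_card)
qed

theorem theorem7p2:
  fixes n :: nat and lam mu :: "nat list"
  assumes "n \<ge> 1" and "is_partition n lam" and "is_partition n mu"
  shows "\<forall>R \<in> {weak_le n, kl_le n, geom_le n, chain_le n}.
    kostka lam mu = card {T \<in> interval n R (one_row n) (row_canonical mu). shape T = lam}"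
proof
  fix R assume "R \<in> {weak_le n, kl_le n, geom_le n, chain_le n}"
  then have "interval n R (one_row n) (row_canonical mu) = compat_tableaux n mu"
    using interval_weak_le[OF assms(1,3)] interval_kl_le[OF assms(1,3)]
      interval_geom_le[OF assms(1,3)] interval_chain_le[OF assms(1,3)] by auto
  then show "kostka lam mu = card {T \<in> interval n R (one_row n) (row_canonical mu). shape T = lam}"
    using kostka_eq_card_compat[OF assms(3,2)] by (simp only:)
qed

end
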